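(* Let $1<p\le\infty$ and $1/p+1/q=1$. The topology $\kappa(\mathcal{D}_{L^p},\mathcal{D}'_{L^q})$ on $\mathcal{D}_{L^p}$ is generated by the family of seminorms $$\mathcal{D}_{L^p}\to\mathbb{R}_+,\quad \varphi\mapsto p_{g,m}(\varphi):=\|g\,(1-\Delta_n)^m\varphi\|_p,\qquad g\in\mathcal{C}_0,\ m\in\mathbb{N}_0,$$ or, equivalently, by the family of seminorms $$\varphi\mapsto\sup_{|\alpha|\le m}\|g\,\partial^\alpha\varphi\|_p,\qquad g\in\mathcal{C}_0,\ m\in\mathbb{N}_0.$$
   Context: All spaces consist of complex-valued functions or distributions on $\mathbb{R}^n$; $\Delta_n$ is the Laplacian on $\mathbb{R}^n$ and $\mathcal{C}_0$ is the space of continuous functions on $\mathbb{R}^n$ vanishing at infinity. For $1\le p\le\infty$, $\mathcal{D}_{L^p}$ is the space of $C^\infty$-functions all of whose derivatives lie in $L^p$, with its usual topology defined by the (semi-)norms $\varphi\mapsto\sup_{|\alpha|\le m}\|\partial^\alpha\varphi\|_p$, $m\in\mathbb{N}_0$. $\dot{\mathcal{B}}$ is the subspace of $\mathcal{D}_{L^\infty}$ of functions all of whose derivatives vanish at infinity. $\mathcal{D}'_{L^q}$ is the strong dual of $\mathcal{D}_{L^p}$, $1/p+1/q=1$, if $q>1$, and $\mathcal{D}'_{L^1}$ is the strong dual of $\dot{\mathcal{B}}$; moreover $(\mathcal{D}'_{L^1})'=\mathcal{D}_{L^\infty}$, which gives the dual pairing used for $p=\infty$. $\kappa(E,F)$ denotes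 the topology on $E$ of uniform convergence on absolutely convex compact subsets of $F$ (here $F=\mathcal{D}'_{L^q}$ with its strong topology). The space $\mathcal{D}_{L^p}$ with $\kappa(\mathcal{D}_{L^p},\mathcal{D}'_{L^q})$ is denoted $\mathcal{D}_{L^p,c}$. *)

theory Defs
  imports "HOL-Analysis.Analysis" "HOL-Probability.Essential_Supremum"
begin

section \<open>Locally convex topologies on spaces of complex-valued functions\<close>

text \<open>
  All vector spaces are sets of functions with values in the complex numbers, with the pointwise
  operations; this includes the dual spaces, whose elements are functionals. A locally convex
  space is given by its carrier \<open>E\<close> together with a family \<open>P\<close> of seminorms on \<open>E\<close>.
\<close>

definition seminorm_on :: "('a \<Rightarrow> complex) set \<Rightarrow> (('a \<Rightarrow> complex) \<Rightarrow> real) \<Rightarrow> bool" where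
  "seminorm_on E \<rho> \<longleftrightarrow>
     (\<forall>f\<in>E. 0 \<le> \<rho> f) \<and>
     (\<forall>f\<in>E. \<forall>g\<in>E. \<rho> (\<lambda>x. f x + g x) \<le> \<rho> f + \<rho> g) \<and>
     (\<forall>f\<in>E. \<forall>c. \<rho> (\<lambda>x. c * f x) = cmod c * \<rho> f)"

text \<open>The carrier itself is added to the subbase so that it is the whole space also if \<open>P = {}\<close>.\<close>

definition seminorm_topology ::
    "('a \<Rightarrow> complex) set \<Rightarrow> (('a \<Rightarrow> complex) \<Rightarrow> real) set \<Rightarrow> ('a \<Rightarrow> complex) topology" where
  "seminorm_topology E P =
     topology_generated_by
       (insert E {{g \<in> E. \<rho> (\<lambda>x. g x - f x) < \<epsilon>} | f \<rho> \<epsilon>. f \<in> E \<and> \<rho> \<in> P \<and> \<epsilon> > 0})"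

definition generated_by_seminorms ::
    "('a \<Rightarrow> complex) topology \<Rightarrow> ('a \<Rightarrow> complex) set \<Rightarrow> (('a \<Rightarrow> complex) \<Rightarrow> real) set \<Rightarrow> bool" where
  "generated_by_seminorms X E P \<longleftrightarrow> (\<forall>\<rho>\<in>P. seminorm_on E \<rho>) \<and> X = seminorm_topology E P"

text \<open>
  The continuous dual. Functionals are extended by 0 outside of \<open>E\<close>, so that an element of the
  dual is determined by its values on \<open>E\<close>.
\<close>

definition cdual ::
    "('a \<Rightarrow> complex) set \<Rightarrow> (('a \<Rightarrow> complex) \<Rightarrow> real) set \<Rightarrow> (('a \<Rightarrow> complex) \<Rightarrow> complex) set" where
  "cdual E P =
     {T. (\<forall>f\<in>E. \<forall>g\<in>E. \<forall>a b. T (\<lambda>x. a * f x + b * g x) = a * T f + b * T g) \<and>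
         continuous_map (seminorm_topology E P) euclidean T \<and>
         (\<forall>f. f \<notin> E \<longrightarrow> T f = 0)}"

definition bounded_subsets ::
    "('a \<Rightarrow> complex) set \<Rightarrow> (('a \<Rightarrow> complex) \<Rightarrow> real) set \<Rightarrow> ('a \<Rightarrow> complex) set set" where
  "bounded_subsets E P = {B. B \<subseteq> E \<and> (\<forall>\<rho>\<in>P. bdd_above (\<rho> ` B))}"

text \<open>The seminorms of the strong topology on \<open>cdual E P\<close>.\<close>

definition strong_seminorms ::
    "('a \<Rightarrow> complex) set \<Rightarrow> (('a \<Rightarrow> complex) \<Rightarrow> real) set \<Rightarrow>
     ((('a \<Rightarrow> complex) \<Rightarrow> complex) \<Rightarrow> real) set" where
  "strong_seminorms E P =
     {\<lambda>T. SUP f\<in>B. cmod (T f) | B. B \<in> bounded_subsets E P \<and> B \<noteq> {}}"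

definition absolutely_convex :: "('a \<Rightarrow> complex) set \<Rightarrow> bool" where
  "absolutely_convex K \<longleftrightarrow> K \<noteq> {} \<and>
     (\<forall>f\<in>K. \<forall>g\<in>K. \<forall>a b. cmod a + cmod b \<le> 1 \<longrightarrow> (\<lambda>x. a * f x + b * g x) \<in> K)"

text \<open>
  The topology \<open>\<kappa>(E, F)\<close> on \<open>E\<close> of uniform convergence on the absolutely convex compact subsets
  of \<open>F\<close>, where \<open>X\<close> is the topology of \<open>F\<close> and \<open>\<langle>f, T\<rangle> = pairing f T\<close> the duality between
  \<open>E\<close> and \<open>F\<close>.
\<close>

definition kappa_topology ::
    "('a \<Rightarrow> complex) set \<Rightarrow> ('b \<Rightarrow> complex) topology \<Rightarrow>
     (('a \<Rightarrow> complex) \<Rightarrow> ('b \<Rightarrow> complex) \<Rightarrow> complex) \<Rightarrow> ('a \<Rightarrow> complex) topology" where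
  "kappa_topology E X pairing =
     seminorm_topology E
       {\<lambda>f. SUP T\<in>K. cmod (pairing f T) | K. absolutely_convex K \<and> compactin X K}"


section \<open>Differential operators\<close>

definition partial_deriv :: "'n \<Rightarrow> (real ^ 'n \<Rightarrow> complex) \<Rightarrow> real ^ 'n \<Rightarrow> complex" where
  "partial_deriv i f x = frechet_derivative f (at x) (axis i 1)"

primrec C_k :: "nat \<Rightarrow> (real ^ 'n \<Rightarrow> complex) \<Rightarrow> bool" where
  "C_k 0 f \<longleftrightarrow> continuous_on UNIV f"
| "C_k (Suc k) f \<longleftrightarrow> f differentiable_on UNIV \<and> (\<forall>i. C_k k (partial_deriv i f))"

definition smooth :: "(real ^ 'n \<Rightarrow> complex) \<Rightarrow> bool" where
  "smooth f \<longleftrightarrow> (\<forall>k. C_k k f)"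

text \<open>
  The derivative \<open>\<partial>\<^sup>\<alpha>\<close> for a multi-index \<open>\<alpha>\<close>. The index type carries no order, hence some
  enumeration of the coordinates is chosen; for smooth functions the choice is immaterial, since
  the partial derivatives commute.
\<close>

definition multi_deriv :: "('n \<Rightarrow> nat) \<Rightarrow> (real ^ 'n \<Rightarrow> complex) \<Rightarrow> real ^ 'n \<Rightarrow> complex" where
  "multi_deriv \<alpha> f =
     foldr (\<lambda>i. partial_deriv i ^^ \<alpha> i) (SOME is. distinct is \<and> set is = (UNIV :: 'n set)) f"

definition multi_indices :: "nat \<Rightarrow> ('n::finite \<Rightarrow> nat) set" where
  "multi_indices m = {\<alpha>. (\<Sum>i\<in>UNIV. \<alpha> i) \<le> m}"

definition laplacian :: "(real ^ 'n \<Rightarrow> complex) \<Rightarrow> real ^ 'n \<Rightarrow> complex" where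
  "laplacian f x = (\<Sum>i\<in>UNIV. partial_deriv i (partial_deriv i f) x)"

definition one_minus_laplacian :: "(real ^ 'n \<Rightarrow> complex) \<Rightarrow> real ^ 'n \<Rightarrow> complex" where
  "one_minus_laplacian f x = f x - laplacian f x"


section \<open>Function spaces\<close>

text \<open>The exponent ranges over \<open>[1, \<infinity>]\<close>.\<close>

definition in_Lp :: "ennreal \<Rightarrow> (real ^ 'n \<Rightarrow> complex) \<Rightarrow> bool" where
  "in_Lp p f \<longleftrightarrow> f \<in> borel_measurable lborel \<and>
     (if p = \<infinity> then esssup lborel (\<lambda>x. ereal (cmod (f x))) < \<infinity>
      else integrable lborel (\<lambda>x. cmod (f x) powr enn2real p))"

definition Lp_norm :: "ennreal \<Rightarrow> (real ^ 'n \<Rightarrow> complex) \<Rightarrow> real" where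
  "Lp_norm p f =
     (if p = \<infinity> then real_of_ereal (esssup lborel (\<lambda>x. ereal (cmod (f x))))
      else (\<integral>x. cmod (f x) powr enn2real p \<partial>lborel) powr (1 / enn2real p))"

definition C_0 :: "(real ^ 'n \<Rightarrow> complex) set" where
  "C_0 = {g. continuous_on UNIV g \<and> (g \<longlongrightarrow> 0) at_infinity}"

definition test_functions :: "(real ^ 'n \<Rightarrow> complex) set" where
  "test_functions = {f. smooth f \<and> compact (closure {x. f x \<noteq> 0})}"

definition D_L :: "ennreal \<Rightarrow> (real ^ 'n \<Rightarrow> complex) set" where
  "D_L p = {\<phi>. smooth \<phi> \<and> (\<forall>\<alpha>. in_Lp p (multi_deriv \<alpha> \<phi>))}"

definition D_L_seminorms :: "ennreal \<Rightarrow> ((real ^ 'n \<Rightarrow> complex) \<Rightarrow> real) set" where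
  "D_L_seminorms p =
     range (\<lambda>m \<phi>. SUP \<alpha>\<in>multi_indices m. Lp_norm p (multi_deriv \<alpha> \<phi>))"

definition B_dot :: "(real ^ 'n \<Rightarrow> complex) set" where
  "B_dot = {\<phi> \<in> D_L \<infinity>. \<forall>\<alpha>. (multi_deriv \<alpha> \<phi> \<longlongrightarrow> 0) at_infinity}"


section \<open>The distribution spaces and the duality pairing\<close>

text \<open>
  The space \<open>D'\<^sub>L\<^sub>q\<close> is the strong dual of its predual: \<open>B_dot\<close>, with the seminorms of \<open>D_L \<infinity>\<close>,
  if \<open>q = 1\<close>, and \<open>D_L p\<close> with \<open>1/p + 1/q = 1\<close> if \<open>q > 1\<close>.
\<close>

definition conjugate_exponent :: "ennreal \<Rightarrow> ennreal" where
  "conjugate_exponent q = inverse (1 - inverse q)"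

definition predual :: "ennreal \<Rightarrow> (real ^ 'n \<Rightarrow> complex) set" where
  "predual q = (if q = 1 then B_dot else D_L (conjugate_exponent q))"

definition predual_seminorms :: "ennreal \<Rightarrow> ((real ^ 'n \<Rightarrow> complex) \<Rightarrow> real) set" where
  "predual_seminorms q = D_L_seminorms (if q = 1 then \<infinity> else conjugate_exponent q)"

definition D'_L :: "ennreal \<Rightarrow> ((real ^ 'n \<Rightarrow> complex) \<Rightarrow> complex) set" where
  "D'_L q = cdual (predual q) (predual_seminorms q)"

definition D'_L_seminorms :: "ennreal \<Rightarrow> (((real ^ 'n \<Rightarrow> complex) \<Rightarrow> complex) \<Rightarrow> real) set" where
  "D'_L_seminorms q = strong_seminorms (predual q) (predual_seminorms q)"

definition D'_L_topology :: "ennreal \<Rightarrow> ((real ^ 'n \<Rightarrow> complex) \<Rightarrow> complex) topology" where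
  "D'_L_topology q = seminorm_topology (D'_L q) (D'_L_seminorms q)"

text \<open>
  The identification \<open>(D'\<^sub>L\<^sub>1)' = D\<^sub>L\<^sub>\<infinity>\<close>: a test function \<open>f\<close> is an element of \<open>D'\<^sub>L\<^sub>1\<close> by
  integration, the test functions are dense in \<open>D'\<^sub>L\<^sub>1\<close>, and \<open>\<phi> \<in> D\<^sub>L\<^sub>\<infinity>\<close> corresponds to the unique
  continuous linear functional on the strong dual \<open>D'\<^sub>L\<^sub>1\<close> given on test functions by integration
  against \<open>\<phi>\<close>.
\<close>

definition D'_L1_of_test :: "(real ^ 'n \<Rightarrow> complex) \<Rightarrow> (real ^ 'n \<Rightarrow> complex) \<Rightarrow> complex" where
  "D'_L1_of_test f = (\<lambda>\<psi>. if \<psi> \<in> B_dot then \<integral>x. f x * \<psi> x \<partial>lborel else 0)"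

definition D_Linf_functional ::
    "(real ^ 'n \<Rightarrow> complex) \<Rightarrow> ((real ^ 'n \<Rightarrow> complex) \<Rightarrow> complex) \<Rightarrow> complex" where
  "D_Linf_functional \<phi> =
     (THE \<Phi>. \<Phi> \<in> cdual (D'_L 1) (D'_L_seminorms 1) \<and>
        (\<forall>f\<in>test_functions. \<Phi> (D'_L1_of_test f) = (\<integral>x. f x * \<phi> x \<partial>lborel)))"

text \<open>The pairing of \<open>\<phi> \<in> D_L p\<close> and \<open>T \<in> D'_L q\<close> for \<open>1/p + 1/q = 1\<close>.\<close>

definition D_L_pairing ::
    "ennreal \<Rightarrow> (real ^ 'n \<Rightarrow> complex) \<Rightarrow> ((real ^ 'n \<Rightarrow> complex) \<Rightarrow> complex) \<Rightarrow> complex" where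
  "D_L_pairing p \<phi> T = (if p = \<infinity> then D_Linf_functional \<phi> T else T \<phi>)"

end

theory Submission
 imports Defs "HOL-Probability.Distributions" "HOL-Real_Asymp.Real_Asymp"
begin

text \<open>
  The polar of the seminorm \<open>\<phi> \<mapsto> sup \<parallel>g \<partial>\<^sup>\<alpha>\<phi>\<parallel>\<^sub>p\<close> is compact in the strong dual, because bounded
  subsets of the predual are precompact for this seminorm, and it has enough elements to recover the
  seminorm. Conversely, a gliding hump shows that a single functional is small on functions supported
  far out. By total boundedness this is uniform on a compact set \<open>K\<close>, and a dyadic decomposition turns
  the decay of the tails of \<open>K\<close> into a weight in \<open>C\<^sub>0\<close>. For \<open>p = \<infinity>\<close> the pairing of \<open>\<phi>\<close> and \<open>T\<close> is the limit
  of \<open>T\<close> on truncations of \<open>\<phi>\<close>, by density of the test functions in the dual. Finally, every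
  weight in \<open>C\<^sub>0\<close> is dominated by a weight \<open>G\<close> with \<open>\<bar>G x\<bar> \<le> (1 + \<parallel>h\<parallel>) \<bar>G (x + h)\<bar>\<close>. Such weights are
  compatible with the rapidly decreasing kernels of \<open>(1 - \<Delta>)\<^sup>-\<^sup>1\<close> and its first derivatives, which
  reduces the seminorms with \<open>\<partial>\<^sup>\<alpha>\<close> to those with \<open>(1 - \<Delta>)\<^sup>m\<close>.
\<close>

section \<open>Calculus of smooth functions\<close>

text \<open>Four obstacles shape the proof. The condition \<open>p > 1\<close> enters through the
  gliding hump: the sum of \<open>J\<close> normalised functions with disjoint supports has norm of
  order at most \<open>J powr (1 / p)\<close>, while the functional grows like \<open>J * e\<close>
  on it; for \<open>p = 1\<close> both rates are linear. Total boundedness in the strong dual is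
  uniform only over sets bounded in every order of differentiation, and the unit ball of a single
  norm is not such a set; mollifying at a fixed scale turns it into one, at the price of one
  derivative. For \<open>p = \<infinity>\<close> the predual of \<open>D'_L 1\<close> is
  \<open>B_dot\<close> and not \<open>D_L \<infinity>\<close>, so a functional \<open>T\<close> has
  no value at \<open>\<phi>\<close> and the pairing is a definite description: existence rests on
  the tail estimate, uniqueness on density. Finally, the Laplacian does not control all second
  derivatives in the supremum norm, so one power of \<open>1 - \<Delta>\<close> is spent on each
  single derivative; this is harmless, because all powers occur in the family of seminorms.\<close>

type_synonym 'n cfun = "(real, 'n) vec \<Rightarrow> complex"
type_synonym 'n functional = "'n cfun \<Rightarrow> complex"

lemma smooth_differentiable: "smooth f \<Longrightarrow> f differentiable (at x)"
 unfolding smooth_def using C_k.simps(2)[of 0 f]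
 by (metis UNIV_I differentiable_on_def)

lemma smooth_partial_deriv: "smooth f \<Longrightarrow> smooth (partial_deriv i f)"
 unfolding smooth_def by (metis C_k.simps(2))

lemma smooth_continuous: "smooth f \<Longrightarrow> continuous_on UNIV f"
 unfolding smooth_def using C_k.simps(1) by blast

text \<open>Smooth functions are the largest class of differentiable functions stable under partial
  derivatives. Exhibiting any such class around a function avoids formulas for its higher
  derivatives.\<close>

lemma smooth_coinduct:
 assumes "f \<in> S"
  and diff: "\<And>g x. g \<in> S \<Longrightarrow> g differentiable (at x)"
  and closed: "\<And>g i. g \<in> S \<Longrightarrow> partial_deriv i g \<in> S"
 shows "smooth f"
proof -
 have "C_k k g" if "g \<in> S" for k g
  using that
 proof (induction k arbitrary: g)
  case 0
  then show ?case
   using diff by (auto intro!: differentiable_imp_continuous_on simp: differentiable_on_def)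
 next
  case (Suc k)
  then show ?case
   using diff closed by (auto simp: differentiable_on_def)
 qed
 then show ?thesis
  using assms(1) unfolding smooth_def by blast
qed

lemma partial_deriv_eq:
 "(f has_derivative D) (at x) \<Longrightarrow> partial_deriv i f x = D (axis i 1)"
 unfolding partial_deriv_def using frechet_derivative_at by metis

lemma has_derivative_partial_deriv:
 fixes f :: "'n::finite cfun"
 assumes "f differentiable (at x)"
 shows "(f has_derivative (\<lambda>h. \<Sum>i\<in>UNIV. h $ i *\<^sub>R partial_deriv i f x)) (at x)"
proof -
 let ?D = "frechet_derivative f (at x)"
 have lin: "linear ?D"
  using assms linear_frechet_derivative by blast
 have "?D h = (\<Sum>i\<in>UNIV. h $ i *\<^sub>R partial_deriv i f x)" for h
 proof -
  have "?D h = ?D (\<Sum>i\<in>UNIV. h $ i *\<^sub>R axis i 1)"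
   using basis_expansion[of h] by (simp add: scalar_mult_eq_scaleR)
  then show ?thesis
   by (simp add: linear_sum[OF lin] linear_cmul[OF lin] partial_deriv_def)
 qed
 then show ?thesis
  using frechet_derivative_works assms by (metis (no_types, lifting) ext)
qed

lemma partial_deriv_add:
 assumes f: "f differentiable (at x)" and g: "g differentiable (at x)"
 shows "partial_deriv i (\<lambda>x. f x + g x) x = partial_deriv i f x + partial_deriv i g x"
 using partial_deriv_eq[OF has_derivative_add[OF f[unfolded frechet_derivative_works]
    g[unfolded frechet_derivative_works]]]
 by (simp add: partial_deriv_def)

lemma partial_deriv_mult:
 assumes f: "f differentiable (at x)" and g: "g differentiable (at x)"
 shows "partial_deriv i (\<lambda>x. f x * g x) x = partial_deriv i f x * g x + f x * partial_deriv i g x"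
 using partial_deriv_eq[OF has_derivative_mult[OF f[unfolded frechet_derivative_works]
    g[unfolded frechet_derivative_works]]]
 by (simp add: partial_deriv_def)

lemma partial_deriv_cmult:
 assumes f: "f differentiable (at x)"
 shows "partial_deriv i (\<lambda>x. c * f x) x = c * partial_deriv i f x"
 using partial_deriv_eq[OF has_derivative_mult_right[OF f[unfolded frechet_derivative_works]]]
 by (simp add: partial_deriv_def)

lemma partial_deriv_affine:
 fixes f :: "'n::finite cfun"
 assumes "\<And>x. f differentiable (at x)"
 shows "partial_deriv i (\<lambda>x. f (y + s *\<^sub>R x)) x = s *\<^sub>R partial_deriv i f (y + s *\<^sub>R x)"
  and "(\<lambda>x. f (y + s *\<^sub>R x)) differentiable (at x)"
proof -
 have "((\<lambda>x. f (y + s *\<^sub>R x)) has_derivative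
     (\<lambda>h. \<Sum>i\<in>UNIV. (s *\<^sub>R h) $ i *\<^sub>R partial_deriv i f (y + s *\<^sub>R x))) (at x)"
  by (rule has_derivative_compose[where f = "\<lambda>x. y + s *\<^sub>R x" and g = f,
     OF _ has_derivative_partial_deriv[OF assms]]) (auto intro!: derivative_eq_intros)
 note D = this
 show "(\<lambda>x. f (y + s *\<^sub>R x)) differentiable (at x)"
  using D differentiable_def by blast
 show "partial_deriv i (\<lambda>x. f (y + s *\<^sub>R x)) x = s *\<^sub>R partial_deriv i f (y + s *\<^sub>R x)"
  unfolding partial_deriv_eq[OF D]
  by (subst sum.remove[of _ i]) (auto simp: axis_def intro!: sum.neutral)
qed

lemma has_vector_derivative_line:
 fixes f :: "'n::finite cfun"
 assumes "f differentiable (at (x + t *\<^sub>R h))"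
 shows "((\<lambda>t. f (x + t *\<^sub>R h)) has_vector_derivative
     (\<Sum>i\<in>UNIV. h $ i *\<^sub>R partial_deriv i f (x + t *\<^sub>R h))) (at t within S)"
proof -
 have "((\<lambda>t. f (x + t *\<^sub>R h)) has_derivative
  (\<lambda>r. \<Sum>i\<in>UNIV. (r *\<^sub>R h) $ i *\<^sub>R partial_deriv i f (x + t *\<^sub>R h))) (at t)"
  by (rule has_derivative_compose[where f = "\<lambda>t. x + t *\<^sub>R h" and g = f,
     OF _ has_derivative_partial_deriv[OF assms]]) (auto intro!: derivative_eq_intros)
 then show ?thesis
  unfolding has_vector_derivative_def
  by (auto simp: scaleR_sum_right intro: has_derivative_at_withinI)
qed

lemma has_vector_derivative_axis:
 fixes f :: "'n::finite cfun"
 assumes "f differentiable (at (x + t *\<^sub>R axis i 1))"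
 shows "((\<lambda>t. f (x + t *\<^sub>R axis i 1)) has_vector_derivative
     partial_deriv i f (x + t *\<^sub>R axis i 1)) (at t within S)"
proof -
 have "(\<Sum>j\<in>UNIV. axis i 1 $ j *\<^sub>R partial_deriv j f (x + t *\<^sub>R axis i 1))
    = partial_deriv i f (x + t *\<^sub>R axis i 1)"
  by (subst sum.remove[of _ i]) (auto simp: axis_def intro!: sum.neutral)
 then show ?thesis
  using has_vector_derivative_line[OF assms] by simp
qed

lemma C_k_Suc: "C_k (Suc k) f \<Longrightarrow> C_k k f"
 by (induction k arbitrary: f) (auto intro: differentiable_imp_continuous_on)

lemma C_k_add: "C_k k f \<Longrightarrow> C_k k g \<Longrightarrow> C_k k (\<lambda>x. f x + g x)"
proof (induction k arbitrary: f g)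
 case 0
 then show ?case by (auto intro: continuous_intros)
next
 case (Suc k)
 then have "partial_deriv i (\<lambda>x. f x + g x) = (\<lambda>x. partial_deriv i f x + partial_deriv i g x)" for i
  by (auto simp: differentiable_on_def partial_deriv_add)
 then show ?case
  using Suc by (auto intro: derivative_intros)
qed

lemma C_k_mult: "C_k k f \<Longrightarrow> C_k k g \<Longrightarrow> C_k k (\<lambda>x. f x * g x)"
proof (induction k arbitrary: f g)
 case 0
 then show ?case by (auto intro: continuous_intros)
next
 case (Suc k)
 then have "partial_deriv i (\<lambda>x. f x * g x)
   = (\<lambda>x. partial_deriv i f x * g x + f x * partial_deriv i g x)" for i
  by (auto simp: differentiable_on_def partial_deriv_mult)
 then show ?case
  using Suc C_k_Suc[OF Suc.prems(1)] C_k_Suc[OF Suc.prems(2)]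
  by (auto simp: differentiable_on_def intro!: C_k_add)
qed

lemma smooth_mult: "smooth f \<Longrightarrow> smooth g \<Longrightarrow> smooth (\<lambda>x. f x * g x)"
 by (simp add: smooth_def C_k_mult)

lemma partial_deriv_const: "partial_deriv i (\<lambda>x. c) = (\<lambda>x. 0)"
 by (rule ext, subst partial_deriv_eq[OF has_derivative_const]) auto

lemma smooth_const: "smooth (\<lambda>x. c)"
 by (rule smooth_coinduct[where S = "range (\<lambda>c x. c)"]) (auto simp: partial_deriv_const)

lemma smooth_add: "smooth f \<Longrightarrow> smooth g \<Longrightarrow> smooth (\<lambda>x. f x + g x)"
 by (simp add: smooth_def C_k_add)

lemma smooth_cmult: "smooth f \<Longrightarrow> smooth (\<lambda>x. c * f x)"
 using smooth_mult[OF smooth_const] by blast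

lemma smooth_affine:
 fixes f :: "'n::finite cfun"
 assumes "smooth f"
 shows "smooth (\<lambda>x. f (y + s *\<^sub>R x))"
proof (rule smooth_coinduct[where S = "{\<lambda>x. c * f (y + s *\<^sub>R x) | c f. smooth f}"])
 show "(\<lambda>x. f (y + s *\<^sub>R x)) \<in> {\<lambda>x. c * f (y + s *\<^sub>R x) |c f. smooth f}"
  using assms by (auto intro!: exI[of _ 1])
next
 fix g :: "'n cfun" and x
 assume "g \<in> {\<lambda>x. c * f (y + s *\<^sub>R x) |c f. smooth f}"
 then show "g differentiable (at x)"
  by (auto intro!: differentiable_mult differentiable_const
     intro: partial_deriv_affine(2) smooth_differentiable)
next
 fix g :: "'n cfun" and i
 assume "g \<in> {\<lambda>x. c * f (y + s *\<^sub>R x) |c f. smooth f}"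
 then obtain c f where g: "g = (\<lambda>x. c * f (y + s *\<^sub>R x))" and f: "smooth f"
  by blast
 have "partial_deriv i g = (\<lambda>x. (c * s) * partial_deriv i f (y + s *\<^sub>R x))"
  unfolding g using smooth_differentiable[OF f]
  by (auto simp: partial_deriv_cmult partial_deriv_affine scaleR_conv_of_real[where ?'a = complex] fun_eq_iff)
 then show "partial_deriv i g \<in> {\<lambda>x. c * f (y + s *\<^sub>R x) |c f. smooth f}"
  using smooth_partial_deriv[OF f] by blast
qed

text \<open>The increment of \<open>f\<close> in direction \<open>i\<close> is the integral of
  \<open>partial_deriv i f\<close> along a segment. Differentiating this identity in direction
  \<open>j\<close> under the integral, and then in the length of the segment at 0, produces the two
  mixed derivatives.\<close>

theorem partial_deriv_commute:
 fixes f :: "'n::finite cfun"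
 assumes f: "smooth f"
 shows "partial_deriv i (partial_deriv j f) = partial_deriv j (partial_deriv i f)"
proof
 fix x
 let ?e = "axis i 1 :: real ^ 'n" and ?d = "axis j 1 :: real ^ 'n"
 define G where "G = partial_deriv i f"
 have G: "smooth G" and Gj: "smooth (partial_deriv j G)" and fj: "smooth (partial_deriv j f)"
  using f smooth_partial_deriv G_def by auto
 have ftc: "f (x + t *\<^sub>R ?d + s *\<^sub>R ?e) - f (x + t *\<^sub>R ?d) =
   integral {0..s} (\<lambda>\<sigma>. G (x + t *\<^sub>R ?d + \<sigma> *\<^sub>R ?e))" if "0 \<le> s" for s t
 proof -
  have "((\<lambda>\<sigma>. G (x + t *\<^sub>R ?d + \<sigma> *\<^sub>R ?e)) has_integral
    f (x + t *\<^sub>R ?d + s *\<^sub>R ?e) - f (x + t *\<^sub>R ?d + 0 *\<^sub>R ?e)) {0..s}"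
   unfolding G_def using that
   by (intro fundamental_theorem_of_calculus has_vector_derivative_axis smooth_differentiable f)
    auto
  then show ?thesis
   by (simp add: integral_unique)
 qed
 have ftc2: "partial_deriv j f (x + s *\<^sub>R ?e) - partial_deriv j f x =
   integral {0..s} (\<lambda>\<sigma>. partial_deriv j G (x + \<sigma> *\<^sub>R ?e))" if "0 \<le> s" for s
 proof -
  have sw: "x + t *\<^sub>R ?d + \<sigma> *\<^sub>R ?e = (x + \<sigma> *\<^sub>R ?e) + t *\<^sub>R ?d" for t \<sigma>
   by (simp add: algebra_simps)
  have cG: "continuous_on UNIV G" and cGj: "continuous_on UNIV (partial_deriv j G)"
   using G Gj smooth_continuous by auto
  have "((\<lambda>t. integral (cbox 0 s) (\<lambda>\<sigma>. G (x + t *\<^sub>R ?d + \<sigma> *\<^sub>R ?e)))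
      has_vector_derivative
     integral (cbox 0 s) (\<lambda>\<sigma>. partial_deriv j G (x + 0 *\<^sub>R ?d + \<sigma> *\<^sub>R ?e)))
     (at 0 within UNIV)"
  proof (rule leibniz_rule_vector_derivative
    [where fx = "\<lambda>t \<sigma>. partial_deriv j G (x + t *\<^sub>R ?d + \<sigma> *\<^sub>R ?e)"])
   fix t \<sigma> :: real
   show "((\<lambda>t. G (x + t *\<^sub>R ?d + \<sigma> *\<^sub>R ?e)) has_vector_derivative
     partial_deriv j G (x + t *\<^sub>R ?d + \<sigma> *\<^sub>R ?e)) (at t within UNIV)"
    unfolding sw by (intro has_vector_derivative_axis smooth_differentiable G)
   show "(\<lambda>\<sigma>. G (x + t *\<^sub>R ?d + \<sigma> *\<^sub>R ?e)) integrable_on cbox 0 s"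
    by (intro integrable_continuous continuous_on_compose2[OF cG] continuous_intros) auto
   show "continuous_on (UNIV \<times> cbox 0 s)
     (\<lambda>(t, \<sigma>). partial_deriv j G (x + t *\<^sub>R ?d + \<sigma> *\<^sub>R ?e))"
    unfolding split_beta by (intro continuous_on_compose2[OF cGj] continuous_intros) auto
  qed auto
  moreover have "(\<lambda>t. integral (cbox 0 s) (\<lambda>\<sigma>. G (x + t *\<^sub>R ?d + \<sigma> *\<^sub>R ?e))) =
    (\<lambda>t. f ((x + s *\<^sub>R ?e) + t *\<^sub>R ?d) - f (x + t *\<^sub>R ?d))"
   using ftc[OF that] by (auto simp: sw fun_eq_iff)
  ultimately have 1: "((\<lambda>t. f ((x + s *\<^sub>R ?e) + t *\<^sub>R ?d) - f (x + t *\<^sub>R ?d)) has_vector_derivative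
     integral (cbox 0 s) (\<lambda>\<sigma>. partial_deriv j G (x + 0 *\<^sub>R ?d + \<sigma> *\<^sub>R ?e))) (at 0)"
   by simp
  have 2: "((\<lambda>t. f ((x + s *\<^sub>R ?e) + t *\<^sub>R ?d) - f (x + t *\<^sub>R ?d)) has_vector_derivative
   partial_deriv j f (x + s *\<^sub>R ?e + 0 *\<^sub>R ?d) - partial_deriv j f (x + 0 *\<^sub>R ?d)) (at 0)"
   by (intro has_vector_derivative_diff has_vector_derivative_axis smooth_differentiable f)
  show ?thesis
   using vector_derivative_unique_at[OF 1 2] by simp
 qed
 have cGe: "continuous_on {0..1} (\<lambda>\<sigma>. partial_deriv j G (x + \<sigma> *\<^sub>R ?e))"
  by (intro continuous_on_compose2[OF smooth_continuous[OF Gj]] continuous_intros) auto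
 \<comment> \<open>\<open>ftc2\<close> holds for \<open>s \<ge> 0\<close> only, so both derivatives
   at 0 are taken from the right, where they are still unique.\<close>
 have A: "((\<lambda>s. integral {0..s} (\<lambda>\<sigma>. partial_deriv j G (x + \<sigma> *\<^sub>R ?e))) has_vector_derivative
   partial_deriv j G (x + 0 *\<^sub>R ?e)) (at 0 within {0..1})"
  by (rule integral_has_vector_derivative[OF cGe]) auto
 have B: "((\<lambda>s. partial_deriv j f (x + s *\<^sub>R ?e) - partial_deriv j f x) has_vector_derivative
   partial_deriv i (partial_deriv j f) (x + 0 *\<^sub>R ?e) - 0) (at 0 within {0..1})"
  by (intro has_vector_derivative_diff has_vector_derivative_axis smooth_differentiable fj
     has_vector_derivative_const)
 have "((\<lambda>s. integral {0..s} (\<lambda>\<sigma>. partial_deriv j G (x + \<sigma> *\<^sub>R ?e))) has_vector_derivative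
   partial_deriv i (partial_deriv j f) (x + 0 *\<^sub>R ?e) - 0) (at 0 within {0..1})"
  by (rule has_vector_derivative_transform[OF _ _ B]) (auto simp: ftc2)
 from vector_derivative_unique_within[OF _ A this]
 show "partial_deriv i (partial_deriv j f) x = partial_deriv j (partial_deriv i f) x"
  by (simp add: at_within_Icc_at_right G_def)
qed

subsection \<open>Iterated partial derivatives\<close>

text \<open>Derivatives are indexed by words in the coordinates, so that inductions peel off one
  derivative at a time. By symmetry of mixed derivatives a word matters only through its multiset,
  which is a multi-index.\<close>

definition iter_deriv :: "'n list \<Rightarrow> 'n::finite cfun \<Rightarrow> 'n cfun" where
 "iter_deriv ks = fold partial_deriv ks"

lemma iter_deriv_Nil [simp]: "iter_deriv [] f = f"
 and iter_deriv_Cons: "iter_deriv (k # ks) f = iter_deriv ks (partial_deriv k f)"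
 and iter_deriv_append: "iter_deriv (ks @ ls) f = iter_deriv ls (iter_deriv ks f)"
 by (simp_all add: iter_deriv_def)

lemma smooth_iter_deriv: "smooth f \<Longrightarrow> smooth (iter_deriv ks f)"
 by (induction ks arbitrary: f) (auto simp: iter_deriv_Cons smooth_partial_deriv)

lemma iter_deriv_partial_deriv:
 "smooth f \<Longrightarrow> iter_deriv ks (partial_deriv i f) = partial_deriv i (iter_deriv ks f)"
proof (induction ks arbitrary: f)
 case (Cons k ks)
 then show ?case
  by (simp add: iter_deriv_Cons smooth_partial_deriv partial_deriv_commute[of f k])
qed simp

lemma iter_deriv_cong_mset:
 "mset ks = mset ls \<Longrightarrow> smooth f \<Longrightarrow> iter_deriv ks f = iter_deriv ls f"
proof (induction ks arbitrary: ls f)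
 case (Cons k ks)
 then have "k \<in> set ls"
  by (metis list.set_intros(1) set_mset_mset)
 then obtain l1 l2 where ls: "ls = l1 @ k # l2"
  by (meson split_list)
 then have "mset ks = mset (l1 @ l2)"
  using Cons.prems by simp
 then have "iter_deriv ks (partial_deriv k f) = iter_deriv (l1 @ l2) (partial_deriv k f)"
  using Cons smooth_partial_deriv by blast
 then show ?case
  using Cons.prems
  by (simp add: ls iter_deriv_Cons iter_deriv_append iter_deriv_partial_deriv)
qed simp

lemma iter_deriv_iter_deriv_commute:
 "smooth f \<Longrightarrow> iter_deriv ks (iter_deriv ls f) = iter_deriv ls (iter_deriv ks f)"
 by (simp add: iter_deriv_append[symmetric] iter_deriv_cong_mset[of "ks @ ls" "ls @ ks"])

lemma multi_deriv_eq_iter_deriv: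
 fixes \<alpha> :: "'n::finite \<Rightarrow> nat"
 obtains ks where "\<And>f. multi_deriv \<alpha> f = iter_deriv ks f" "\<And>i. count (mset ks) i = \<alpha> i"
  "length ks = (\<Sum>i\<in>UNIV. \<alpha> i)"
proof -
 define e where "e = (SOME is. distinct is \<and> set is = (UNIV :: 'n set))"
 have "\<exists>is. distinct is \<and> set is = (UNIV :: 'n set)"
  using finite_distinct_list[of "UNIV :: 'n set"] by auto
 then have e: "distinct e" "set e = UNIV"
  unfolding e_def by (metis (mono_tags, lifting) someI_ex)+
 define L where "L xs = rev (concat (map (\<lambda>i. replicate (\<alpha> i) i) xs))" for xs
 have "foldr (\<lambda>i. partial_deriv i ^^ \<alpha> i) xs f = iter_deriv (L xs) f" for xs f
  by (induction xs) (auto simp: iter_deriv_def L_def)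
 then have 1: "multi_deriv \<alpha> f = iter_deriv (L e) f" for f
  unfolding multi_deriv_def e_def[symmetric] by simp
 have cnt: "count (mset (L xs)) i = (if i \<in> set xs then \<alpha> i else 0)" if "distinct xs" for xs i
  using that by (induction xs) (auto simp: L_def)
 have len: "length (L xs) = (\<Sum>i\<in>set xs. \<alpha> i)" if "distinct xs" for xs
  using that by (induction xs) (auto simp: L_def)
 show ?thesis
  using that[of "L e"] 1 cnt[OF e(1)] len[OF e(1)] e(2) by auto
qed

text \<open>The way back from words to multi-indices of the same order: seminorms given as suprema
  over multi-indices thereby control every word.\<close>

lemma iter_deriv_eq_multi_deriv:
 fixes f :: "'n::finite cfun"
 assumes "smooth f"
 shows "iter_deriv ks f = multi_deriv (count (mset ks)) f"
  and "count (mset ks) \<in> multi_indices (length ks)"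
proof -
 obtain ls where ls: "multi_deriv (count (mset ks)) f = iter_deriv ls f"
  "\<And>i. count (mset ls) i = count (mset ks) i" "length ls = (\<Sum>i\<in>UNIV. count (mset ks) i)"
  by (rule multi_deriv_eq_iter_deriv[of "count (mset ks)"]) blast
 then have m: "mset ls = mset ks"
  by (simp add: multiset_eq_iff)
 then show "iter_deriv ks f = multi_deriv (count (mset ks)) f"
  using ls(1) iter_deriv_cong_mset[OF m assms] by simp
 show "count (mset ks) \<in> multi_indices (length ks)"
  using ls(3) mset_eq_length[OF m] by (simp add: multi_indices_def)
qed

lemma finite_multi_indices: "finite (multi_indices m :: ('n::finite \<Rightarrow> nat) set)"
proof (rule finite_subset)
 show "(multi_indices m :: ('n \<Rightarrow> nat) set) \<subseteq> PiE UNIV (\<lambda>_. {..m})"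
  unfolding multi_indices_def
  by (auto intro: order_trans[OF member_le_sum[of _ UNIV]])
 show "finite (PiE UNIV (\<lambda>_. {..m}) :: ('n \<Rightarrow> nat) set)"
  by (intro finite_PiE) auto
qed

lemma multi_indices_nonempty: "multi_indices m \<noteq> {}"
 unfolding multi_indices_def using zero_le by (auto intro!: exI[of _ "\<lambda>_. 0"])

lemma iter_deriv_add:
 "smooth f \<Longrightarrow> smooth g \<Longrightarrow>
 iter_deriv ks (\<lambda>x. f x + g x) = (\<lambda>x. iter_deriv ks f x + iter_deriv ks g x)"
proof (induction ks arbitrary: f g)
 case (Cons k ks)
 then have "partial_deriv k (\<lambda>x. f x + g x) = (\<lambda>x. partial_deriv k f x + partial_deriv k g x)"
  by (auto simp: partial_deriv_add smooth_differentiable)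
 then show ?case
  using Cons by (simp add: iter_deriv_Cons smooth_partial_deriv)
qed simp

lemma iter_deriv_cmult:
 "smooth f \<Longrightarrow> iter_deriv ks (\<lambda>x. c * f x) = (\<lambda>x. c * iter_deriv ks f x)"
proof (induction ks arbitrary: f)
 case (Cons k ks)
 then have "partial_deriv k (\<lambda>x. c * f x) = (\<lambda>x. c * partial_deriv k f x)"
  by (auto simp: partial_deriv_cmult smooth_differentiable)
 then show ?case
  using Cons by (simp add: iter_deriv_Cons smooth_partial_deriv)
qed simp

lemma smooth_diff: "smooth f \<Longrightarrow> smooth g \<Longrightarrow> smooth (\<lambda>x. f x - g x)"
 using smooth_add[of f "\<lambda>x. -1 * g x"] smooth_cmult[of g "-1"] by simp

lemma iter_deriv_diff:
 "smooth f \<Longrightarrow> smooth g \<Longrightarrow>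
 iter_deriv ks (\<lambda>x. f x - g x) = (\<lambda>x. iter_deriv ks f x - iter_deriv ks g x)"
 using iter_deriv_add[of f "\<lambda>x. -1 * g x" ks] iter_deriv_cmult[of g ks "-1"]
  smooth_cmult[of g "-1"] by simp

lemma smooth_sum: "(\<And>i. i \<in> I \<Longrightarrow> smooth (f i)) \<Longrightarrow> smooth (\<lambda>x. \<Sum>i\<in>I. f i x)"
 by (induction I rule: infinite_finite_induct) (auto simp: smooth_const smooth_add)

lemma iter_deriv_zero: "iter_deriv ks (\<lambda>x. 0) = (\<lambda>x. 0)"
 by (induction ks) (auto simp: iter_deriv_Cons partial_deriv_const)

lemma iter_deriv_sum:
 "(\<And>i. i \<in> I \<Longrightarrow> smooth (f i)) \<Longrightarrow>
 iter_deriv ks (\<lambda>x. \<Sum>i\<in>I. f i x) = (\<lambda>x. \<Sum>i\<in>I. iter_deriv ks (f i) x)"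
 by (induction I rule: infinite_finite_induct) (auto simp: iter_deriv_zero iter_deriv_add smooth_sum)

lemma iter_deriv_affine:
 "smooth f \<Longrightarrow> iter_deriv ks (\<lambda>x. f (y + s *\<^sub>R x)) =
  (\<lambda>x. of_real (s ^ length ks) * iter_deriv ks f (y + s *\<^sub>R x))"
proof (induction ks arbitrary: f)
 case (Cons k ks)
 have "partial_deriv k (\<lambda>x. f (y + s *\<^sub>R x)) = (\<lambda>x. of_real s * partial_deriv k f (y + s *\<^sub>R x))"
  using smooth_differentiable[OF Cons.prems]
  by (auto simp: partial_deriv_affine scaleR_conv_of_real[where ?'a = complex] fun_eq_iff)
 note eq = this
 have "iter_deriv ks (\<lambda>x. of_real s * partial_deriv k f (y + s *\<^sub>R x)) =
   (\<lambda>x. of_real s * iter_deriv ks (\<lambda>x. partial_deriv k f (y + s *\<^sub>R x)) x)"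
  by (intro iter_deriv_cmult smooth_affine smooth_partial_deriv Cons.prems)
 then show ?case
  using Cons.IH[OF smooth_partial_deriv[OF Cons.prems, of k]]
  by (simp add: iter_deriv_Cons eq mult_ac)
qed simp

lemma partial_deriv_local:
 assumes "open S" "x \<in> S" "\<And>y. y \<in> S \<Longrightarrow> f y = g y"
 shows "partial_deriv i f x = partial_deriv i g x"
proof -
 have "(f has_derivative D) (at x) \<longleftrightarrow> (g has_derivative D) (at x)" for D
  using assms by (metis has_derivative_transform_within_open)
 then show ?thesis
  unfolding partial_deriv_def frechet_derivative_def by simp
qed

lemma iter_deriv_local:
 assumes "open S" "\<And>y. y \<in> S \<Longrightarrow> f y = g y" "x \<in> S"
 shows "iter_deriv ks f x = iter_deriv ks g x"
 using assms(2,3)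
proof (induction ks arbitrary: f g)
 case (Cons k ks)
 then have "partial_deriv k f y = partial_deriv k g y" if "y \<in> S" for y
  using partial_deriv_local[OF assms(1) that] by blast
 then show ?case
  using Cons.IH[of "partial_deriv k f" "partial_deriv k g"] Cons.prems(2)
  by (simp add: iter_deriv_Cons)
qed simp

subsection \<open>The Leibniz rule\<close>

definition deriv_sum :: "nat \<Rightarrow> 'n cfun \<Rightarrow> real ^ 'n \<Rightarrow> real" where
 "deriv_sum m f x = (\<Sum>ks | length ks \<le> m. cmod (iter_deriv ks f x))"

lemma finite_lists_le: "finite {ks :: 'n::finite list. length ks \<le> m}"
 using finite_lists_length_le[of "UNIV :: 'n set" m] by simp

lemma deriv_sum_nonneg: "0 \<le> deriv_sum m f x"
 by (auto simp: deriv_sum_def intro: sum_nonneg)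

lemma deriv_sum_mono: "m \<le> m' \<Longrightarrow> deriv_sum m f x \<le> deriv_sum m' f x"
 unfolding deriv_sum_def by (rule sum_mono2) (auto intro: finite_lists_le)

lemma deriv_sum_partial_deriv: "deriv_sum m (partial_deriv k f) x \<le> deriv_sum (Suc m) f x"
proof -
 have "deriv_sum m (partial_deriv k f) x = (\<Sum>ks\<in>Cons k ` {ks. length ks \<le> m}. cmod (iter_deriv ks f x))"
  unfolding deriv_sum_def by (subst sum.reindex) (auto simp: iter_deriv_Cons)
 also have "... \<le> deriv_sum (Suc m) f x"
  unfolding deriv_sum_def by (rule sum_mono2) (auto intro: finite_lists_le)
 finally show ?thesis .
qed

text \<open>A Leibniz rule without binomial coefficients: each derivative splits the product into
  two products of the same kind, and bounding both by the same quantity doubles the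
  constant.\<close>

lemma cmod_iter_deriv_mult_le:
 fixes a f :: "'n::finite cfun"
 assumes "smooth a" "smooth f" "\<And>js. length js \<le> length ks \<Longrightarrow> cmod (iter_deriv js a x) \<le> c"
 shows "cmod (iter_deriv ks (\<lambda>x. a x * f x) x) \<le> 2 ^ length ks * c * deriv_sum (length ks) f x"
 using assms
proof (induction ks arbitrary: a f)
 case Nil
 have "cmod (a x * f x) \<le> c * cmod (f x)"
  using Nil(3)[of "[]"] by (simp add: norm_mult mult_right_mono)
 then show ?case
  by (simp add: deriv_sum_def)
next
 case (Cons k ks)
 let ?m = "length ks"
 have c0: "0 \<le> c"
  using order_trans[OF norm_ge_zero Cons.prems(3)[of "[]"]] by simp
 have eq: "partial_deriv k (\<lambda>x. a x * f x) = (\<lambda>x. partial_deriv k a x * f x + a x * partial_deriv k f x)"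
  using Cons.prems by (auto simp: partial_deriv_mult smooth_differentiable)
 let ?b = "2 ^ ?m * c * deriv_sum (Suc ?m) f x"
 have E: "iter_deriv (k # ks) (\<lambda>x. a x * f x) x =
  iter_deriv ks (\<lambda>x. partial_deriv k a x * f x) x + iter_deriv ks (\<lambda>x. a x * partial_deriv k f x) x"
  using Cons.prems by (simp add: iter_deriv_Cons eq iter_deriv_add smooth_mult smooth_partial_deriv)
 have "cmod (iter_deriv ks (\<lambda>x. partial_deriv k a x * f x) x) \<le> 2 ^ ?m * c * deriv_sum ?m f x"
 proof (rule Cons.IH)
  fix js :: "'n list" assume "length js \<le> ?m"
  then show "cmod (iter_deriv js (partial_deriv k a) x) \<le> c"
   using Cons.prems(3)[of "k # js"] by (simp add: iter_deriv_Cons)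
 qed (use Cons.prems smooth_partial_deriv in auto)
 moreover have "cmod (iter_deriv ks (\<lambda>x. a x * partial_deriv k f x) x) \<le> 2 ^ ?m * c * deriv_sum ?m (partial_deriv k f) x"
  using Cons.prems smooth_partial_deriv by (intro Cons.IH) auto
 moreover have "2 ^ ?m * c * deriv_sum ?m f x \<le> ?b"
  "2 ^ ?m * c * deriv_sum ?m (partial_deriv k f) x \<le> ?b"
  using c0 deriv_sum_partial_deriv deriv_sum_mono[of ?m "Suc ?m"] by (auto intro!: mult_left_mono)
 ultimately have "cmod (iter_deriv (k # ks) (\<lambda>x. a x * f x) x) \<le> ?b + ?b"
  unfolding E
  using norm_triangle_ineq[of "iter_deriv ks (\<lambda>x. partial_deriv k a x * f x) x"
    "iter_deriv ks (\<lambda>x. a x * partial_deriv k f x) x"] by linarith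
 then show ?case
  by (simp add: mult_ac)
qed

subsection \<open>Test functions\<close>

lemma test_functionsI:
 fixes f :: "'n::finite cfun"
 assumes "smooth f" "\<And>x. R < norm x \<Longrightarrow> f x = 0"
 shows "f \<in> test_functions"
proof -
 have "{x. f x \<noteq> 0} \<subseteq> cball 0 R"
  using assms(2) by (auto simp: not_less[symmetric])
 then have "bounded {x. f x \<noteq> 0}"
  using bounded_cball bounded_subset by blast
 then show ?thesis
  using assms(1) by (simp add: test_functions_def)
qed

lemma test_functions_support:
 fixes f :: "'n::finite cfun"
 assumes "f \<in> test_functions"
 shows "\<exists>R>0. \<forall>x. R < norm x \<longrightarrow> f x = 0"
proof -
 have "bounded (closure {x. f x \<noteq> 0})"
  using assms compact_imp_bounded unfolding test_functions_def by blast
 then have "bounded {x. f x \<noteq> 0}"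
  using bounded_subset closure_subset by blast
 then obtain R where "0 < R" "\<And>x. f x \<noteq> 0 \<Longrightarrow> norm x \<le> R"
  unfolding bounded_pos by blast
 then show ?thesis
  using not_less by blast
qed

lemma test_smooth: "f \<in> test_functions \<Longrightarrow> smooth f"
 by (simp add: test_functions_def)

lemma iter_deriv_support:
 fixes f :: "'n::finite cfun"
 assumes "\<And>x. R < norm x \<Longrightarrow> f x = 0" "R < norm x"
 shows "iter_deriv ks f x = 0"
proof -
 have "open {x :: real ^ 'n. R < norm x}"
  by (intro open_Collect_less continuous_intros)
 from iter_deriv_local[OF this, of f "\<lambda>_. 0" x ks] show ?thesis
  using assms by (simp add: iter_deriv_zero)
qed

lemma test_iter_deriv:
 fixes f :: "'n::finite cfun"
 assumes "f \<in> test_functions"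
 shows "iter_deriv ks f \<in> test_functions"
proof -
 obtain R where "\<forall>x. R < norm x \<longrightarrow> f x = 0"
  using test_functions_support[OF assms] by metis
 then show ?thesis
  using smooth_iter_deriv[OF test_smooth[OF assms]] iter_deriv_support[of R f _ ks]
  by (intro test_functionsI[where R = R]) blast+
qed

lemma test_mult_left:
 assumes "f \<in> test_functions" "smooth a"
 shows "(\<lambda>x. a x * f x) \<in> test_functions" "(\<lambda>x. f x * a x) \<in> test_functions"
proof -
 obtain R where "\<forall>x. R < norm x \<longrightarrow> f x = 0"
  using test_functions_support[OF assms(1)] by metis
 then show "(\<lambda>x. a x * f x) \<in> test_functions" "(\<lambda>x. f x * a x) \<in> test_functions"
  using assms test_smooth[OF assms(1)]
  by (intro test_functionsI[where R = R]; simp add: smooth_mult)+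
qed

lemma test_lincomb:
 assumes "f \<in> test_functions" "g \<in> test_functions"
 shows "(\<lambda>x. a * f x + b * g x) \<in> test_functions"
proof -
 obtain R R' where "\<forall>x. R < norm x \<longrightarrow> f x = 0" "\<forall>x. R' < norm x \<longrightarrow> g x = 0"
  using test_functions_support[OF assms(1)] test_functions_support[OF assms(2)] by metis
 then show ?thesis
  using test_smooth[OF assms(1)] test_smooth[OF assms(2)]
  by (intro test_functionsI[where R = "max R R'"]; simp add: smooth_add smooth_cmult)
qed

lemma cont_support_bounded:
 fixes f :: "'n::finite cfun"
 assumes "continuous_on UNIV f" "\<And>x. R < norm x \<Longrightarrow> f x = 0"
 shows "\<exists>c\<ge>0. \<forall>x. cmod (f x) \<le> c"
proof -
 have "bounded (f ` cball 0 R)"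
  by (intro compact_imp_bounded compact_continuous_image continuous_on_subset[OF assms(1)]) auto
 then obtain c where c: "0 < c" "\<And>x. norm x \<le> R \<Longrightarrow> cmod (f x) \<le> c"
  unfolding bounded_pos by auto
 then have "cmod (f x) \<le> c" for x
  using assms(2)[of x] by (cases "norm x \<le> R") auto
 then show ?thesis
  using c(1) by (meson less_imp_le)
qed

lemma test_bounded:
 fixes f :: "'n::finite cfun"
 assumes "f \<in> test_functions"
 shows "\<exists>c\<ge>0. \<forall>x. cmod (f x) \<le> c"
proof -
 obtain R where "\<forall>x. R < norm x \<longrightarrow> f x = 0"
  using test_functions_support[OF assms] by metis
 then show ?thesis
  using cont_support_bounded[of f R] smooth_continuous[OF test_smooth[OF assms]] by simp
qed

lemma smooth_laplacian: "smooth f \<Longrightarrow> smooth (laplacian f)"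
 unfolding laplacian_def[abs_def] by (intro smooth_sum smooth_partial_deriv)

lemma smooth_one_minus_laplacian: "smooth f \<Longrightarrow> smooth (one_minus_laplacian f)"
 unfolding one_minus_laplacian_def[abs_def] by (intro smooth_diff smooth_laplacian)

lemma laplacian_iter_deriv: "laplacian f = (\<lambda>x. \<Sum>i\<in>UNIV. iter_deriv [i, i] f x)"
 by (simp add: laplacian_def fun_eq_iff iter_deriv_Cons)

lemma iter_deriv_one_minus_laplacian:
 assumes f: "smooth f"
 shows "iter_deriv ks (one_minus_laplacian f) = one_minus_laplacian (iter_deriv ks f)"
proof -
 have "iter_deriv ks (laplacian f) = laplacian (iter_deriv ks f)"
  unfolding laplacian_iter_deriv
  by (subst iter_deriv_sum) (auto simp: f smooth_iter_deriv iter_deriv_iter_deriv_commute[OF f])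
 then show ?thesis
  unfolding one_minus_laplacian_def[abs_def]
  by (simp add: iter_deriv_diff f smooth_laplacian)
qed

section \<open>The Lebesgue norms\<close>

text \<open>Young's inequality in the form "the graph of \<open>y powr r\<close> lies above its
  tangent at \<open>x\<close>". It includes \<open>r = 1\<close> and stands in for the inequalities
  of Hoelder, Minkowski and Jensen below, always with a suitable point of tangency.\<close>

lemma powr_tangent_le:
 fixes x y r :: real
 assumes "1 \<le> r" "0 \<le> x" "0 \<le> y"
 shows "r * (x powr (r - 1) * y) \<le> (r - 1) * x powr r + y powr r"
proof (cases "x = 0 \<or> y = 0")
 case False
 with assms have "x > 0" "y > 0" by auto
 then have "(x powr r) powr ((r - 1) / r) * (y powr r) powr (1 / r) \<le>
   ((r - 1) / r) * x powr r + (1 / r) * y powr r"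
  using assms by (intro Youngs_inequality_0) (auto simp: field_simps)
 moreover have "(x powr r) powr ((r - 1) / r) = x powr (r - 1)" "(y powr r) powr (1 / r) = y"
  using assms \<open>y > 0\<close> by (auto simp: powr_powr)
 ultimately have "x powr (r - 1) * y \<le> ((r - 1) * x powr r + y powr r) / r"
  by (simp add: add_divide_distrib)
 then show ?thesis
  using assms by (simp add: pos_le_divide_eq mult.commute)
qed (use assms in auto)

lemma powr_minus1_mult: "0 \<le> (x::real) \<Longrightarrow> x powr (r - 1) * x = x powr r"
 by (cases "x = 0") (auto simp: powr_diff)

text \<open>Averaging the tangent inequality at the mean \<open>\<theta> * s + \<mu> * t\<close>
  over the two points \<open>s\<close> and \<open>t\<close> cancels the linear terms.\<close>

lemma powr_convex_comb:
 fixes s t r \<theta> \<mu> :: real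
 assumes "1 \<le> r" "0 \<le> s" "0 \<le> t" "0 \<le> \<theta>" "0 \<le> \<mu>" "\<theta> + \<mu> = 1"
 shows "(\<theta> * s + \<mu> * t) powr r \<le> \<theta> * s powr r + \<mu> * t powr r"
proof -
 define m where "m = \<theta> * s + \<mu> * t"
 have m0: "0 \<le> m" using assms by (simp add: m_def)
 have "\<theta> * (r * (m powr (r - 1) * s)) + \<mu> * (r * (m powr (r - 1) * t)) \<le>
   \<theta> * ((r - 1) * m powr r + s powr r) + \<mu> * ((r - 1) * m powr r + t powr r)"
  using assms m0 by (intro add_mono mult_left_mono powr_tangent_le) auto
 also have "... = (\<theta> + \<mu>) * ((r - 1) * m powr r) + \<theta> * s powr r + \<mu> * t powr r"
  by (simp add: algebra_simps)
 also have "\<theta> * (r * (m powr (r - 1) * s)) + \<mu> * (r * (m powr (r - 1) * t)) = r * (m powr (r - 1) * m)"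
  by (simp add: m_def algebra_simps)
 also have "... = r * m powr r"
  using m0 powr_minus1_mult by simp
 finally have "r * m powr r \<le> (r - 1) * m powr r + \<theta> * s powr r + \<mu> * t powr r"
  using assms(6) by simp
 then show ?thesis
  unfolding m_def[symmetric] by (simp add: algebra_simps)
qed

text \<open>Outside of the Lebesgue space \<open>Lp_norm\<close> has the junk value 0, since the
  Bochner integral of a non-integrable function is 0 and \<open>real_of_ereal\<close> sends infinity
  to 0. Norm bounds therefore travel together with membership.\<close>

definition Lp_ball :: "ennreal \<Rightarrow> real \<Rightarrow> 'n::finite cfun \<Rightarrow> bool" where
 "Lp_ball p c f \<longleftrightarrow> in_Lp p f \<and> Lp_norm p f \<le> c"

lemma Lp_norm_nonneg: "0 \<le> Lp_norm p f"
proof (cases "p = \<infinity>")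
 case True
 have "(0::ereal) \<le> esssup lborel (\<lambda>x. ereal (cmod (f x)))"
 proof (cases "(\<lambda>x. ereal (cmod (f x))) \<in> borel_measurable lborel")
  case m: True
  have "esssup lborel (\<lambda>x::real^'a. 0::ereal) \<le> esssup lborel (\<lambda>x. ereal (cmod (f x)))"
   by (intro esssup_mono) auto
  moreover have "esssup lborel (\<lambda>x::real^'a. 0::ereal) = 0"
   by (rule esssup_const) (simp add: emeasure_lborel_UNIV)
  ultimately show ?thesis by simp
 qed (simp add: esssup_non_measurable)
 then show ?thesis
  using True by (simp add: Lp_norm_def real_of_ereal_pos)
qed (simp add: Lp_norm_def)

lemma Lp_ball_infinity:
 assumes p: "p = \<infinity>" and c: "0 \<le> c"
 shows "Lp_ball p c f \<longleftrightarrow> f \<in> borel_measurable lborel \<and> (AE x in lborel. cmod (f x) \<le> c)"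
 unfolding p
proof
 assume *: "Lp_ball \<infinity> c f"
 let ?e = "esssup lborel (\<lambda>x. ereal (cmod (f x)))"
 have f: "f \<in> borel_measurable lborel" and fin: "?e < \<infinity>" and le: "real_of_ereal ?e \<le> c"
  using * by (auto simp: Lp_ball_def in_Lp_def Lp_norm_def)
 have "?e \<le> ereal c"
  using fin le by (cases ?e) auto
 have "AE x in lborel. ereal (cmod (f x)) \<le> ?e"
  by (rule esssup_AE)
 then have "AE x in lborel. cmod (f x) \<le> c"
 proof eventually_elim
  case (elim x)
  then show ?case
   using \<open>?e \<le> ereal c\<close> order_trans ereal_less_eq(3) by blast
 qed
 with f show "f \<in> borel_measurable lborel \<and> (AE x in lborel. cmod (f x) \<le> c)" by simp
next
 assume *: "f \<in> borel_measurable lborel \<and> (AE x in lborel. cmod (f x) \<le> c)"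
 then have f[measurable]: "f \<in> borel_measurable lborel" by simp
 have le: "esssup lborel (\<lambda>x. ereal (cmod (f x))) \<le> ereal c"
  using * by (intro esssup_I) auto
 then have "esssup lborel (\<lambda>x. ereal (cmod (f x))) < \<infinity>"
  using le_less_trans less_ereal.simps(4) by blast
 moreover have "real_of_ereal (esssup lborel (\<lambda>x. ereal (cmod (f x)))) \<le> c"
  using le c by (cases "esssup lborel (\<lambda>x. ereal (cmod (f x)))") auto
 ultimately show "Lp_ball \<infinity> c f"
  using f by (simp add: Lp_ball_def in_Lp_def Lp_norm_def)
qed

lemma enn2real_ge_1: "1 \<le> p \<Longrightarrow> p \<noteq> \<infinity> \<Longrightarrow> 1 \<le> enn2real p"
 by (cases p) (auto simp: ennreal_1[symmetric] simp del: ennreal_1)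

text \<open>With the nonnegative integral, integrability and the norm bound become one inequality,
  to which monotonicity and Tonelli apply without side conditions.\<close>

lemma Lp_ball_finite:
 assumes p: "1 \<le> p" "p \<noteq> \<infinity>" and c: "0 \<le> c"
 shows "Lp_ball p c f \<longleftrightarrow> f \<in> borel_measurable lborel \<and>
  (\<integral>\<^sup>+x. ennreal (cmod (f x) powr enn2real p) \<partial>lborel) \<le> ennreal (c powr enn2real p)"
proof -
 let ?r = "enn2real p"
 have r: "1 \<le> ?r" using enn2real_ge_1 p by blast
 have norm_le: "Lp_norm p f \<le> c \<longleftrightarrow> (LBINT x. cmod (f x) powr ?r) \<le> c powr ?r"
  if "integrable lborel (\<lambda>x. cmod (f x) powr ?r)"
 proof -
  have nn: "0 \<le> (LBINT x. cmod (f x) powr ?r)" by simp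
  have "Lp_norm p f powr ?r = (LBINT x. cmod (f x) powr ?r)"
   using p r nn by (simp add: Lp_norm_def powr_powr)
  then show ?thesis
   using powr_mono2[of ?r "Lp_norm p f" c] powr_less_mono2[of ?r c "Lp_norm p f"]
    Lp_norm_nonneg[of p f] c r by (smt (verit))
 qed
 show ?thesis
 proof
  assume *: "Lp_ball p c f"
  then have "integrable lborel (\<lambda>x. cmod (f x) powr ?r)"
   using p by (auto simp: Lp_ball_def in_Lp_def)
  then show "f \<in> borel_measurable lborel \<and>
   (\<integral>\<^sup>+x. ennreal (cmod (f x) powr ?r) \<partial>lborel) \<le> ennreal (c powr ?r)"
   using * norm_le by (auto simp: Lp_ball_def in_Lp_def nn_integral_eq_integral intro: ennreal_leI)
 next
  assume *: "f \<in> borel_measurable lborel \<and>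
   (\<integral>\<^sup>+x. ennreal (cmod (f x) powr ?r) \<partial>lborel) \<le> ennreal (c powr ?r)"
  then have [measurable]: "f \<in> borel_measurable lborel" by simp
  have int: "integrable lborel (\<lambda>x. cmod (f x) powr ?r)"
   by (rule integrableI_nonneg) (use * in \<open>auto intro: le_less_trans[OF _ ennreal_less_top]\<close>)
  then have "(LBINT x. cmod (f x) powr ?r) \<le> c powr ?r"
   using * by (simp add: nn_integral_eq_integral)
  then show "Lp_ball p c f"
   using int norm_le p * by (simp add: Lp_ball_def in_Lp_def)
 qed
qed

lemma in_Lp_measurable: "in_Lp p f \<Longrightarrow> f \<in> borel_measurable lborel"
 by (simp add: in_Lp_def)

lemma Lp_ball_mono: "Lp_ball p c f \<Longrightarrow> c \<le> d \<Longrightarrow> Lp_ball p d f"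
 by (auto simp: Lp_ball_def)

lemma Lp_ball_dominated:
 assumes p: "1 \<le> p" and c: "0 \<le> c" and d: "0 \<le> d" and g: "Lp_ball p d g"
  and f[measurable]: "f \<in> borel_measurable lborel" and le: "\<And>x. cmod (f x) \<le> c * cmod (g x)"
 shows "Lp_ball p (c * d) f"
proof (cases "p = \<infinity>")
 case True
 have "AE x in lborel. cmod (g x) \<le> d"
  using g d by (simp add: True Lp_ball_infinity)
 then have "AE x in lborel. cmod (f x) \<le> c * d"
 proof eventually_elim
  case (elim x)
  then show ?case using le[of x] c by (meson mult_left_mono order_trans)
 qed
 then show ?thesis
  using f c d by (simp add: True Lp_ball_infinity)
next
 case False
 let ?r = "enn2real p"
 have r: "1 \<le> ?r" using enn2real_ge_1 p False by blast
 have g': "g \<in> borel_measurable lborel"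
  "(\<integral>\<^sup>+x. ennreal (cmod (g x) powr ?r) \<partial>lborel) \<le> ennreal (d powr ?r)"
  using g d p False by (auto simp: Lp_ball_finite)
 note [measurable] = g'(1)
 have "(\<integral>\<^sup>+x. ennreal (cmod (f x) powr ?r) \<partial>lborel) \<le>
   (\<integral>\<^sup>+x. ennreal (c powr ?r) * ennreal (cmod (g x) powr ?r) \<partial>lborel)"
 proof (rule nn_integral_mono)
  fix x
  have "cmod (f x) powr ?r \<le> (c * cmod (g x)) powr ?r"
   using le r by (intro powr_mono2) auto
  then show "ennreal (cmod (f x) powr ?r) \<le> ennreal (c powr ?r) * ennreal (cmod (g x) powr ?r)"
   using c by (simp add: powr_mult ennreal_mult'[symmetric] ennreal_leI)
 qed
 also have "... \<le> ennreal (c powr ?r) * ennreal (d powr ?r)"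
  using g'(2) by (subst nn_integral_cmult) (auto intro: mult_left_mono)
 also have "... = ennreal ((c * d) powr ?r)"
  using c d by (simp add: powr_mult ennreal_mult')
 finally show ?thesis
  using f p False c d by (simp add: Lp_ball_finite)
qed

text \<open>Minkowski from convexity: the modulus of \<open>(f + g) / (A + B)\<close> is dominated
  by the convex combination of those of \<open>f / A\<close> and \<open>g / B\<close> with weights
  \<open>A / (A + B)\<close> and \<open>B / (A + B)\<close>. Radius 0 is treated afterwards as a
  limit of positive radii.\<close>

lemma Lp_ball_add_pos:
 assumes p: "1 \<le> p" and A: "0 < A" and B: "0 < B" and f: "Lp_ball p A f" and g: "Lp_ball p B g"
 shows "Lp_ball p (A + B) (\<lambda>x. f x + g x)"
proof (cases "p = \<infinity>")
 case True
 have [measurable]: "f \<in> borel_measurable lborel" "g \<in> borel_measurable lborel"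
  using f g by (auto simp: Lp_ball_def in_Lp_def)
 have "AE x in lborel. cmod (f x) \<le> A" "AE x in lborel. cmod (g x) \<le> B"
  using f g A B by (simp_all add: True Lp_ball_infinity)
 then have "AE x in lborel. cmod (f x + g x) \<le> A + B"
  by eventually_elim (meson add_mono norm_triangle_le)
 then show ?thesis
  using A B by (simp add: True Lp_ball_infinity)
next
 case False
 let ?r = "enn2real p"
 have r: "1 \<le> ?r" using enn2real_ge_1 p False by blast
 have [measurable]: "f \<in> borel_measurable lborel" "g \<in> borel_measurable lborel"
  using f g by (auto simp: Lp_ball_def in_Lp_def)
 have If: "(\<integral>\<^sup>+x. ennreal (cmod (f x) powr ?r) \<partial>lborel) \<le> ennreal (A powr ?r)"
  and Ig: "(\<integral>\<^sup>+x. ennreal (cmod (g x) powr ?r) \<partial>lborel) \<le> ennreal (B powr ?r)"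
  using f g A B p False by (simp_all add: Lp_ball_finite)
 define \<theta> \<mu> where "\<theta> = A / (A + B)" and "\<mu> = B / (A + B)"
 have lm: "0 \<le> \<theta>" "0 \<le> \<mu>" "\<theta> + \<mu> = 1"
  using A B by (auto simp: \<theta>_def \<mu>_def add_divide_distrib[symmetric])
 define a b where "a = (A + B) powr ?r * \<theta> / A powr ?r" and "b = (A + B) powr ?r * \<mu> / B powr ?r"
 have ab: "0 \<le> a" "0 \<le> b" using lm by (auto simp: a_def b_def)
 have pt: "cmod (f x + g x) powr ?r \<le> a * cmod (f x) powr ?r + b * cmod (g x) powr ?r" for x
 proof -
  let ?s = "cmod (f x) / A" and ?t = "cmod (g x) / B"
  have "(A + B) * (\<theta> * ?s + \<mu> * ?t) = cmod (f x) + cmod (g x)"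
   using A B by (simp add: \<theta>_def \<mu>_def distrib_left)
  then have "cmod (f x + g x) powr ?r \<le> ((A + B) * (\<theta> * ?s + \<mu> * ?t)) powr ?r"
   using r by (intro powr_mono2) (auto simp: norm_triangle_ineq)
  also have "... = (A + B) powr ?r * (\<theta> * ?s + \<mu> * ?t) powr ?r"
   by (rule powr_mult)
  also have "... \<le> (A + B) powr ?r * (\<theta> * ?s powr ?r + \<mu> * ?t powr ?r)"
   using r lm A B by (intro mult_left_mono powr_convex_comb) auto
  also have "... = a * cmod (f x) powr ?r + b * cmod (g x) powr ?r"
   using A B by (simp add: powr_divide a_def b_def distrib_left)
  finally show ?thesis .
 qed
 have "(\<integral>\<^sup>+x. ennreal (cmod (f x + g x) powr ?r) \<partial>lborel) \<le>
   (\<integral>\<^sup>+x. ennreal a * ennreal (cmod (f x) powr ?r) + ennreal b * ennreal (cmod (g x) powr ?r) \<partial>lborel)"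
  using pt ab by (intro nn_integral_mono) (simp add: ennreal_mult'[symmetric] ennreal_leI flip: ennreal_plus)
 also have "... \<le> ennreal a * ennreal (A powr ?r) + ennreal b * ennreal (B powr ?r)"
  using If Ig by (simp add: nn_integral_add nn_integral_cmult add_mono mult_left_mono)
 also have "... = ennreal (a * A powr ?r + b * B powr ?r)"
  using ab by (simp add: ennreal_mult')
 also have "a * A powr ?r + b * B powr ?r = (A + B) powr ?r * (\<theta> + \<mu>)"
  using A B by (simp add: a_def b_def distrib_left)
 finally show ?thesis
  using A B p False lm(3) by (simp add: Lp_ball_finite)
qed

lemma Lp_ball_limit:
 assumes "\<And>e. 0 < e \<Longrightarrow> Lp_ball p (c + e) f"
 shows "Lp_ball p c f"
 using assms[of 1] assms field_le_epsilon unfolding Lp_ball_def by auto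

lemma Lp_ball_nonneg: "Lp_ball p c f \<Longrightarrow> 0 \<le> c"
 using Lp_norm_nonneg unfolding Lp_ball_def by (metis order_trans)

lemma Lp_ball_add:
 assumes p: "1 \<le> p" and f: "Lp_ball p A f" and g: "Lp_ball p B g"
 shows "Lp_ball p (A + B) (\<lambda>x. f x + g x)"
proof (rule Lp_ball_limit)
 fix e :: real assume e: "0 < e"
 have "Lp_ball p ((A + e/2) + (B + e/2)) (\<lambda>x. f x + g x)"
  using e Lp_ball_nonneg[OF f] Lp_ball_nonneg[OF g]
  by (intro Lp_ball_add_pos p Lp_ball_mono[OF f] Lp_ball_mono[OF g]) auto
 then show "Lp_ball p (A + B + e) (\<lambda>x. f x + g x)"
  by (simp add: algebra_simps)
qed

lemma in_Lp_ball: "in_Lp p f \<Longrightarrow> Lp_ball p (Lp_norm p f) f"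
 by (simp add: Lp_ball_def)

lemma Lp_ball_zero: "1 \<le> p \<Longrightarrow> 0 \<le> c \<Longrightarrow> Lp_ball p c (\<lambda>x. 0)"
 by (cases "p = \<infinity>") (auto simp: Lp_ball_infinity Lp_ball_finite)

lemma Lp_ball_sum:
 "1 \<le> p \<Longrightarrow> (\<And>i. i \<in> I \<Longrightarrow> Lp_ball p (c i) (f i)) \<Longrightarrow> Lp_ball p (\<Sum>i\<in>I. c i) (\<lambda>x. \<Sum>i\<in>I. f i x)"
 by (induction I rule: infinite_finite_induct) (auto simp: Lp_ball_zero Lp_ball_add)

lemma in_Lp_add: "1 \<le> p \<Longrightarrow> in_Lp p f \<Longrightarrow> in_Lp p g \<Longrightarrow> in_Lp p (\<lambda>x. f x + g x)"
 and Lp_norm_add: "1 \<le> p \<Longrightarrow> in_Lp p f \<Longrightarrow> in_Lp p g \<Longrightarrow>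
  Lp_norm p (\<lambda>x. f x + g x) \<le> Lp_norm p f + Lp_norm p g"
 using Lp_ball_add[OF _ in_Lp_ball in_Lp_ball] by (auto simp: Lp_ball_def)

lemma in_Lp_dominated:
 assumes "1 \<le> p" "0 \<le> c" "in_Lp p g" "f \<in> borel_measurable lborel" "\<And>x. cmod (f x) \<le> c * cmod (g x)"
 shows "in_Lp p f" "Lp_norm p f \<le> c * Lp_norm p g"
 using Lp_ball_dominated[OF assms(1,2) Lp_norm_nonneg in_Lp_ball[OF assms(3)] assms(4,5)]
 by (auto simp: Lp_ball_def)

lemma Lp_norm_cmult:
 assumes "1 \<le> p" "in_Lp p f"
 shows "in_Lp p (\<lambda>x. c * f x)" "Lp_norm p (\<lambda>x. c * f x) = cmod c * Lp_norm p f"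
proof -
 have m: "f \<in> borel_measurable lborel" using assms in_Lp_measurable by blast
 have 1: "in_Lp p (\<lambda>x. c * f x)" "Lp_norm p (\<lambda>x. c * f x) \<le> cmod c * Lp_norm p f"
  using in_Lp_dominated[OF assms(1) _ assms(2), of "cmod c" "\<lambda>x. c * f x"] m by (auto simp: norm_mult)
 show "in_Lp p (\<lambda>x. c * f x)" by fact
 show "Lp_norm p (\<lambda>x. c * f x) = cmod c * Lp_norm p f"
 proof (cases "c = 0")
  case True
  then show ?thesis
   using 1(2) Lp_norm_nonneg[of p "\<lambda>x. c * f x"] by simp
 next
  case False
  have "Lp_norm p f \<le> inverse (cmod c) * Lp_norm p (\<lambda>x. c * f x)"
   using False m by (intro in_Lp_dominated(2)[OF assms(1) _ 1(1)]) (auto simp: norm_mult simp flip: mult.assoc)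
  then have "cmod c * Lp_norm p f \<le> Lp_norm p (\<lambda>x. c * f x)"
   using False by (simp add: field_simps)
  then show ?thesis
   using 1(2) by simp
 qed
qed

lemma Lp_norm_mono:
 assumes "1 \<le> p" "in_Lp p g" "f \<in> borel_measurable lborel" "\<And>x. cmod (f x) \<le> cmod (g x)"
 shows "in_Lp p f" "Lp_norm p f \<le> Lp_norm p g"
 using in_Lp_dominated[OF assms(1) _ assms(2,3), of 1] assms(4) by auto

text \<open>For a continuous function the exceptional null set is open, hence empty, so that the
  essential supremum bounds every single value.\<close>

lemma cmod_le_Lp_norm_infinity:
 fixes f :: "'n::finite cfun"
 assumes f: "continuous_on UNIV f" and L: "in_Lp \<infinity> f"
 shows "cmod (f x) \<le> Lp_norm \<infinity> f"
proof (rule ccontr)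
 assume neg: "\<not> ?thesis"
 let ?S = "{x. Lp_norm \<infinity> f < cmod (f x)}"
 have op: "open ?S"
  by (intro open_Collect_less continuous_intros f)
 have "AE x in lborel. cmod (f x) \<le> Lp_norm \<infinity> f"
  using in_Lp_ball[OF L] by (simp add: Lp_ball_infinity Lp_norm_nonneg)
 then have "?S \<in> null_sets lborel"
  using op by (subst (asm) AE_iff_null) (auto simp: not_le)
 then have "negligible ?S"
  by (simp add: negligible_iff_null_sets null_sets_completionI)
 moreover have "x \<in> ?S"
  using neg by simp
 ultimately show False
  using open_not_negligible[OF op] by blast
qed

lemma bounded_in_Lp_infinity:
 assumes "f \<in> borel_measurable lborel" "0 \<le> c" "\<And>x. cmod (f x) \<le> c"
 shows "Lp_ball \<infinity> c f"
 using assms by (simp add: Lp_ball_infinity)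

section \<open>Averages of translates in Lebesgue spaces\<close>

lemma nn_integral_lborel_shift:
 fixes f :: "real ^ 'n \<Rightarrow> ennreal"
 assumes "f \<in> borel_measurable borel"
 shows "(\<integral>\<^sup>+x. f (x + y) \<partial>lborel) = (\<integral>\<^sup>+x. f x \<partial>lborel)"
proof -
 have "(\<integral>\<^sup>+x. f x \<partial>lborel) = (\<integral>\<^sup>+x. f x \<partial>distr lborel borel ((+) y))"
  by (simp add: lborel_distr_plus)
 also have "... = (\<integral>\<^sup>+x. f (x + y) \<partial>lborel)"
  using assms by (subst nn_integral_distr) (auto simp: add.commute)
 finally show ?thesis by simp
qed

text \<open>A substitute for Young's convolution inequality.\<close>

lemma Lp_ball_average:
 fixes F u :: "'n::finite cfun" and Y :: "'w \<Rightarrow> real ^ 'n"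
 assumes p: "1 \<le> p" and M: "sigma_finite_measure M"
  and Y[measurable]: "Y \<in> borel_measurable M" and w[measurable]: "w \<in> borel_measurable M"
  and w0: "\<And>y. 0 \<le> w y" and W: "integrable M w" "(\<integral>y. w y \<partial>M) \<le> W" "0 < W"
  and F: "Lp_ball p d F" and u: "u \<in> borel_measurable lborel"
  and int: "\<And>x. integrable M (\<lambda>y. cmod (F (x + Y y)) * w y)"
  and le: "\<And>x. cmod (u x) \<le> (\<integral>y. cmod (F (x + Y y)) * w y \<partial>M)"
 shows "Lp_ball p (W * d) u"
proof -
 interpret sigma_finite_measure M by fact
 interpret pair_sigma_finite M "lborel :: (real ^ 'n) measure" ..
 have d0: "0 \<le> d" using Lp_ball_nonneg[OF F] .
 have F'[measurable]: "F \<in> borel_measurable borel"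
  using F by (simp add: Lp_ball_def in_Lp_def)
 have nW: "(\<integral>\<^sup>+y. ennreal (w y) \<partial>M) \<le> ennreal W"
  using W w0 by (simp add: nn_integral_eq_integral ennreal_leI)
 note [measurable] = u
 show ?thesis
 proof (cases "p = \<infinity>")
  case True
  have AEF: "AE x in lborel. cmod (F x) \<le> d"
   using F d0 by (simp add: True Lp_ball_infinity)
  \<comment> \<open>For each fixed \<open>y\<close> the exceptional set is a translate of a null
    set. Exchanging the order of the two quantifiers gives, for almost every \<open>x\<close>, a
    bound valid under the integral over \<open>y\<close>.\<close>
  have "AE y in M. AE x in lborel. cmod (F (x + Y y)) \<le> d"
  proof (rule AE_I2)
   fix y
   have "(\<integral>\<^sup>+x. indicator {x. \<not> cmod (F x) \<le> d} (x + Y y) \<partial>lborel) =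
     (\<integral>\<^sup>+x. indicator {x. \<not> cmod (F x) \<le> d} x \<partial>lborel)"
    by (rule nn_integral_lborel_shift) measurable
   also have "... = 0"
    using AEF by (subst nn_integral_0_iff_AE) (auto simp: indicator_def)
   finally show "AE x in lborel. cmod (F (x + Y y)) \<le> d"
    by (subst (asm) nn_integral_0_iff_AE) (auto simp: indicator_def)
  qed
  moreover have "{z \<in> space (M \<Otimes>\<^sub>M lborel). cmod (F (snd z + Y (fst z))) \<le> d} \<in> sets (M \<Otimes>\<^sub>M lborel)"
   by measurable
  ultimately have "AE x in lborel. AE y in M. cmod (F (x + Y y)) \<le> d"
   by (subst AE_commute[symmetric]) auto
  then have "AE x in lborel. cmod (u x) \<le> W * d"
  proof eventually_elim
   case (elim x)
   have "(\<integral>y. cmod (F (x + Y y)) * w y \<partial>M) \<le> (\<integral>y. d * w y \<partial>M)"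
    using elim w0 W int by (intro integral_mono_AE) (auto elim!: eventually_mono intro: mult_right_mono)
   also have "... \<le> d * W"
    using W d0 by (auto intro: mult_left_mono)
   finally show ?case
    using le[of x] by (simp add: mult.commute)
  qed
  then show ?thesis
   using u W d0 by (simp add: True Lp_ball_infinity)
 next
  case False
  let ?r = "enn2real p"
  have r: "1 \<le> ?r" using enn2real_ge_1 p False by blast
  define I where "I x = (\<integral>\<^sup>+y. ennreal (cmod (F (x + Y y)) powr ?r) * ennreal (w y) \<partial>M)" for x
  have pt: "ennreal (cmod (u x) powr ?r) \<le> ennreal (W powr (?r - 1)) * I x" for x
  proof (cases "I x = \<infinity>")
   case True
   then show ?thesis using W(3) by (simp add: ennreal_mult_top)
  next
   case fin: False
   let ?t = "\<lambda>y. cmod (F (x + Y y))"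
   have iI: "integrable M (\<lambda>y. ?t y powr ?r * w y)"
    using fin w0 unfolding I_def
    by (intro integrableI_nonneg) (auto simp: ennreal_mult' less_top)
   define J where "J = (\<integral>y. ?t y powr ?r * w y \<partial>M)"
   have IJ: "I x = ennreal J"
    unfolding I_def J_def using iI w0
    by (subst nn_integral_eq_integral[symmetric]) (auto simp: ennreal_mult')
   have J0: "0 \<le> J" unfolding J_def using w0 by simp
   \<comment> \<open>Jensen's inequality with the point of tangency \<open>a\<close> left free. The
     choice \<open>a = cmod (u x) / W\<close> made below merges the first two terms and leaves
     \<open>a powr r * W \<le> J\<close>.\<close>
   have key: "?r * (a powr (?r - 1) * cmod (u x)) \<le> (?r - 1) * a powr ?r * W + J" if "0 < a" for a
   proof -
    have "?r * a powr (?r - 1) * cmod (u x) \<le> ?r * a powr (?r - 1) * (\<integral>y. ?t y * w y \<partial>M)"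
     using r le by (intro mult_left_mono) auto
    also have "... = (\<integral>y. (?r * (a powr (?r - 1) * ?t y)) * w y \<partial>M)"
     by (simp add: mult.assoc flip: integral_mult_right_zero)
    also have "... \<le> (\<integral>y. (?r - 1) * a powr ?r * w y + ?t y powr ?r * w y \<partial>M)"
    proof (rule integral_mono)
     show "integrable M (\<lambda>y. (?r * (a powr (?r - 1) * ?t y)) * w y)"
      using integrable_mult_right[OF int[of x], of "?r * a powr (?r - 1)"] by (simp add: mult_ac)
     show "integrable M (\<lambda>y. (?r - 1) * a powr ?r * w y + ?t y powr ?r * w y)"
      using W iI by auto
     fix y
     show "(?r * (a powr (?r - 1) * ?t y)) * w y \<le> (?r - 1) * a powr ?r * w y + ?t y powr ?r * w y"
      using mult_right_mono[OF powr_tangent_le[OF r, of a "?t y"] w0[of y]] that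
      by (simp add: distrib_right)
    qed
    also have "... = (?r - 1) * a powr ?r * (\<integral>y. w y \<partial>M) + J"
     unfolding J_def using W iI by (subst Bochner_Integration.integral_add) auto
    also have "... \<le> (?r - 1) * a powr ?r * W + J"
     using W r by (intro add_right_mono mult_left_mono) auto
    finally show ?thesis by (simp add: mult.assoc)
   qed
   have "cmod (u x) powr ?r \<le> W powr (?r - 1) * J"
   proof (cases "cmod (u x) = 0")
    case True
    then show ?thesis using J0 W by simp
   next
    case u0: False
    let ?a = "cmod (u x) / W"
    have a: "0 < ?a" using u0 W by simp
    have "?r * (?a powr (?r - 1) * ?a) * W \<le> (?r - 1) * ?a powr ?r * W + J"
     using key[OF a] W by (simp add: mult.assoc)
    then have "?r * ?a powr ?r * W \<le> (?r - 1) * ?a powr ?r * W + J"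
     by (simp only: powr_minus1_mult[OF less_imp_le[OF a]])
    then have "?a powr ?r * W \<le> J"
     by (simp only: left_diff_distrib mult_1 add.commute)
    then have "W powr (?r - 1) * (?a powr ?r * W) \<le> W powr (?r - 1) * J"
     by (rule mult_left_mono) simp
    moreover have "W powr (?r - 1) * (?a powr ?r * W) = cmod (u x) powr ?r"
     using W(3) by (simp add: powr_divide powr_diff)
    ultimately show ?thesis by simp
   qed
   then show ?thesis
    using J0 by (simp add: IJ ennreal_mult'[symmetric] ennreal_leI)
  qed
  have "(\<integral>\<^sup>+x. ennreal (cmod (u x) powr ?r) \<partial>lborel) \<le> (\<integral>\<^sup>+x. ennreal (W powr (?r - 1)) * I x \<partial>lborel)"
   by (intro nn_integral_mono pt)
  also have "... = ennreal (W powr (?r - 1)) * (\<integral>\<^sup>+x. I x \<partial>lborel)"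
   unfolding I_def by (intro nn_integral_cmult) measurable
  finally have 1: "(\<integral>\<^sup>+x. ennreal (cmod (u x) powr ?r) \<partial>lborel) \<le>
    ennreal (W powr (?r - 1)) * (\<integral>\<^sup>+x. I x \<partial>lborel)" .
  have "(\<integral>\<^sup>+x. I x \<partial>lborel) =
    (\<integral>\<^sup>+y. (\<integral>\<^sup>+x. ennreal (cmod (F (x + Y y)) powr ?r) * ennreal (w y) \<partial>lborel) \<partial>M)"
   unfolding I_def by (rule Fubini') measurable
  also have "... = (\<integral>\<^sup>+y. (\<integral>\<^sup>+x. ennreal (cmod (F x) powr ?r) \<partial>lborel) * ennreal (w y) \<partial>M)"
   by (subst nn_integral_multc, measurable) (simp add: nn_integral_lborel_shift[where f = "\<lambda>x. ennreal (cmod (F x) powr ?r)"])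
  also have "... \<le> (\<integral>\<^sup>+y. ennreal (d powr ?r) * ennreal (w y) \<partial>M)"
   using F d0 p False by (intro nn_integral_mono mult_right_mono) (auto simp: Lp_ball_finite)
  also have "... \<le> ennreal (d powr ?r) * ennreal W"
   using nW by (subst nn_integral_cmult) (auto intro: mult_left_mono)
  finally have "(\<integral>\<^sup>+x. I x \<partial>lborel) \<le> ennreal (d powr ?r) * ennreal W" .
  then have "ennreal (W powr (?r - 1)) * (\<integral>\<^sup>+x. I x \<partial>lborel) \<le>
    ennreal (W powr (?r - 1)) * (ennreal (d powr ?r) * ennreal W)"
   by (intro mult_left_mono) auto
  note order_trans[OF 1 this]
  also have "ennreal (W powr (?r - 1)) * (ennreal (d powr ?r) * ennreal W) = ennreal ((W * d) powr ?r)"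
   using powr_minus1_mult[of W ?r] W(3) d0
   by (simp add: ennreal_mult'[symmetric] powr_mult mult_ac)
  finally have "(\<integral>\<^sup>+x. ennreal (cmod (u x) powr ?r) \<partial>lborel) \<le> ennreal ((W * d) powr ?r)" .
  then show ?thesis
   using u p False W d0 by (simp add: Lp_ball_finite)
 qed
qed

section \<open>Norming functions, local integrability and tails in Lebesgue spaces\<close>

lemma Lp_norm_powr:
 assumes "1 \<le> p" "p \<noteq> \<infinity>"
 shows "Lp_norm p f powr enn2real p = (LBINT x. cmod (f x) powr enn2real p)"
 using assms enn2real_ge_1[OF assms] by (simp add: Lp_norm_def powr_powr)

lemma Lp_ball_integral_le:
 assumes "1 \<le> p" "p \<noteq> \<infinity>" "Lp_ball p A u"
 shows "(LBINT x. cmod (u x) powr enn2real p) \<le> A powr enn2real p"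
 unfolding Lp_norm_powr[OF assms(1,2), symmetric]
 using assms enn2real_ge_1[OF assms(1,2)] by (intro powr_mono2) (auto simp: Lp_ball_def Lp_norm_nonneg)

text \<open>With \<open>H\<close> the norm of \<open>h\<close> and \<open>r\<close> the real
  exponent, the function is the conjugate phase of \<open>h\<close> times
  \<open>(cmod h / H) powr (r - 1)\<close>, the equality case of Hoelder. The bound against
  \<open>u\<close> is the integrated tangent inequality for \<open>cmod h / H\<close> and
  \<open>cmod u / A\<close>.\<close>

lemma Lp_norming_function:
 fixes h :: "'n::finite cfun"
 assumes p: "1 \<le> p" "p \<noteq> \<infinity>" and h: "in_Lp p h"
 shows "\<exists>c. c \<in> borel_measurable lborel \<and>
  (\<forall>u A. Lp_ball p A u \<longrightarrow> integrable lborel (\<lambda>x. c x * u x) \<and> cmod (LBINT x. c x * u x) \<le> A) \<and>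
  (LBINT x. c x * h x) = of_real (Lp_norm p h)"
proof (cases "Lp_norm p h = 0")
 case True
 then show ?thesis
  by (intro exI[of _ "\<lambda>_. 0"]) (auto dest: Lp_ball_nonneg)
next
 case False
 define H where "H = Lp_norm p h"
 have H: "0 < H" using False Lp_norm_nonneg[of p h] by (simp add: H_def)
 let ?r = "enn2real p"
 have r: "1 \<le> ?r" using enn2real_ge_1 p by blast
 have [measurable]: "h \<in> borel_measurable borel" using h by (simp add: in_Lp_def)
 have ih: "integrable lborel (\<lambda>x. cmod (h x) powr ?r)"
  using h p by (simp add: in_Lp_def)
 have Hr: "(LBINT x. cmod (h x) powr ?r) = H powr ?r"
  unfolding H_def Lp_norm_powr[OF p] ..
 define c where "c x = cnj (h x) * of_real ((cmod (h x) / H) powr (?r - 1) / cmod (h x))" for x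
 have [measurable]: "cnj \<in> borel_measurable borel" "complex_of_real \<in> borel_measurable borel"
  by (intro borel_measurable_continuous_onI continuous_intros)+
 have c_meas[measurable]: "c \<in> borel_measurable borel"
  unfolding c_def by measurable
 have cc: "cmod (c x) \<le> (cmod (h x) / H) powr (?r - 1)" for x
  by (cases "h x = 0") (auto simp: c_def norm_mult norm_divide)
 have ch: "c x * h x = of_real (H * (cmod (h x) powr ?r / H powr ?r))" for x
 proof (cases "h x = 0")
  case False
  have "c x * h x = (h x * cnj (h x)) * of_real ((cmod (h x) / H) powr (?r - 1) / cmod (h x))"
   by (simp add: c_def mult_ac)
  then have "c x * h x = of_real ((cmod (h x))\<^sup>2 * ((cmod (h x) / H) powr (?r - 1) / cmod (h x)))"
   unfolding complex_norm_square[symmetric] by simp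
  also have "(cmod (h x))\<^sup>2 * ((cmod (h x) / H) powr (?r - 1) / cmod (h x)) =
    H * ((cmod (h x) / H) powr (?r - 1) * (cmod (h x) / H))"
   using H False by (simp add: power2_eq_square)
  also have "... = H * (cmod (h x) powr ?r / H powr ?r)"
   using H by (subst powr_minus1_mult) (auto simp: powr_divide)
  finally show ?thesis .
 qed (simp add: c_def)
 have pos: "integrable lborel (\<lambda>x. c x * u x) \<and> cmod (LBINT x. c x * u x) \<le> A"
  if u: "Lp_ball p A u" and A: "0 < A" for u A
 proof -
  have [measurable]: "u \<in> borel_measurable borel" and iu: "integrable lborel (\<lambda>x. cmod (u x) powr ?r)"
   using u p by (auto simp: Lp_ball_def in_Lp_def)
  \<comment> \<open>The Young majorant of the product; its integral is at most
    \<open>(A / r) * ((r - 1) + 1) = A\<close>.\<close>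
  define b where "b x = (A / ?r) * ((?r - 1) * (cmod (h x) powr ?r / H powr ?r) + cmod (u x) powr ?r / A powr ?r)" for x
  have ib: "integrable lborel b"
   unfolding b_def using ih iu by auto
  have le: "cmod (c x * u x) \<le> b x" for x
  proof -
   have "cmod (c x * u x) \<le> (cmod (h x) / H) powr (?r - 1) * cmod (u x)"
    by (simp add: norm_mult cc mult_right_mono)
   also have "... = (A / ?r) * (?r * ((cmod (h x) / H) powr (?r - 1) * (cmod (u x) / A)))"
    using A r by simp
   also have "... \<le> b x"
    unfolding b_def using powr_tangent_le[OF r, of "cmod (h x) / H" "cmod (u x) / A"] A H r
    by (intro mult_left_mono) (auto simp: powr_divide)
   finally show ?thesis .
  qed
  have b0: "0 \<le> b x" for x
   using le[of x] norm_ge_zero order_trans by blast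
  have i: "integrable lborel (\<lambda>x. c x * u x)"
   by (rule Bochner_Integration.integrable_bound[OF ib]) (use le b0 in auto)
  have "cmod (LBINT x. c x * u x) \<le> (LBINT x. b x)"
   by (rule Bochner_Integration.integral_norm_bound_integral[OF i ib le])
  also have "... = (A / ?r) * ((?r - 1) * (H powr ?r / H powr ?r) +
    (LBINT x. cmod (u x) powr ?r) / A powr ?r)"
   unfolding b_def using ih iu Hr by simp
  also have "... \<le> (A / ?r) * ((?r - 1) * 1 + 1)"
   using Lp_ball_integral_le[OF p u] A H r by (intro mult_left_mono add_mono) auto
  also have "... = A" using r by simp
  finally show ?thesis using i by simp
 qed
 have "integrable lborel (\<lambda>x. c x * u x) \<and> cmod (LBINT x. c x * u x) \<le> A" if u: "Lp_ball p A u" for u A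
 proof -
  have A0: "0 \<le> A" using Lp_ball_nonneg[OF u] .
  have "Lp_ball p (A + e) u" if "0 < e" for e
   using Lp_ball_mono[OF u] that by simp
  then have "integrable lborel (\<lambda>x. c x * u x)" "\<And>e. 0 < e \<Longrightarrow> cmod (LBINT x. c x * u x) \<le> A + e"
   using pos[of "A + 1" u] pos[of "A + e" u for e] A0 by auto
  then show ?thesis using field_le_epsilon by blast
 qed
 moreover have "(LBINT x. c x * h x) = of_real (Lp_norm p h)"
  using ih Hr H by (simp add: ch H_def[symmetric])
 ultimately show ?thesis
  using c_meas by (intro exI[of _ c]) auto
qed

text \<open>Hoelder against the indicator of a ball, through the tangent inequality at 1. For finite
  exponents the constant \<open>V + 1\<close>, with \<open>V\<close> the volume of the ball, comes
  from \<open>(A / r) * (r * V + r)\<close>. It makes mollified functions pointwise bounded on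
  balls.\<close>

lemma Lp_local_integral_bound:
 fixes p :: ennreal and R :: real
 assumes p: "1 \<le> p"
 shows "\<exists>C\<ge>0. \<forall>(u :: 'n::finite cfun) A. Lp_ball p A u \<longrightarrow>
  integrable lborel (\<lambda>x. indicator (cball 0 R) x * cmod (u x)) \<and>
  (LBINT x. indicator (cball 0 R) x * cmod (u x)) \<le> C * A"
proof -
 let ?i = "indicator (cball 0 R) :: real ^ 'n \<Rightarrow> real"
 have [measurable]: "cball 0 R \<in> sets (borel :: (real ^ 'n) measure)"
  by auto
 have ii: "integrable lborel ?i"
  using emeasure_lborel_cball_finite[of "0 :: real ^ 'n" R]
  by (intro integrable_real_indicator) auto
 define V where "V = (LBINT x. ?i x)"
 have V0: "0 \<le> V" by (simp add: V_def)
 have pos: "integrable lborel (\<lambda>x. ?i x * cmod (u x)) \<and> (LBINT x. ?i x * cmod (u x)) \<le> (V + 1) * A"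
  if u: "Lp_ball p A u" and A: "0 < A" for u A
 proof -
  have [measurable]: "u \<in> borel_measurable borel"
   using u by (auto simp: Lp_ball_def in_Lp_def)
  show ?thesis
  proof (cases "p = \<infinity>")
   case True
   have "AE x in lborel. cmod (u x) \<le> A"
    using u A by (simp add: Lp_ball_infinity[OF True])
   then have ae: "AE x in lborel. ?i x * cmod (u x) \<le> A * ?i x"
    by eventually_elim (auto simp: indicator_def)
   have i: "integrable lborel (\<lambda>x. ?i x * cmod (u x))"
    using ae A by (intro Bochner_Integration.integrable_bound[OF integrable_mult_right[OF ii, of A]])
     (auto simp: abs_mult)
   have "(LBINT x. ?i x * cmod (u x)) \<le> (LBINT x. A * ?i x)"
    using ii i ae by (intro integral_mono_AE) auto
   also have "... = A * V"
    by (simp add: V_def)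
   finally show ?thesis using i A by (simp add: algebra_simps)
  next
   case False
   let ?r = "enn2real p"
   have r: "1 \<le> ?r" using enn2real_ge_1 p False by blast
   have iu: "integrable lborel (\<lambda>x. cmod (u x) powr ?r)"
    using u False by (auto simp: Lp_ball_def in_Lp_def)
   define b where "b x = (A / ?r) * ((?r - 1) * ?i x + cmod (u x) powr ?r / A powr ?r)" for x
   have ib: "integrable lborel b"
    unfolding b_def using ii iu by auto
   have le: "?i x * cmod (u x) \<le> b x" for x
   proof (cases "x \<in> cball 0 R")
    case True
    have "cmod (u x) = (A / ?r) * (?r * (1 powr (?r - 1) * (cmod (u x) / A)))"
     using A r by simp
    also have "... \<le> b x"
     unfolding b_def using powr_tangent_le[OF r, of 1 "cmod (u x) / A"] A r True
     by (intro mult_left_mono) (auto simp: powr_divide)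
    finally show ?thesis using True by simp
   qed (use A r in \<open>simp add: b_def\<close>)
   have i: "integrable lborel (\<lambda>x. ?i x * cmod (u x))"
    by (rule Bochner_Integration.integrable_bound[OF ib]) (use le in \<open>auto simp: abs_mult intro: order_trans[OF le abs_ge_self]\<close>)
   have "(LBINT x. ?i x * cmod (u x)) \<le> (LBINT x. b x)"
    by (rule integral_mono[OF i ib le])
   also have "... = (A / ?r) * ((?r - 1) * V + (LBINT x. cmod (u x) powr ?r) / A powr ?r)"
    unfolding b_def V_def using ii iu by simp
   also have "... \<le> (A / ?r) * (?r * V + ?r)"
   proof (rule mult_left_mono)
    have "(LBINT x. cmod (u x) powr ?r) / A powr ?r \<le> 1"
     using Lp_ball_integral_le[OF p False u] A by simp
    moreover have "(?r - 1) * V \<le> ?r * V"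
     using V0 by (intro mult_right_mono) auto
    ultimately show "(?r - 1) * V + (LBINT x. cmod (u x) powr ?r) / A powr ?r \<le> ?r * V + ?r"
     using r by linarith
   qed (use A r in simp)
   also have "... = (V + 1) * A" using r by (simp add: algebra_simps)
   finally show ?thesis using i by simp
  qed
 qed
 have "integrable lborel (\<lambda>x. ?i x * cmod (u x)) \<and> (LBINT x. ?i x * cmod (u x)) \<le> (V + 1) * A"
  if u: "Lp_ball p A u" for u A
 proof -
  have A0: "0 \<le> A" using Lp_ball_nonneg[OF u] .
  have *: "Lp_ball p (A + e) u" if "0 < e" for e
   using Lp_ball_mono[OF u] that by simp
  have "integrable lborel (\<lambda>x. ?i x * cmod (u x))"
   using pos[OF *[of 1]] A0 by simp
  moreover have "(LBINT x. ?i x * cmod (u x)) \<le> (V + 1) * A + e" if "0 < e" for e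
  proof -
   have "0 < e / (V + 1)" using V0 that by simp
   then show ?thesis
    using pos[OF *[of "e / (V + 1)"]] A0 V0 by (simp add: distrib_left)
  qed
  ultimately show ?thesis using field_le_epsilon by blast
 qed
 then show ?thesis
  using V0 by (intro exI[of _ "V + 1"]) auto
qed

text \<open>The exponent \<open>1 / p\<close>, read as 0 for infinite \<open>p\<close>: the rate at
  which the norm of a sum of normalised functions with disjoint supports grows with their
  number.\<close>

definition conj_rate :: "ennreal \<Rightarrow> real" where
 "conj_rate p = (if p = \<infinity> then 0 else 1 / enn2real p)"

text \<open>On disjoint supports the \<open>p\<close>-th powers of the norms add, and for infinite
  \<open>p\<close> the norm is the maximum. \<open>J\<close> counts the functions already summed
  into \<open>u\<close>, so this is one induction step of the gliding hump.\<close>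

lemma Lp_ball_disjoint_add:
 fixes u v :: "'n::finite cfun"
 assumes p: "1 \<le> p" and J: "1 \<le> J" and c: "0 \<le> c"
  and u: "Lp_ball p (c * J powr conj_rate p) u" and v: "Lp_ball p c v"
  and disj: "\<And>x. u x = 0 \<or> v x = 0"
 shows "Lp_ball p (c * (J + 1) powr conj_rate p) (\<lambda>x. u x + v x)"
proof -
 have [measurable]: "u \<in> borel_measurable borel" "v \<in> borel_measurable borel"
  using u v by (auto simp: Lp_ball_def in_Lp_def)
 show ?thesis
 proof (cases "p = \<infinity>")
  case True
  have "AE x in lborel. cmod (u x) \<le> c" "AE x in lborel. cmod (v x) \<le> c"
   using u v c J Lp_ball_infinity[OF True c] by (auto simp: conj_rate_def True)
  then have "AE x in lborel. cmod (u x + v x) \<le> c"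
  proof eventually_elim
   case (elim x)
   then show ?case using disj[of x] by auto
  qed
  then have "Lp_ball p c (\<lambda>x. u x + v x)"
   using c by (simp add: Lp_ball_infinity[OF True])
  then show ?thesis
   using J by (simp add: conj_rate_def True)
 next
  case False
  let ?r = "enn2real p"
  have r: "1 \<le> ?r" using enn2real_ge_1 p False by blast
  have pw: "(c * K powr conj_rate p) powr ?r = c powr ?r * K" if "0 < K" for K
   using r that c False by (simp add: conj_rate_def powr_mult powr_powr)
  have "(\<integral>\<^sup>+x. ennreal (cmod (u x + v x) powr ?r) \<partial>lborel) =
    (\<integral>\<^sup>+x. ennreal (cmod (u x) powr ?r) + ennreal (cmod (v x) powr ?r) \<partial>lborel)"
  proof (rule nn_integral_cong)
   fix x
   show "ennreal (cmod (u x + v x) powr ?r) = ennreal (cmod (u x) powr ?r) + ennreal (cmod (v x) powr ?r)"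
    using disj[of x] by auto
  qed
  also have "... \<le> ennreal (c powr ?r * J) + ennreal (c powr ?r)"
   using u v c J p False pw[of J] by (subst nn_integral_add) (auto simp: Lp_ball_finite intro!: add_mono)
  also have "... = ennreal (c powr ?r * (J + 1))"
   using J by (simp add: distrib_left flip: ennreal_plus)
  also have "c powr ?r * (J + 1) = (c * (J + 1) powr conj_rate p) powr ?r"
   using pw[of "J + 1"] J by simp
  finally show ?thesis
   using p False c by (simp add: Lp_ball_finite)
 qed
qed

lemma in_Lp_bounded_support:
 fixes f :: "'n::finite cfun"
 assumes p: "1 \<le> p"
 shows "\<exists>C\<ge>0. \<forall>(f :: 'n cfun) c. f \<in> borel_measurable borel \<longrightarrow> (\<forall>x. cmod (f x) \<le> c * indicator (cball 0 R) x) \<longrightarrow>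
  0 \<le> c \<longrightarrow> Lp_ball p (C * c) f"
proof -
 let ?i = "\<lambda>x :: real ^ 'n. of_real (indicator (cball 0 R) x) :: complex"
 have "in_Lp p ?i"
 proof (cases "p = \<infinity>")
  case True
  have "Lp_ball \<infinity> 1 ?i"
   by (rule bounded_in_Lp_infinity) (auto simp: indicator_def)
  then show ?thesis by (simp only: True Lp_ball_def)
 next
  case False
  have eq: "(\<lambda>x. cmod (?i x) powr enn2real p) = indicator (cball 0 R)"
   by (auto simp: indicator_def)
  have [measurable]: "cball 0 R \<in> sets (borel :: (real ^ 'n) measure)"
   by auto
  have "integrable lborel (indicator (cball 0 R) :: real ^ 'n \<Rightarrow> real)"
   using emeasure_lborel_cball_finite[of "0 :: real ^ 'n" R]
   by (intro integrable_real_indicator) auto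
  moreover have "?i \<in> borel_measurable lborel"
   by (simp only: indicator_def of_real_eq_iff) (simp add: if_distrib cong: if_cong)
  ultimately show ?thesis
   unfolding in_Lp_def eq using False by simp
 qed
 then have i: "Lp_ball p (Lp_norm p ?i) ?i" by (rule in_Lp_ball)
 show ?thesis
 proof (intro exI[of _ "Lp_norm p ?i"] conjI allI impI)
  fix f :: "'n cfun" and c
  assume f: "f \<in> borel_measurable borel" "\<forall>x. cmod (f x) \<le> c * indicator (cball 0 R) x" "0 \<le> c"
  then have "Lp_ball p (c * Lp_norm p ?i) f"
   by (intro Lp_ball_dominated[OF p _ Lp_norm_nonneg i]) auto
  then show "Lp_ball p (Lp_norm p ?i * c) f" by (simp add: mult.commute)
 qed (rule Lp_norm_nonneg)
qed

lemma Lp_norm_tail_tendsto_0: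
 fixes u :: "'n::finite cfun"
 assumes p: "1 \<le> p" "p \<noteq> \<infinity>" and u: "in_Lp p u"
 shows "(\<lambda>k. Lp_norm p (\<lambda>x. indicator {x. real k \<le> norm x} x * u x)) \<longlonglongrightarrow> 0"
proof -
 let ?r = "enn2real p"
 have r: "1 \<le> ?r" using enn2real_ge_1 p by blast
 have [measurable]: "u \<in> borel_measurable borel" and iu: "integrable lborel (\<lambda>x. cmod (u x) powr ?r)"
  using u p by (auto simp: in_Lp_def)
 have "(\<lambda>k. LBINT x. cmod (indicator {x. real k \<le> norm x} x * u x) powr ?r) \<longlonglongrightarrow> integral\<^sup>L lborel (\<lambda>x :: real ^ 'n. 0)"
 proof (rule integral_dominated_convergence[OF _ _ iu])
  show "AE x in lborel. (\<lambda>k. cmod (indicator {x. real k \<le> norm x} x * u x) powr ?r) \<longlonglongrightarrow> 0"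
  proof (rule AE_I2)
   fix x :: "real ^ 'n"
   obtain k0 :: nat where "norm x < k0" using reals_Archimedean2 by blast
   note k0 = this
   have "\<forall>\<^sub>F k in sequentially. cmod (indicator {x. real k \<le> norm x} x * u x) powr ?r = 0"
    using eventually_ge_at_top[of k0] by eventually_elim (use k0 in auto)
   then show "(\<lambda>k. cmod (indicator {x. real k \<le> norm x} x * u x) powr ?r) \<longlonglongrightarrow> 0"
    by (rule tendsto_eventually)
  qed
 qed (auto simp: indicator_def)
 then show ?thesis
  using p r by (auto simp: Lp_norm_def intro!: tendsto_zero_powrI[where b = "1 / ?r"])
qed

section \<open>Cutoffs and mollifiers\<close>

text \<open>The \<open>k\<close>-th derivative of the function equal to \<open>exp (- 1 / t)\<close>
  for \<open>t > 0\<close> and to 0 otherwise. Differentiating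
  \<open>poly q (1 / t) * exp (- 1 / t)\<close> multiplies \<open>q - pderiv q\<close> by the square
  of \<open>1 / t\<close>, hence the recursion on polynomials.\<close>

definition flat_exp_deriv :: "nat \<Rightarrow> real \<Rightarrow> real" where
 "flat_exp_deriv k t = (if 0 < t
  then poly (((\<lambda>q. [:0, 0, 1:] * (q - pderiv q)) ^^ k) 1) (1 / t) * exp (- 1 / t) else 0)"

lemma poly_exp_tendsto_0: "((\<lambda>u. poly p u * exp (- u)) \<longlongrightarrow> (0::real)) at_top"
proof -
 have "((\<lambda>u. \<Sum>i\<le>degree p. coeff p i * (u ^ i / exp u)) \<longlongrightarrow> (\<Sum>i\<le>degree p. coeff p i * 0)) at_top"
  by (intro tendsto_sum tendsto_mult tendsto_const tendsto_power_div_exp_0)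
 moreover have "poly p u * exp (- u) = (\<Sum>i\<le>degree p. coeff p i * (u ^ i / exp u))" for u
  by (simp add: poly_altdef sum_distrib_right exp_minus divide_inverse mult.assoc)
 ultimately show ?thesis by simp
qed

lemma poly_flat_exp_tendsto_0: "((\<lambda>t. poly p (1 / t) * exp (- 1 / t)) \<longlongrightarrow> (0::real)) (at_right 0)"
 using filterlim_compose[OF poly_exp_tendsto_0 filterlim_inverse_at_top_right, of p]
 by (simp add: divide_inverse)

lemma flat_exp_deriv: "(flat_exp_deriv k has_real_derivative flat_exp_deriv (Suc k) t) (at t)"
proof -
 define q where "q = ((\<lambda>q. [:0, 0, 1:] * (q - pderiv q)) ^^ k) (1 :: real poly)"
 define q' where "q' = [:0, 0, 1:] * (q - pderiv q)"
 have D: "flat_exp_deriv k t = (if 0 < t then poly q (1 / t) * exp (- 1 / t) else 0)"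
  and D': "flat_exp_deriv (Suc k) t = (if 0 < t then poly q' (1 / t) * exp (- 1 / t) else 0)" for t
  by (simp_all add: flat_exp_deriv_def q_def q'_def)
 consider "t > 0" | "t < 0" | "t = 0" by linarith
 then show ?thesis
 proof cases
  case 1
  have "((\<lambda>t. poly q (1 / t) * exp (- 1 / t)) has_real_derivative poly q' (1 / t) * exp (- 1 / t)) (at t)"
   using 1 by (auto intro!: derivative_eq_intros DERIV_chain2[OF poly_DERIV]
     simp: q'_def field_simps power2_eq_square)
  then have "(flat_exp_deriv k has_real_derivative poly q' (1 / t) * exp (- 1 / t)) (at t)"
   by (rule has_field_derivative_transform_within_open[of _ _ _ "{0<..}"]) (use 1 in \<open>auto simp: D\<close>)
  then show ?thesis using 1 by (simp add: D')
 next
  case 2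
  have "((\<lambda>t. 0) has_real_derivative 0) (at t)" by simp
  then have "(flat_exp_deriv k has_real_derivative 0) (at t)"
   by (rule has_field_derivative_transform_within_open[of _ _ _ "{..<0}"]) (use 2 in \<open>auto simp: D\<close>)
  then show ?thesis using 2 by (simp add: D')
 next
  case 3
  have "((\<lambda>h. flat_exp_deriv k h / h) \<longlongrightarrow> 0) (at_right 0)"
  \<comment> \<open>The difference quotient at 0 has an extra factor \<open>1 / h\<close>, so it is
    of the same shape with the polynomial multiplied by its variable.\<close>
  proof (rule Lim_transform_eventually[OF poly_flat_exp_tendsto_0[of "[:0, 1:] * q"]])
   show "\<forall>\<^sub>F h in at_right 0. poly ([:0, 1:] * q) (1 / h) * exp (- 1 / h) = flat_exp_deriv k h / h"
    using eventually_at_right_less[of 0] by eventually_elim (simp add: D)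
  qed
  moreover have "((\<lambda>h. flat_exp_deriv k h / h) \<longlongrightarrow> 0) (at_left 0)"
  proof (rule tendsto_eventually)
   show "\<forall>\<^sub>F h in at_left 0. flat_exp_deriv k h / h = 0"
    unfolding eventually_at_filter by (simp add: D)
  qed
  ultimately have "((\<lambda>h. flat_exp_deriv k h / h) \<longlongrightarrow> 0) (at 0)"
   by (simp add: filterlim_split_at)
  then have "(flat_exp_deriv k has_real_derivative 0) (at 0)"
   unfolding has_field_derivative_iff by (simp add: D)
  then show ?thesis using 3 by (simp add: D')
 qed
qed

lemma flat_exp_0: "flat_exp_deriv 0 t = (if 0 < t then exp (- 1 / t) else 0)"
 by (simp add: flat_exp_deriv_def)

section \<open>Smooth bumps and cutoffs and their scaling\<close>

lemma smooth_coordinate: "smooth (\<lambda>x. of_real (x $ i))"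
proof (rule smooth_coinduct[where S = "insert (\<lambda>x. of_real (x $ i)) (range (\<lambda>c x. c))"])
 have D: "((\<lambda>x. complex_of_real (x $ i)) has_derivative (\<lambda>h. of_real (h $ i))) (at x)" for x
  by (auto intro!: derivative_eq_intros bounded_linear.has_derivative[OF bounded_linear_vec_nth])
 fix g :: "real ^ 'a \<Rightarrow> complex" and x j
 assume g: "g \<in> insert (\<lambda>x. of_real (x $ i)) (range (\<lambda>c x. c))"
 show "g differentiable (at x)"
  using g D differentiable_def by fastforce
 have "partial_deriv j (\<lambda>x. complex_of_real (x $ i)) = (\<lambda>x. of_real (axis j 1 $ i))"
  using partial_deriv_eq[OF D] by blast
 then show "partial_deriv j g \<in> insert (\<lambda>x. of_real (x $ i)) (range (\<lambda>c x. c))"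
  using g by (auto simp: partial_deriv_const)
qed simp

lemma smooth_flat_exp_radial:
 fixes a b :: real
 shows "smooth (\<lambda>x :: real ^ 'n. of_real (flat_exp_deriv 0 (a + b * (norm x)\<^sup>2)))"
proof -
 have D: "((\<lambda>x :: real ^ 'n. complex_of_real (flat_exp_deriv k (a + b * (norm x)\<^sup>2))) has_derivative
   (\<lambda>h. of_real (flat_exp_deriv (Suc k) (a + b * (norm x)\<^sup>2) * (2 * b * (x \<bullet> h))))) (at x)" for k x
 proof -
  have "((\<lambda>x :: real ^ 'n. a + b * (x \<bullet> x)) has_derivative (\<lambda>h. 2 * b * (x \<bullet> h))) (at x)"
   by (auto intro!: derivative_eq_intros simp: inner_commute algebra_simps)
  from has_derivative_compose[OF this flat_exp_deriv[THEN has_field_derivative_imp_has_derivative]]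
  have "((\<lambda>x :: real ^ 'n. flat_exp_deriv k (a + b * (x \<bullet> x))) has_derivative
    (\<lambda>h. flat_exp_deriv (Suc k) (a + b * (x \<bullet> x)) * (2 * b * (x \<bullet> h)))) (at x)" .
  from has_derivative_of_real[OF this] show ?thesis
   by (simp add: power2_norm_eq_inner)
 qed
 have P: "partial_deriv i (\<lambda>x :: real ^ 'n. complex_of_real (flat_exp_deriv k (a + b * (norm x)\<^sup>2))) =
  (\<lambda>x. of_real (flat_exp_deriv (Suc k) (a + b * (norm x)\<^sup>2)) * (of_real (2 * b) * of_real (x $ i)))" for k i
  by (rule ext, subst partial_deriv_eq[OF D]) (simp add: inner_axis)
 have "C_k m (\<lambda>x :: real ^ 'n. complex_of_real (flat_exp_deriv k (a + b * (norm x)\<^sup>2)))" for m k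
 proof (induction m arbitrary: k)
  case 0
  have "isCont (\<lambda>x :: real ^ 'n. complex_of_real (flat_exp_deriv k (a + b * (norm x)\<^sup>2))) x" for x
   using D has_derivative_continuous by blast
  then show ?case
   unfolding C_k.simps(1) by (intro continuous_at_imp_continuous_on) blast
 next
  case (Suc m)
  have "C_k m (\<lambda>x :: real ^ 'n. complex_of_real (2 * b) * of_real (x $ i))" for i
   using smooth_cmult[OF smooth_coordinate] unfolding smooth_def by blast
  then have "C_k m (\<lambda>x :: real ^ 'n. of_real (flat_exp_deriv (Suc k) (a + b * (norm x)\<^sup>2)) *
    (of_real (2 * b) * of_real (x $ i)))" for i
   by (rule C_k_mult[OF Suc.IH])
  moreover have "(\<lambda>x :: real ^ 'n. complex_of_real (flat_exp_deriv k (a + b * (norm x)\<^sup>2))) differentiable_on UNIV"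
   unfolding differentiable_on_def differentiable_def using D by blast
  ultimately show ?case
   unfolding C_k.simps P by blast
 qed
 then show ?thesis
  by (simp add: smooth_def)
qed

lemma C_k_inverse:
 fixes f :: "'n::finite cfun"
 shows "C_k k f \<Longrightarrow> (\<And>x. f x \<noteq> 0) \<Longrightarrow> C_k k (\<lambda>x. inverse (f x))"
proof (induction k)
 case 0
 then show ?case by (auto intro: continuous_intros)
next
 case (Suc k)
 have P: "partial_deriv i (\<lambda>x. inverse (f x)) = (\<lambda>x. (-1) * (partial_deriv i f x * (inverse (f x) * inverse (f x))))" for i
 proof
  fix x
  have f: "(f has_derivative frechet_derivative f (at x)) (at x)"
   using Suc.prems by (auto simp: differentiable_on_def frechet_derivative_works)
  show "partial_deriv i (\<lambda>x. inverse (f x)) x = (-1) * (partial_deriv i f x * (inverse (f x) * inverse (f x)))"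
   using partial_deriv_eq[OF Deriv.has_derivative_inverse[OF Suc.prems(2) f]]
   by (simp add: partial_deriv_def mult_ac)
 qed
 have const: "C_k k (\<lambda>x. -1)"
  using smooth_const unfolding smooth_def by blast
 have IH: "C_k k (\<lambda>x. inverse (f x))"
  using Suc C_k_Suc by blast
 have "C_k k (\<lambda>x. (-1) * (partial_deriv i f x * (inverse (f x) * inverse (f x))))" for i
  using Suc.prems by (intro C_k_mult const IH) auto
 moreover have "(\<lambda>x. inverse (f x)) differentiable_on UNIV"
  using Suc.prems by (auto simp: differentiable_on_def intro: differentiable_inverse)
 ultimately show ?case
  unfolding C_k.simps P by blast
qed

text \<open>Squaring the norm keeps the function smooth at the origin. Three instances occur:
  \<open>bump 1 (-1)\<close> is positive exactly on the open unit ball, \<open>bump 4 (-1)\<close>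
  exactly where the norm is below 2, \<open>bump (-1) 1\<close> exactly where it exceeds 1.\<close>

definition bump :: "real \<Rightarrow> real \<Rightarrow> real ^ 'n \<Rightarrow> real" where
 "bump a b x = flat_exp_deriv 0 (a + b * (norm x)\<^sup>2)"

text \<open>The two bumps in the denominator never vanish together. The quotient is 1 up to radius
  \<open>R\<close>, where the second bump vanishes, and 0 from radius \<open>2 * R\<close> on, where
  the first one does.\<close>

definition cutoff :: "real \<Rightarrow> 'n::finite cfun" where
 "cutoff R x = of_real (bump 4 (-1) (x /\<^sub>R R)) *
  inverse (of_real (bump 4 (-1) (x /\<^sub>R R)) + of_real (bump (-1) 1 (x /\<^sub>R R)))"

lemma bump_nonneg: "0 \<le> bump a b x"
 by (simp add: bump_def flat_exp_0)

lemma bump_eq_0_iff: "bump a b x = 0 \<longleftrightarrow> a + b * (norm x)\<^sup>2 \<le> 0"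
 by (simp add: bump_def flat_exp_0 not_less)

lemma bump_sum_pos: "0 < bump 4 (-1) x + bump (-1) 1 x"
proof -
 have "bump 4 (-1) x \<noteq> 0 \<or> bump (-1) 1 x \<noteq> 0"
  unfolding bump_eq_0_iff by linarith
 then show ?thesis
  using bump_nonneg[of 4 "-1" x] bump_nonneg[of "-1" 1 x] by linarith
qed

lemma cutoff_scale: "cutoff R = (\<lambda>x. cutoff 1 (0 + inverse R *\<^sub>R x))"
 by (simp add: cutoff_def fun_eq_iff)

lemma smooth_cutoff: "smooth (cutoff R :: 'n::finite cfun)"
proof -
 have s: "smooth (\<lambda>x :: real ^ 'n. complex_of_real (bump a b x))" for a b
  unfolding bump_def by (rule smooth_flat_exp_radial)
 have "complex_of_real (bump 4 (-1) x) + of_real (bump (-1) 1 x) \<noteq> 0" for x :: "real ^ 'n"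
  using bump_sum_pos[of x] by (metis of_real_add of_real_eq_0_iff less_irrefl)
 then have "smooth (\<lambda>x :: real ^ 'n. inverse (complex_of_real (bump 4 (-1) x) + of_real (bump (-1) 1 x)))"
  using smooth_add[OF s s] C_k_inverse unfolding smooth_def by blast
 then have "smooth (cutoff 1 :: 'n cfun)"
  unfolding cutoff_def using s by (auto intro: smooth_mult)
 then show ?thesis
  unfolding cutoff_scale[of R] by (rule smooth_affine)
qed

lemma cutoff_eq_1:
 assumes "0 < R" "norm x \<le> R"
 shows "cutoff R x = 1"
proof -
 have "norm (x /\<^sub>R R) \<le> 1" using assms by (simp add: field_simps)
 then have "(norm (x /\<^sub>R R))\<^sup>2 \<le> 1" by (simp add: power_le_one)
 then have "bump (-1) 1 (x /\<^sub>R R) = 0" unfolding bump_eq_0_iff by simp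
 then show ?thesis
  using bump_sum_pos[of "x /\<^sub>R R"] by (simp add: cutoff_def)
qed

lemma cutoff_eq_0:
 assumes "0 < R" "2 * R \<le> norm x"
 shows "cutoff R x = 0"
proof -
 have "2 \<le> norm (x /\<^sub>R R)" using assms by (simp add: field_simps)
 then have "2\<^sup>2 \<le> (norm (x /\<^sub>R R))\<^sup>2" by (intro power_mono) auto
 then have "bump 4 (-1) (x /\<^sub>R R) = 0" unfolding bump_eq_0_iff by simp
 then show ?thesis by (simp add: cutoff_def)
qed

lemma test_cutoff: "0 < R \<Longrightarrow> cutoff R \<in> test_functions"
 by (rule test_functionsI[where R = "2 * R"]) (auto simp: smooth_cutoff cutoff_eq_0)

text \<open>Rescaling from radius 1 to \<open>R\<close> multiplies a derivative by a power of
  \<open>1 / R\<close>, so one constant serves all \<open>R \<ge> 1\<close>.\<close>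

lemma cutoff_deriv_bound:
 "\<exists>c\<ge>1. \<forall>R\<ge>1. \<forall>ks :: 'n list. length ks \<le> m \<longrightarrow> (\<forall>x :: real ^ 'n. cmod (iter_deriv ks (cutoff R) x) \<le> c)"
proof -
 have "\<exists>c. \<forall>x :: real ^ 'n. cmod (iter_deriv ks (cutoff 1) x) \<le> c" for ks
  using test_bounded[OF test_iter_deriv[OF test_cutoff[of 1]]] by auto
 then obtain c where c: "\<And>ks (x :: real ^ 'n). cmod (iter_deriv ks (cutoff 1) x) \<le> c ks"
  by metis
 have c0: "0 \<le> c ks" for ks using order_trans[OF norm_ge_zero c] .
 define C where "C = 1 + (\<Sum>ks | length ks \<le> m. c ks)"
 have "cmod (iter_deriv ks (cutoff R) x) \<le> C" if "1 \<le> R" "length ks \<le> m" for R ks and x :: "real ^ 'n"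
 proof -
  have "cmod (iter_deriv ks (cutoff R) x) =
    inverse R ^ length ks * cmod (iter_deriv ks (cutoff 1) (0 + inverse R *\<^sub>R x))"
   unfolding cutoff_scale[of R] iter_deriv_affine[OF smooth_cutoff] using that(1)
   by (simp add: norm_mult norm_power norm_inverse)
  also have "... \<le> 1 * c ks"
   using that(1) c by (intro mult_mono power_le_one) (auto simp: inverse_le_1_iff)
  also have "... \<le> C"
   unfolding C_def using that(2) c0 member_le_sum[of ks "{ks. length ks \<le> m}" c] finite_lists_le by force
  finally show ?thesis .
 qed
 moreover have "1 \<le> C"
  unfolding C_def using c0 by (simp add: sum_nonneg)
 ultimately show ?thesis by blast
qed

definition tail_cutoff :: "real \<Rightarrow> 'n::finite cfun" where
 "tail_cutoff R x = 1 - cutoff R x"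

lemma smooth_tail_cutoff: "smooth (tail_cutoff R)"
 unfolding tail_cutoff_def[abs_def] by (intro smooth_diff smooth_const smooth_cutoff)

lemma iter_deriv_const: "ks \<noteq> [] \<Longrightarrow> iter_deriv ks (\<lambda>x. c) = (\<lambda>x. 0)"
 by (cases ks) (auto simp: iter_deriv_Cons partial_deriv_const iter_deriv_zero)

text \<open>The indicator remembers that also the derivatives vanish where the norm is below
  \<open>R\<close>; Leibniz estimates use it to see only the part of a function lying far
  out.\<close>

lemma tail_cutoff_deriv_bound:
 "\<exists>c\<ge>1. \<forall>R\<ge>1. \<forall>ks :: 'n list. length ks \<le> m \<longrightarrow>
  (\<forall>x :: real ^ 'n. cmod (iter_deriv ks (tail_cutoff R) x) \<le> c * indicator {x. R \<le> norm x} x)"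
proof -
 obtain c where c: "1 \<le> c" "\<And>R ks x. 1 \<le> R \<Longrightarrow> length ks \<le> m \<Longrightarrow>
   cmod (iter_deriv ks (cutoff R) (x :: real ^ 'n)) \<le> c"
  using cutoff_deriv_bound[of m] by blast
 have "cmod (iter_deriv ks (tail_cutoff R) x) \<le> (1 + c) * indicator {x. R \<le> norm x} x"
  if R: "1 \<le> R" and ks: "length ks \<le> m" for R ks and x :: "real ^ 'n"
 proof (cases "R \<le> norm x")
  case True
  have "iter_deriv ks (tail_cutoff R) x = iter_deriv ks (\<lambda>x. 1) x - iter_deriv ks (cutoff R) x"
   unfolding tail_cutoff_def[abs_def] by (simp add: iter_deriv_diff smooth_const smooth_cutoff)
  moreover have "cmod (iter_deriv ks (\<lambda>x. 1) x) \<le> 1"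
   by (cases "ks = []") (auto simp: iter_deriv_const)
  ultimately show ?thesis
   using norm_triangle_ineq4[of "iter_deriv ks (\<lambda>x. 1) x" "iter_deriv ks (cutoff R) x"] c(2)[OF R ks, of x] True
   by simp
 next
  case False
  have "open {x :: real ^ 'n. norm x < R}"
   by (intro open_Collect_less continuous_intros)
  from iter_deriv_local[OF this, of "tail_cutoff R" "\<lambda>_. 0" x ks] False R
  show ?thesis by (simp add: tail_cutoff_def cutoff_eq_1 iter_deriv_zero)
 qed
 then show ?thesis
  using c(1) by (intro exI[of _ "1 + c"]) auto
qed

lemma cutoff_mult_cutoff_bound:
 "\<exists>c\<ge>1. \<forall>R\<ge>1. \<forall>ks :: 'n list. length ks \<le> m \<longrightarrow>
  (\<forall>x :: real ^ 'n. cmod (iter_deriv ks (cutoff R) x) \<le> c * indicator (cball 0 (2 * R)) x)"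
proof -
 obtain c where c: "1 \<le> c" "\<And>R ks x. 1 \<le> R \<Longrightarrow> length ks \<le> m \<Longrightarrow>
   cmod (iter_deriv ks (cutoff R) (x :: real ^ 'n)) \<le> c"
  using cutoff_deriv_bound[of m] by blast
 have "cmod (iter_deriv ks (cutoff R) x) \<le> c * indicator (cball 0 (2 * R)) x"
  if R: "1 \<le> R" and ks: "length ks \<le> m" for R ks and x :: "real ^ 'n"
 proof (cases "norm x \<le> 2 * R")
  case False
  then show ?thesis
   using iter_deriv_support[of "2 * R" "cutoff R" x ks] R by (simp add: cutoff_eq_0)
 qed (use c(2)[OF R ks] in simp)
 then show ?thesis using c(1) by blast
qed

subsection \<open>Integration\<close>

lemma integrable_compact_support:
 fixes f :: "real ^ 'n \<Rightarrow> 'b :: {banach, second_countable_topology}"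
 assumes f: "continuous_on UNIV f" and z: "\<And>x. R < norm x \<Longrightarrow> f x = 0"
 shows "integrable lborel f"
proof -
 have "integrable lborel (\<lambda>x. indicator (cball 0 R) x *\<^sub>R f x)"
  by (rule borel_integrable_compact) (auto intro: continuous_on_subset[OF f])
 moreover have "(\<lambda>x. indicator (cball 0 R) x *\<^sub>R f x) = f"
 proof
  fix x
  show "indicator (cball 0 R) x *\<^sub>R f x = f x"
   by (cases "norm x \<le> R") (use z[of x] in auto)
 qed
 ultimately show ?thesis by simp
qed

lemma integral_shift:
 fixes f :: "real ^ 'n \<Rightarrow> 'b :: {banach, second_countable_topology}"
 assumes "f \<in> borel_measurable borel"
 shows "(LBINT x. f (x + y)) = (LBINT x. f x)"
  and "integrable lborel (\<lambda>x. f (x + y)) \<longleftrightarrow> integrable lborel f"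
proof -
 have "(\<lambda>x. x + y) = (+) y"
  by (simp add: fun_eq_iff add.commute)
 then have eq: "distr lborel borel (\<lambda>x. x + y) = lborel"
  by (simp add: lborel_distr_plus)
 show "(LBINT x. f (x + y)) = (LBINT x. f x)"
  using integral_distr[of "\<lambda>x. x + y" lborel borel f] assms by (simp add: eq)
 show "integrable lborel (\<lambda>x. f (x + y)) \<longleftrightarrow> integrable lborel f"
  using integrable_distr_eq[of "\<lambda>x. x + y" lborel borel f] assms by (simp add: eq)
qed

text \<open>Averaging the derivative over the unit segment in direction \<open>i\<close> gives
  \<open>u (x + e) - u x\<close>, whose integral is 0 by translation invariance; by Fubini the
  averaging does not change the integral of the derivative. No compact support is required.\<close>

lemma integral_partial_deriv_eq_0:
 fixes u :: "'n::finite cfun"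
 assumes d: "\<And>x. u differentiable (at x)" and c: "continuous_on UNIV (partial_deriv i u)"
  and iu: "integrable lborel u" and id: "integrable lborel (partial_deriv i u)"
 shows "(LBINT x. partial_deriv i u x) = 0"
proof -
 let ?v = "partial_deriv i u" and ?e = "axis i 1 :: real ^ 'n"
 let ?I = "indicator {0..1} :: real \<Rightarrow> real"
 have [measurable]: "?v \<in> borel_measurable borel" "u \<in> borel_measurable borel"
  using id iu borel_measurable_integrable by force+
 have "continuous_on {0..1} (\<lambda>t. ?v (x + t *\<^sub>R ?e))" for x
  by (intro continuous_on_compose2[OF c] continuous_intros) auto
 then have ftc: "(LBINT t. ?I t *\<^sub>R ?v (x + t *\<^sub>R ?e)) = u (x + ?e) - u x" for x
  using integral_FTC_Icc[of 0 1 "\<lambda>t. u (x + t *\<^sub>R ?e)" "\<lambda>t. ?v (x + t *\<^sub>R ?e)"]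
   has_vector_derivative_axis[OF d] by simp
 have int: "integrable (lborel \<Otimes>\<^sub>M lborel) (\<lambda>(t, x). ?I t *\<^sub>R ?v (x + t *\<^sub>R ?e))"
 proof (rule lborel_pair.Fubini_integrable)
  show "(\<lambda>(t, x). ?I t *\<^sub>R ?v (x + t *\<^sub>R ?e)) \<in> borel_measurable (lborel \<Otimes>\<^sub>M lborel)"
   by measurable
  show "AE t in lborel. integrable lborel (\<lambda>x. case (t, x) of (t, x) \<Rightarrow> ?I t *\<^sub>R ?v (x + t *\<^sub>R ?e))"
   using id by (auto intro!: AE_I2 integrable_scaleR_right simp: integral_shift)
  have "(LBINT x. norm (?I t *\<^sub>R ?v (x + t *\<^sub>R ?e))) = ?I t * (LBINT x. norm (?v x))" for t
   using integral_shift(1)[of "\<lambda>x. norm (?v x)" "t *\<^sub>R ?e"] by simp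
  then have "(\<lambda>t. LBINT x. norm (case (t, x) of (t, x) \<Rightarrow> ?I t *\<^sub>R ?v (x + t *\<^sub>R ?e))) =
    (\<lambda>t. ?I t * (LBINT x. norm (?v x)))"
   by (simp only: prod.case)
  then show "integrable lborel (\<lambda>t. LBINT x. norm (case (t, x) of (t, x) \<Rightarrow> ?I t *\<^sub>R ?v (x + t *\<^sub>R ?e)))"
   by (auto intro!: integrable_mult_left integrable_real_indicator)
 qed
 have "(LBINT x. (LBINT t. ?I t *\<^sub>R ?v (x + t *\<^sub>R ?e))) =
   (LBINT t. (LBINT x. ?I t *\<^sub>R ?v (x + t *\<^sub>R ?e)))"
  using lborel_pair.integral_fst[OF int] lborel_pair.integral_snd[OF int] by simp
 also have "... = (LBINT t. ?I t *\<^sub>R (LBINT x. ?v x))"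
  by (simp add: integral_shift)
 also have "... = (LBINT x. ?v x)"
  by simp
 also have "(LBINT x. (LBINT t. ?I t *\<^sub>R ?v (x + t *\<^sub>R ?e))) = 0"
  unfolding ftc using iu by (subst Bochner_Integration.integral_diff) (auto simp: integral_shift)
 finally show ?thesis by simp
qed

subsection \<open>Averages\<close>

text \<open>For \<open>d > 0\<close> this is a convolution with a rescaled and reflected kernel.
  Written as an average of translates it commutes visibly with derivatives of \<open>u\<close>, and
  no power of \<open>d\<close> appears.\<close>

definition average :: "'n::finite cfun \<Rightarrow> real \<Rightarrow> 'n cfun \<Rightarrow> 'n cfun" where
 "average k d u x = (LBINT z. u (x + d *\<^sub>R z) * k z)"

lemma continuous_translate:
 fixes u :: "'n::finite cfun"
 assumes "continuous_on UNIV u"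
 shows "continuous_on UNIV (\<lambda>z. u (x + d *\<^sub>R z))"
 by (intro continuous_on_compose2[OF assms] continuous_intros) auto

lemma average_integrable:
 assumes "continuous_on UNIV u" "k \<in> test_functions"
 shows "integrable lborel (\<lambda>z. u (x + d *\<^sub>R z) * k z)"
proof -
 obtain R where "\<forall>x. R < norm x \<longrightarrow> k x = 0"
  using test_functions_support[OF assms(2)] by metis
 then show ?thesis
  by (intro integrable_compact_support[where R = R] continuous_intros
    continuous_translate assms smooth_continuous test_smooth) auto
qed

lemma borel_measurable_continuous: "continuous_on UNIV u \<Longrightarrow> u \<in> borel_measurable borel"
 by (rule borel_measurable_continuous_onI)

lemma average_measurable:
 assumes "continuous_on UNIV u" "k \<in> test_functions"
 shows "average k d u \<in> borel_measurable borel"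
proof -
 have [measurable]: "u \<in> borel_measurable borel" "k \<in> borel_measurable borel"
  using assms smooth_continuous test_smooth borel_measurable_continuous by blast+
 show ?thesis
  unfolding average_def by measurable
qed

lemma Lp_ball_average_test:
 assumes p: "1 \<le> p" and k: "k \<in> test_functions"
 shows "\<exists>W>0. \<forall>h u d. continuous_on UNIV u \<longrightarrow> Lp_ball p d u \<longrightarrow> Lp_ball p (W * d) (average k h u)"
proof -
 have ck: "continuous_on UNIV k" using k smooth_continuous test_smooth by blast
 obtain R where R: "\<forall>x. R < norm x \<longrightarrow> k x = 0"
  using test_functions_support[OF k] by metis
 have [measurable]: "k \<in> borel_measurable borel"
  using ck borel_measurable_continuous by blast
 have ik: "integrable lborel (\<lambda>z. cmod (k z))"
  using R by (intro integrable_compact_support[where R = R] continuous_intros ck) auto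
 let ?W = "(LBINT z. cmod (k z)) + 1"
 have "Lp_ball p (?W * d) (average k h u)" if u: "continuous_on UNIV u" "Lp_ball p d u" for h u d
 proof (rule Lp_ball_average[where M = lborel and Y = "\<lambda>z. h *\<^sub>R z" and w = "\<lambda>z. cmod (k z)" and F = u])
  show "sigma_finite_measure (lborel :: (real ^ 'a) measure)" by (rule sigma_finite_lborel)
  show "0 < ?W" by (simp add: add_nonneg_pos)
  have i: "integrable lborel (\<lambda>z. u (x + h *\<^sub>R z) * k z)" for x
   by (rule average_integrable[OF u(1) k])
  then show "integrable lborel (\<lambda>z. cmod (u (x + h *\<^sub>R z)) * cmod (k z))" for x
   using integrable_norm[OF i[of x]] by (simp add: norm_mult)
  show "cmod (average k h u x) \<le> (LBINT z. cmod (u (x + h *\<^sub>R z)) * cmod (k z))" for x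
   unfolding average_def using integral_norm_bound[of lborel "\<lambda>z. u (x + h *\<^sub>R z) * k z"] by (simp add: norm_mult)
  show "average k h u \<in> borel_measurable lborel"
   using average_measurable[OF u(1) k] by simp
 qed (use p ik u in auto)
 moreover have "0 < ?W" by (simp add: add_nonneg_pos)
 ultimately show ?thesis by blast
qed

text \<open>These functions turn out to form \<open>D_L \<infinity>\<close>. The bounds make Taylor
  remainders uniform in the base point, which allows averages to be differentiated without any decay
  of \<open>u\<close>.\<close>

definition smooth_bounded :: "'n::finite cfun \<Rightarrow> bool" where
 "smooth_bounded u \<longleftrightarrow> smooth u \<and> (\<forall>ks. \<exists>c. \<forall>x. cmod (iter_deriv ks u x) \<le> c)"

lemma smooth_bounded_smooth: "smooth_bounded u \<Longrightarrow> smooth u"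
 by (simp add: smooth_bounded_def)

lemma smooth_bounded_iter_deriv: "smooth_bounded u \<Longrightarrow> smooth_bounded (iter_deriv ks u)"
 by (auto simp: smooth_bounded_def smooth_iter_deriv simp flip: iter_deriv_append)

lemma smooth_bounded_partial_deriv: "smooth_bounded u \<Longrightarrow> smooth_bounded (partial_deriv i u)"
 using smooth_bounded_iter_deriv[of u "[i]"] by (simp add: iter_deriv_Cons)

lemma test_smooth_bounded: "u \<in> test_functions \<Longrightarrow> smooth_bounded u"
 using test_bounded[of "iter_deriv _ u"] test_iter_deriv[of u] test_smooth[of u]
 unfolding smooth_bounded_def by metis

lemma increment_bound:
 fixes G :: "real \<Rightarrow> complex"
 assumes "\<And>t. t \<in> {0..1} \<Longrightarrow> (G has_vector_derivative G' t) (at t)" "\<And>t. t \<in> {0..1} \<Longrightarrow> norm (G' t) \<le> B"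
 shows "norm (G 1 - G 0) \<le> B"
proof -
 have "norm (G 1 - G 0) \<le> B * norm (1 - 0 :: real)"
 proof (rule differentiable_bound[where S = "{0..1}" and f' = "\<lambda>t r. r *\<^sub>R G' t"])
  fix t :: real assume t: "t \<in> {0..1}"
  then show "(G has_derivative (\<lambda>r. r *\<^sub>R G' t)) (at t within {0..1})"
   using assms(1) has_vector_derivative_at_within unfolding has_vector_derivative_def by blast
  show "onorm (\<lambda>r. r *\<^sub>R G' t) \<le> B"
   using assms(2)[OF t] by (intro onorm_le) (simp add: mult.commute[of B] mult_left_mono)
 qed auto
 then show ?thesis by simp
qed

lemma smooth_bounded_lipschitz:
 fixes u :: "'n::finite cfun"
 assumes u: "\<And>x. u differentiable (at x)" and c: "\<And>i x. cmod (partial_deriv i u x) \<le> c"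
 shows "cmod (u (x + h) - u x) \<le> real CARD('n) * c * norm h"
proof -
 have c0: "0 \<le> c" using order_trans[OF norm_ge_zero c] .
 have "cmod (u (x + 1 *\<^sub>R h) - u (x + 0 *\<^sub>R h)) \<le> real CARD('n) * c * norm h"
 proof (rule increment_bound)
  fix t
  show "((\<lambda>t. u (x + t *\<^sub>R h)) has_vector_derivative
    (\<Sum>i\<in>UNIV. h $ i *\<^sub>R partial_deriv i u (x + t *\<^sub>R h))) (at t)"
   by (rule has_vector_derivative_line[OF u])
  have "cmod (\<Sum>i\<in>UNIV. h $ i *\<^sub>R partial_deriv i u (x + t *\<^sub>R h)) \<le> (\<Sum>i\<in>(UNIV :: 'n set). norm h * c)"
   using c c0 by (intro sum_norm_le) (auto intro!: mult_mono component_le_norm_cart)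
  then show "cmod (\<Sum>i\<in>UNIV. h $ i *\<^sub>R partial_deriv i u (x + t *\<^sub>R h)) \<le> real CARD('n) * c * norm h"
   by (simp add: mult_ac)
 qed
 then show ?thesis by simp
qed

text \<open>The first derivatives are Lipschitz with one constant for all points; applying the
  increment bound along the segment to \<open>u\<close> minus its linear part gains the second
  factor \<open>norm h\<close>.\<close>

lemma smooth_bounded_taylor:
 fixes u :: "'n::finite cfun"
 assumes "smooth_bounded u"
 shows "\<exists>c\<ge>0. \<forall>x h. cmod (u (x + h) - u x - (\<Sum>i\<in>UNIV. h $ i *\<^sub>R partial_deriv i u x)) \<le> c * (norm h)\<^sup>2"
proof -
 have u: "smooth u" using assms smooth_bounded_smooth by blast
 have "\<exists>c. \<forall>x. cmod (partial_deriv j (partial_deriv i u) x) \<le> c" for i j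
  using assms unfolding smooth_bounded_def by (metis iter_deriv_Cons iter_deriv_Nil)
 then have "\<forall>i j. \<exists>c. \<forall>x. cmod (partial_deriv j (partial_deriv i u) x) \<le> c"
  by blast
 then obtain c where c: "\<And>i j x. cmod (partial_deriv j (partial_deriv i u) x) \<le> c i j"
  by metis
 have c0: "0 \<le> c i j" for i j using order_trans[OF norm_ge_zero c] .
 define C where "C = (\<Sum>i\<in>UNIV. \<Sum>j\<in>UNIV. c i j)"
 have cC: "c i j \<le> C" for i j
 proof -
  have "c i j \<le> (\<Sum>j\<in>UNIV. c i j)" using c0 by (intro member_le_sum) auto
  also have "... \<le> C" unfolding C_def using c0 by (intro member_le_sum) (auto intro: sum_nonneg)
  finally show ?thesis .
 qed
 have C0: "0 \<le> C" unfolding C_def using c0 by (intro sum_nonneg) auto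
 let ?n = "real CARD('n)"
 have lip: "cmod (partial_deriv i u (x + h) - partial_deriv i u x) \<le> ?n * C * norm h" for i x h
  using u by (intro smooth_bounded_lipschitz smooth_differentiable smooth_partial_deriv order_trans[OF c cC])
 have "cmod (u (x + h) - u x - (\<Sum>i\<in>UNIV. h $ i *\<^sub>R partial_deriv i u x)) \<le> (?n * ?n * C) * (norm h)\<^sup>2" for x h
 proof -
  let ?S = "\<lambda>y. \<Sum>i\<in>UNIV. h $ i *\<^sub>R partial_deriv i u y"
  have "cmod ((u (x + 1 *\<^sub>R h) - 1 *\<^sub>R ?S x) - (u (x + 0 *\<^sub>R h) - 0 *\<^sub>R ?S x)) \<le> (?n * ?n * C) * (norm h)\<^sup>2"
  proof (rule increment_bound)
   fix t :: real assume t: "t \<in> {0..1}"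
   show "((\<lambda>t. u (x + t *\<^sub>R h) - t *\<^sub>R ?S x) has_vector_derivative (?S (x + t *\<^sub>R h) - ?S x)) (at t)"
    by (intro has_vector_derivative_diff has_vector_derivative_line smooth_differentiable u)
     (auto intro!: derivative_eq_intros simp: has_vector_derivative_def)
   have "cmod (?S (x + t *\<^sub>R h) - ?S x) = cmod (\<Sum>i\<in>UNIV. h $ i *\<^sub>R (partial_deriv i u (x + t *\<^sub>R h) - partial_deriv i u x))"
    by (simp add: scaleR_diff_right sum_subtractf)
   also have "... \<le> (\<Sum>i\<in>(UNIV :: 'n set). norm h * (?n * C * norm h))"
   proof (rule sum_norm_le)
    fix i :: 'n
    have "cmod (partial_deriv i u (x + t *\<^sub>R h) - partial_deriv i u x) \<le> ?n * C * norm (t *\<^sub>R h)"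
     by (rule lip)
    also have "... \<le> ?n * C * norm h"
     using t C0 by (intro mult_left_mono) (auto intro: mult_left_le_one_le)
    finally show "cmod (h $ i *\<^sub>R (partial_deriv i u (x + t *\<^sub>R h) - partial_deriv i u x)) \<le> norm h * (?n * C * norm h)"
     using component_le_norm_cart[of h i] by (auto intro!: mult_mono)
   qed
   also have "... = (?n * ?n * C) * (norm h)\<^sup>2"
    by (simp add: power2_eq_square)
   finally show "cmod (?S (x + t *\<^sub>R h) - ?S x) \<le> (?n * ?n * C) * (norm h)\<^sup>2" .
  qed
  then show ?thesis by (simp add: algebra_simps)
 qed
 then show ?thesis
  using C0 by (intro exI[of _ "?n * ?n * C"]) auto
qed

text \<open>The uniform Taylor remainder is integrated against the modulus of the kernel, which
  gives an error quadratic in the increment.\<close>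

lemma average_has_derivative:
 fixes u :: "'n::finite cfun"
 assumes u: "smooth_bounded u" and k: "k \<in> test_functions"
 shows "(average k d u has_derivative (\<lambda>h. \<Sum>i\<in>UNIV. h $ i *\<^sub>R average k d (partial_deriv i u) x)) (at x)"
proof -
 let ?L = "\<lambda>h. \<Sum>i\<in>UNIV. h $ i *\<^sub>R average k d (partial_deriv i u) x"
 obtain c where c: "0 \<le> c" "\<And>x h. cmod (u (x + h) - u x - (\<Sum>i\<in>UNIV. h $ i *\<^sub>R partial_deriv i u x)) \<le> c * (norm h)\<^sup>2"
  using smooth_bounded_taylor[OF u] by blast
 have cu: "continuous_on UNIV u" and cd: "\<And>i. continuous_on UNIV (partial_deriv i u)"
  using u smooth_bounded_smooth smooth_partial_deriv smooth_continuous by blast+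
 have ck: "continuous_on UNIV k" using k smooth_continuous test_smooth by blast
 obtain R where R: "\<forall>x. R < norm x \<longrightarrow> k x = 0"
  using test_functions_support[OF k] by metis
 have ik: "integrable lborel (\<lambda>z. cmod (k z))"
  using R by (intro integrable_compact_support[where R = R] continuous_intros ck) auto
 define W where "W = (LBINT z. cmod (k z))"
 have iu: "integrable lborel (\<lambda>z. u (y + d *\<^sub>R z) * k z)" for y
  by (rule average_integrable[OF cu k])
 have iL: "integrable lborel (\<lambda>z. (\<Sum>i\<in>UNIV. h $ i *\<^sub>R partial_deriv i u (x + d *\<^sub>R z)) * k z)" for h
  using average_integrable[OF cd k] by (simp add: sum_distrib_right)
 have L: "?L h = (LBINT z. (\<Sum>i\<in>UNIV. h $ i *\<^sub>R partial_deriv i u (x + d *\<^sub>R z)) * k z)" for h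
  unfolding average_def sum_distrib_right
  using average_integrable[OF cd k] by (subst Bochner_Integration.integral_sum) auto
 have bd: "cmod ((average k d u y - average k d u x) - ?L (y - x)) \<le> c * W * (norm (y - x))\<^sup>2" for y
 proof -
  let ?h = "y - x"
  let ?r = "\<lambda>z. (u (x + d *\<^sub>R z + ?h) - u (x + d *\<^sub>R z) - (\<Sum>i\<in>UNIV. ?h $ i *\<^sub>R partial_deriv i u (x + d *\<^sub>R z))) * k z"
  have r: "?r = (\<lambda>z. u (y + d *\<^sub>R z) * k z - u (x + d *\<^sub>R z) * k z -
    (\<Sum>i\<in>UNIV. ?h $ i *\<^sub>R partial_deriv i u (x + d *\<^sub>R z)) * k z)"
   by (simp add: fun_eq_iff left_diff_distrib add.commute)
  have ir: "integrable lborel ?r"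
   unfolding r using iu iL by (intro Bochner_Integration.integrable_diff)
  have E: "(average k d u y - average k d u x) - ?L ?h = (LBINT z. ?r z)"
   unfolding L unfolding average_def r
   using Bochner_Integration.integral_diff[OF Bochner_Integration.integrable_diff[OF iu[of y] iu[of x]] iL[of ?h]]
    Bochner_Integration.integral_diff[OF iu[of y] iu[of x]] by simp
  have "(LBINT z. cmod (?r z)) \<le> (LBINT z. (c * (norm ?h)\<^sup>2) * cmod (k z))"
  proof (rule integral_mono)
   show "integrable lborel (\<lambda>z. cmod (?r z))"
    using ir by (rule integrable_norm)
   show "cmod (?r z) \<le> (c * (norm ?h)\<^sup>2) * cmod (k z)" for z
    unfolding norm_mult by (intro mult_right_mono c(2)) simp
  qed (use ik in simp)
  moreover have "(LBINT z. (c * (norm ?h)\<^sup>2) * cmod (k z)) = c * W * (norm ?h)\<^sup>2"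
   by (simp add: W_def)
  ultimately show ?thesis
   unfolding E using integral_norm_bound[of lborel ?r] by linarith
 qed
 show ?thesis
 proof (rule has_derivativeI_sandwich[where e = 1 and H = "\<lambda>y. c * W * norm (y - x)"])
  show "bounded_linear ?L"
   by (intro bounded_linear_sum bounded_linear_scaleR_const bounded_linear_vec_nth)
  show "norm ((average k d u y - average k d u x) - ?L (y - x)) / norm (y - x) \<le> c * W * norm (y - x)"
   if "y \<noteq> x" for y
   using bd[of y] that by (simp add: divide_le_eq power2_eq_square mult.assoc)
  have "((\<lambda>y. c * W * norm (y - x)) \<longlongrightarrow> c * W * norm (x - x)) (at x)"
   by (intro tendsto_intros)
  then show "((\<lambda>y. c * W * norm (y - x)) \<longlongrightarrow> 0) (at x)" by simp
 qed simp
qed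

lemma partial_deriv_average:
 fixes u :: "'n::finite cfun"
 assumes u: "smooth_bounded u" and k: "k \<in> test_functions"
 shows "partial_deriv i (average k d u) = average k d (partial_deriv i u)"
proof
 fix x
 show "partial_deriv i (average k d u) x = average k d (partial_deriv i u) x"
  unfolding partial_deriv_eq[OF average_has_derivative[OF u k]]
  by (subst sum.remove[of _ i]) (auto simp: axis_def intro!: sum.neutral)
qed

lemma smooth_average:
 fixes u :: "'n::finite cfun"
 assumes u: "smooth_bounded u" and k: "k \<in> test_functions"
 shows "smooth (average k d u)"
proof (rule smooth_coinduct[where S = "average k d ` {u. smooth_bounded u}"])
 fix g :: "'n cfun" and x i
 assume "g \<in> average k d ` {u. smooth_bounded u}"
 then show "g differentiable (at x)" "partial_deriv i g \<in> average k d ` {u. smooth_bounded u}"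
  using average_has_derivative[OF _ k] partial_deriv_average[OF _ k] smooth_bounded_partial_deriv
  unfolding differentiable_def by blast+
qed (use u in blast)

lemma iter_deriv_average:
 fixes u :: "'n::finite cfun"
 assumes "smooth_bounded u" and k: "k \<in> test_functions"
 shows "iter_deriv ks (average k d u) = average k d (iter_deriv ks u)"
 using assms(1)
 by (induction ks arbitrary: u)
  (auto simp: iter_deriv_Cons partial_deriv_average[OF _ k] smooth_bounded_partial_deriv)

lemma test_partial_deriv: "f \<in> test_functions \<Longrightarrow> partial_deriv i f \<in> test_functions"
 using test_iter_deriv[of f "[i]"] by (simp add: iter_deriv_Cons)

text \<open>Transfers a derivative from the function to the kernel at the price of
  \<open>1 / d\<close>: at a fixed scale the derivatives of an average are controlled by the
  function alone.\<close>

lemma average_by_parts: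
 fixes u :: "'n::finite cfun"
 assumes u: "smooth u" and k: "k \<in> test_functions" and d: "d \<noteq> 0"
 shows "average k d (partial_deriv i u) x = of_real (- 1 / d) * average (partial_deriv i k) d u x"
proof -
 let ?v = "\<lambda>z. u (x + d *\<^sub>R z) * k z"
 have v: "?v \<in> test_functions"
  using test_mult_left(1)[OF k smooth_affine[OF u]] by simp
 have int: "integrable lborel w" if "w \<in> test_functions" for w :: "'n cfun"
  using average_integrable[of "\<lambda>_. 1" w 0 0] that by simp
 have P: "partial_deriv i ?v = (\<lambda>z. d *\<^sub>R (partial_deriv i u (x + d *\<^sub>R z) * k z) + u (x + d *\<^sub>R z) * partial_deriv i k z)"
  using smooth_differentiable[OF u] smooth_differentiable[OF test_smooth[OF k]]
  by (simp add: fun_eq_iff partial_deriv_mult partial_deriv_affine)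
 have "0 = (LBINT z. partial_deriv i ?v z)"
  using v by (intro integral_partial_deriv_eq_0[symmetric] int smooth_differentiable smooth_continuous test_smooth test_partial_deriv)
 also have "... = d *\<^sub>R average k d (partial_deriv i u) x + average (partial_deriv i k) d u x"
  unfolding P average_def
  using average_integrable[OF smooth_continuous[OF smooth_partial_deriv[OF u]] k]
   average_integrable[OF smooth_continuous[OF u] test_partial_deriv[OF k]]
  by (subst Bochner_Integration.integral_add) auto
 finally have "of_real d * average k d (partial_deriv i u) x = - average (partial_deriv i k) d u x"
  by (simp add: scaleR_conv_of_real eq_neg_iff_add_eq_0)
 then show ?thesis
  using d by (simp add: field_simps)
qed

lemma average_iter_deriv_by_parts:
 fixes u :: "'n::finite cfun"
 assumes "smooth u" "k \<in> test_functions" and d: "d \<noteq> 0"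
 shows "average k d (iter_deriv ks u) x = of_real ((- 1 / d) ^ length ks) * average (iter_deriv ks k) d u x"
 using assms(1,2)
proof (induction ks arbitrary: u k)
 case (Cons i ks)
 have "average k d (iter_deriv (i # ks) u) x =
   of_real ((- 1 / d) ^ length ks) * average (iter_deriv ks k) d (partial_deriv i u) x"
  using Cons.IH[OF smooth_partial_deriv[OF Cons.prems(1)] Cons.prems(2)] by (simp add: iter_deriv_Cons)
 also have "average (iter_deriv ks k) d (partial_deriv i u) x =
   of_real (- 1 / d) * average (partial_deriv i (iter_deriv ks k)) d u x"
  using Cons.prems by (intro average_by_parts d test_iter_deriv)
 also have "partial_deriv i (iter_deriv ks k) = iter_deriv (i # ks) k"
  using Cons.prems by (simp add: iter_deriv_Cons iter_deriv_partial_deriv test_smooth)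
 finally show ?case by (simp add: mult_ac)
qed simp

subsection \<open>Mollification\<close>

lemma test_integrable: "f \<in> test_functions \<Longrightarrow> integrable lborel f"
 using average_integrable[of "\<lambda>_. 1" f 0 0] by simp

definition mollifier :: "'n::finite cfun" where
 "mollifier x = of_real (bump 1 (-1) x / (\<integral>y. bump 1 (-1) y \<partial>(lborel :: (real ^ 'n) measure)))"

lemma test_bump: "(\<lambda>x :: real ^ 'n. complex_of_real (bump 1 (-1) x)) \<in> test_functions"
proof (rule test_functionsI[where R = 1])
 show "smooth (\<lambda>x :: real ^ 'n. complex_of_real (bump 1 (-1) x))"
  unfolding bump_def by (rule smooth_flat_exp_radial)
 fix x :: "real ^ 'n" assume "1 < norm x"
 then have "1 \<le> (norm x)\<^sup>2" by (simp add: less_imp_le one_le_power)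
 then show "complex_of_real (bump 1 (-1) x) = 0"
  unfolding of_real_eq_0_iff bump_eq_0_iff by simp
qed

lemma bump_integrable: "integrable lborel (bump 1 (-1) :: real ^ 'n \<Rightarrow> real)"
proof -
 have "integrable lborel (\<lambda>x :: real ^ 'n. complex_of_real (bump 1 (-1) x))"
  by (rule test_integrable[OF test_bump])
 from integrable_Re[OF this] show ?thesis by simp
qed

lemma integral_bump_pos: "0 < (\<integral>y. bump 1 (-1) y \<partial>(lborel :: (real ^ 'n) measure))"
proof -
 let ?b = "bump 1 (-1) :: real ^ 'n \<Rightarrow> real"
 have "(LBINT y. ?b y) \<noteq> 0"
 proof
  assume "(LBINT y. ?b y) = 0"
  then have "AE x in lborel. ?b x = 0"
   using integral_nonneg_eq_0_iff_AE[OF bump_integrable] bump_nonneg by auto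
  moreover have [measurable]: "?b \<in> borel_measurable borel"
   using bump_integrable borel_measurable_integrable by force
  ultimately have "{x. ?b x \<noteq> 0} \<in> null_sets lborel"
   by (subst (asm) AE_iff_null) auto
  moreover have "{x. ?b x \<noteq> 0} = ball 0 1"
   by (auto simp: bump_eq_0_iff not_le power_less_one_iff)
  ultimately have "negligible (ball (0 :: real ^ 'n) 1)"
   by (simp add: negligible_iff_null_sets null_sets_completionI)
  then show False
   using open_not_negligible[of "ball (0 :: real ^ 'n) 1"] by auto
 qed
 moreover have "0 \<le> (LBINT y. ?b y)"
  by (simp add: bump_nonneg)
 ultimately show ?thesis by linarith
qed

lemma test_mollifier: "(mollifier :: 'n::finite cfun) \<in> test_functions"
proof -
 let ?c = "of_real (inverse (\<integral>y. bump 1 (-1) y \<partial>(lborel :: (real ^ 'n) measure))) :: complex"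
 have "(mollifier :: 'n cfun) = (\<lambda>x. ?c * of_real (bump 1 (-1) x))"
  by (simp add: mollifier_def fun_eq_iff divide_inverse mult.commute)
 moreover have "(\<lambda>x :: real ^ 'n. ?c * of_real (bump 1 (-1) x)) \<in> test_functions"
  by (rule test_mult_left(1)[OF test_bump smooth_const])
 ultimately show ?thesis by (simp only:)
qed

lemma cmod_mollifier: "complex_of_real (cmod (mollifier x)) = mollifier x"
 using bump_nonneg[of 1 "-1" x] integral_bump_pos[where 'n = 'a]
 by (simp add: mollifier_def norm_divide)

lemma mollifier_eq_0: "1 < norm x \<Longrightarrow> mollifier x = 0"
proof -
 assume "1 < norm x"
 then have "1 \<le> (norm x)\<^sup>2" by (simp add: less_imp_le one_le_power)
 then have "bump 1 (-1) x = 0" unfolding bump_eq_0_iff by simp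
 then show ?thesis by (simp add: mollifier_def)
qed

lemma mollifier_integrable: "integrable lborel (mollifier :: 'n::finite cfun)"
 by (rule test_integrable[OF test_mollifier])

lemma integral_mollifier: "(\<integral>x. mollifier x \<partial>(lborel :: (real ^ 'n) measure)) = 1"
 and integral_cmod_mollifier: "(\<integral>x. cmod (mollifier x) \<partial>(lborel :: (real ^ 'n) measure)) = 1"
proof -
 have "(\<integral>x. bump 1 (-1) x / (\<integral>y. bump 1 (-1) y \<partial>(lborel :: (real ^ 'n) measure)) \<partial>(lborel :: (real ^ 'n) measure)) = 1"
  using integral_bump_pos[where 'n = 'n] by simp
 then show 1: "(\<integral>x. mollifier x \<partial>(lborel :: (real ^ 'n) measure)) = 1"
  unfolding mollifier_def by (simp only: integral_complex_of_real) simp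
 have "complex_of_real (\<integral>x. cmod (mollifier x) \<partial>(lborel :: (real ^ 'n) measure)) = 1"
  unfolding integral_complex_of_real[symmetric] cmod_mollifier by (rule 1)
 then show "(\<integral>x. cmod (mollifier x) \<partial>(lborel :: (real ^ 'n) measure)) = 1"
  by simp
qed

text \<open>The difference is an average of increments over segments of length at most
  \<open>q\<close>, hence of gradients at points of these segments. One application of
  \<open>Lp_ball_average\<close>, with the segment parameter and the displacement integrated
  jointly, gives the bound.\<close>

lemma Lp_ball_mollify_diff:
 fixes u F :: "'n::finite cfun"
 assumes p: "1 \<le> p" and u: "smooth u" and q: "0 < q" and F: "Lp_ball p d F" "continuous_on UNIV F"
  and grad: "\<And>x. (\<Sum>i\<in>UNIV. cmod (partial_deriv i u x)) \<le> cmod (F x)"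
 shows "Lp_ball p (q * d) (\<lambda>x. u x - average mollifier q u x)"
proof -
 let ?I = "indicator {0..1} :: real \<Rightarrow> real" and ?m = "mollifier :: 'n cfun"
 have cu: "continuous_on UNIV u" using u smooth_continuous by blast
 have cm: "continuous_on UNIV ?m" using test_mollifier test_smooth smooth_continuous by blast
 have [measurable]: "F \<in> borel_measurable borel" "?m \<in> borel_measurable borel" "u \<in> borel_measurable borel"
  using F cm cu borel_measurable_continuous by blast+
 have im: "integrable lborel (\<lambda>z. cmod (?m z))"
  using mollifier_integrable by (rule integrable_norm)
 \<comment> \<open>A point of the segment from \<open>x\<close> to \<open>x + q z\<close> is
   \<open>x + (t q) z\<close>. The weight is \<open>q\<close> times Lebesgue measure in
   \<open>t\<close> on the unit interval times the mollifier in \<open>z\<close>; its total mass is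
   \<open>q\<close>.\<close>
 define w where "w = (\<lambda>\<omega> :: real \<times> (real ^ 'n). q * (?I (fst \<omega>) * cmod (?m (snd \<omega>))))"
 define Y where "Y = (\<lambda>\<omega> :: real \<times> (real ^ 'n). (fst \<omega> * q) *\<^sub>R snd \<omega>)"
 have Ym[measurable]: "Y \<in> borel_measurable (lborel \<Otimes>\<^sub>M lborel)" and wm[measurable]: "w \<in> borel_measurable (lborel \<Otimes>\<^sub>M lborel)"
  unfolding Y_def w_def by measurable
 have iI: "integrable lborel ?I" by (intro integrable_real_indicator) auto
 have ip: "integrable (lborel \<Otimes>\<^sub>M lborel) (\<lambda>(t, z). ?I t * cmod (?m z))"
 proof (rule lborel_pair.Fubini_integrable)
  show "integrable lborel (\<lambda>t. LBINT z. norm (case (t, z) of (t, z) \<Rightarrow> ?I t * cmod (?m z)))"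
   using iI by (simp add: integral_cmod_mollifier)
 qed (use im in auto)
 have ivw: "integrable (lborel \<Otimes>\<^sub>M lborel) w"
  unfolding w_def using ip by (intro integrable_mult_right) (simp add: case_prod_beta')
 have Iw: "(\<integral>\<omega>. w \<omega> \<partial>(lborel \<Otimes>\<^sub>M lborel)) = q"
 proof -
  have "(\<integral>\<omega>. ?I (fst \<omega>) * cmod (?m (snd \<omega>)) \<partial>(lborel \<Otimes>\<^sub>M lborel)) = (LBINT t. (LBINT z. ?I t * cmod (?m z)))"
   using lborel_pair.integral_fst[OF ip] by (simp add: case_prod_beta')
  also have "... = 1" by (simp add: integral_cmod_mollifier)
  finally show ?thesis unfolding w_def by simp
 qed
 have iF: "integrable (lborel \<Otimes>\<^sub>M lborel) (\<lambda>\<omega>. cmod (F (x + Y \<omega>)) * w \<omega>)" for x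
 proof -
  have "bounded (F ` cball x q)"
   by (intro compact_imp_bounded compact_continuous_image continuous_on_subset[OF F(2)]) auto
  then obtain c where c: "\<And>y. y \<in> cball x q \<Longrightarrow> cmod (F y) \<le> c" "0 < c"
   unfolding bounded_pos by (meson imageI)
  show ?thesis
  proof (rule Bochner_Integration.integrable_bound[OF integrable_mult_right[OF ivw, of c]])
   show "AE \<omega> in lborel \<Otimes>\<^sub>M lborel. norm (cmod (F (x + Y \<omega>)) * w \<omega>) \<le> norm (c * w \<omega>)"
   proof (rule AE_I2)
    fix \<omega> :: "real \<times> (real ^ 'n)"
    obtain t z where \<omega>: "\<omega> = (t, z)" by fastforce
    show "norm (cmod (F (x + Y \<omega>)) * w \<omega>) \<le> norm (c * w \<omega>)"
    proof (cases "t \<in> {0..1} \<and> norm z \<le> 1")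
     case True
     then have "norm ((t * q) *\<^sub>R z) \<le> 1 * q * 1"
      unfolding norm_scaleR using q by (intro mult_mono) auto
     then have "x + Y \<omega> \<in> cball x q"
      by (simp add: \<omega> Y_def dist_norm)
     then show ?thesis
      using c by (auto simp: abs_mult intro!: mult_right_mono)
    next
     case False
     then have "w \<omega> = 0"
      using mollifier_eq_0[of z] by (auto simp: \<omega> w_def)
     then show ?thesis by simp
    qed
   qed
  qed measurable
 qed
 have le: "cmod (u x - average ?m q u x) \<le> (\<integral>\<omega>. cmod (F (x + Y \<omega>)) * w \<omega> \<partial>(lborel \<Otimes>\<^sub>M lborel))" for x
 proof -
  define f where "f = (\<lambda>t z. cmod (F (x + (t * q) *\<^sub>R z)) * (q * (?I t * cmod (?m z))))"
  have fi: "integrable (lborel \<Otimes>\<^sub>M lborel) (\<lambda>(t, z). f t z)"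
   using iF[of x] by (simp add: f_def Y_def w_def case_prod_beta')
  have incr: "cmod (u x - u (x + q *\<^sub>R z)) * cmod (?m z) \<le> (LBINT t. f t z)" for z
  proof (cases "norm z \<le> 1")
   case False
   then show ?thesis using mollifier_eq_0[of z] by (simp add: f_def)
  next
   case True
   let ?h = "q *\<^sub>R z"
   let ?D = "\<lambda>t. \<Sum>i\<in>UNIV. ?h $ i *\<^sub>R partial_deriv i u (x + t *\<^sub>R ?h)"
   have cD: "continuous_on {0..1} ?D"
    by (intro continuous_intros continuous_on_compose2[OF smooth_continuous[OF smooth_partial_deriv[OF u]]]) auto
   have E: "u (x + 1 *\<^sub>R ?h) - u (x + 0 *\<^sub>R ?h) = (LBINT t. ?I t *\<^sub>R ?D t)"
    by (rule integral_FTC_Icc[symmetric, OF _ has_vector_derivative_line[OF smooth_differentiable[OF u]] cD]) simp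
   have "cmod (u x - u (x + ?h)) = cmod (u (x + 1 *\<^sub>R ?h) - u (x + 0 *\<^sub>R ?h))"
    by (simp add: norm_minus_commute)
   also have "... = cmod (LBINT t. ?I t *\<^sub>R ?D t)"
    by (simp only: E)
   also have "... \<le> (LBINT t. norm (?I t *\<^sub>R ?D t))"
    by (rule integral_norm_bound)
   also have "... \<le> (LBINT t. ?I t *\<^sub>R (q * cmod (F (x + t *\<^sub>R ?h))))"
   proof (rule integral_mono)
    have "integrable lborel (\<lambda>t. ?I t *\<^sub>R ?D t)"
     using cD by (intro borel_integrable_compact) auto
    then show "integrable lborel (\<lambda>t. norm (?I t *\<^sub>R ?D t))" by (rule integrable_norm)
    show "integrable lborel (\<lambda>t. ?I t *\<^sub>R (q * cmod (F (x + t *\<^sub>R ?h))))"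
     by (intro borel_integrable_compact continuous_intros continuous_on_compose2[OF F(2)]) auto
    fix t
    have "cmod (?D t) \<le> (\<Sum>i\<in>UNIV. q * cmod (partial_deriv i u (x + t *\<^sub>R ?h)))"
    proof (rule sum_norm_le)
     fix i
     have "\<bar>?h $ i\<bar> \<le> q"
      using component_le_norm_cart[of ?h i] True q by (auto intro: order_trans mult_left_le)
     then show "cmod (?h $ i *\<^sub>R partial_deriv i u (x + t *\<^sub>R ?h)) \<le> q * cmod (partial_deriv i u (x + t *\<^sub>R ?h))"
      unfolding norm_scaleR by (intro mult_right_mono) auto
    qed
    also have "... \<le> q * cmod (F (x + t *\<^sub>R ?h))"
     unfolding sum_distrib_left[symmetric] using q grad by (intro mult_left_mono) auto
    finally show "norm (?I t *\<^sub>R ?D t) \<le> ?I t *\<^sub>R (q * cmod (F (x + t *\<^sub>R ?h)))"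
     by (simp add: mult_left_mono)
   qed
   finally have "cmod (u x - u (x + ?h)) * cmod (?m z) \<le>
     (LBINT t. ?I t *\<^sub>R (q * cmod (F (x + t *\<^sub>R ?h)))) * cmod (?m z)"
    by (intro mult_right_mono) auto
   also have "... = (LBINT t. f t z)"
    unfolding f_def by (subst integral_mult_left_zero[symmetric]) (simp add: mult_ac)
   finally show ?thesis .
  qed
  have i1: "integrable lborel (\<lambda>z. u x * ?m z)" and i2: "integrable lborel (\<lambda>z. u (x + q *\<^sub>R z) * ?m z)"
   using mollifier_integrable average_integrable[OF cu test_mollifier] by auto
  have "u x - average ?m q u x = (LBINT z. u x * ?m z) - (LBINT z. u (x + q *\<^sub>R z) * ?m z)"
   by (simp add: average_def integral_mollifier)
  also have "... = (LBINT z. (u x - u (x + q *\<^sub>R z)) * ?m z)"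
   using Bochner_Integration.integral_diff[OF i1 i2] by (simp add: left_diff_distrib)
  finally have "cmod (u x - average ?m q u x) \<le> (LBINT z. cmod ((u x - u (x + q *\<^sub>R z)) * ?m z))"
   using integral_norm_bound by metis
  also have "... \<le> (LBINT z. (LBINT t. f t z))"
  proof (rule integral_mono)
   show "integrable lborel (\<lambda>z. cmod ((u x - u (x + q *\<^sub>R z)) * ?m z))"
    using Bochner_Integration.integrable_diff[OF i1 i2]
    by (intro integrable_norm) (simp add: left_diff_distrib)
   show "integrable lborel (\<lambda>z. LBINT t. f t z)"
    using lborel_pair.integrable_snd[OF fi] .
  qed (use incr in \<open>simp add: norm_mult\<close>)
  also have "... = (\<integral>(t, z). f t z \<partial>(lborel \<Otimes>\<^sub>M lborel))"
   by (rule lborel_pair.integral_snd[OF fi])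
  finally show ?thesis
   by (simp add: f_def Y_def w_def case_prod_beta')
 qed
 show ?thesis
 proof (rule Lp_ball_average[where M = "lborel \<Otimes>\<^sub>M lborel" and Y = Y and w = w and F = F])
  show "sigma_finite_measure (lborel \<Otimes>\<^sub>M lborel :: (real \<times> (real ^ 'n)) measure)"
   by (metis lborel_prod sigma_finite_lborel)
  show "0 \<le> w \<omega>" for \<omega> using q by (simp add: w_def)
  show "(\<lambda>x. u x - average ?m q u x) \<in> borel_measurable lborel"
   using average_measurable[OF cu test_mollifier] by simp
 qed (use p ivw Iw q F iF le in auto)
qed

lemma average_change_of_variables:
 fixes u k :: "'n::finite cfun"
 assumes u: "continuous_on UNIV u" and k: "k \<in> test_functions" and d: "0 < d"
 shows "average k d u x = of_real (inverse d ^ CARD('n)) * (LBINT y. u y * k (inverse d *\<^sub>R (y - x)))"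
  and "integrable lborel (\<lambda>y. u y * k (inverse d *\<^sub>R (y - x)))"
proof -
 have ck: "continuous_on UNIV k" using k test_smooth smooth_continuous by blast
 let ?g = "\<lambda>y. u y * k (inverse d *\<^sub>R (y - x))"
 have cg: "continuous_on UNIV ?g"
  by (intro continuous_intros u continuous_on_compose2[OF ck]) auto
 then have [measurable]: "?g \<in> borel_measurable borel" by (rule borel_measurable_continuous)
 obtain R where R: "0 < R" "\<forall>x. R < norm x \<longrightarrow> k x = 0"
  using test_functions_support[OF k] by metis
 show "integrable lborel ?g"
 proof (rule integrable_compact_support[OF cg])
  fix y :: "real ^ 'n" assume "norm x + d * R < norm y"
  then have "d * R < norm (y - x)" using norm_triangle_ineq2[of y x] by linarith
  then have "R < norm (inverse d *\<^sub>R (y - x))" using d unfolding norm_scaleR by (simp add: field_simps)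
  then show "?g y = 0" using R by simp
 qed
 have "(LBINT y. ?g y) = (\<integral>y. ?g y \<partial>density (distr lborel borel (\<lambda>z. x + d *\<^sub>R z)) (\<lambda>_. \<bar>d\<bar> ^ CARD('n)))"
  using lborel_affine[of d x] d by simp
 also have "... = (LBINT z. (d ^ CARD('n)) *\<^sub>R ?g (x + d *\<^sub>R z))"
  using d by (subst integral_density) (auto simp: integral_distr)
 also have "... = of_real (d ^ CARD('n)) * average k d u x"
  using d by (simp add: average_def scaleR_conv_of_real[where 'a = complex])
 finally show "average k d u x = of_real (inverse d ^ CARD('n)) * (LBINT y. ?g y)"
  using d by (simp add: field_simps)
qed

text \<open>After a change of variables the point \<open>x\<close> occurs only in the kernel, which
  is bounded and Lipschitz; the function enters through its integral over a ball. This supplies the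
  equicontinuity for the precompactness argument below.\<close>

lemma average_local_bounds:
 fixes p :: ennreal
 assumes p: "1 \<le> p" and k: "k \<in> test_functions" and d: "0 < d"
 shows "\<exists>C\<ge>0. \<forall>(u :: 'n::finite cfun) A. continuous_on UNIV u \<longrightarrow> Lp_ball p A u \<longrightarrow>
  (\<forall>x y. norm x \<le> R \<longrightarrow> norm y \<le> R \<longrightarrow>
   cmod (average k d u x) \<le> C * A \<and> cmod (average k d u x - average k d u y) \<le> C * A * norm (x - y))"
proof -
 obtain r where r: "0 < r" "\<forall>x. r < norm x \<longrightarrow> k x = 0"
  using test_functions_support[OF k] by metis
 obtain b where b: "0 \<le> b" "\<And>x. cmod (k x) \<le> b"
  using test_bounded[OF k] by blast
 obtain l where l: "0 \<le> l" "\<And>x h. cmod (k (x + h) - k x) \<le> l * norm h"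
 proof -
  have "\<exists>c\<ge>0. \<forall>x. cmod (partial_deriv i k x) \<le> c" for i
   using test_bounded[OF test_partial_deriv[OF k]] .
  then obtain c where c: "\<And>i x. cmod (partial_deriv i k x) \<le> c i" "\<And>i. 0 \<le> c i"
   by metis
  have "cmod (partial_deriv i k x) \<le> (\<Sum>i\<in>UNIV. c i)" for i x
   using order_trans[OF c(1) member_le_sum[of i UNIV c]] c(2) by auto
  then show ?thesis
   using that[of "real CARD('n) * (\<Sum>i\<in>UNIV. c i)"] c(2)
    smooth_bounded_lipschitz[of k "\<Sum>i\<in>UNIV. c i"] smooth_differentiable[OF test_smooth[OF k]]
   by (auto simp: sum_nonneg)
 qed
 let ?B = "cball 0 (R + d * r) :: (real ^ 'n) set"
 obtain C where C: "0 \<le> C" "\<And>(u :: 'n cfun) A. Lp_ball p A u \<Longrightarrow>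
   integrable lborel (\<lambda>x. indicator ?B x * cmod (u x)) \<and> (LBINT x. indicator ?B x * cmod (u x)) \<le> C * A"
  using Lp_local_integral_bound[OF p, of "R + d * r"] by blast
 let ?n = "inverse d ^ CARD('n)"
 have n0: "0 \<le> ?n" using d by simp
 have main: "cmod (LBINT y. u y * f y) \<le> C * A * s"
  if u: "continuous_on UNIV u" "Lp_ball p A u" and f: "\<And>y. cmod (f y) \<le> s * indicator ?B y"
   and int: "integrable lborel (\<lambda>y. u y * f y)" and s: "0 \<le> s"
  for u f :: "'n cfun" and A s
 proof -
  have "cmod (LBINT y. u y * f y) \<le> (LBINT y. cmod (u y * f y))"
   by (rule integral_norm_bound)
  also have "... \<le> (LBINT y. s * (indicator ?B y * cmod (u y)))"
  proof (rule integral_mono)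
   show "cmod (u y * f y) \<le> s * (indicator ?B y * cmod (u y))" for y
    using mult_right_mono[OF f[of y], of "cmod (u y)"] by (simp add: norm_mult mult_ac)
  qed (use C(2)[OF u(2)] integrable_norm[OF int] in auto)
  also have "... \<le> s * (C * A)"
   using C(2)[OF u(2)] s by (simp add: mult_left_mono)
  finally show ?thesis by (simp add: mult_ac)
 qed
 have supp: "y \<in> ?B" if "k (inverse d *\<^sub>R (y - x)) \<noteq> 0" "norm x \<le> R" for x y :: "real ^ 'n"
 proof -
  have "norm (inverse d *\<^sub>R (y - x)) \<le> r"
   using r that(1) by (meson not_le)
  then have "norm (y - x) \<le> d * r" using d unfolding norm_scaleR by (simp add: field_simps)
  then show ?thesis using that(2) norm_triangle_sub[of y x] by simp
 qed
 define K where "K = ?n * C * (b + inverse d * l)"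
 have K0: "0 \<le> K" using C b l d by (simp add: K_def)
 have "cmod (average k d u x) \<le> K * A \<and> cmod (average k d u x - average k d u y) \<le> K * A * norm (x - y)"
  if u: "continuous_on UNIV u" "Lp_ball p A u" and x: "norm x \<le> R" and y: "norm y \<le> R" for u A x y
 proof
  have A0: "0 \<le> A" using Lp_ball_nonneg[OF u(2)] .
  note cv = average_change_of_variables[OF u(1) k d]
  have "cmod (average k d u x) \<le> ?n * (C * A * b)"
   unfolding cv(1) norm_mult
  proof (rule mult_mono)
   show "cmod (LBINT y. u y * k (inverse d *\<^sub>R (y - x))) \<le> C * A * b"
   proof (rule main[OF u _ cv(2) b(1)])
    fix y
    show "cmod (k (inverse d *\<^sub>R (y - x))) \<le> b * indicator ?B y"
     using b supp[of y x] x by (cases "k (inverse d *\<^sub>R (y - x)) = 0") auto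
   qed
  qed (use d in \<open>auto simp: norm_power norm_inverse\<close>)
  also have "... \<le> K * A"
   unfolding K_def using n0 C(1) A0 l(1) d by (simp add: algebra_simps mult_left_mono)
  finally show "cmod (average k d u x) \<le> K * A" .
  let ?f = "\<lambda>z. k (inverse d *\<^sub>R (z - x)) - k (inverse d *\<^sub>R (z - y))"
  have int: "integrable lborel (\<lambda>z. u z * ?f z)"
   using Bochner_Integration.integrable_diff[OF cv(2)[of x] cv(2)[of y]] by (simp add: right_diff_distrib)
  have E: "average k d u x - average k d u y = of_real ?n * (LBINT z. u z * ?f z)"
   unfolding cv(1)[of x] cv(1)[of y]
   using Bochner_Integration.integral_diff[OF cv(2)[of x] cv(2)[of y]] by (simp add: right_diff_distrib)
  have "cmod (average k d u x - average k d u y) \<le> ?n * (C * A * (l * (inverse d * norm (x - y))))"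
   unfolding E norm_mult
  proof (rule mult_mono)
   show "cmod (LBINT z. u z * ?f z) \<le> C * A * (l * (inverse d * norm (x - y)))"
   proof (rule main[OF u _ int])
    fix z
    have "inverse d *\<^sub>R (z - x) = inverse d *\<^sub>R (z - y) + inverse d *\<^sub>R (y - x)"
     by (simp add: algebra_simps)
    then have "cmod (?f z) \<le> l * norm (inverse d *\<^sub>R (y - x))"
     using l(2) by metis
    then have "cmod (?f z) \<le> l * (inverse d * norm (x - y))"
     using d by (simp add: norm_minus_commute)
    then show "cmod (?f z) \<le> l * (inverse d * norm (x - y)) * indicator ?B z"
     using supp[of z x] supp[of z y] x y
     by (cases "z \<in> ?B") (simp, force)
   qed (use l d in simp)
  qed (use d in \<open>auto simp: norm_power norm_inverse\<close>)
  also have "... = (?n * C * (inverse d * l)) * A * norm (x - y)"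
   by (simp add: mult_ac)
  also have "... \<le> K * A * norm (x - y)"
   unfolding K_def using n0 C(1) A0 b(1) by (intro mult_right_mono mult_left_mono) auto
  finally show "cmod (average k d u x - average k d u y) \<le> K * A * norm (x - y)" .
 qed
 then show ?thesis using K0 by blast
qed

section \<open>Seminorm topologies\<close>

definition function_space :: "('a \<Rightarrow> complex) set \<Rightarrow> bool" where
 "function_space E \<longleftrightarrow> E \<noteq> {} \<and> (\<forall>f\<in>E. \<forall>g\<in>E. \<forall>a b. (\<lambda>x. a * f x + b * g x) \<in> E)"

lemma function_space_lincomb:
 "function_space E \<Longrightarrow> f \<in> E \<Longrightarrow> g \<in> E \<Longrightarrow> (\<lambda>x. a * f x + b * g x) \<in> E"
 by (simp add: function_space_def)

lemma function_space_closed: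
 assumes "function_space E" "f \<in> E" "g \<in> E"
 shows "(\<lambda>x. f x + g x) \<in> E" "(\<lambda>x. f x - g x) \<in> E" "(\<lambda>x. c * f x) \<in> E" "(\<lambda>x. 0) \<in> E"
 using function_space_lincomb[OF assms, of 1 1] function_space_lincomb[OF assms, of 1 "-1"]
  function_space_lincomb[OF assms, of c 0] function_space_lincomb[OF assms, of 0 0] by simp_all

lemma function_space_zero: "function_space E \<Longrightarrow> (\<lambda>x. 0) \<in> E"
proof -
 assume E: "function_space E"
 then obtain f where "f \<in> E" unfolding function_space_def by auto
 then show ?thesis using function_space_closed(4)[OF E] by blast
qed

lemma seminorm_on_cmult: "seminorm_on E r \<Longrightarrow> f \<in> E \<Longrightarrow> r (\<lambda>x. c * f x) = cmod c * r f"
 and seminorm_on_add: "seminorm_on E r \<Longrightarrow> f \<in> E \<Longrightarrow> g \<in> E \<Longrightarrow> r (\<lambda>x. f x + g x) \<le> r f + r g"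
 and seminorm_on_nonneg: "seminorm_on E r \<Longrightarrow> f \<in> E \<Longrightarrow> 0 \<le> r f"
 by (simp_all add: seminorm_on_def)

lemma seminorm_on_zero: "function_space E \<Longrightarrow> seminorm_on E r \<Longrightarrow> r (\<lambda>x. 0) = 0"
 using seminorm_on_cmult[of E r "\<lambda>x. 0" 0] function_space_zero[of E] by simp

lemma seminorm_on_diff:
 assumes "function_space E" "seminorm_on E r" "f \<in> E" "g \<in> E"
 shows "r (\<lambda>x. f x - g x) \<le> r f + r g"
 using seminorm_on_add[OF assms(2,3) function_space_closed(3)[OF assms(1,4,4)], of "-1"]
  seminorm_on_cmult[OF assms(2,4), of "-1"] by simp

lemma seminorm_on_triangle:
 assumes "function_space E" "seminorm_on E r" "f \<in> E" "g \<in> E" "h \<in> E"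
 shows "r (\<lambda>x. f x - h x) \<le> r (\<lambda>x. f x - g x) + r (\<lambda>x. g x - h x)"
 using seminorm_on_add[OF assms(2) function_space_closed(2)[OF assms(1,3,4)] function_space_closed(2)[OF assms(1,4,5)]]
 by simp

lemma topspace_seminorm_topology: "topspace (seminorm_topology E P) = E"
 unfolding seminorm_topology_def topology_generated_by_topspace by auto

lemma openin_seminorm_ball:
 assumes "f \<in> E" "r \<in> P" "0 < e"
 shows "openin (seminorm_topology E P) {g \<in> E. r (\<lambda>x. g x - f x) < e}"
 unfolding seminorm_topology_def by (rule topology_generated_by_Basis) (use assms in blast)

lemma openin_seminorm_balls:
 assumes "finite P0" "P0 \<subseteq> P" "f \<in> E" "0 < e"
 shows "openin (seminorm_topology E P) {g \<in> E. \<forall>r\<in>P0. r (\<lambda>x. g x - f x) < e}"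
 using assms(1,2)
proof (induction P0)
 case empty
 then show ?case
  using openin_topspace[of "seminorm_topology E P"] by (simp add: topspace_seminorm_topology)
next
 case (insert r P0)
 have "{g \<in> E. \<forall>\<sigma>\<in>insert r P0. \<sigma> (\<lambda>x. g x - f x) < e} =
   {g \<in> E. r (\<lambda>x. g x - f x) < e} \<inter> {g \<in> E. \<forall>\<sigma>\<in>P0. \<sigma> (\<lambda>x. g x - f x) < e}"
  by auto
 then show ?case
  using insert assms(3,4) openin_seminorm_ball[of f E r P e] by auto
qed

text \<open>A finite set of seminorms with one common radius; the empty set is allowed, so that the
  whole space is a neighbourhood also for an empty family.\<close>

definition seminorm_nbhd ::
  "('a \<Rightarrow> complex) set \<Rightarrow> (('a \<Rightarrow> complex) \<Rightarrow> real) set \<Rightarrow> ('a \<Rightarrow> complex) \<Rightarrow> ('a \<Rightarrow> complex) set \<Rightarrow> bool" where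
 "seminorm_nbhd E P f U \<longleftrightarrow>
  (\<exists>P0 e. finite P0 \<and> P0 \<subseteq> P \<and> 0 < e \<and> {g \<in> E. \<forall>r\<in>P0. r (\<lambda>x. g x - f x) < e} \<subseteq> U)"

lemma seminorm_nbhdI:
 assumes "finite P0" "P0 \<subseteq> P" "0 < e" "{g \<in> E. \<forall>r\<in>P0. r (\<lambda>x. g x - f x) < e} \<subseteq> U"
 shows "seminorm_nbhd E P f U"
 unfolding seminorm_nbhd_def by (intro exI[of _ P0] exI[of _ e] conjI assms)

lemma seminorm_nbhdE:
 assumes "seminorm_nbhd E P f U"
 obtains P0 e where "finite P0" "P0 \<subseteq> P" "0 < e" "{g \<in> E. \<forall>r\<in>P0. r (\<lambda>x. g x - f x) < e} \<subseteq> U"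
 using assms unfolding seminorm_nbhd_def by (elim exE conjE) (rule that)

text \<open>The subbase consists of balls with arbitrary centres. The triangle inequality replaces
  such a ball by a smaller one centred at the given point, so centred balls suffice as
  neighbourhoods.\<close>

theorem openin_seminorm_topology:
 assumes E: "function_space E" and P: "\<forall>r\<in>P. seminorm_on E r"
 shows "openin (seminorm_topology E P) U \<longleftrightarrow> U \<subseteq> E \<and> (\<forall>f\<in>U. seminorm_nbhd E P f U)"
  (is "?L \<longleftrightarrow> ?R")
proof
 assume ?L
 then have "generate_topology_on (insert E {{g \<in> E. r (\<lambda>x. g x - f x) < e} | f r e. f \<in> E \<and> r \<in> P \<and> e > 0}) U"
  unfolding seminorm_topology_def openin_topology_generated_by_iff .
 then have "\<forall>f\<in>U. seminorm_nbhd E P f U"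
 proof induction
  case (Int U V)
  show ?case
  proof
   fix f assume "f \<in> U \<inter> V"
   then have UV: "seminorm_nbhd E P f U" "seminorm_nbhd E P f V"
    using Int by auto
   obtain P1 e1 where 1: "finite P1" "P1 \<subseteq> P" "0 < e1" "{g \<in> E. \<forall>r\<in>P1. r (\<lambda>x. g x - f x) < e1} \<subseteq> U"
    by (rule seminorm_nbhdE[OF UV(1)])
   obtain P2 e2 where 2: "finite P2" "P2 \<subseteq> P" "0 < e2" "{g \<in> E. \<forall>r\<in>P2. r (\<lambda>x. g x - f x) < e2} \<subseteq> V"
    by (rule seminorm_nbhdE[OF UV(2)])
   have "{g \<in> E. \<forall>r\<in>P1 \<union> P2. r (\<lambda>x. g x - f x) < min e1 e2} \<subseteq> U \<inter> V"
    using 1(4) 2(4) by auto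
   then show "seminorm_nbhd E P f (U \<inter> V)"
    using 1(1-3) 2(1-3) by (intro seminorm_nbhdI[of "P1 \<union> P2" P "min e1 e2"]) auto
  qed
 next
  case (UN K)
  show ?case
  proof
   fix f assume "f \<in> \<Union>K"
   then obtain V where V: "V \<in> K" "f \<in> V" by blast
   then have nb: "seminorm_nbhd E P f V" using UN by blast
   obtain P1 e1 where 1: "finite P1" "P1 \<subseteq> P" "0 < e1" "{g \<in> E. \<forall>r\<in>P1. r (\<lambda>x. g x - f x) < e1} \<subseteq> V"
    by (rule seminorm_nbhdE[OF nb])
   show "seminorm_nbhd E P f (\<Union>K)"
    by (rule seminorm_nbhdI[OF 1(1-3)]) (use 1(4) V(1) in blast)
  qed
 next
  case (Basis B)
  then consider "B = E" | f0 r e where "B = {g \<in> E. r (\<lambda>x. g x - f0 x) < e}" "f0 \<in> E" "r \<in> P" "e > 0"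
   by blast
  then show ?case
  proof cases
   case 1
   then show ?thesis
    by (intro ballI seminorm_nbhdI[of "{}" P 1]) auto
  next
   case 2
   show ?thesis
   proof
    fix f assume f: "f \<in> B"
    let ?e = "e - r (\<lambda>x. f x - f0 x)"
    have "{g \<in> E. \<forall>\<sigma>\<in>{r}. \<sigma> (\<lambda>x. g x - f x) < ?e} \<subseteq> B"
    proof
     fix g assume g: "g \<in> {g \<in> E. \<forall>\<sigma>\<in>{r}. \<sigma> (\<lambda>x. g x - f x) < ?e}"
     then show "g \<in> B"
      using seminorm_on_triangle[OF E bspec[OF P 2(3)] _ _ 2(2), of g f] f unfolding 2(1) by auto
    qed
    then show "seminorm_nbhd E P f B"
     using 2 f by (intro seminorm_nbhdI[of "{r}" P ?e]) auto
   qed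
  qed
 qed auto
 moreover have "U \<subseteq> E"
  using openin_subset[OF \<open>?L\<close>] by (simp add: topspace_seminorm_topology)
 ultimately show ?R by blast
next
 assume R: ?R
 show ?L
 proof (subst openin_subopen, intro ballI)
  fix f assume f: "f \<in> U"
  then have nb: "seminorm_nbhd E P f U" using R by blast
  obtain P0 e where *: "finite P0" "P0 \<subseteq> P" "0 < e" "{g \<in> E. \<forall>r\<in>P0. r (\<lambda>x. g x - f x) < e} \<subseteq> U"
   by (rule seminorm_nbhdE[OF nb])
  have fE: "f \<in> E" using R f by blast
  have "r (\<lambda>x. 0) < e" if "r \<in> P0" for r
   using seminorm_on_zero[OF E bspec[OF P subsetD[OF *(2) that]]] *(3) by simp
  then have "f \<in> {g \<in> E. \<forall>r\<in>P0. r (\<lambda>x. g x - f x) < e}"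
   using fE by simp
  then show "\<exists>T. openin (seminorm_topology E P) T \<and> f \<in> T \<and> T \<subseteq> U"
   using openin_seminorm_balls[OF *(1,2) fE *(3)] *(4) by meson
 qed
qed

text \<open>A ball for finitely many seminorms of \<open>P\<close> contains a ball for the seminorms
  of \<open>Q\<close> dominating them, with the radius divided by one constant that exceeds all
  factors involved.\<close>

lemma seminorm_topology_finer:
 assumes E: "function_space E" and P: "\<forall>r\<in>P. seminorm_on E r" and Q: "\<forall>\<sigma>\<in>Q. seminorm_on E \<sigma>"
  and dom: "\<And>r. r \<in> P \<Longrightarrow> \<exists>\<sigma>\<in>Q. \<exists>C. \<forall>f\<in>E. r f \<le> C * \<sigma> f"
  and U: "openin (seminorm_topology E P) U"
 shows "openin (seminorm_topology E Q) U"
 unfolding openin_seminorm_topology[OF E Q]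
proof (intro conjI ballI)
 have U': "U \<subseteq> E" "\<And>f. f \<in> U \<Longrightarrow> seminorm_nbhd E P f U"
  using U unfolding openin_seminorm_topology[OF E P] by blast+
 show "U \<subseteq> E" by fact
 fix f assume f: "f \<in> U"
 obtain P0 e where *: "finite P0" "P0 \<subseteq> P" "0 < e" "{g \<in> E. \<forall>r\<in>P0. r (\<lambda>x. g x - f x) < e} \<subseteq> U"
  by (rule seminorm_nbhdE[OF U'(2)[OF f]])
 obtain s C where sC: "\<And>r. r \<in> P \<Longrightarrow> s r \<in> Q \<and> (\<forall>f\<in>E. r f \<le> C r * s r f)"
  using dom by metis
 define D where "D = 1 + (\<Sum>r\<in>P0. \<bar>C r\<bar>)"
 have D: "0 < D" unfolding D_def by (smt (verit) sum_nonneg abs_ge_zero)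
 have "{g \<in> E. \<forall>\<sigma>\<in>s ` P0. \<sigma> (\<lambda>x. g x - f x) < e / D} \<subseteq> {g \<in> E. \<forall>r\<in>P0. r (\<lambda>x. g x - f x) < e}"
 proof clarify
  fix g r assume g: "g \<in> E" "\<forall>\<sigma>\<in>s ` P0. \<sigma> (\<lambda>x. g x - f x) < e / D" and r: "r \<in> P0"
  have gf: "(\<lambda>x. g x - f x) \<in> E"
   using function_space_closed(2)[OF E] g(1) f U'(1) by blast
  have "\<bar>C r\<bar> \<le> D"
   unfolding D_def using *(1) r member_le_sum[of r P0 "\<lambda>r. \<bar>C r\<bar>"] by auto
  then have "r (\<lambda>x. g x - f x) \<le> D * s r (\<lambda>x. g x - f x)"
  proof -
   have "r \<in> P" using r *(2) by blast
   then have s: "s r \<in> Q" "r (\<lambda>x. g x - f x) \<le> C r * s r (\<lambda>x. g x - f x)"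
    using sC gf by blast+
   have "C r * s r (\<lambda>x. g x - f x) \<le> D * s r (\<lambda>x. g x - f x)"
    using \<open>\<bar>C r\<bar> \<le> D\<close> seminorm_on_nonneg[OF bspec[OF Q s(1)] gf] by (intro mult_right_mono) auto
   then show ?thesis using s(2) by linarith
  qed
  also have "... < D * (e / D)"
   using g(2) r D by (intro mult_strict_left_mono) auto
  finally show "r (\<lambda>x. g x - f x) < e" using D by simp
 qed
 then show "seminorm_nbhd E Q f U"
  using *(1-3) sC D order_trans[OF _ *(4)] by (intro seminorm_nbhdI[of "s ` P0" Q "e / D"]) auto
qed

theorem seminorm_topology_eqI:
 assumes "function_space E" "\<forall>r\<in>P. seminorm_on E r" "\<forall>\<sigma>\<in>Q. seminorm_on E \<sigma>"
  and "\<And>r. r \<in> P \<Longrightarrow> \<exists>\<sigma>\<in>Q. \<exists>C. \<forall>f\<in>E. r f \<le> C * \<sigma> f"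
  and "\<And>\<sigma>. \<sigma> \<in> Q \<Longrightarrow> \<exists>r\<in>P. \<exists>C. \<forall>f\<in>E. \<sigma> f \<le> C * r f"
 shows "seminorm_topology E P = seminorm_topology E Q"
 unfolding topology_eq
proof (intro allI iffI)
 fix U
 show "openin (seminorm_topology E Q) U" if "openin (seminorm_topology E P) U"
  by (rule seminorm_topology_finer[OF assms(1-4) that])
 show "openin (seminorm_topology E P) U" if "openin (seminorm_topology E Q) U"
  by (rule seminorm_topology_finer[OF assms(1,3,2,5) that])
qed

section \<open>Continuous linear functionals\<close>

lemma cdual_linear: "T \<in> cdual E P \<Longrightarrow> f \<in> E \<Longrightarrow> g \<in> E \<Longrightarrow> T (\<lambda>x. a * f x + b * g x) = a * T f + b * T g"
 by (simp add: cdual_def)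

lemma cdual_ops:
 assumes T: "T \<in> cdual E P" and "f \<in> E"
 shows cdual_add: "g \<in> E \<Longrightarrow> T (\<lambda>x. f x + g x) = T f + T g"
  and cdual_diff: "g \<in> E \<Longrightarrow> T (\<lambda>x. f x - g x) = T f - T g"
  and cdual_cmult: "T (\<lambda>x. c * f x) = c * T f"
  and cdual_zero: "T (\<lambda>x. 0) = 0"
 using cdual_linear[OF assms, of _ 1 1] cdual_linear[OF assms, of _ 1 "-1"]
  cdual_linear[OF assms assms(2), of c 0] cdual_linear[OF assms assms(2), of 0 0] by simp_all

lemma cdual_bounded_near_0:
 assumes E: "function_space E" and P: "\<forall>r\<in>P. seminorm_on E r" and T: "T \<in> cdual E P"
 shows "\<exists>P0 e. finite P0 \<and> P0 \<subseteq> P \<and> 0 < e \<and> (\<forall>f\<in>E. (\<forall>r\<in>P0. r f < e) \<longrightarrow> cmod (T f) < 1)"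
proof -
 let ?U = "{f \<in> topspace (seminorm_topology E P). T f \<in> ball 0 1}"
 have op: "openin (seminorm_topology E P) ?U"
 proof (rule openin_continuous_map_preimage[where Y = euclidean])
  show "continuous_map (seminorm_topology E P) euclidean T"
   using T unfolding cdual_def by blast
 qed auto
 have z: "(\<lambda>x. 0) \<in> ?U"
  using function_space_zero[OF E] cdual_zero[OF T function_space_zero[OF E]]
  by (simp add: topspace_seminorm_topology)
 from op[unfolded openin_seminorm_topology[OF E P]] have "\<forall>f\<in>?U. seminorm_nbhd E P f ?U"
  by (rule conjunct2)
 then have nb: "seminorm_nbhd E P (\<lambda>x. 0) ?U"
  using z by (rule bspec)
 obtain P0 e where *: "finite P0" "P0 \<subseteq> P" "0 < e" "{g \<in> E. \<forall>r\<in>P0. r (\<lambda>x. g x - 0) < e} \<subseteq> ?U"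
  by (rule seminorm_nbhdE[OF nb])
 have "cmod (T f) < 1" if "f \<in> E" "\<forall>r\<in>P0. r f < e" for f
 proof -
  have "f \<in> ?U" using that by (intro subsetD[OF *(4)]) simp
  then show ?thesis by simp
 qed
 then show ?thesis
  using * by blast
qed

text \<open>Rescaling \<open>f\<close> into the ball of radius \<open>e\<close> gives the bound; the
  2 keeps the rescaled function strictly inside. If \<open>r f = 0\<close>, all multiples of
  \<open>f\<close> stay in the ball, which forces \<open>T f = 0\<close>.\<close>

lemma homogeneous_bound:
 assumes r: "seminorm_on E r" and E: "function_space E" and f: "f \<in> E" and e: "0 < e"
  and T: "\<And>c f. f \<in> E \<Longrightarrow> T (\<lambda>x. c * f x) = c * T f"
  and b: "\<And>f. f \<in> E \<Longrightarrow> r f < e \<Longrightarrow> cmod (T f) < 1"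
 shows "cmod (T f) \<le> (2 / e) * r f"
proof -
 have cf: "(\<lambda>x. c * f x) \<in> E" for c using function_space_closed(3)[OF E f f] .
 have *: "c * cmod (T f) < 1" if "0 \<le> c" "c * r f < e" for c
  using b[OF cf[of "of_real c"]] that T[OF f, of "of_real c"] seminorm_on_cmult[OF r f, of "of_real c"]
  by (simp add: norm_mult)
 show ?thesis
 proof (cases "r f = 0")
  case True
  have "cmod (T f) = 0"
  proof (rule ccontr)
   assume "cmod (T f) \<noteq> 0"
   then have "inverse (cmod (T f)) * cmod (T f) = 1" by simp
   then show False using *[of "inverse (cmod (T f))"] True e by simp
  qed
  then show ?thesis using True by simp
 next
  case False
  then have pos: "0 < r f" using seminorm_on_nonneg[OF r f] by simp
  have "(e / (2 * r f)) * cmod (T f) < 1"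
   using *[of "e / (2 * r f)"] pos e by simp
  then show ?thesis using pos e by (simp add: field_simps)
 qed
qed

lemma cdualI:
 assumes E: "function_space E" and P: "\<forall>\<rho>\<in>P. seminorm_on E \<rho>"
  and lin: "\<And>f g a b. f \<in> E \<Longrightarrow> g \<in> E \<Longrightarrow> T (\<lambda>x. a * f x + b * g x) = a * T f + b * T g"
  and out: "\<And>f. f \<notin> E \<Longrightarrow> T f = 0"
  and \<rho>: "\<rho> \<in> P" and le: "\<And>f. f \<in> E \<Longrightarrow> cmod (T f) \<le> C * \<rho> f"
 shows "T \<in> cdual E P"
proof -
 have "openin (seminorm_topology E P) {f \<in> E. T f \<in> V}" if V: "open V" for V
  unfolding openin_seminorm_topology[OF E P]
 proof (intro conjI ballI)
  fix f assume f: "f \<in> {f \<in> E. T f \<in> V}"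
  then obtain d where d: "0 < d" "ball (T f) d \<subseteq> V"
   using V open_contains_ball by blast
  define D where "D = \<bar>C\<bar> + 1"
  have D: "0 < D" "C \<le> D" by (auto simp: D_def)
  have "{g \<in> E. \<forall>\<sigma>\<in>{\<rho>}. \<sigma> (\<lambda>x. g x - f x) < d / D} \<subseteq> {f \<in> E. T f \<in> V}"
  proof clarify
   fix g assume g: "g \<in> E" "\<forall>\<sigma>\<in>{\<rho>}. \<sigma> (\<lambda>x. g x - f x) < d / D"
   have gf: "(\<lambda>x. g x - f x) \<in> E"
    using function_space_closed(2)[OF E g(1)] f by blast
   have "cmod (T g - T f) = cmod (T (\<lambda>x. g x - f x))"
    using lin[of g f 1 "-1"] g f by simp
   also have "... \<le> C * \<rho> (\<lambda>x. g x - f x)" by (rule le[OF gf])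
   also have "... \<le> D * \<rho> (\<lambda>x. g x - f x)"
    using D seminorm_on_nonneg[OF bspec[OF P \<rho>] gf] by (intro mult_right_mono)
   also have "... < D * (d / D)"
    using g D by (intro mult_strict_left_mono) auto
   finally show "T g \<in> V"
    using d D by (auto simp: dist_norm norm_minus_commute)
  qed
  then show "seminorm_nbhd E P f {f \<in> E. T f \<in> V}"
   using \<rho> d D by (intro seminorm_nbhdI[of "{\<rho>}" P "d / D"]) auto
 qed auto
 then have "continuous_map (seminorm_topology E P) euclidean T"
  by (simp add: continuous_map_def topspace_seminorm_topology)
 then show ?thesis
  using lin out by (simp add: cdual_def)
qed

section \<open>Weighted norms on the spaces of smooth functions\<close>

definition weighted_norm :: "ennreal \<Rightarrow> 'n::finite cfun \<Rightarrow> nat \<Rightarrow> 'n cfun \<Rightarrow> real" where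
 "weighted_norm p g m \<phi> = (SUP \<alpha>\<in>multi_indices m. Lp_norm p (\<lambda>x. g x * multi_deriv \<alpha> \<phi> x))"

definition weight :: "'n::finite cfun \<Rightarrow> bool" where
 "weight g \<longleftrightarrow> continuous_on UNIV g \<and> (\<exists>b\<ge>0. \<forall>x. cmod (g x) \<le> b)"

lemma weight_const: "weight (\<lambda>_. c)"
 unfolding weight_def by (intro conjI exI[of _ "cmod c"] continuous_on_const) auto

lemma weight_continuous: "weight g \<Longrightarrow> continuous_on UNIV g"
 by (simp add: weight_def)

lemma C_0_small_outside:
 assumes "g \<in> C_0" "0 < e"
 shows "\<exists>R>0. \<forall>x. R \<le> norm x \<longrightarrow> cmod (g x) \<le> e"
proof -
 have "(g \<longlongrightarrow> 0) at_infinity" using assms by (simp add: C_0_def)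
 then have "\<forall>\<^sub>F x in at_infinity. dist (g x) 0 < e"
  using assms(2) tendstoD by blast
 then obtain b where b: "\<And>x. b \<le> norm x \<Longrightarrow> cmod (g x) < e"
  unfolding eventually_at_infinity by auto
 then show ?thesis
  by (intro exI[of _ "max b 1"]) (auto intro: less_imp_le)
qed

lemma C_0_weight:
 fixes g :: "'n::finite cfun"
 assumes "g \<in> C_0"
 shows "weight g"
proof -
 obtain R where R: "\<forall>x. R \<le> norm x \<longrightarrow> cmod (g x) \<le> 1"
  using C_0_small_outside[OF assms, of 1] by auto
 have c: "continuous_on UNIV g" using assms by (simp add: C_0_def)
 have "bounded (g ` cball 0 R)"
  by (intro compact_imp_bounded compact_continuous_image continuous_on_subset[OF c]) auto
 then obtain b where b: "\<forall>y\<in>g ` cball 0 R. cmod y \<le> b" unfolding bounded_iff by blast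
 have "cmod (g x) \<le> max b 1" for x
 proof (cases "norm x \<le> R")
  case True
  then show ?thesis using b by (auto intro: max.coboundedI1)
 qed (use R in \<open>auto intro: max.coboundedI2\<close>)
 then show ?thesis
  unfolding weight_def using c by (intro conjI exI[of _ "max b 1"]) auto
qed

lemma D_L_iff: "\<phi> \<in> D_L p \<longleftrightarrow> smooth \<phi> \<and> (\<forall>ks. in_Lp p (iter_deriv ks \<phi>))"
proof
 assume "\<phi> \<in> D_L p"
 then show "smooth \<phi> \<and> (\<forall>ks. in_Lp p (iter_deriv ks \<phi>))"
  unfolding D_L_def by (auto simp: iter_deriv_eq_multi_deriv)
next
 assume R: "smooth \<phi> \<and> (\<forall>ks. in_Lp p (iter_deriv ks \<phi>))"
 have "in_Lp p (multi_deriv \<alpha> \<phi>)" for \<alpha>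
  by (rule multi_deriv_eq_iter_deriv[of \<alpha>]) (use R in simp)
 then show "\<phi> \<in> D_L p" using R by (simp add: D_L_def)
qed

lemma D_L_smooth: "\<phi> \<in> D_L p \<Longrightarrow> smooth \<phi>"
 and D_L_in_Lp: "\<phi> \<in> D_L p \<Longrightarrow> in_Lp p (iter_deriv ks \<phi>)"
 by (simp_all add: D_L_iff)

lemma Lp_norm_le_weighted_norm:
 assumes "smooth \<phi>" "length ks \<le> m"
 shows "Lp_norm p (\<lambda>x. g x * iter_deriv ks \<phi> x) \<le> weighted_norm p g m \<phi>"
proof -
 have "count (mset ks) \<in> multi_indices m"
  using iter_deriv_eq_multi_deriv(2)[OF assms(1), of ks] assms(2) by (auto simp: multi_indices_def)
 then show ?thesis
  unfolding weighted_norm_def iter_deriv_eq_multi_deriv(1)[OF assms(1), of ks]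
  by (intro cSUP_upper) (simp_all add: bdd_above_finite finite_multi_indices)
qed

lemma weighted_norm_le:
 assumes "\<And>ks. length ks \<le> m \<Longrightarrow> Lp_norm p (\<lambda>x. g x * iter_deriv ks \<phi> x) \<le> c"
 shows "weighted_norm p g m \<phi> \<le> c"
 unfolding weighted_norm_def
proof (rule cSUP_least)
 fix \<alpha> :: "'a \<Rightarrow> nat" assume "\<alpha> \<in> multi_indices m"
 then show "Lp_norm p (\<lambda>x. g x * multi_deriv \<alpha> \<phi> x) \<le> c"
  by (rule_tac multi_deriv_eq_iter_deriv[of \<alpha>]) (use assms in \<open>simp add: multi_indices_def\<close>)
qed (rule multi_indices_nonempty)

lemma weighted_norm_nonneg: "smooth \<phi> \<Longrightarrow> 0 \<le> weighted_norm p g m \<phi>"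
 using order_trans[OF Lp_norm_nonneg Lp_norm_le_weighted_norm[of \<phi> "[]"]] by simp

lemma weight_in_Lp:
 assumes p: "1 \<le> p" and g: "weight g" and u: "in_Lp p u"
 shows "in_Lp p (\<lambda>x. g x * u x)"
proof -
 obtain b where b: "0 \<le> b" "\<And>x. cmod (g x) \<le> b" using g by (auto simp: weight_def)
 have "g \<in> borel_measurable borel" using g weight_continuous borel_measurable_continuous by blast
 then show ?thesis
  using u b by (intro in_Lp_dominated(1)[OF p b(1) u]) (auto simp: in_Lp_def norm_mult mult_right_mono)
qed

lemma weighted_Lp_ball:
 assumes "1 \<le> p" "weight g" "\<phi> \<in> D_L p" "length ks \<le> m"
 shows "Lp_ball p (weighted_norm p g m \<phi>) (\<lambda>x. g x * iter_deriv ks \<phi> x)"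
 using assms weight_in_Lp[OF assms(1,2) D_L_in_Lp[OF assms(3)]] Lp_norm_le_weighted_norm[OF D_L_smooth[OF assms(3)]]
 by (simp add: Lp_ball_def)

lemma weighted_norm_leI:
 assumes "\<And>ks. length ks \<le> m \<Longrightarrow> Lp_ball p c (\<lambda>x. g x * iter_deriv ks \<phi> x)"
 shows "weighted_norm p g m \<phi> \<le> c"
 using assms by (intro weighted_norm_le) (simp add: Lp_ball_def)

lemma weighted_norm_mono_order:
 "smooth \<phi> \<Longrightarrow> m \<le> m' \<Longrightarrow> weighted_norm p g m \<phi> \<le> weighted_norm p g m' \<phi>"
 by (intro weighted_norm_le Lp_norm_le_weighted_norm) auto

lemma weighted_norm_mono_weight:
 assumes p: "1 \<le> p" and g: "weight g" and h: "weight h" and \<phi>: "\<phi> \<in> D_L p" and c: "0 \<le> c"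
  and le: "\<And>x. cmod (g x) \<le> c * cmod (h x)"
 shows "weighted_norm p g m \<phi> \<le> c * weighted_norm p h m \<phi>"
proof (rule weighted_norm_leI, rule Lp_ball_dominated[OF p c weighted_norm_nonneg[OF D_L_smooth[OF \<phi>]] weighted_Lp_ball[OF p h \<phi>]])
 fix ks :: "'a list" and x
 show "(\<lambda>x. g x * iter_deriv ks \<phi> x) \<in> borel_measurable lborel"
  using weight_in_Lp[OF p g D_L_in_Lp[OF \<phi>]] in_Lp_measurable by blast
 show "cmod (g x * iter_deriv ks \<phi> x) \<le> c * cmod (h x * iter_deriv ks \<phi> x)"
  using mult_right_mono[OF le[of x], of "cmod (iter_deriv ks \<phi> x)"] by (simp add: norm_mult mult.assoc)
qed

lemma D_L_lincomb:
 assumes "1 \<le> p" "f \<in> D_L p" "g \<in> D_L p"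
 shows "(\<lambda>x. a * f x + b * g x) \<in> D_L p"
 using assms
 by (auto simp: D_L_iff iter_deriv_add iter_deriv_cmult smooth_add smooth_cmult
   intro!: in_Lp_add Lp_norm_cmult(1))

lemma Lp_zero: "1 \<le> p \<Longrightarrow> in_Lp p (\<lambda>x. 0)"
 by (rule conjunct1, rule Lp_ball_zero[of p 0, unfolded Lp_ball_def]) auto

lemma function_space_D_L: "1 \<le> p \<Longrightarrow> function_space (D_L p :: 'n::finite cfun set)"
proof -
 assume p: "1 \<le> p"
 have "(\<lambda>x :: real ^ 'n. 0) \<in> D_L p"
  by (simp add: D_L_iff smooth_const iter_deriv_zero Lp_zero p)
 then show ?thesis using D_L_lincomb[OF p] unfolding function_space_def by blast
qed

lemma seminorm_on_weighted_norm:
 assumes p: "1 \<le> p" and g: "weight g"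
 shows "seminorm_on (D_L p) (weighted_norm p g m)"
 unfolding seminorm_on_def
proof (intro conjI ballI allI)
 fix \<phi> \<psi> :: "real ^ 'a \<Rightarrow> complex" and c :: complex
 assume \<phi>: "\<phi> \<in> D_L p"
 show "0 \<le> weighted_norm p g m \<phi>" using weighted_norm_nonneg D_L_smooth[OF \<phi>] .
 have le: "weighted_norm p g m (\<lambda>x. c * \<phi> x) \<le> cmod c * weighted_norm p g m \<phi>" if \<phi>: "\<phi> \<in> D_L p" for c \<phi>
 proof (rule weighted_norm_leI)
  fix ks :: "'a list" assume "length ks \<le> m"
  then have "Lp_ball p (weighted_norm p g m \<phi>) (\<lambda>x. g x * iter_deriv ks \<phi> x)"
   using weighted_Lp_ball[OF p g \<phi>] by blast
  then have "in_Lp p (\<lambda>x. g x * iter_deriv ks \<phi> x)" "Lp_norm p (\<lambda>x. g x * iter_deriv ks \<phi> x) \<le> weighted_norm p g m \<phi>"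
   by (auto simp: Lp_ball_def)
  then have "Lp_ball p (cmod c * weighted_norm p g m \<phi>) (\<lambda>x. c * (g x * iter_deriv ks \<phi> x))"
   using Lp_norm_cmult[OF p, of "\<lambda>x. g x * iter_deriv ks \<phi> x" c] by (simp add: Lp_ball_def mult_left_mono)
  then show "Lp_ball p (cmod c * weighted_norm p g m \<phi>) (\<lambda>x. g x * iter_deriv ks (\<lambda>x. c * \<phi> x) x)"
   by (simp add: iter_deriv_cmult D_L_smooth[OF \<phi>] mult.left_commute)
 qed
 show "weighted_norm p g m (\<lambda>x. c * \<phi> x) = cmod c * weighted_norm p g m \<phi>"
 proof (cases "c = 0")
  case True
  have "smooth (\<lambda>x :: real ^ 'a. c * \<phi> x)" using D_L_smooth[OF \<phi>] smooth_cmult by blast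
  then show ?thesis using le[OF \<phi>, of c] weighted_norm_nonneg[of "\<lambda>x. c * \<phi> x" p g m] True by simp
 next
  case False
  have c\<phi>: "(\<lambda>x. c * \<phi> x) \<in> D_L p"
   using function_space_closed(3)[OF function_space_D_L[OF p] \<phi> \<phi>] .
  have "weighted_norm p g m \<phi> \<le> cmod (inverse c) * weighted_norm p g m (\<lambda>x. c * \<phi> x)"
   using le[OF c\<phi>, of "inverse c"] False by (simp flip: mult.assoc)
  then have "cmod c * weighted_norm p g m \<phi> \<le> weighted_norm p g m (\<lambda>x. c * \<phi> x)"
   using False by (simp add: norm_divide field_simps)
  then show ?thesis using le[OF \<phi>, of c] by simp
 qed
 assume \<psi>: "\<psi> \<in> D_L p"
 show "weighted_norm p g m (\<lambda>x. \<phi> x + \<psi> x) \<le> weighted_norm p g m \<phi> + weighted_norm p g m \<psi>"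
 proof (rule weighted_norm_leI)
  fix ks :: "'a list" assume "length ks \<le> m"
  then show "Lp_ball p (weighted_norm p g m \<phi> + weighted_norm p g m \<psi>) (\<lambda>x. g x * iter_deriv ks (\<lambda>x. \<phi> x + \<psi> x) x)"
   using Lp_ball_add[OF p weighted_Lp_ball[OF p g \<phi>] weighted_Lp_ball[OF p g \<psi>]]
   by (simp add: iter_deriv_add D_L_smooth[OF \<phi>] D_L_smooth[OF \<psi>] distrib_left)
 qed
qed

abbreviation D_norm :: "ennreal \<Rightarrow> nat \<Rightarrow> 'n::finite cfun \<Rightarrow> real" where
 "D_norm p \<equiv> weighted_norm p (\<lambda>_. 1)"

lemma D_L_seminorms_eq: "D_L_seminorms p = range (D_norm p)"
 unfolding D_L_seminorms_def weighted_norm_def by simp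

lemma D_norm_ball:
 assumes "1 \<le> p" "\<phi> \<in> D_L p" "length ks \<le> m"
 shows "Lp_ball p (D_norm p m \<phi>) (iter_deriv ks \<phi>)"
 using weighted_Lp_ball[OF assms(1) weight_const assms(2,3), of 1] by simp

section \<open>Leibniz estimates for weighted norms\<close>

lemma borel_measurable_complex_of_real:
 assumes "f \<in> borel_measurable M"
 shows "(\<lambda>x. complex_of_real (f x)) \<in> borel_measurable M"
proof -
 have "complex_of_real \<in> borel_measurable borel"
  by (intro borel_measurable_continuous_onI continuous_intros)
 from measurable_compose[OF assms this] show ?thesis .
qed

text \<open>The function \<open>w\<close> records where the derivatives of \<open>a\<close> live.
  With an indicator for \<open>w\<close>, only the restrictions of the derivatives of
  \<open>\<phi>\<close> to that region enter the bound.\<close>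

lemma Lp_ball_Leibniz:
 fixes a \<phi> g :: "'n::finite cfun"
 assumes p: "1 \<le> p" and a: "smooth a" and \<phi>: "smooth \<phi>" and c: "0 \<le> c"
  and bd: "\<And>js x. length js \<le> m \<Longrightarrow> cmod (iter_deriv js a x) \<le> c * w x"
  and w: "\<And>x. 0 \<le> w x"
  and g: "g \<in> borel_measurable borel"
  and d: "\<And>ls. length ls \<le> m \<Longrightarrow> Lp_ball p (d ls) (\<lambda>x. of_real (w x) * (g x * iter_deriv ls \<phi> x))"
  and ks: "length ks \<le> m"
 shows "Lp_ball p (2 ^ m * c * (\<Sum>ls | length ls \<le> m. d ls)) (\<lambda>x. g x * iter_deriv ks (\<lambda>x. a x * \<phi> x) x)"
proof -
 let ?F = "\<lambda>x. \<Sum>ls | length ls \<le> m. of_real (cmod (of_real (w x) * (g x * iter_deriv ls \<phi> x))) :: complex"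
 have "Lp_ball p (d ls) (\<lambda>x. of_real (cmod (of_real (w x) * (g x * iter_deriv ls \<phi> x))))" if "length ls \<le> m" for ls
 proof -
  have "(\<lambda>x. of_real (w x) * (g x * iter_deriv ls \<phi> x)) \<in> borel_measurable lborel"
   using d[OF that] by (simp add: Lp_ball_def in_Lp_def)
  then have "(\<lambda>x. complex_of_real (cmod (of_real (w x) * (g x * iter_deriv ls \<phi> x)))) \<in> borel_measurable lborel"
   by (rule borel_measurable_complex_of_real[OF measurable_compose[OF _ borel_measurable_norm]])
  then have "Lp_ball p (1 * d ls) (\<lambda>x. of_real (cmod (of_real (w x) * (g x * iter_deriv ls \<phi> x))))"
   using Lp_ball_nonneg[OF d[OF that]] by (intro Lp_ball_dominated[OF p _ _ d[OF that]]) auto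
  then show ?thesis by simp
 qed
 then have F: "Lp_ball p (\<Sum>ls | length ls \<le> m. d ls) ?F"
  by (intro Lp_ball_sum[OF p]) auto
 have cF: "cmod (?F x) = (\<Sum>ls | length ls \<le> m. cmod (of_real (w x) * (g x * iter_deriv ls \<phi> x)))" for x
  unfolding of_real_sum[symmetric] norm_of_real by (intro abs_of_nonneg sum_nonneg) simp
 have ap: "smooth (\<lambda>x. a x * \<phi> x)" using a \<phi> smooth_mult by blast
 show ?thesis
 proof (rule Lp_ball_dominated[OF p _ Lp_ball_nonneg[OF F] F])
  have "iter_deriv ks (\<lambda>x. a x * \<phi> x) \<in> borel_measurable borel"
   using ap smooth_iter_deriv smooth_continuous borel_measurable_continuous by blast
  then show "(\<lambda>x. g x * iter_deriv ks (\<lambda>x. a x * \<phi> x) x) \<in> borel_measurable lborel"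
   using g by simp
  fix x
  have "cmod (iter_deriv ks (\<lambda>x. a x * \<phi> x) x) \<le> 2 ^ length ks * (c * w x) * deriv_sum (length ks) \<phi> x"
   using bd ks by (intro cmod_iter_deriv_mult_le a \<phi>) auto
  also have "... \<le> 2 ^ m * (c * w x) * deriv_sum m \<phi> x"
   using c w ks deriv_sum_mono[OF ks, of \<phi> x] deriv_sum_nonneg by (intro mult_mono) auto
  finally have "cmod (g x) * cmod (iter_deriv ks (\<lambda>x. a x * \<phi> x) x) \<le> cmod (g x) * (2 ^ m * (c * w x) * deriv_sum m \<phi> x)"
   by (intro mult_left_mono) auto
  also have "... = 2 ^ m * c * cmod (?F x)"
   unfolding cF deriv_sum_def using w by (simp add: norm_mult sum_distrib_left mult_ac)
  finally show "cmod (g x * iter_deriv ks (\<lambda>x. a x * \<phi> x) x) \<le> 2 ^ m * c * cmod (?F x)"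
   by (simp add: norm_mult)
 qed (use c in simp)
qed

definition leibniz_const :: "'n itself \<Rightarrow> nat \<Rightarrow> real" where
 "leibniz_const _ m = 2 ^ m * real (card {ls :: 'n list. length ls \<le> m})"

lemma leibniz_const_nonneg: "0 \<le> leibniz_const TYPE('n) m"
 by (simp add: leibniz_const_def)

text \<open>Multiplication by \<open>a\<close> may change the weight: on the region recorded by
  \<open>w\<close> the weight \<open>g\<close> need only be dominated by \<open>h\<close>. This is
  how cutoffs exchange decay of a weight for localisation.\<close>

lemma weighted_norm_Leibniz:
 fixes a \<phi> g :: "'n::finite cfun"
 assumes p: "1 \<le> p" and a: "smooth a" and \<phi>: "\<phi> \<in> D_L p" and c: "0 \<le> c"
  and bd: "\<And>js x. length js \<le> m \<Longrightarrow> cmod (iter_deriv js a x) \<le> c * w x" and w: "\<And>x. 0 \<le> w x"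
  and wm: "w \<in> borel_measurable borel"
  and g: "weight g" and h: "weight h" and le: "\<And>x. w x * cmod (g x) \<le> cmod (h x)"
 shows "weighted_norm p g m (\<lambda>x. a x * \<phi> x) \<le> leibniz_const TYPE('n) m * c * weighted_norm p h m \<phi>"
proof (rule weighted_norm_leI)
 fix ks :: "'n list" assume ks: "length ks \<le> m"
 have gm: "g \<in> borel_measurable borel" using g weight_continuous borel_measurable_continuous by blast
 have "Lp_ball p (2 ^ m * c * (\<Sum>ls :: 'n list | length ls \<le> m. weighted_norm p h m \<phi>)) (\<lambda>x. g x * iter_deriv ks (\<lambda>x. a x * \<phi> x) x)"
 proof (rule Lp_ball_Leibniz[OF p a D_L_smooth[OF \<phi>] c bd w gm _ ks])
  fix ls :: "'n list" assume ls: "length ls \<le> m"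
  have "Lp_ball p (1 * weighted_norm p h m \<phi>) (\<lambda>x. of_real (w x) * (g x * iter_deriv ls \<phi> x))"
  proof (rule Lp_ball_dominated[OF p _ weighted_norm_nonneg[OF D_L_smooth[OF \<phi>]] weighted_Lp_ball[OF p h \<phi> ls]])
   have "iter_deriv ls \<phi> \<in> borel_measurable borel"
    using D_L_in_Lp[OF \<phi>, of ls] by (simp add: in_Lp_def)
   then show "(\<lambda>x. of_real (w x) * (g x * iter_deriv ls \<phi> x)) \<in> borel_measurable lborel"
    using gm wm by simp
   show "cmod (of_real (w x) * (g x * iter_deriv ls \<phi> x)) \<le> 1 * cmod (h x * iter_deriv ls \<phi> x)" for x
    using mult_right_mono[OF le[of x], of "cmod (iter_deriv ls \<phi> x)"] w[of x] by (simp add: norm_mult mult.assoc)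
  qed simp
  then show "Lp_ball p (weighted_norm p h m \<phi>) (\<lambda>x. of_real (w x) * (g x * iter_deriv ls \<phi> x))" by simp
 qed
 then show "Lp_ball p (leibniz_const TYPE('n) m * c * weighted_norm p h m \<phi>) (\<lambda>x. g x * iter_deriv ks (\<lambda>x. a x * \<phi> x) x)"
  by (simp add: leibniz_const_def mult_ac)
qed

lemma smooth_bounded_uniform:
 fixes a :: "'n::finite cfun"
 assumes "smooth_bounded a"
 shows "\<exists>c\<ge>0. \<forall>js x. length js \<le> m \<longrightarrow> cmod (iter_deriv js a x) \<le> c"
proof -
 obtain c where c: "\<And>ks x. cmod (iter_deriv ks a x) \<le> c ks"
  using assms unfolding smooth_bounded_def by metis
 have c0: "0 \<le> c ks" for ks using order_trans[OF norm_ge_zero c] .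
 have "cmod (iter_deriv js a x) \<le> (\<Sum>ks | length ks \<le> m. c ks)" if "length js \<le> m" for js x
  using order_trans[OF c[of js x] member_le_sum[of js "{ks. length ks \<le> m}" c]] that c0 finite_lists_le by auto
 then show ?thesis
  using c0 by (intro exI[of _ "\<Sum>ks | length ks \<le> m. c ks"]) (auto intro: sum_nonneg)
qed

section \<open>Test functions and the preduals of the distribution spaces\<close>

lemma test_D_L:
 fixes f :: "'n::finite cfun"
 assumes p: "1 \<le> p" and f: "f \<in> test_functions"
 shows "f \<in> D_L p"
proof -
 have "in_Lp p u" if u: "u \<in> test_functions" for u :: "'n cfun"
 proof -
  obtain R where R: "\<forall>x. R < norm x \<longrightarrow> u x = 0"
   using test_functions_support[OF u] by metis
  obtain c where c: "0 \<le> c" "\<And>x. cmod (u x) \<le> c"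
   using test_bounded[OF u] by blast
  obtain C where "\<And>(f :: 'n cfun) c. f \<in> borel_measurable borel \<Longrightarrow> (\<forall>x. cmod (f x) \<le> c * indicator (cball 0 R) x) \<Longrightarrow>
    0 \<le> c \<Longrightarrow> Lp_ball p (C * c) f"
   using in_Lp_bounded_support[OF p, of R] by blast
  moreover have "u \<in> borel_measurable borel"
   using u test_smooth smooth_continuous borel_measurable_continuous by blast
  moreover have "\<forall>x. cmod (u x) \<le> c * indicator (cball 0 R) x"
   using R c by (auto simp: indicator_def not_le)
  ultimately have "Lp_ball p (C * c) u" using c(1) by blast
  then show ?thesis by (simp add: Lp_ball_def)
 qed
 then show ?thesis
  using test_iter_deriv[OF f] test_smooth[OF f] by (simp add: D_L_iff)
qed

lemma D_L_infinity_smooth_bounded: "\<phi> \<in> D_L \<infinity> \<longleftrightarrow> smooth_bounded \<phi>"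
proof
 assume \<phi>: "\<phi> \<in> D_L \<infinity>"
 have "cmod (iter_deriv ks \<phi> x) \<le> Lp_norm \<infinity> (iter_deriv ks \<phi>)" for ks x
  by (rule cmod_le_Lp_norm_infinity[OF smooth_continuous[OF smooth_iter_deriv[OF D_L_smooth[OF \<phi>]]] D_L_in_Lp[OF \<phi>]])
 then show "smooth_bounded \<phi>"
  using D_L_smooth[OF \<phi>] unfolding smooth_bounded_def by blast
next
 assume \<phi>: "smooth_bounded \<phi>"
 have "in_Lp \<infinity> (iter_deriv ks \<phi>)" for ks
 proof -
  obtain c where c: "0 \<le> c" "\<And>js x. length js \<le> length ks \<Longrightarrow> cmod (iter_deriv js \<phi> x) \<le> c"
   using smooth_bounded_uniform[OF \<phi>, of "length ks"] by auto
  have "iter_deriv ks \<phi> \<in> borel_measurable lborel"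
   using borel_measurable_continuous[OF smooth_continuous[OF smooth_iter_deriv[OF smooth_bounded_smooth[OF \<phi>]]]] by simp
  then have "Lp_ball \<infinity> c (iter_deriv ks \<phi>)"
   using c by (intro bounded_in_Lp_infinity) auto
  then show ?thesis by (simp only: Lp_ball_def)
 qed
 then show "\<phi> \<in> D_L \<infinity>"
  using smooth_bounded_smooth[OF \<phi>] by (simp add: D_L_iff)
qed

text \<open>The predual of the distribution space with the conjugate exponent: \<open>D_L p\<close>
  itself unless \<open>p\<close> is infinite. On it truncations converge in every
  \<open>D_norm\<close>, which fails for the constant 1 in \<open>D_L \<infinity>\<close>.\<close>

definition core :: "ennreal \<Rightarrow> 'n::finite cfun set" where
 "core p = (if p = \<infinity> then B_dot else D_L p)"

lemma core_subset_D_L: "\<phi> \<in> core p \<Longrightarrow> \<phi> \<in> D_L p"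
 by (auto simp: core_def B_dot_def split: if_splits)

lemma B_dot_iff: "\<phi> \<in> B_dot \<longleftrightarrow> \<phi> \<in> D_L \<infinity> \<and> (\<forall>ks. (iter_deriv ks \<phi> \<longlongrightarrow> 0) at_infinity)"
proof -
 have "(\<forall>\<alpha>. (multi_deriv \<alpha> \<phi> \<longlongrightarrow> 0) at_infinity) \<longleftrightarrow> (\<forall>ks. (iter_deriv ks \<phi> \<longlongrightarrow> 0) at_infinity)"
  if "smooth \<phi>"
 proof
  assume "\<forall>ks. (iter_deriv ks \<phi> \<longlongrightarrow> 0) at_infinity"
  then show "\<forall>\<alpha>. (multi_deriv \<alpha> \<phi> \<longlongrightarrow> 0) at_infinity"
   using multi_deriv_eq_iter_deriv by metis
 qed (simp add: iter_deriv_eq_multi_deriv(1)[OF that])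
 then show ?thesis
  unfolding B_dot_def using D_L_smooth by auto
qed

lemma test_tendsto_0:
 fixes f :: "'n::finite cfun"
 assumes "f \<in> test_functions"
 shows "(f \<longlongrightarrow> 0) at_infinity"
proof -
 obtain R where R: "\<forall>x. R < norm x \<longrightarrow> f x = 0"
  using test_functions_support[OF assms] by metis
 have "\<forall>\<^sub>F x in at_infinity. f x = 0"
  unfolding eventually_at_infinity using R by (intro exI[of _ "R + 1"]) auto
 then show ?thesis by (rule tendsto_eventually)
qed

lemma test_core: "1 \<le> p \<Longrightarrow> f \<in> test_functions \<Longrightarrow> f \<in> core p"
 using test_D_L test_tendsto_0[OF test_iter_deriv] by (auto simp: core_def B_dot_iff)

lemma function_space_core: "1 \<le> p \<Longrightarrow> function_space (core p :: 'n::finite cfun set)"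
proof (cases "p = \<infinity>")
 case True
 have "(\<lambda>x. a * f x + b * g x) \<in> B_dot" if "f \<in> B_dot" "g \<in> B_dot" for f g :: "'n cfun" and a b
 proof -
  have "((\<lambda>x. a * iter_deriv ks f x + b * iter_deriv ks g x) \<longlongrightarrow> a * 0 + b * 0) at_infinity" for ks
   using that by (intro tendsto_intros) (auto simp: B_dot_iff)
  then show ?thesis
   using that D_L_lincomb[of \<infinity> f g a b] D_L_smooth[of f] D_L_smooth[of g]
   by (auto simp: B_dot_iff iter_deriv_add iter_deriv_cmult smooth_cmult)
 qed
 moreover have "(\<lambda>x :: real ^ 'n. 0) \<in> B_dot"
  using test_core[of \<infinity> "\<lambda>x. 0"] by (simp add: core_def test_functions_def smooth_const)
 ultimately show ?thesis
  unfolding function_space_def core_def using True by auto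
qed (simp add: core_def function_space_D_L)

lemma seminorm_on_subset: "seminorm_on E r \<Longrightarrow> E' \<subseteq> E \<Longrightarrow> seminorm_on E' r"
 unfolding seminorm_on_def by blast

lemma seminorm_on_core: "1 \<le> p \<Longrightarrow> weight g \<Longrightarrow> seminorm_on (core p) (weighted_norm p g m)"
 using seminorm_on_subset[OF seminorm_on_weighted_norm] core_subset_D_L by blast

lemma seminorm_on_D_L_seminorms: "1 \<le> p \<Longrightarrow> r \<in> D_L_seminorms p \<Longrightarrow> seminorm_on (core p) r"
 using seminorm_on_core[OF _ weight_const] unfolding D_L_seminorms_eq by blast

subsection \<open>Approximation by test functions\<close>

lemma cutoff_mult_test: "smooth \<phi> \<Longrightarrow> 0 < R \<Longrightarrow> (\<lambda>x. cutoff R x * \<phi> x) \<in> test_functions"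
 using test_mult_left(2)[OF test_cutoff] by blast

lemma tail_cutoff_mult: "tail_cutoff R x * \<phi> x = \<phi> x - cutoff R x * \<phi> x"
 by (simp add: tail_cutoff_def left_diff_distrib)

lemma tail_cutoff_D_L: "1 \<le> p \<Longrightarrow> 0 < R \<Longrightarrow> \<phi> \<in> D_L p \<Longrightarrow> (\<lambda>x. tail_cutoff R x * \<phi> x) \<in> D_L p"
 unfolding tail_cutoff_mult
 using function_space_closed(2)[OF function_space_D_L] test_D_L[OF _ cutoff_mult_test] D_L_smooth by blast

lemma tail_cutoff_core: "1 \<le> p \<Longrightarrow> 0 < R \<Longrightarrow> \<phi> \<in> core p \<Longrightarrow> (\<lambda>x. tail_cutoff R x * \<phi> x) \<in> core p"
 unfolding tail_cutoff_mult
 using function_space_closed(2)[OF function_space_core] test_core[OF _ cutoff_mult_test] D_L_smooth core_subset_D_L by blast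

lemma tail_cutoff_test: "0 < R \<Longrightarrow> \<phi> \<in> test_functions \<Longrightarrow> (\<lambda>x. tail_cutoff R x * \<phi> x) \<in> test_functions"
 using test_mult_left(1)[OF _ smooth_tail_cutoff] by blast

lemma borel_measurable_tail_indicator [measurable]:
 "(indicator {x :: real ^ 'n. R \<le> norm x} :: real ^ 'n \<Rightarrow> real) \<in> borel_measurable borel"
 by measurable

text \<open>The decay comes from the weight, so truncations converge for all of
  \<open>D_L p\<close>, also at the infinite exponent. This substitutes for density of the test
  functions in the original norms.\<close>

lemma weighted_norm_tail_tendsto_0:
 fixes \<phi> :: "'n::finite cfun"
 assumes p: "1 \<le> p" and g: "g \<in> C_0" and \<phi>: "\<phi> \<in> D_L p"
 shows "(\<lambda>k. weighted_norm p g m (\<lambda>x. tail_cutoff (real k) x * \<phi> x)) \<longlonglongrightarrow> 0"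
proof -
 obtain c where c: "1 \<le> c" "\<And>R ks x. 1 \<le> R \<Longrightarrow> length ks \<le> m \<Longrightarrow>
   cmod (iter_deriv ks (tail_cutoff R) (x :: real ^ 'n)) \<le> c * indicator {x. R \<le> norm x} x"
  using tail_cutoff_deriv_bound[of m] by blast
 let ?K = "leibniz_const TYPE('n) m * c * D_norm p m \<phi>"
 have K0: "0 \<le> ?K"
  using c(1) by (intro mult_nonneg_nonneg leibniz_const_nonneg weighted_norm_nonneg D_L_smooth[OF \<phi>]) auto
 show ?thesis
 proof (rule LIMSEQ_I)
  fix e :: real assume e: "0 < e"
  \<comment> \<open>Beyond radius \<open>R\<close> the weight is at most \<open>e'\<close>, hence
    the weighted norm of the tail is at most \<open>e'\<close> times the unweighted bound
    \<open>?K\<close>.\<close>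
  define e' where "e' = e / (?K + 1)"
  have e': "0 < e'" using e K0 by (simp add: e'_def)
  obtain R where R: "0 < R" "\<And>x. R \<le> norm x \<Longrightarrow> cmod (g x) \<le> e'"
   using C_0_small_outside[OF g e'] by blast
  obtain k0 :: nat where k0: "max R 1 \<le> k0" using real_arch_simple by blast
  have "norm (weighted_norm p g m (\<lambda>x. tail_cutoff (real k) x * \<phi> x) - 0) < e" if "k0 \<le> k" for k
  proof -
   have k: "1 \<le> real k" "R \<le> real k" using k0 that by auto
   have "weighted_norm p g m (\<lambda>x. tail_cutoff (real k) x * \<phi> x) \<le>
     leibniz_const TYPE('n) m * c * weighted_norm p (\<lambda>_. of_real e') m \<phi>"
    by (rule weighted_norm_Leibniz[OF p smooth_tail_cutoff \<phi> _ c(2)[OF k(1)] _ _ C_0_weight[OF g] weight_const])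
     (use c(1) R k e' in \<open>auto simp: indicator_def\<close>)
   also have "... \<le> leibniz_const TYPE('n) m * c * (e' * D_norm p m \<phi>)"
   proof (rule mult_left_mono)
    show "weighted_norm p (\<lambda>_. of_real e') m \<phi> \<le> e' * D_norm p m \<phi>"
     using e' by (intro weighted_norm_mono_weight[OF p weight_const weight_const \<phi>]) auto
    show "0 \<le> leibniz_const TYPE('n) m * c"
     using c(1) by (intro mult_nonneg_nonneg leibniz_const_nonneg) auto
   qed
   also have "... = e' * ?K"
    by (simp add: mult_ac)
   also have "... < e"
    using e K0 by (simp add: e'_def divide_less_eq)
   finally show ?thesis
    using weighted_norm_nonneg[OF smooth_mult[OF smooth_tail_cutoff D_L_smooth[OF \<phi>]]] by simp
  qed
  then show "\<exists>k0. \<forall>k\<ge>k0. norm (weighted_norm p g m (\<lambda>x. tail_cutoff (real k) x * \<phi> x) - 0) < e" by blast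
 qed
qed

lemma core_tail_Lp_tendsto_0:
 fixes \<phi> :: "'n::finite cfun"
 assumes p: "1 \<le> p" and \<phi>: "\<phi> \<in> core p"
 shows "(\<lambda>k. Lp_norm p (\<lambda>x. indicator {x. real k \<le> norm x} x * iter_deriv ls \<phi> x)) \<longlonglongrightarrow> 0"
proof (cases "p = \<infinity>")
 case False
 then show ?thesis
  using Lp_norm_tail_tendsto_0[OF p False D_L_in_Lp[OF core_subset_D_L[OF \<phi>]]] by blast
next
 case True
 have lim: "(iter_deriv ls \<phi> \<longlongrightarrow> 0) at_infinity"
  using \<phi> True by (simp add: core_def B_dot_iff)
 have sm: "smooth (iter_deriv ls \<phi>)" using smooth_iter_deriv D_L_smooth core_subset_D_L[OF \<phi>] by blast
 have meas: "iter_deriv ls \<phi> \<in> borel_measurable borel"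
  using smooth_continuous[OF sm] borel_measurable_continuous by blast
 show ?thesis
 proof (rule LIMSEQ_I)
  fix e :: real assume e: "0 < e"
  have "iter_deriv ls \<phi> \<in> C_0"
   using lim smooth_continuous[OF sm] by (simp add: C_0_def)
  then obtain R where R: "0 < R" "\<And>x. R \<le> norm x \<Longrightarrow> cmod (iter_deriv ls \<phi> x) \<le> e / 2"
   using C_0_small_outside[of _ "e / 2"] e by (metis half_gt_zero)
  obtain k0 :: nat where k0: "R \<le> k0" using real_arch_simple by blast
  have "norm (Lp_norm p (\<lambda>x. indicator {x. real k \<le> norm x} x * iter_deriv ls \<phi> x) - 0) < e" if "k0 \<le> k" for k
  proof -
   have "Lp_ball \<infinity> (e / 2) (\<lambda>x. indicator {x. real k \<le> norm x} x * iter_deriv ls \<phi> x)"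
    using e R k0 that meas by (intro bounded_in_Lp_infinity) (auto simp: indicator_def)
   then have "Lp_norm p (\<lambda>x. indicator {x. real k \<le> norm x} x * iter_deriv ls \<phi> x) \<le> e / 2"
    unfolding True Lp_ball_def by blast
   then show ?thesis using e Lp_norm_nonneg[of p "\<lambda>x. indicator {x. real k \<le> norm x} x * iter_deriv ls \<phi> x"] by simp
  qed
  then show "\<exists>k0. \<forall>k\<ge>k0. norm (Lp_norm p (\<lambda>x. indicator {x. real k \<le> norm x} x * iter_deriv ls \<phi> x) - 0) < e" by blast
 qed
qed

text \<open>Here the decay comes from \<open>\<phi>\<close>: dominated convergence for finite
  exponents, vanishing derivatives at infinity for \<open>B_dot\<close>.\<close>

lemma D_norm_tail_tendsto_0:
 fixes \<phi> :: "'n::finite cfun"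
 assumes p: "1 \<le> p" and \<phi>: "\<phi> \<in> core p"
 shows "(\<lambda>k. D_norm p m (\<lambda>x. tail_cutoff (real k) x * \<phi> x)) \<longlonglongrightarrow> 0"
proof -
 obtain c where c: "1 \<le> c" "\<And>R ks x. 1 \<le> R \<Longrightarrow> length ks \<le> m \<Longrightarrow>
   cmod (iter_deriv ks (tail_cutoff R) (x :: real ^ 'n)) \<le> c * indicator {x. R \<le> norm x} x"
  using tail_cutoff_deriv_bound[of m] by blast
 have \<phi>': "\<phi> \<in> D_L p" using \<phi> core_subset_D_L by blast
 let ?b = "\<lambda>k. 2 ^ m * c * (\<Sum>ls :: 'n list | length ls \<le> m. Lp_norm p (\<lambda>x. indicator {x. real k \<le> norm x} x * iter_deriv ls \<phi> x))"
 have "?b \<longlonglongrightarrow> 2 ^ m * c * (\<Sum>ls :: 'n list | length ls \<le> m. 0)"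
  by (intro tendsto_intros core_tail_Lp_tendsto_0[OF p \<phi>])
 then have b: "?b \<longlonglongrightarrow> 0" by simp
 have "D_norm p m (\<lambda>x. tail_cutoff (real k) x * \<phi> x) \<le> ?b k" if k: "1 \<le> k" for k
 proof (rule weighted_norm_leI)
  fix ks :: "'n list" assume ks: "length ks \<le> m"
  show "Lp_ball p (?b k) (\<lambda>x. 1 * iter_deriv ks (\<lambda>x. tail_cutoff (real k) x * \<phi> x) x)"
  proof (rule Lp_ball_Leibniz[OF p smooth_tail_cutoff D_L_smooth[OF \<phi>'] _ c(2) _ _ _ ks])
   fix ls :: "'n list"
   have "in_Lp p (\<lambda>x. indicator {x. real k \<le> norm x} x * iter_deriv ls \<phi> x)"
   proof (rule Lp_norm_mono(1)[OF p D_L_in_Lp[OF \<phi>', of ls]])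
    have [measurable]: "iter_deriv ls \<phi> \<in> borel_measurable borel"
     using D_L_in_Lp[OF \<phi>', of ls] by (simp add: in_Lp_def)
    show "(\<lambda>x. indicator {x. real k \<le> norm x} x * iter_deriv ls \<phi> x) \<in> borel_measurable lborel"
     by measurable
   qed (auto simp: indicator_def)
   then have "Lp_ball p (Lp_norm p (\<lambda>x. indicator {x. real k \<le> norm x} x * iter_deriv ls \<phi> x))
    (\<lambda>x. indicator {x. real k \<le> norm x} x * iter_deriv ls \<phi> x)"
    by (rule in_Lp_ball)
   moreover have "(\<lambda>x. indicator {x. real k \<le> norm x} x * iter_deriv ls \<phi> x) =
     (\<lambda>x. complex_of_real (indicator {x. real k \<le> norm x} x) * (1 * iter_deriv ls \<phi> x))"
    by (auto simp: indicator_def)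
   ultimately show "Lp_ball p (Lp_norm p (\<lambda>x. indicator {x. real k \<le> norm x} x * iter_deriv ls \<phi> x))
    (\<lambda>x. complex_of_real (indicator {x. real k \<le> norm x} x) * (1 * iter_deriv ls \<phi> x))" by simp
  qed (use c(1) k in auto)
 qed
 moreover have "0 \<le> D_norm p m (\<lambda>x. tail_cutoff (real k) x * \<phi> x)" for k
  by (rule weighted_norm_nonneg[OF smooth_mult[OF smooth_tail_cutoff D_L_smooth[OF \<phi>']]])
 ultimately show ?thesis
  by (intro tendsto_sandwich[OF _ _ tendsto_const b] eventually_sequentiallyI[of 1]) auto
qed

section \<open>The dual space\<close>

definition dual :: "ennreal \<Rightarrow> 'n::finite functional set" where
 "dual p = cdual (core p) (D_L_seminorms p)"

definition sup_on :: "'a set \<Rightarrow> ('a \<Rightarrow> complex) \<Rightarrow> real" where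
 "sup_on B T = (SUP f\<in>B. cmod (T f))"

definition D_bounded :: "ennreal \<Rightarrow> 'n::finite cfun set \<Rightarrow> bool" where
 "D_bounded p B \<longleftrightarrow> B \<noteq> {} \<and> B \<subseteq> core p \<and> (\<forall>m. \<exists>c. \<forall>f\<in>B. D_norm p m f \<le> c)"

lemma bounded_subsets_iff:
 "B \<in> bounded_subsets (core p) (D_L_seminorms p) \<and> B \<noteq> {} \<longleftrightarrow> D_bounded p B"
 unfolding bounded_subsets_def D_L_seminorms_eq D_bounded_def
 by (auto simp: bdd_above_def)

lemma strong_seminorms_eq:
 "strong_seminorms (core p) (D_L_seminorms p) = {sup_on B | B. D_bounded p B}"
 unfolding strong_seminorms_def bounded_subsets_iff sup_on_def by simp

context
 fixes p :: ennreal
 assumes p: "1 \<le> p"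
begin

text \<open>Continuity involves finitely many of the norms, and these increase with the order, so
  the one of the largest order suffices.\<close>

lemma dual_bound:
 fixes T :: "'n::finite functional"
 assumes "T \<in> dual p"
 shows "\<exists>m C. 0 \<le> C \<and> (\<forall>f\<in>core p. cmod (T f) \<le> C * D_norm p m f)"
proof -
 have E: "function_space (core p)" using function_space_core[OF p] .
 have P: "\<forall>r\<in>D_L_seminorms p. seminorm_on (core p) r" using seminorm_on_D_L_seminorms[OF p] by blast
 have T: "T \<in> cdual (core p) (D_L_seminorms p)" using assms by (simp add: dual_def)
 obtain P0 e where *: "finite P0" "P0 \<subseteq> D_L_seminorms p" "0 < e"
  "\<And>f. f \<in> core p \<Longrightarrow> (\<forall>r\<in>P0. r f < e) \<Longrightarrow> cmod (T f) < 1"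
  using cdual_bounded_near_0[OF E P T] by metis
 obtain M where M: "finite M" "P0 = D_norm p ` M"
  using finite_subset_image[OF *(1) *(2)[unfolded D_L_seminorms_eq]] by blast
 obtain m where m: "\<And>k. k \<in> M \<Longrightarrow> k \<le> m"
  using M(1) unfolding finite_nat_set_iff_bounded_le by auto
 have "cmod (T f) \<le> (2 / e) * D_norm p m f" if f: "f \<in> core p" for f
 proof (rule homogeneous_bound[OF seminorm_on_core[OF p weight_const] E f *(3)])
  show "T (\<lambda>x. c * f x) = c * T f" if "f \<in> core p" for c f
   using cdual_cmult[OF T that] .
  fix f :: "'n cfun" assume f: "f \<in> core p" "D_norm p m f < e"
  have "D_norm p k f < e" if "k \<in> M" for k
   using weighted_norm_mono_order[OF D_L_smooth[OF core_subset_D_L[OF f(1)]] m[OF that], of p "\<lambda>_. 1"] f(2) by simp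
  then show "cmod (T f) < 1" using *(4)[OF f(1)] M(2) by blast
 qed
 then show ?thesis using *(3) by (intro exI[of _ m] exI[of _ "2 / e"]) auto
qed

lemma dualI:
 assumes "\<And>f g a b. f \<in> core p \<Longrightarrow> g \<in> core p \<Longrightarrow> T (\<lambda>x. a * f x + b * g x) = a * T f + b * T g"
  and "\<And>f. f \<notin> core p \<Longrightarrow> T f = 0" and "\<And>f. f \<in> core p \<Longrightarrow> cmod (T f) \<le> C * D_norm p m f"
 shows "T \<in> dual p"
 unfolding dual_def
proof (rule cdualI[OF function_space_core[OF p] _ assms(1,2) _ assms(3)])
 show "\<forall>\<rho>\<in>D_L_seminorms p. seminorm_on (core p) \<rho>" using seminorm_on_D_L_seminorms[OF p] by blast
 show "D_norm p m \<in> D_L_seminorms p" unfolding D_L_seminorms_eq by blast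
qed auto

lemma dual_ops:
 assumes "T \<in> dual p" "f \<in> core p"
 shows dual_add: "g \<in> core p \<Longrightarrow> T (\<lambda>x. f x + g x) = T f + T g"
  and dual_diff: "g \<in> core p \<Longrightarrow> T (\<lambda>x. f x - g x) = T f - T g"
  and dual_cmult: "T (\<lambda>x. c * f x) = c * T f"
  and dual_lincomb: "g \<in> core p \<Longrightarrow> T (\<lambda>x. a * f x + b * g x) = a * T f + b * T g"
proof -
 have T: "T \<in> cdual (core p) (D_L_seminorms p)" using assms(1) by (simp add: dual_def)
 show "g \<in> core p \<Longrightarrow> T (\<lambda>x. f x + g x) = T f + T g" by (rule cdual_add[OF T assms(2)])
 show "g \<in> core p \<Longrightarrow> T (\<lambda>x. f x - g x) = T f - T g" by (rule cdual_diff[OF T assms(2)])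
 show "T (\<lambda>x. c * f x) = c * T f" by (rule cdual_cmult[OF T assms(2)])
 show "g \<in> core p \<Longrightarrow> T (\<lambda>x. a * f x + b * g x) = a * T f + b * T g" by (rule cdual_linear[OF T assms(2)])
qed

lemma dual_outside: "T \<in> dual p \<Longrightarrow> f \<notin> core p \<Longrightarrow> T f = 0"
 by (simp add: dual_def cdual_def)

lemma function_space_dual: "function_space (dual p :: 'n::finite functional set)"
 unfolding function_space_def
proof (intro conjI ballI allI)
 have "(\<lambda>f :: 'n cfun. 0) \<in> dual p"
  by (rule dualI[where C = 0 and m = 0]) auto
 then show "dual p \<noteq> ({} :: 'n functional set)" by blast
 fix S T :: "'n functional" and a b
 assume S: "S \<in> dual p" and T: "T \<in> dual p"
 obtain m1 C1 where 1: "0 \<le> C1" "\<And>f. f \<in> core p \<Longrightarrow> cmod (S f) \<le> C1 * D_norm p m1 f"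
  using dual_bound[OF S] by blast
 obtain m2 C2 where 2: "0 \<le> C2" "\<And>f. f \<in> core p \<Longrightarrow> cmod (T f) \<le> C2 * D_norm p m2 f"
  using dual_bound[OF T] by blast
 show "(\<lambda>f. a * S f + b * T f) \<in> dual p"
 proof (rule dualI[where C = "cmod a * C1 + cmod b * C2" and m = "max m1 m2"])
  fix f :: "'n cfun" assume f: "f \<in> core p"
  have sf: "smooth f" using D_L_smooth core_subset_D_L[OF f] by blast
  have "cmod (S f) \<le> C1 * D_norm p (max m1 m2) f"
   using order_trans[OF 1(2)[OF f] mult_left_mono[OF weighted_norm_mono_order[OF sf] 1(1)]] by simp
  moreover have "cmod (T f) \<le> C2 * D_norm p (max m1 m2) f"
   using order_trans[OF 2(2)[OF f] mult_left_mono[OF weighted_norm_mono_order[OF sf] 2(1)]] by simp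
  ultimately have "cmod a * cmod (S f) + cmod b * cmod (T f) \<le>
    cmod a * (C1 * D_norm p (max m1 m2) f) + cmod b * (C2 * D_norm p (max m1 m2) f)"
   by (intro add_mono mult_left_mono) auto
  then show "cmod (a * S f + b * T f) \<le> (cmod a * C1 + cmod b * C2) * D_norm p (max m1 m2) f"
   using norm_triangle_ineq[of "a * S f" "b * T f"] by (simp add: norm_mult algebra_simps)
 next
  fix f :: "'n cfun" assume "f \<notin> core p"
  then show "a * S f + b * T f = 0" using dual_outside[OF S] dual_outside[OF T] by simp
 next
  fix f g :: "'n cfun" and c d assume fg: "f \<in> core p" "g \<in> core p"
  show "a * S (\<lambda>x. c * f x + d * g x) + b * T (\<lambda>x. c * f x + d * g x) =
    c * (a * S f + b * T f) + d * (a * S g + b * T g)"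
   unfolding dual_lincomb[OF S fg] dual_lincomb[OF T fg] by (simp add: algebra_simps)
 qed
qed

lemma D_bounded_bdd_above:
 assumes B: "D_bounded p B" and T: "T \<in> dual p"
 shows "bdd_above ((\<lambda>f. cmod (T f)) ` B)"
proof -
 obtain m C where C: "0 \<le> C" "\<And>f. f \<in> core p \<Longrightarrow> cmod (T f) \<le> C * D_norm p m f"
  using dual_bound[OF T] by blast
 obtain c where c: "\<And>f. f \<in> B \<Longrightarrow> D_norm p m f \<le> c"
  using B unfolding D_bounded_def by blast
 have "cmod (T f) \<le> C * c" if "f \<in> B" for f
  using order_trans[OF C(2) mult_left_mono[OF c[OF that] C(1)]] B that unfolding D_bounded_def by blast
 then show ?thesis by (auto intro!: bdd_aboveI)
qed

lemma sup_on_upper: "D_bounded p B \<Longrightarrow> T \<in> dual p \<Longrightarrow> f \<in> B \<Longrightarrow> cmod (T f) \<le> sup_on B T"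
 unfolding sup_on_def by (rule cSUP_upper[OF _ D_bounded_bdd_above])

lemma sup_on_least: "D_bounded p B \<Longrightarrow> (\<And>f. f \<in> B \<Longrightarrow> cmod (T f) \<le> c) \<Longrightarrow> sup_on B T \<le> c"
 unfolding sup_on_def by (rule cSUP_least) (auto simp: D_bounded_def)

lemma seminorm_on_sup_on:
 fixes B :: "'n::finite cfun set"
 assumes B: "D_bounded p B"
 shows "seminorm_on (dual p) (sup_on B)"
 unfolding seminorm_on_def
proof (intro conjI ballI allI)
 obtain f0 where f0: "f0 \<in> B" using B unfolding D_bounded_def by blast
 fix S T :: "'n functional" and c assume S: "S \<in> dual p"
 show "0 \<le> sup_on B S" using order_trans[OF norm_ge_zero sup_on_upper[OF B S f0]] .
 have le: "sup_on B (\<lambda>x. c * S x) \<le> cmod c * sup_on B S" if S: "S \<in> dual p" for c S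
  by (rule sup_on_least[OF B]) (simp add: norm_mult mult_left_mono sup_on_upper[OF B S])
 show "sup_on B (\<lambda>x. c * S x) = cmod c * sup_on B S"
 proof (cases "c = 0")
  case True
  have "B \<noteq> {}" using f0 by blast
  then show ?thesis using True by (simp add: sup_on_def)
 next
  case False
  have "(\<lambda>x. c * S x) \<in> dual p" using function_space_closed(3)[OF function_space_dual S S] .
  from le[OF this, of "inverse c"] have "sup_on B S \<le> inverse (cmod c) * sup_on B (\<lambda>x. c * S x)"
   using False by (simp add: norm_inverse flip: mult.assoc)
  then have "cmod c * sup_on B S \<le> sup_on B (\<lambda>x. c * S x)" using False by (simp add: field_simps)
  then show ?thesis using le[OF S, of c] by simp
 qed
 assume T: "T \<in> dual p"
 show "sup_on B (\<lambda>x. S x + T x) \<le> sup_on B S + sup_on B T"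
  by (rule sup_on_least[OF B])
   (meson B S T add_mono norm_triangle_le sup_on_upper)
qed

lemma strong_seminorms_seminorm:
 "\<forall>r\<in>strong_seminorms (core p) (D_L_seminorms p). seminorm_on (dual p) r"
 unfolding strong_seminorms_eq using seminorm_on_sup_on by blast

end

definition dual_topology :: "ennreal \<Rightarrow> 'n::finite functional topology" where
 "dual_topology p = seminorm_topology (dual p) (strong_seminorms (core p) (D_L_seminorms p))"

section \<open>Bounded sets are precompact for the weighted seminorms\<close>

lemma average_diff:
 assumes "continuous_on UNIV u" "continuous_on UNIV v" "k \<in> test_functions"
 shows "average k d (\<lambda>x. u x - v x) x = average k d u x - average k d v x"
 using average_integrable[OF assms(1,3)] average_integrable[OF assms(2,3)]
 by (simp add: average_def left_diff_distrib)

text \<open>Pigeonhole form of total boundedness: one representative is chosen for each of the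
  finitely many labels.\<close>

lemma finite_cover_of_labels:
 assumes "finite (lab ` B)" "\<And>f g. f \<in> B \<Longrightarrow> g \<in> B \<Longrightarrow> lab f = lab g \<Longrightarrow> R f g"
 shows "\<exists>B0. finite B0 \<and> B0 \<subseteq> B \<and> (\<forall>f\<in>B. \<exists>g\<in>B0. R f g)"
proof -
 define r where "r y = (SOME f. f \<in> B \<and> lab f = y)" for y
 have r: "r (lab f) \<in> B \<and> lab (r (lab f)) = lab f" if "f \<in> B" for f
  unfolding r_def using someI[of "\<lambda>g. g \<in> B \<and> lab g = lab f" f] that by blast
 show ?thesis
  by (rule exI[of _ "r ` lab ` B"]) (use assms r in fastforce)
qed

lemma floor_eq_imp_close:
 fixes s t \<eta> :: real
 assumes "0 < \<eta>" "\<lfloor>s / \<eta>\<rfloor> = \<lfloor>t / \<eta>\<rfloor>"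
 shows "\<bar>s - t\<bar> \<le> \<eta>"
proof -
 have "\<bar>s / \<eta> - t / \<eta>\<bar> \<le> 1" using assms(2) by linarith
 then show ?thesis using assms(1) by (simp add: diff_divide_distrib[symmetric] abs_divide)
qed

lemma floor_bounded:
 fixes t M :: real
 assumes "\<bar>t\<bar> \<le> M"
 shows "\<lfloor>t\<rfloor> \<in> {- \<lceil>M\<rceil> - 1..\<lceil>M\<rceil> + 1}"
 using assms by (auto; linarith)

lemma Lp_ball_gradient:
 fixes u :: "'n::finite cfun"
 assumes p: "1 \<le> p" and u: "smooth u" and d: "\<And>i. Lp_ball p d (partial_deriv i u)"
 shows "Lp_ball p (real CARD('n) * d) (\<lambda>x. \<Sum>i\<in>UNIV. of_real (cmod (partial_deriv i u x)))"
proof -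
 have "Lp_ball p (1 * d) (\<lambda>x. complex_of_real (cmod (partial_deriv i u x)))" for i
 proof (rule Lp_ball_dominated[OF p _ Lp_ball_nonneg[OF d] d])
  have "partial_deriv i u \<in> borel_measurable lborel" using d[of i] by (simp add: Lp_ball_def in_Lp_def)
  then show "(\<lambda>x. complex_of_real (cmod (partial_deriv i u x))) \<in> borel_measurable lborel"
   by (rule borel_measurable_complex_of_real[OF measurable_compose[OF _ borel_measurable_norm]])
 qed auto
 then have "Lp_ball p (\<Sum>i\<in>(UNIV :: 'n set). d) (\<lambda>x. \<Sum>i\<in>UNIV. of_real (cmod (partial_deriv i u x)))"
  by (intro Lp_ball_sum[OF p]) simp
 then show ?thesis by simp
qed

lemma Lp_ball_mollify_diff_gradient:
 fixes u :: "'n::finite cfun"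
 assumes p: "1 \<le> p" and u: "smooth u" and h: "0 < h" and d: "\<And>i. Lp_ball p d (partial_deriv i u)"
 shows "Lp_ball p (h * (real CARD('n) * d)) (\<lambda>x. u x - average mollifier h u x)"
proof (rule Lp_ball_mollify_diff[OF p u h Lp_ball_gradient[OF p u d]])
 show "continuous_on UNIV (\<lambda>x. \<Sum>i\<in>UNIV. complex_of_real (cmod (partial_deriv i u x)))"
  by (intro continuous_intros smooth_continuous smooth_partial_deriv u)
 show "(\<Sum>i\<in>UNIV. cmod (partial_deriv i u x)) \<le> cmod (\<Sum>i\<in>UNIV. complex_of_real (cmod (partial_deriv i u x)))" for x
  unfolding of_real_sum[symmetric] norm_of_real by simp
qed

text \<open>An Arzela-Ascoli argument in three errors. Mollification at scale \<open>t\<close> costs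
  one derivative and little norm; outside a large ball the weight is small; inside it the mollified
  derivatives are Lipschitz, so finitely many rounded values determine them up to a small
  error.\<close>

theorem D_bounded_precompact:
 fixes B :: "'n::finite cfun set"
 assumes p: "1 \<le> p" and g: "g \<in> C_0" and B: "B \<subseteq> D_L p" and bd: "\<exists>c. \<forall>f\<in>B. D_norm p (Suc m) f \<le> c" and e: "0 < e"
 shows "\<exists>B0. finite B0 \<and> B0 \<subseteq> B \<and> (\<forall>f\<in>B. \<exists>f0\<in>B0. weighted_norm p g m (\<lambda>x. f x - f0 x) \<le> e)"
proof -
 obtain c0 where c0: "\<And>f. f \<in> B \<Longrightarrow> D_norm p (Suc m) f \<le> c0" using bd by blast
 define c where "c = max c0 1"
 have c: "0 < c" "\<And>f. f \<in> B \<Longrightarrow> D_norm p (Suc m) f \<le> c"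
  using c0 by (auto simp: c_def intro: max.coboundedI1)
 obtain b0 where b0: "\<And>x. cmod (g x) \<le> b0" using C_0_weight[OF g] by (auto simp: weight_def)
 define b where "b = max b0 1"
 have b: "0 < b" "\<And>x. cmod (g x) \<le> b" using b0 by (auto simp: b_def intro: max.coboundedI1)
 let ?P = "\<lambda>t. average (mollifier :: 'n cfun) t"
 let ?n = "real CARD('n)"
 have n: "0 < ?n" by simp
 \<comment> \<open>Two members of \<open>B\<close> differ by norm at most \<open>2 * c\<close>. With
   \<open>b\<close> bounding the weight, mollifying the difference costs
   \<open>b * (t * (n * (2 * c))) = e / 3\<close>; the constants \<open>e1\<close> and
   \<open>h\<close> below give the other two thirds.\<close>
 define t where "t = e / (3 * b * ?n * (2 * c))"
 have t: "0 < t" using e b c n by (simp add: t_def)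
 obtain W where W: "0 < W" "\<And>t u d. continuous_on UNIV u \<Longrightarrow> Lp_ball p d u \<Longrightarrow> Lp_ball p (W * d) (?P t u)"
  using Lp_ball_average_test[OF p test_mollifier] by blast
 define e1 where "e1 = e / (3 * W * (2 * c))"
 have e1: "0 < e1" using e W c by (simp add: e1_def)
 obtain R where R: "0 < R" "\<And>x. R \<le> norm x \<Longrightarrow> cmod (g x) \<le> e1"
  using C_0_small_outside[OF g e1] by blast
 obtain C where C: "0 \<le> C" "\<And>(u :: 'n cfun) A x y. continuous_on UNIV u \<Longrightarrow> Lp_ball p A u \<Longrightarrow> norm x \<le> R \<Longrightarrow> norm y \<le> R \<Longrightarrow>
   cmod (?P t u x) \<le> C * A \<and> cmod (?P t u x - ?P t u y) \<le> C * A * norm (x - y)"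
  using average_local_bounds[OF p test_mollifier t, of R] by blast
 obtain V where V: "0 \<le> V" "\<And>(f :: 'n cfun) c. f \<in> borel_measurable borel \<Longrightarrow> (\<forall>x. cmod (f x) \<le> c * indicator (cball 0 R) x) \<Longrightarrow>
    0 \<le> c \<Longrightarrow> Lp_ball p (V * c) f"
  using in_Lp_bounded_support[OF p, of R] by blast
 define h where "h = e / (3 * b * (V + 1))"
 have h: "0 < h" using e b V by (simp add: h_def)
 \<comment> \<open>The mesh of the net: the Lipschitz constant of the mollified difference is
   \<open>C * (2 * c)\<close>, so moving by less than \<open>s\<close> changes it by at most
   \<open>h / 2\<close>. The summand 1 keeps the denominator positive.\<close>
 define s where "s = h / (2 * (C * (2 * c) + 1))"
 have s: "0 < s" using h C c by (simp add: s_def add_nonneg_pos)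
 \<comment> \<open>Equal labels bound the real and the imaginary part by \<open>\<eta>\<close> each
   at the points of the net, hence the modulus by \<open>h / 2\<close>.\<close>
 define \<eta> where "\<eta> = h / 4"
 have \<eta>: "0 < \<eta>" using h by (simp add: \<eta>_def)
 obtain X where X: "finite X" "X \<subseteq> cball (0 :: real ^ 'n) R" "cball 0 R \<subseteq> (\<Union>x\<in>X. ball x s)"
 proof -
  have "\<exists>X. finite X \<and> X \<subseteq> cball (0 :: real ^ 'n) R \<and> cball 0 R \<subseteq> (\<Union>x\<in>X. ball x s)"
   using seq_compact_imp_totally_bounded[OF compact_imp_seq_compact[OF compact_cball[of "0 :: real ^ 'n" R]]] s by simp
  then show ?thesis using that by (elim exE conjE)
 qed
 define S where "S = {ks :: 'n list. length ks \<le> m}"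
 define lab where "lab f = (\<lambda>(ks, x) \<in> S \<times> X. (\<lfloor>Re (?P t (iter_deriv ks f) x) / \<eta>\<rfloor>, \<lfloor>Im (?P t (iter_deriv ks f) x) / \<eta>\<rfloor>))" for f
 have smB: "smooth f" if "f \<in> B" for f using that B D_L_smooth by blast
 have fin: "finite (lab ` B)"
 proof (rule finite_subset)
  let ?M = "C * c / \<eta>"
  let ?I = "{- \<lceil>?M\<rceil> - 1..\<lceil>?M\<rceil> + 1}"
  show "lab ` B \<subseteq> PiE (S \<times> X) (\<lambda>_. ?I \<times> ?I)"
  proof
   fix l assume "l \<in> lab ` B"
   then obtain f where f: "f \<in> B" "l = lab f" by blast
   have "(\<lfloor>Re (?P t (iter_deriv ks f) x) / \<eta>\<rfloor>, \<lfloor>Im (?P t (iter_deriv ks f) x) / \<eta>\<rfloor>) \<in> ?I \<times> ?I"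
    if "ks \<in> S" "x \<in> X" for ks x
   proof -
    have "Lp_ball p c (iter_deriv ks f)"
     using D_norm_ball[OF p subsetD[OF B f(1)], of ks "Suc m"] c(2)[OF f(1)] that(1) Lp_ball_mono by (auto simp: S_def)
    moreover have "norm x \<le> R" using that(2) X(2) by auto
    ultimately have "cmod (?P t (iter_deriv ks f) x) \<le> C * c"
     using C(2)[OF smooth_continuous[OF smooth_iter_deriv[OF smB[OF f(1)]]]] by blast
    then have "\<bar>Re (?P t (iter_deriv ks f) x) / \<eta>\<bar> \<le> ?M" "\<bar>Im (?P t (iter_deriv ks f) x) / \<eta>\<bar> \<le> ?M"
     using \<eta> abs_Re_le_cmod[of "?P t (iter_deriv ks f) x"] abs_Im_le_cmod[of "?P t (iter_deriv ks f) x"]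
     by (auto simp: abs_divide intro!: divide_right_mono)
    then show ?thesis using floor_bounded by blast
   qed
   then show "l \<in> PiE (S \<times> X) (\<lambda>_. ?I \<times> ?I)"
    unfolding f(2) lab_def by (intro PiE_I) auto
  qed
  have "finite S" unfolding S_def by (rule finite_lists_le)
  then show "finite (PiE (S \<times> X) (\<lambda>_. ?I \<times> ?I))"
   using X(1) by (intro finite_PiE) auto
 qed
 have close: "weighted_norm p g m (\<lambda>x. f1 x - f2 x) \<le> e" if f: "f1 \<in> B" "f2 \<in> B" and eq: "lab f1 = lab f2" for f1 f2
 proof (rule weighted_norm_leI)
  fix ks :: "'n list" assume ks: "length ks \<le> m"
  let ?D = "\<lambda>x. f1 x - f2 x"
  define w where "w = iter_deriv ks ?D"
  have sD: "smooth ?D" using f smB smooth_diff by blast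
  have sw: "smooth w" unfolding w_def using sD smooth_iter_deriv by blast
  have D: "?D \<in> D_L p" using function_space_closed(2)[OF function_space_D_L[OF p]] f B by blast
  have ND: "D_norm p (Suc m) ?D \<le> 2 * c"
   using seminorm_on_diff[OF function_space_D_L[OF p] seminorm_on_weighted_norm[OF p weight_const] subsetD[OF B f(1)] subsetD[OF B f(2)], of 1 "Suc m"]
    c(2)[OF f(1)] c(2)[OF f(2)] by simp
  have ball: "Lp_ball p (2 * c) (iter_deriv ls ?D)" if "length ls \<le> Suc m" for ls
   using Lp_ball_mono[OF D_norm_ball[OF p D that] ND] .
  have wb: "Lp_ball p (2 * c) w" unfolding w_def using ball ks by simp
  have wg: "Lp_ball p (2 * c) (partial_deriv i w)" for i
   using ball[of "ks @ [i]"] ks by (simp add: w_def iter_deriv_append iter_deriv_Cons)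
  have cw: "continuous_on UNIV w" using sw smooth_continuous by blast
  have gm[measurable]: "g \<in> borel_measurable borel" using C_0_weight[OF g] weight_continuous borel_measurable_continuous by blast
  have Pm[measurable]: "?P t w \<in> borel_measurable borel" by (rule average_measurable[OF cw test_mollifier])
  have wm[measurable]: "w \<in> borel_measurable borel" using cw borel_measurable_continuous by blast
  have [measurable]: "cball 0 R \<in> sets (borel :: (real ^ 'n) measure)" by auto
  have t1: "Lp_ball p (e / 3) (\<lambda>x. g x * (w x - ?P t w x))"
  proof -
   have "Lp_ball p (b * (t * (?n * (2 * c)))) (\<lambda>x. g x * (w x - ?P t w x))"
    by (rule Lp_ball_dominated[OF p _ _ Lp_ball_mollify_diff_gradient[OF p sw t wg]])
     (use b t c in \<open>auto simp: norm_mult intro!: mult_right_mono\<close>)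
   moreover have "b * (t * (?n * (2 * c))) = e / 3" using b c n by (simp add: t_def)
   ultimately show ?thesis by simp
  qed
  have t2: "Lp_ball p (e / 3) (\<lambda>x. (1 - indicator (cball 0 R) x) * (g x * ?P t w x))"
  proof -
   have "Lp_ball p (e1 * (W * (2 * c))) (\<lambda>x. (1 - indicator (cball 0 R) x) * (g x * ?P t w x))"
   proof (rule Lp_ball_dominated[OF p _ _ W(2)[OF cw wb]])
    show "(\<lambda>x. (1 - indicator (cball 0 R) x) * (g x * ?P t w x)) \<in> borel_measurable lborel" by measurable
    fix x
    show "cmod ((1 - indicator (cball 0 R) x) * (g x * ?P t w x)) \<le> e1 * cmod (?P t w x)"
     using R(2)[of x] e1 by (cases "x \<in> cball 0 R") (auto simp: norm_mult mult_right_mono)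
   qed (use e1 W c in auto)
   moreover have "e1 * (W * (2 * c)) = e / 3" using W c by (simp add: e1_def)
   ultimately show ?thesis by simp
  qed
  have Psmall: "cmod (?P t w x) \<le> h" if x: "norm x \<le> R" for x
  proof -
   have "x \<in> (\<Union>x\<in>X. ball x s)" using x by (intro subsetD[OF X(3)]) simp
   then obtain y where y: "y \<in> X" "dist y x < s" by auto
   have yR: "norm y \<le> R" using y X(2) by auto
   have wd: "w = (\<lambda>x. iter_deriv ks f1 x - iter_deriv ks f2 x)"
    unfolding w_def using f smB by (intro iter_deriv_diff) auto
   have "lab f1 (ks, y) = lab f2 (ks, y)" using eq by simp
   then have fl: "\<lfloor>Re (?P t (iter_deriv ks f1) y) / \<eta>\<rfloor> = \<lfloor>Re (?P t (iter_deriv ks f2) y) / \<eta>\<rfloor>"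
    "\<lfloor>Im (?P t (iter_deriv ks f1) y) / \<eta>\<rfloor> = \<lfloor>Im (?P t (iter_deriv ks f2) y) / \<eta>\<rfloor>"
    using y(1) ks by (auto simp: lab_def S_def)
   have Pd: "?P t w y = ?P t (iter_deriv ks f1) y - ?P t (iter_deriv ks f2) y"
    unfolding wd using f smB by (intro average_diff test_mollifier smooth_continuous smooth_iter_deriv) auto
   have "cmod (?P t w y) \<le> \<bar>Re (?P t w y)\<bar> + \<bar>Im (?P t w y)\<bar>" by (rule cmod_le)
   also have "... \<le> \<eta> + \<eta>"
    unfolding Pd using floor_eq_imp_close[OF \<eta> fl(1)] floor_eq_imp_close[OF \<eta> fl(2)] by simp
   finally have 1: "cmod (?P t w y) \<le> h / 2" by (simp add: \<eta>_def)
   have "cmod (?P t w x - ?P t w y) \<le> C * (2 * c) * norm (x - y)"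
    using C(2)[OF cw wb x yR] by blast
   also have "... \<le> (C * (2 * c) + 1) * s"
    using y(2) C(1) c(1) by (intro mult_mono) (auto simp: dist_norm norm_minus_commute)
   also have "... = h / 2"
   proof -
    define K where "K = C * (2 * c) + 1"
    have "0 < K" using C(1) c(1) by (simp add: K_def add_nonneg_pos)
    then show ?thesis unfolding s_def K_def[symmetric] by simp
   qed
   finally have 2: "cmod (?P t w x - ?P t w y) \<le> h / 2" .
   show ?thesis using 1 2 norm_triangle_sub[of "?P t w x" "?P t w y"] by linarith
  qed
  have t3: "Lp_ball p (e / 3) (\<lambda>x. indicator (cball 0 R) x * (g x * ?P t w x))"
  proof -
   have "Lp_ball p (V * (b * h)) (\<lambda>x. indicator (cball 0 R) x * (g x * ?P t w x))"
   proof (rule V(2))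
    show "(\<lambda>x. indicator (cball 0 R) x * (g x * ?P t w x)) \<in> borel_measurable borel" by measurable
    show "\<forall>x. cmod (indicator (cball 0 R) x * (g x * ?P t w x)) \<le> b * h * indicator (cball 0 R) x"
    proof
     fix x
     show "cmod (indicator (cball 0 R) x * (g x * ?P t w x)) \<le> b * h * indicator (cball 0 R) x"
      using b(2)[of x] b(1) Psmall[of x] by (cases "x \<in> cball 0 R") (auto simp: norm_mult intro!: mult_mono)
    qed
   qed (use b h in simp)
   moreover have "V * (b * h) \<le> (V + 1) * (b * h)" using b h by (intro mult_right_mono) auto
   moreover have "(V + 1) * (b * h) = e / 3"
   proof -
    define K where "K = V + 1"
    have "0 < K" using V by (simp add: K_def)
    then show ?thesis unfolding h_def K_def[symmetric] using b(1) by simp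
   qed
   ultimately show ?thesis using Lp_ball_mono by metis
  qed
  have "Lp_ball p (e / 3 + (e / 3 + e / 3)) (\<lambda>x. g x * (w x - ?P t w x) +
    ((1 - indicator (cball 0 R) x) * (g x * ?P t w x) + indicator (cball 0 R) x * (g x * ?P t w x)))"
   by (intro Lp_ball_add[OF p] t1 t2 t3)
  moreover have "(\<lambda>x. g x * (w x - ?P t w x) +
    ((1 - indicator (cball 0 R) x) * (g x * ?P t w x) + indicator (cball 0 R) x * (g x * ?P t w x))) = (\<lambda>x. g x * w x)"
   by (simp add: fun_eq_iff algebra_simps)
  ultimately show "Lp_ball p e (\<lambda>x. g x * iter_deriv ks ?D x)"
   by (simp add: w_def)
 qed
 show ?thesis by (rule finite_cover_of_labels[OF fin close])
qed

section \<open>Polars of the weighted seminorms\<close>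

definition polar :: "ennreal \<Rightarrow> 'n::finite cfun \<Rightarrow> nat \<Rightarrow> 'n functional set" where
 "polar p g m = {T \<in> dual p. \<forall>\<psi>\<in>core p. cmod (T \<psi>) \<le> weighted_norm p g m \<psi>}"

lemma weighted_norm_le_D_norm:
 assumes p: "1 \<le> p" and g: "weight g"
 shows "\<exists>b\<ge>0. \<forall>\<phi>\<in>D_L p. weighted_norm p g m \<phi> \<le> b * D_norm p m \<phi>"
proof -
 obtain b where "0 \<le> b" "\<And>x. cmod (g x) \<le> b" using g by (auto simp: weight_def)
 then show ?thesis
  using weighted_norm_mono_weight[OF p g weight_const, of _ b 1 m] by auto
qed

lemma polarI:
 assumes p: "1 \<le> p" and g: "weight g"
  and lin: "\<And>f h a b. f \<in> core p \<Longrightarrow> h \<in> core p \<Longrightarrow> T (\<lambda>x. a * f x + b * h x) = a * T f + b * T h"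
  and out: "\<And>f. f \<notin> core p \<Longrightarrow> T f = 0"
  and le: "\<And>f. f \<in> core p \<Longrightarrow> cmod (T f) \<le> weighted_norm p g m f"
 shows "T \<in> polar p g m"
proof -
 obtain b where b: "\<And>\<phi>. \<phi> \<in> D_L p \<Longrightarrow> weighted_norm p g m \<phi> \<le> b * D_norm p m \<phi>"
  using weighted_norm_le_D_norm[OF p g] by blast
 have "T \<in> dual p"
  by (rule dualI[OF p lin out order_trans[OF le b[OF core_subset_D_L]]])
 then show ?thesis using le by (simp add: polar_def)
qed

lemma absolutely_convex_polar:
 assumes p: "1 \<le> p" and g: "weight g"
 shows "absolutely_convex (polar p g m)"
 unfolding absolutely_convex_def
proof (intro conjI ballI allI impI)
 have "(\<lambda>f. 0) \<in> polar p g m"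
  by (rule polarI[OF p g]) (auto intro: weighted_norm_nonneg D_L_smooth core_subset_D_L)
 then show "polar p g m \<noteq> {}" by blast
 fix S T :: "(real ^ 'a \<Rightarrow> complex) \<Rightarrow> complex" and a b :: complex
 assume S: "S \<in> polar p g m" and T: "T \<in> polar p g m" and ab: "cmod a + cmod b \<le> 1"
 have ST: "S \<in> dual p" "T \<in> dual p" using S T by (auto simp: polar_def)
 have "(\<lambda>f. a * S f + b * T f) \<in> dual p"
  using function_space_lincomb[OF function_space_dual[OF p] ST] .
 moreover have "cmod (a * S f + b * T f) \<le> weighted_norm p g m f" if f: "f \<in> core p" for f
 proof -
  let ?w = "weighted_norm p g m f"
  have w: "0 \<le> ?w" using weighted_norm_nonneg D_L_smooth core_subset_D_L f by blast
  have "cmod (a * S f + b * T f) \<le> cmod a * cmod (S f) + cmod b * cmod (T f)"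
   using norm_triangle_ineq[of "a * S f" "b * T f"] by (simp add: norm_mult)
  also have "... \<le> cmod a * ?w + cmod b * ?w"
   using S T f by (intro add_mono mult_left_mono) (auto simp: polar_def)
  also have "... \<le> 1 * ?w"
   unfolding distrib_right[symmetric] using ab w by (rule mult_right_mono)
  finally show ?thesis by simp
 qed
 ultimately show "(\<lambda>f. a * S f + b * T f) \<in> polar p g m" by (simp add: polar_def)
qed

text \<open>Banach-Alaoglu: the polar is the intersection of a product of discs, compact by
  Tychonoff, with the closed set of linear maps. Radius 0 outside of \<open>core p\<close> encodes
  the extension of functionals by 0.\<close>

lemma compact_polar_pointwise:
 assumes p: "1 \<le> p" and g: "weight g"
 shows "compact (polar p g m :: 'n::finite functional set)"
proof -
 let ?r = "\<lambda>\<psi> :: 'n cfun. if \<psi> \<in> core p then weighted_norm p g m \<psi> else 0"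
 let ?box = "PiE UNIV (\<lambda>\<psi> :: 'n cfun. cball (0 :: complex) (?r \<psi>))"
 let ?lin = "\<Inter>f\<in>core p. \<Inter>h\<in>core p. \<Inter>a. \<Inter>b. {T :: 'n functional. T (\<lambda>x. a * f x + b * h x) = a * T f + b * T h}"
 have "compactin (product_topology (\<lambda>_. euclidean) UNIV) ?box"
  unfolding compactin_PiE by simp
 then have "compact ?box"
  by (simp add: euclidean_product_topology)
 moreover have "closed ?lin"
  by (intro closed_INT ballI closed_Collect_eq continuous_intros continuous_on_product_coordinates)
 ultimately have "compact (?box \<inter> ?lin)"
  by (rule compact_Int_closed)
 moreover have "polar p g m = ?box \<inter> ?lin"
 proof (intro equalityI subsetI)
  fix T :: "'n functional"
  assume "T \<in> polar p g m"
  then have T: "T \<in> dual p" "\<And>\<psi>. \<psi> \<in> core p \<Longrightarrow> cmod (T \<psi>) \<le> weighted_norm p g m \<psi>"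
   by (auto simp: polar_def)
  have "T \<psi> \<in> cball 0 (?r \<psi>)" for \<psi>
   using T(2)[of \<psi>] dual_outside[OF p T(1), of \<psi>] by auto
  moreover have "T \<in> ?lin"
   using dual_lincomb[OF p T(1)] by blast
  ultimately show "T \<in> ?box \<inter> ?lin" by auto
 next
  fix T :: "'n functional"
  assume T: "T \<in> ?box \<inter> ?lin"
  then have b: "T \<psi> \<in> cball 0 (?r \<psi>)" for \<psi> by (auto simp: PiE_def Pi_def)
  show "T \<in> polar p g m"
  proof (rule polarI[OF p g])
   show "T (\<lambda>x. a * f x + b * h x) = a * T f + b * T h" if "f \<in> core p" "h \<in> core p" for f h a b
    using T that by blast
   show "T f = 0" if "f \<notin> core p" for f using b[of f] that by simp
   show "cmod (T f) \<le> weighted_norm p g m f" if "f \<in> core p" for f using b[of f] that by simp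
  qed
 qed
 ultimately show ?thesis by simp
qed

text \<open>The polar is compact for pointwise convergence, so it suffices that the identity from
  this topology to the strong one is continuous on it. Its members are equicontinuous for the
  weighted norm, which reduces a supremum over a bounded set to a finite net.\<close>

theorem compactin_polar:
 assumes p: "1 \<le> p" and g: "g \<in> C_0"
 shows "compactin (dual_topology p) (polar p g m :: 'n::finite functional set)"
proof -
 let ?K = "polar p g m :: 'n functional set"
 have w: "weight g" using g by (rule C_0_weight)
 have top: "topspace (dual_topology p) = (dual p :: 'n functional set)"
  unfolding dual_topology_def by (rule topspace_seminorm_topology)
 have Kd: "?K \<subseteq> dual p" by (auto simp: polar_def)
 have "continuous_map (top_of_set ?K) (dual_topology p) id"
  unfolding continuous_map_def
 proof (intro conjI allI impI)
  show "id \<in> topspace (top_of_set ?K) \<rightarrow> topspace (dual_topology p)"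
   using Kd by (auto simp: top)
  fix U :: "'n functional set"
  assume U: "openin (dual_topology p) U"
  let ?V = "{T \<in> topspace (top_of_set ?K). id T \<in> U}"
  show "openin (top_of_set ?K) ?V"
  proof (subst openin_subopen, intro ballI)
   fix T0 assume "T0 \<in> ?V"
   then have T0: "T0 \<in> ?K" "T0 \<in> U" by auto
   have "\<forall>T\<in>U. seminorm_nbhd (dual p) (strong_seminorms (core p) (D_L_seminorms p)) T U"
    using U[unfolded dual_topology_def openin_seminorm_topology[OF function_space_dual[OF p] strong_seminorms_seminorm[OF p]]]
    by (rule conjunct2)
   then have nb: "seminorm_nbhd (dual p) (strong_seminorms (core p) (D_L_seminorms p)) T0 U"
    using T0(2) by (rule bspec)
   obtain P0 e where P0: "finite P0" "P0 \<subseteq> strong_seminorms (core p) (D_L_seminorms p)" "0 < e"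
    "{T \<in> dual p. \<forall>r\<in>P0. r (\<lambda>f. T f - T0 f) < e} \<subseteq> U"
    by (rule seminorm_nbhdE[OF nb])
   \<comment> \<open>\<open>B0\<close> is a finite set of functions at which closeness to
     \<open>T0\<close> implies closeness in the strong seminorm \<open>r\<close>. Replacing
     \<open>f\<close> by its neighbour in the net costs \<open>e / 8\<close> for \<open>T\<close>
     and for \<open>T0\<close>; with \<open>e / 8\<close> at the net point the sum stays below
     \<open>e / 2\<close>.\<close>
   define Q where "Q r B0 \<longleftrightarrow> (\<forall>T\<in>?K. (\<forall>f0\<in>B0. cmod (T f0 - T0 f0) < e / 8) \<longrightarrow> r (\<lambda>f. T f - T0 f) < e)" for r B0
   have "\<exists>B0. finite B0 \<and> Q r B0"
    if r: "r \<in> P0" for r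
   proof -
    have "r \<in> {sup_on B | B. D_bounded p (B :: 'n cfun set)}"
     using P0(2) r unfolding strong_seminorms_eq[symmetric] by (rule subsetD)
    then obtain B where B: "r = sup_on B" "D_bounded p B" by blast
    have "B \<subseteq> D_L p" "\<exists>c. \<forall>f\<in>B. D_norm p (Suc m) f \<le> c"
     using B(2) core_subset_D_L unfolding D_bounded_def by blast+
    from D_bounded_precompact[OF p g this, of "e / 8" ] P0(3) obtain B0 where B0: "finite B0" "B0 \<subseteq> B"
     "\<And>f. f \<in> B \<Longrightarrow> \<exists>f0\<in>B0. weighted_norm p g m (\<lambda>x. f x - f0 x) \<le> e / 8" by auto
    have "r (\<lambda>f. T f - T0 f) < e" if T: "T \<in> ?K" "\<forall>f0\<in>B0. cmod (T f0 - T0 f0) < e / 8" for T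
    proof -
     have "sup_on B (\<lambda>f. T f - T0 f) \<le> e / 2"
     proof (rule sup_on_least[OF p B(2)])
      fix f assume f: "f \<in> B"
      obtain f0 where f0: "f0 \<in> B0" "weighted_norm p g m (\<lambda>x. f x - f0 x) \<le> e / 8"
       using B0(3)[OF f] by blast
      have c: "f \<in> core p" "f0 \<in> core p"
       using f f0(1) B(2) B0(2) unfolding D_bounded_def by blast+
      have cd: "(\<lambda>x. f x - f0 x) \<in> core p"
       using function_space_closed(2)[OF function_space_core[OF p] c] .
      have "cmod (S f - S f0) \<le> e / 8" if S: "S \<in> ?K" for S
      proof -
       have "cmod (S (\<lambda>x. f x - f0 x)) \<le> weighted_norm p g m (\<lambda>x. f x - f0 x)"
        using S cd by (simp add: polar_def)
       moreover have "S (\<lambda>x. f x - f0 x) = S f - S f0"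
        using dual_diff[OF p _ c] S Kd by blast
       ultimately show ?thesis using f0(2) by simp
      qed
      from this[OF T(1)] this[OF T0(1)]
      have "cmod (T f - T f0) \<le> e / 8" "cmod (T0 f - T0 f0) \<le> e / 8" .
      moreover have "cmod (T f0 - T0 f0) < e / 8" using T(2) f0(1) by blast
      moreover have "cmod (T f - T0 f) = cmod ((T f - T f0) + (T f0 - T0 f0) - (T0 f - T0 f0))" by simp
      then have "cmod (T f - T0 f) \<le> cmod (T f - T f0) + cmod (T f0 - T0 f0) + cmod (T0 f - T0 f0)"
       using norm_triangle_ineq4[of "(T f - T f0) + (T f0 - T0 f0)" "T0 f - T0 f0"]
        norm_triangle_ineq[of "T f - T f0" "T f0 - T0 f0"] by linarith
      ultimately show "cmod (T f - T0 f) \<le> e / 2" using P0(3) by linarith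
     qed
     then show ?thesis using P0(3) unfolding B(1) by linarith
    qed
    then have "Q r B0" by (simp add: Q_def)
    then show ?thesis using B0(1) by blast
   qed
   then have "\<forall>r\<in>P0. \<exists>B0. finite B0 \<and> Q r B0" by blast
   from bchoice[OF this] obtain B0 where B0: "\<forall>r\<in>P0. finite (B0 r) \<and> Q r (B0 r)" by blast
   define \<Psi> where "\<Psi> = (\<Union>r\<in>P0. B0 r)"
   have fin: "finite \<Psi>" unfolding \<Psi>_def using P0(1) B0 by blast
   define N where "N = (\<Inter>\<psi>\<in>\<Psi>. {T :: 'n functional. cmod (T \<psi> - T0 \<psi>) < e / 8})"
   have "open N"
    unfolding N_def
    by (intro open_INT fin ballI open_Collect_less continuous_intros continuous_on_product_coordinates)
   then have "openin (top_of_set ?K) (?K \<inter> N)" by (rule openin_open_Int)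
   moreover have "T0 \<in> ?K \<inter> N" using T0(1) P0(3) by (auto simp: N_def)
   moreover have "?K \<inter> N \<subseteq> ?V"
   proof
    fix T assume T: "T \<in> ?K \<inter> N"
    have "r (\<lambda>f. T f - T0 f) < e" if r: "r \<in> P0" for r
    proof -
     have "Q r (B0 r)" using B0 r by blast
     moreover have "\<forall>f0\<in>B0 r. cmod (T f0 - T0 f0) < e / 8"
      using T r by (auto simp: N_def \<Psi>_def)
     ultimately show ?thesis using T unfolding Q_def by blast
    qed
    then have "T \<in> {T \<in> dual p. \<forall>r\<in>P0. r (\<lambda>f. T f - T0 f) < e}" using T Kd by auto
    then show "T \<in> ?V" using T subsetD[OF P0(4)] by simp
   qed
   ultimately show "\<exists>W. openin (top_of_set ?K) W \<and> T0 \<in> W \<and> W \<subseteq> ?V" by blast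
  qed
 qed
 moreover have "compactin (top_of_set ?K) ?K"
  using compact_polar_pointwise[OF p w] by (simp add: compactin_subtopology)
 ultimately have "compactin (dual_topology p) (id ` ?K)" by (rule image_compactin[rotated])
 then show ?thesis by simp
qed

text \<open>Evaluations attain the seminorm if the exponent is infinite, otherwise the extremal
 functionals come from the equality case of Hoelder's inequality.\<close>

lemma evaluation_in_polar:
 fixes g :: "'n::finite cfun"
 assumes g: "g \<in> C_0" and ks: "length ks \<le> m"
 shows "(\<lambda>\<psi>. if \<psi> \<in> core \<infinity> then g x * iter_deriv ks \<psi> x else 0) \<in> polar \<infinity> g m"
proof (rule polarI[OF _ C_0_weight[OF g]])
 fix f h :: "'n cfun" and a b
 assume f: "f \<in> core \<infinity>"
 then have sf: "smooth f" and fD: "f \<in> D_L \<infinity>" using D_L_smooth core_subset_D_L by blast+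
 have "cmod (g x * iter_deriv ks f x) \<le> Lp_norm \<infinity> (\<lambda>x. g x * iter_deriv ks f x)"
  by (intro cmod_le_Lp_norm_infinity weight_in_Lp C_0_weight[OF g] D_L_in_Lp[OF fD]
    continuous_intros smooth_continuous smooth_iter_deriv sf weight_continuous) simp
 also have "... \<le> weighted_norm \<infinity> g m f"
  by (rule Lp_norm_le_weighted_norm[OF sf ks])
 finally show "cmod (if f \<in> core \<infinity> then g x * iter_deriv ks f x else 0) \<le> weighted_norm \<infinity> g m f"
  using f by simp
 assume h: "h \<in> core \<infinity>"
 then have sh: "smooth h" using D_L_smooth core_subset_D_L by blast
 have "(\<lambda>x. a * f x + b * h x) \<in> core \<infinity>" using function_space_lincomb[OF function_space_core f h] by simp
 then show "(if (\<lambda>x. a * f x + b * h x) \<in> core \<infinity> then g x * iter_deriv ks (\<lambda>x. a * f x + b * h x) x else 0) =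
   a * (if f \<in> core \<infinity> then g x * iter_deriv ks f x else 0) + b * (if h \<in> core \<infinity> then g x * iter_deriv ks h x else 0)"
  using f h by (simp add: iter_deriv_add iter_deriv_cmult smooth_cmult sf sh algebra_simps)
qed auto

lemma polar_norming:
 fixes g :: "'n::finite cfun"
 assumes p: "1 \<le> p" "p \<noteq> \<infinity>" and g: "g \<in> C_0" and ks: "length ks \<le> m" and \<phi>: "\<phi> \<in> D_L p"
 shows "\<exists>T\<in>polar p g m. T \<phi> = of_real (Lp_norm p (\<lambda>x. g x * iter_deriv ks \<phi> x))"
proof -
 have w: "weight g" using g by (rule C_0_weight)
 have core: "core p = (D_L p :: 'n cfun set)" using p(2) by (simp add: core_def)
 obtain c where c: "c \<in> borel_measurable lborel"
  "\<And>u A. Lp_ball p A u \<Longrightarrow> integrable lborel (\<lambda>x. c x * u x) \<and> cmod (LBINT x. c x * u x) \<le> A"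
  "(LBINT x. c x * (g x * iter_deriv ks \<phi> x)) = of_real (Lp_norm p (\<lambda>x. g x * iter_deriv ks \<phi> x))"
  using Lp_norming_function[OF p weight_in_Lp[OF p(1) w D_L_in_Lp[OF \<phi>, of ks]]] by blast
 let ?T = "\<lambda>\<psi>. if \<psi> \<in> core p then LBINT x. c x * (g x * iter_deriv ks \<psi> x) else 0"
 have "?T \<in> polar p g m"
 proof (rule polarI[OF p(1) w])
  fix f h :: "'n cfun" and a b
  assume f: "f \<in> core p"
  then have sf: "smooth f" and fD: "f \<in> D_L p" using D_L_smooth core_subset_D_L by blast+
  note cf = c(2)[OF weighted_Lp_ball[OF p(1) w fD ks]]
  show "cmod (?T f) \<le> weighted_norm p g m f" using cf f by simp
  assume h: "h \<in> core p"
  then have sh: "smooth h" and hD: "h \<in> D_L p" using D_L_smooth core_subset_D_L by blast+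
  note ch = c(2)[OF weighted_Lp_ball[OF p(1) w hD ks]]
  have fh: "(\<lambda>x. a * f x + b * h x) \<in> core p" using function_space_lincomb[OF function_space_core[OF p(1)] f h] .
  have "(\<lambda>x. c x * (g x * iter_deriv ks (\<lambda>x. a * f x + b * h x) x)) =
    (\<lambda>x. a * (c x * (g x * iter_deriv ks f x)) + b * (c x * (g x * iter_deriv ks h x)))"
   by (simp add: iter_deriv_add iter_deriv_cmult smooth_cmult sf sh algebra_simps)
  then show "?T (\<lambda>x. a * f x + b * h x) = a * ?T f + b * ?T h"
   using f h fh cf ch by simp
 qed auto
 note A = this
 have "?T \<phi> = of_real (Lp_norm p (\<lambda>x. g x * iter_deriv ks \<phi> x))"
  using \<phi> c(3) by (simp add: core)
 then show ?thesis using A by (rule bexI[where x = ?T])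
qed

section \<open>Moderate weights\<close>

definition moderate :: "'n::finite cfun \<Rightarrow> bool" where
 "moderate G \<longleftrightarrow> G \<in> C_0 \<and> (\<forall>x h. cmod (G x) \<le> (1 + norm h) * cmod (G (x + h)))"

lemma moderate_majorant:
 fixes g0 :: "real ^ 'n \<Rightarrow> real"
 assumes g0: "\<And>x. 0 \<le> g0 x" and bd: "\<And>x. g0 x \<le> M"
  and lim: "\<And>e. 0 < e \<Longrightarrow> \<exists>R. \<forall>x. R \<le> norm x \<longrightarrow> g0 x \<le> e"
 shows "\<exists>G. moderate G \<and> (\<forall>x. g0 x \<le> cmod (G x))"
proof -
 define G where "G x = (SUP y. g0 y / (1 + norm (x - y)))" for x
 have M0: "0 \<le> M" using order_trans[OF g0 bd] by blast
 have tM: "g0 y / (1 + norm (x - y)) \<le> M" for x y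
 proof -
  have "g0 y / (1 + norm (x - y)) \<le> g0 y / 1"
   using g0 by (intro divide_left_mono) (auto simp: add_pos_nonneg)
  then show ?thesis using bd[of y] by simp
 qed
 have bdd: "bdd_above (range (\<lambda>y. g0 y / (1 + norm (x - y))))" for x
  using tM by (auto intro!: bdd_aboveI)
 have up: "g0 y / (1 + norm (x - y)) \<le> G x" for x y
  unfolding G_def by (rule cSUP_upper[OF _ bdd]) simp
 have least: "G x \<le> c" if "\<And>y. g0 y / (1 + norm (x - y)) \<le> c" for x c
  unfolding G_def using that by (intro cSUP_least) auto
 have g0G: "g0 x \<le> G x" for x using up[of x x] by simp
 have G0: "0 \<le> G x" for x using order_trans[OF g0 g0G] .
 have GM: "G x \<le> M" for x using least tM by blast
 have mod: "G x \<le> (1 + norm h) * G (x + h)" for x h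
 proof (rule least)
  fix y
  have pos: "0 < 1 + norm (x - y)" "0 < 1 + norm (x + h - y)" by (auto simp: add_pos_nonneg)
  have "norm (x + h - y) \<le> norm h + norm (x - y)"
   using norm_triangle_ineq[of h "x - y"] by (simp add: algebra_simps)
  moreover have "0 \<le> norm h * norm (x - y)" by simp
  moreover have "(1 + norm h) * (1 + norm (x - y)) = 1 + norm h + norm (x - y) + norm h * norm (x - y)"
   by (simp add: algebra_simps)
  ultimately have "1 + norm (x + h - y) \<le> (1 + norm h) * (1 + norm (x - y))"
   by linarith
  then have "inverse (1 + norm (x - y)) \<le> (1 + norm h) * inverse (1 + norm (x + h - y))"
   using pos by (simp add: field_simps)
  then have "g0 y * inverse (1 + norm (x - y)) \<le> g0 y * ((1 + norm h) * inverse (1 + norm (x + h - y)))"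
   using g0 by (rule mult_left_mono)
  also have "... = (1 + norm h) * (g0 y / (1 + norm (x + h - y)))"
   by (simp add: divide_inverse mult_ac)
  also have "... \<le> (1 + norm h) * G (x + h)"
   using up by (intro mult_left_mono) auto
  finally show "g0 y / (1 + norm (x - y)) \<le> (1 + norm h) * G (x + h)" by (simp add: divide_inverse)
 qed
 have lip: "G x - G z \<le> M * dist x z" for x z
 proof -
  have "G x \<le> (1 + norm (z - x)) * G z" using mod[of x "z - x"] by simp
  also have "... = G z + norm (z - x) * G z" by (simp add: algebra_simps)
  also have "... \<le> G z + norm (z - x) * M" using GM by (simp add: mult_left_mono)
  finally show ?thesis by (simp add: dist_norm norm_minus_commute mult.commute)
 qed
 have "M-lipschitz_on UNIV G"
 proof (rule lipschitz_onI[OF _ M0])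
  fix x z show "dist (G x) (G z) \<le> M * dist x z"
   using lip[of x z] lip[of z x] by (auto simp: dist_real_def dist_commute abs_le_iff)
 qed
 then have cont: "continuous_on UNIV G" by (rule lipschitz_on_continuous_on)
 have "(G \<longlongrightarrow> 0) at_infinity"
 proof (rule tendstoI)
  fix e' :: real assume e': "0 < e'"
  define e where "e = e' / 2"
  have e: "0 < e" "e < e'" using e' by (auto simp: e_def)
  obtain R where R: "\<And>x. R \<le> norm x \<Longrightarrow> g0 x \<le> e" using lim[OF e(1)] by blast
  \<comment> \<open>Either \<open>y\<close> lies beyond \<open>R\<close>, where \<open>g0\<close> is
    small, or \<open>x\<close> and \<open>y\<close> are at least \<open>M / e\<close> apart and the
    denominator makes the quotient small.\<close>
  have "G x \<le> e" if x: "R + M / e \<le> norm x" for x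
  proof (rule least)
   fix y
   have pos: "0 < 1 + norm (x - y)" by (auto simp: add_pos_nonneg)
   show "g0 y / (1 + norm (x - y)) \<le> e"
   proof (cases "R \<le> norm y")
    case True
    have "g0 y / (1 + norm (x - y)) \<le> g0 y / 1"
     using g0 by (intro divide_left_mono) (auto simp: add_pos_nonneg)
    then show ?thesis using R[OF True] by simp
   next
    case False
    then have "M / e \<le> norm (x - y)" using x norm_triangle_ineq2[of x y] by linarith
    then have "M \<le> e * norm (x - y)" using e by (simp add: field_simps)
    then have "g0 y \<le> e * (1 + norm (x - y))" using bd[of y] e by (simp add: distrib_left)
    then show ?thesis using pos by (simp add: divide_le_eq)
   qed
  qed
  then show "\<forall>\<^sub>F x in at_infinity. dist (G x) 0 < e'"
   unfolding eventually_at_infinity using e G0 by (intro exI[of _ "R + M / e"]) (auto simp: abs_of_nonneg intro: le_less_trans)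
 qed
 then have "(\<lambda>x. complex_of_real (G x)) \<in> C_0"
  unfolding C_0_def using cont tendsto_of_real[of G 0 at_infinity, where 'a = complex] by (auto intro!: continuous_intros)
 then have "moderate (\<lambda>x. complex_of_real (G x))"
  unfolding moderate_def using mod G0 by (simp add: abs_of_nonneg)
 then show ?thesis
  using g0G G0 by (intro exI[of _ "\<lambda>x. complex_of_real (G x)"]) (simp add: abs_of_nonneg)
qed

lemma moderate_dominates_C_0:
 assumes "g \<in> C_0"
 shows "\<exists>G. moderate G \<and> (\<forall>x. cmod (g x) \<le> cmod (G x))"
proof -
 obtain b where b: "\<And>x. cmod (g x) \<le> b" using C_0_weight[OF assms] by (auto simp: weight_def)
 have "\<exists>R. \<forall>x. R \<le> norm x \<longrightarrow> cmod (g x) \<le> e" if "0 < e" for e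
  using C_0_small_outside[OF assms that] by blast
 from moderate_majorant[of "\<lambda>x. cmod (g x)" b, OF _ b this] show ?thesis by simp
qed

lemma moderate_C_0: "moderate G \<Longrightarrow> G \<in> C_0"
 by (simp add: moderate_def)

text \<open>The step function taking the value \<open>(1 / 2) ^ j\<close> for the first
  \<open>j\<close> with \<open>norm x \<le> s j\<close> has the required lower bound but jumps; its
  moderate majorant is continuous. The hypothesis on \<open>s\<close> ensures that such
  \<open>j\<close> exists for every \<open>x\<close>.\<close>

lemma weight_decaying_slowly:
 fixes s :: "nat \<Rightarrow> real"
 assumes s: "\<And>j. real j \<le> s j"
 shows "\<exists>G :: 'n::finite cfun. G \<in> C_0 \<and> (\<forall>j x. norm x \<le> s j \<longrightarrow> (1 / 2) ^ j \<le> cmod (G x))"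
proof -
 define l where "l x = (LEAST j. norm x \<le> s j)" for x :: "real ^ 'n"
 have ex: "\<exists>j. norm x \<le> s j" for x :: "real ^ 'n"
  using s real_arch_simple[of "norm x"] order_trans by blast
 have l1: "norm x \<le> s (l x)" for x unfolding l_def using ex by (rule LeastI_ex)
 have l2: "l x \<le> j" if "norm x \<le> s j" for x j unfolding l_def using that by (rule Least_le)
 have "\<exists>G. moderate G \<and> (\<forall>x :: real ^ 'n. (1 / 2) ^ l x \<le> cmod (G x))"
 proof (rule moderate_majorant)
  show "(1 / 2 :: real) ^ l x \<le> 1" for x by (simp add: power_le_one)
  fix e :: real assume "0 < e"
  then obtain J where J: "(1 / 2) ^ J < e" using real_arch_pow_inv[of e "1 / 2"] by auto
  have "(1 / 2) ^ l x \<le> e" if x: "Max (s ` {..J}) + 1 \<le> norm x" for x :: "real ^ 'n"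
  proof -
   have "J < l x"
   proof (rule ccontr)
    assume "\<not> J < l x"
    then have "s (l x) \<le> Max (s ` {..J})" by (intro Max_ge) auto
    then show False using l1[of x] x by linarith
   qed
   then have "(1 / 2 :: real) ^ l x \<le> (1 / 2) ^ J" by (intro power_decreasing) auto
   then show ?thesis using J by linarith
  qed
  then show "\<exists>R. \<forall>x :: real ^ 'n. R \<le> norm x \<longrightarrow> (1 / 2) ^ l x \<le> e" by blast
 qed simp
 then obtain G where G: "moderate G" "\<And>x :: real ^ 'n. (1 / 2) ^ l x \<le> cmod (G x)" by blast
 have "(1 / 2) ^ j \<le> cmod (G x)" if "norm x \<le> s j" for j x
  using order_trans[OF power_decreasing[OF l2[OF that], of "1 / 2"] G(2)] by simp
 then show ?thesis using G(1) moderate_C_0 by blast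
qed

section \<open>Compact subsets of the dual space\<close>

text \<open>What matters is that \<open>K\<close> does not depend on \<open>R\<close>, so that humps
  located arbitrarily far out keep comparable norms.\<close>

lemma D_norm_tail_cutoff_le:
 assumes p: "1 \<le> p"
 shows "\<exists>K\<ge>1. \<forall>R\<ge>1. \<forall>\<psi> :: 'n::finite cfun. \<psi> \<in> D_L p \<longrightarrow>
  D_norm p m (\<lambda>x. tail_cutoff R x * \<psi> x) \<le> K * D_norm p m \<psi>"
proof -
 obtain c where c: "1 \<le> c" "\<And>R ks x. 1 \<le> R \<Longrightarrow> length ks \<le> m \<Longrightarrow>
   cmod (iter_deriv ks (tail_cutoff R) (x :: real ^ 'n)) \<le> c * indicator {x. R \<le> norm x} x"
  using tail_cutoff_deriv_bound[of m] by blast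
 let ?K = "leibniz_const TYPE('n) m * c"
 have "D_norm p m (\<lambda>x. tail_cutoff R x * \<psi> x) \<le> (?K + 1) * D_norm p m \<psi>"
  if R: "1 \<le> R" and \<psi>: "\<psi> \<in> D_L p" for R and \<psi> :: "'n cfun"
 proof -
  have "D_norm p m (\<lambda>x. tail_cutoff R x * \<psi> x) \<le> ?K * D_norm p m \<psi>"
   by (rule weighted_norm_Leibniz[OF p smooth_tail_cutoff \<psi> _ c(2)[OF R] _ _ weight_const weight_const])
    (use c(1) in \<open>auto simp: indicator_def\<close>)
  then show ?thesis using weighted_norm_nonneg[OF D_L_smooth[OF \<psi>], of p "\<lambda>_. 1" m] by (simp add: distrib_right)
 qed
 moreover have "1 \<le> ?K + 1" using c(1) leibniz_const_nonneg[where 'n = 'n, of m] by simp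
 ultimately show ?thesis by blast
qed

lemma conj_rate_less_1: "1 < p \<Longrightarrow> conj_rate p < 1"
proof (cases "p = \<infinity>")
 case False
 assume "1 < p"
 then have "1 < enn2real p" using False by (cases p) (auto simp: ennreal_less_iff ennreal_1[symmetric] simp del: ennreal_1)
 then show ?thesis using False by (simp add: conj_rate_def)
qed (simp add: conj_rate_def)

text \<open>Gliding hump: functions with disjoint supports on which the functional is not small add up
 to functions of norm growing slower than linearly.\<close>

theorem dual_tail_small:
 fixes T :: "'n::finite functional"
 assumes p: "1 < p" and T: "T \<in> dual p" and C: "0 \<le> C" "\<And>f. f \<in> core p \<Longrightarrow> cmod (T f) \<le> C * D_norm p m f"
  and e: "0 < e"
 shows "\<exists>R0\<ge>1. \<forall>R\<ge>R0. \<forall>\<psi>\<in>test_functions. cmod (T (\<lambda>x. tail_cutoff R x * \<psi> x)) \<le> e * D_norm p m \<psi>"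
proof (rule ccontr)
 assume neg: "\<not> ?thesis"
 have p': "1 \<le> p" using p by simp
 obtain K where K: "1 \<le> K" "\<And>R (\<psi> :: 'n cfun). 1 \<le> R \<Longrightarrow> \<psi> \<in> D_L p \<Longrightarrow>
   D_norm p m (\<lambda>x. tail_cutoff R x * \<psi> x) \<le> K * D_norm p m \<psi>"
  using D_norm_tail_cutoff_le[OF p', of m] by blast
 let ?\<iota> = "conj_rate p"
 \<comment> \<open>The negated claim beyond \<open>R0\<close> gives a function on which
   \<open>T\<close> exceeds \<open>e\<close> times the norm. After scaling and a change of phase
   \<open>T\<close> is real and at least \<open>e\<close> on it, while the norm is at most
   \<open>K\<close>.\<close>
 have hump: "\<exists>v\<in>test_functions. (\<exists>t\<ge>e. T v = of_real t) \<and> D_norm p m v \<le> K \<and> (\<forall>x. norm x < R0 \<longrightarrow> v x = 0)"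
  if R0: "1 \<le> R0" for R0
 proof -
  obtain R \<psi> where R: "R0 \<le> R" and \<psi>: "\<psi> \<in> test_functions" and gt: "e * D_norm p m \<psi> < cmod (T (\<lambda>x. tail_cutoff R x * \<psi> x))"
   using neg R0 by (meson not_le)
  have R1: "1 \<le> R" using R R0 by linarith
  have \<psi>D: "\<psi> \<in> D_L p" using test_D_L[OF p' \<psi>] .
  let ?N = "D_norm p m \<psi>" and ?v = "\<lambda>x. tail_cutoff R x * \<psi> x"
  have N0: "0 \<le> ?N" using weighted_norm_nonneg[OF test_smooth[OF \<psi>]] .
  have v: "?v \<in> test_functions" using tail_cutoff_test[OF _ \<psi>, of R] R1 by simp
  have vc: "?v \<in> core p" using test_core[OF p' v] .
  have vD: "?v \<in> D_L p" using test_D_L[OF p' v] .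
  have Tv: "0 < cmod (T ?v)" using gt N0 e by (smt (verit) mult_nonneg_nonneg)
  \<comment> \<open>If the norm of \<open>\<psi>\<close> vanishes, any scaling preserves this, and
    the factor is chosen to make the value of \<open>T\<close> exactly \<open>e\<close>.\<close>
  define s where "s = (if ?N = 0 then e / cmod (T ?v) else 1 / ?N)"
  have s: "0 \<le> s" "e \<le> s * cmod (T ?v)" "s * ?N \<le> 1"
   using N0 e Tv gt by (auto simp: s_def field_simps)
  define c where "c = of_real s * (cnj (T ?v) / of_real (cmod (T ?v)))"
  have cc: "cmod c = s" using s(1) Tv by (simp add: c_def norm_mult norm_divide)
  have cT: "c * T ?v = of_real (s * cmod (T ?v))"
  proof -
   have "cnj (T ?v) * T ?v = of_real ((cmod (T ?v))\<^sup>2)"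
    using complex_norm_square[of "T ?v"] by (simp add: mult.commute)
   moreover have "c * T ?v = of_real s * ((cnj (T ?v) * T ?v) / of_real (cmod (T ?v)))"
    by (simp add: c_def)
   ultimately show ?thesis using Tv by (simp add: power2_eq_square)
  qed
  have "(\<lambda>x. c * ?v x) \<in> test_functions" using test_mult_left(1)[OF v smooth_const[of c]] .
  moreover have "T (\<lambda>x. c * ?v x) = of_real (s * cmod (T ?v))"
   using dual_cmult[OF p' T vc, of c] cT by simp
  moreover have "D_norm p m (\<lambda>x. c * ?v x) \<le> K"
  proof -
   have "D_norm p m (\<lambda>x. c * ?v x) = s * D_norm p m ?v"
    using seminorm_on_cmult[OF seminorm_on_weighted_norm[OF p' weight_const] vD] cc by blast
   also have "... \<le> s * (K * ?N)" using K(2)[OF R1 \<psi>D] s(1) by (rule mult_left_mono)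
   also have "... = K * (s * ?N)" by simp
   also have "... \<le> K * 1" using s(3) K(1) by (intro mult_left_mono) auto
   finally show ?thesis by simp
  qed
  moreover have "c * ?v x = 0" if "norm x < R0" for x
   using cutoff_eq_1[of R x] that R R0 by (simp add: tail_cutoff_def)
  ultimately show ?thesis using s(2) by blast
 qed
 \<comment> \<open>Stage \<open>J\<close> is a sum of \<open>Suc J\<close> humps: the values of
   \<open>T\<close> add up linearly, the norm of each derivative grows like the power
   \<open>1 / p\<close>.\<close>
 have main: "\<exists>u\<in>test_functions. (\<exists>t\<ge>real (Suc J) * e. T u = of_real t) \<and>
   (\<forall>ks. length ks \<le> m \<longrightarrow> Lp_ball p (K * real (Suc J) powr ?\<iota>) (iter_deriv ks u))" for J
 proof (induction J)
  case 0
  obtain v t where v: "v \<in> test_functions" "e \<le> t" "T v = of_real t" "D_norm p m v \<le> K"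
   using hump[of 1] by auto
  then show ?case
   using Lp_ball_mono[OF D_norm_ball[OF p' test_D_L[OF p' v(1)]] v(4)] by (intro bexI[of _ v]) auto
 next
  case (Suc J)
  then obtain u t where u: "u \<in> test_functions" "real (Suc J) * e \<le> t" "T u = of_real t"
   "\<And>ks. length ks \<le> m \<Longrightarrow> Lp_ball p (K * real (Suc J) powr ?\<iota>) (iter_deriv ks u)" by blast
  obtain S where S: "0 < S" "\<forall>x. S < norm x \<longrightarrow> u x = 0" using test_functions_support[OF u(1)] by blast
  \<comment> \<open>The radius \<open>S + 1\<close> instead of \<open>S\<close> makes
    \<open>v\<close> vanish on an open set containing the support of \<open>u\<close>, so that all
    derivatives have disjoint supports as well.\<close>
  obtain v t' where v: "v \<in> test_functions" "e \<le> t'" "T v = of_real t'" "D_norm p m v \<le> K" "\<And>x. norm x < S + 1 \<Longrightarrow> v x = 0"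
   using hump[of "S + 1"] S(1) by auto
  have "T (\<lambda>x. u x + v x) = of_real (t + t')"
   using dual_add[OF p' T test_core[OF p' u(1)] test_core[OF p' v(1)]] u(3) v(3) by simp
  moreover have "real (Suc (Suc J)) * e \<le> t + t'" using u(2) v(2) by (simp add: algebra_simps)
  moreover have "(\<lambda>x. u x + v x) \<in> test_functions" using test_lincomb[OF u(1) v(1), of 1 1] by simp
  moreover have "Lp_ball p (K * real (Suc (Suc J)) powr ?\<iota>) (iter_deriv ks (\<lambda>x. u x + v x))" if ks: "length ks \<le> m" for ks
  proof -
   have "iter_deriv ks u x = 0 \<or> iter_deriv ks v x = 0" for x
   proof (cases "S < norm x")
    case True
    then show ?thesis using iter_deriv_support[of S u x ks] S(2) by blast
   next
    case False
    have "open {x :: real ^ 'n. norm x < S + 1}" by (intro open_Collect_less continuous_intros)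
    from iter_deriv_local[OF this, of v "\<lambda>_. 0" x ks] v(5) False show ?thesis
     by (simp add: iter_deriv_zero)
   qed
   then have "Lp_ball p (K * (real (Suc J) + 1) powr ?\<iota>) (\<lambda>x. iter_deriv ks u x + iter_deriv ks v x)"
    using K(1) Lp_ball_mono[OF D_norm_ball[OF p' test_D_L[OF p' v(1)] ks] v(4)]
    by (intro Lp_ball_disjoint_add[OF p' _ _ u(4)[OF ks]]) auto
   then show ?thesis
    by (simp add: iter_deriv_add test_smooth[OF u(1)] test_smooth[OF v(1)] add.commute)
  qed
  ultimately show ?case by blast
 qed
 have est: "real (Suc J) * e \<le> C * K * real (Suc J) powr ?\<iota>" for J
 proof -
  obtain u t where u: "u \<in> test_functions" "real (Suc J) * e \<le> t" "T u = of_real t"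
   "\<And>ks. length ks \<le> m \<Longrightarrow> Lp_ball p (K * real (Suc J) powr ?\<iota>) (iter_deriv ks u)"
   using main[of J] by blast
  have "D_norm p m u \<le> K * real (Suc J) powr ?\<iota>"
   using u(4) by (intro weighted_norm_leI) simp
  then have "C * D_norm p m u \<le> C * (K * real (Suc J) powr ?\<iota>)" using C(1) by (rule mult_left_mono)
  moreover have "t \<le> cmod (T u)" using u(3) by simp
  ultimately show ?thesis using C(2)[OF test_core[OF p' u(1)]] u(2) by (simp add: mult.assoc)
 qed
 \<comment> \<open>This is where \<open>p > 1\<close> enters: the estimate \<open>est\<close> bounds
   \<open>real (Suc J) powr (1 - 1 / p)\<close> independently of \<open>J\<close>, which is
   impossible for a positive exponent.\<close>
 have \<iota>: "0 < 1 - ?\<iota>" using conj_rate_less_1[OF p] by simp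
 define x where "x = C * K / e + 1"
 have x: "0 < x" using C(1) K(1) e by (simp add: x_def add_nonneg_pos)
 obtain J :: nat where J: "x powr (1 / (1 - ?\<iota>)) \<le> real J" using real_arch_simple by blast
 have "x = (x powr (1 / (1 - ?\<iota>))) powr (1 - ?\<iota>)" using x \<iota> by (simp add: powr_powr)
 also have "... \<le> real (Suc J) powr (1 - ?\<iota>)" using J \<iota> by (intro powr_mono2) auto
 also have "... = real (Suc J) / real (Suc J) powr ?\<iota>" by (simp add: powr_diff)
 also have "... \<le> C * K / e" using est[of J] e by (simp add: field_simps)
 finally show False by (simp add: x_def)
qed

section \<open>Boundedness and equicontinuity of compact sets\<close>

lemma compactin_bounded:
 assumes p: "1 \<le> p" and K: "compactin (dual_topology p) K" and B: "D_bounded p B"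
 shows "\<exists>M. \<forall>T\<in>K. sup_on B T \<le> M"
proof -
 let ?P = "strong_seminorms (core p) (D_L_seminorms p)"
 have top: "K \<subseteq> dual p"
  using compactin_subset_topspace[OF K] unfolding dual_topology_def topspace_seminorm_topology .
 have z: "(\<lambda>f. 0) \<in> dual p" using function_space_zero[OF function_space_dual[OF p]] .
 have BP: "sup_on B \<in> ?P" unfolding strong_seminorms_eq using B by blast
 let ?U = "\<lambda>n. {T \<in> dual p. sup_on B (\<lambda>f. T f - 0) < real (Suc n)}"
 have "openin (dual_topology p) (?U n)" for n
  unfolding dual_topology_def by (rule openin_seminorm_ball[OF z BP]) simp
 moreover have "K \<subseteq> \<Union>(range ?U)"
 proof
  fix T assume "T \<in> K"
  obtain n :: nat where n: "sup_on B T \<le> real n" using real_arch_simple by blast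
  then show "T \<in> \<Union>(range ?U)" using \<open>T \<in> K\<close> top by (auto intro!: exI[of _ n])
 qed
 ultimately obtain \<F> where F: "finite \<F>" "\<F> \<subseteq> range ?U" "K \<subseteq> \<Union>\<F>"
  using compactinD[OF K, of "range ?U"] by auto
 obtain I where I: "finite I" "\<F> = ?U ` I" using finite_subset_image[OF F(1,2)] by blast
 have "sup_on B T \<le> (\<Sum>n\<in>I. real (Suc n))" if "T \<in> K" for T
 proof -
  have "T \<in> \<Union>(?U ` I)" using F(3) that unfolding I(2) by (rule subsetD)
  then obtain n where n: "n \<in> I" "sup_on B T < real (Suc n)" by auto
  have "real (Suc n) \<le> (\<Sum>n\<in>I. real (Suc n))" using n(1) I(1) by (intro member_le_sum) auto
  then show ?thesis using n(2) by linarith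
 qed
 then show ?thesis by blast
qed

lemma compactin_totally_bounded:
 assumes p: "1 \<le> p" and K: "compactin (dual_topology p) K" and B: "D_bounded p B" and e: "0 < e"
 shows "\<exists>K0. finite K0 \<and> K0 \<subseteq> K \<and> (\<forall>T\<in>K. \<exists>T0\<in>K0. sup_on B (\<lambda>f. T f - T0 f) < e)"
proof -
 let ?P = "strong_seminorms (core p) (D_L_seminorms p)"
 have top: "K \<subseteq> dual p"
  using compactin_subset_topspace[OF K] unfolding dual_topology_def topspace_seminorm_topology .
 have BP: "sup_on B \<in> ?P" unfolding strong_seminorms_eq using B by blast
 let ?U = "\<lambda>T0. {T \<in> dual p. sup_on B (\<lambda>f. T f - T0 f) < e}"
 have "openin (dual_topology p) (?U T0)" if "T0 \<in> K" for T0
  unfolding dual_topology_def by (rule openin_seminorm_ball[OF _ BP e]) (use that top in blast)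
 moreover have "K \<subseteq> \<Union>(?U ` K)"
 proof
  fix T assume T: "T \<in> K"
  have "sup_on B (\<lambda>f. 0) = 0"
   by (rule seminorm_on_zero[OF function_space_dual[OF p] seminorm_on_sup_on[OF p B]])
  then have "T \<in> ?U T" using T top e by auto
  then show "T \<in> \<Union>(?U ` K)" using T by blast
 qed
 ultimately obtain \<F> where F: "finite \<F>" "\<F> \<subseteq> ?U ` K" "K \<subseteq> \<Union>\<F>"
  using compactinD[OF K, of "?U ` K"] by auto
 obtain K0 where K0: "K0 \<subseteq> K" "finite K0" "\<F> = ?U ` K0" using finite_subset_image[OF F(1,2)] by blast
 have "\<exists>T0\<in>K0. sup_on B (\<lambda>f. T f - T0 f) < e" if "T \<in> K" for T
  using F(3) that K0(3) by auto
 then show ?thesis using K0 by blast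
qed

text \<open>No completeness is needed here: a sequence violating equicontinuity is made bounded by
 normalising its terms.\<close>

lemma compactin_equicontinuous:
 fixes K :: "'n::finite functional set"
 assumes p: "1 \<le> p" and K: "compactin (dual_topology p) K"
 shows "\<exists>m C. 0 \<le> C \<and> (\<forall>T\<in>K. \<forall>f\<in>core p. cmod (T f) \<le> C * D_norm p m f)"
proof (rule ccontr)
 assume neg: "\<not> ?thesis"
 have top: "K \<subseteq> dual p"
  using compactin_subset_topspace[OF K] unfolding dual_topology_def topspace_seminorm_topology .
 have sn: "seminorm_on (core p) (D_norm p m :: 'n cfun \<Rightarrow> real)" for m
  by (rule seminorm_on_core[OF p weight_const])
 \<comment> \<open>The failure is tested with order and constant both equal to \<open>k\<close>, so
   that one sequence defeats every order at once.\<close>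
 have "\<exists>\<psi>\<in>core p. D_norm p k \<psi> \<le> 1 \<and> (\<exists>T\<in>K. real k < cmod (T \<psi>))" for k
 proof -
  obtain T f where T: "T \<in> K" and f: "f \<in> core p" and gt: "real k * D_norm p k f < cmod (T f)"
   using neg by (metis not_le of_nat_0_le_iff)
  let ?N = "D_norm p k f"
  have N0: "0 \<le> ?N" using seminorm_on_nonneg[OF sn f] .
  have Tf: "0 < cmod (T f)" using gt N0 by (smt (verit) mult_nonneg_nonneg of_nat_0_le_iff)
  define s where "s = (if ?N = 0 then real (Suc k) / cmod (T f) else 1 / ?N)"
  have s: "0 \<le> s" "real k < s * cmod (T f)" "s * ?N \<le> 1"
   using N0 Tf gt by (auto simp: s_def field_simps)
  let ?g = "\<lambda>x. of_real s * f x"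
  have "?g \<in> core p" using function_space_closed(3)[OF function_space_core[OF p] f f] .
  moreover have "D_norm p k ?g \<le> 1" using seminorm_on_cmult[OF sn f, of k "of_real s"] s by simp
  moreover have "real k < cmod (T ?g)"
   using dual_cmult[OF p subsetD[OF top T] f, of "of_real s"] s by (simp add: norm_mult)
  ultimately show ?thesis using T by blast
 qed
 then obtain \<psi> where \<psi>: "\<And>k. \<psi> k \<in> core p" "\<And>k. D_norm p k (\<psi> k) \<le> 1" "\<And>k. \<exists>T\<in>K. real k < cmod (T (\<psi> k))"
  by metis
 \<comment> \<open>For \<open>k \<ge> m\<close> the norm of order \<open>m\<close> is at most the
   one of order \<open>k\<close>, hence at most 1; the finitely many earlier terms are covered by
   the sum.\<close>
 have B: "D_bounded p (range \<psi>)"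
  unfolding D_bounded_def
 proof (intro conjI allI)
  fix m
  have "D_norm p m (\<psi> k) \<le> 1 + (\<Sum>j<m. D_norm p m (\<psi> j))" for k
  proof (cases "k < m")
   case True
   then have "D_norm p m (\<psi> k) \<le> (\<Sum>j<m. D_norm p m (\<psi> j))"
    using seminorm_on_nonneg[OF sn \<psi>(1)] by (intro member_le_sum) auto
   then show ?thesis by simp
  next
   case False
   then have "D_norm p m (\<psi> k) \<le> 1"
    using order_trans[OF weighted_norm_mono_order[OF D_L_smooth[OF core_subset_D_L[OF \<psi>(1)]]] \<psi>(2)] by simp
   moreover have "0 \<le> (\<Sum>j<m. D_norm p m (\<psi> j))" using seminorm_on_nonneg[OF sn \<psi>(1)] by (intro sum_nonneg)
   ultimately show ?thesis by linarith
  qed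
  then show "\<exists>c. \<forall>f\<in>range \<psi>. D_norm p m f \<le> c" by blast
 qed (use \<psi>(1) in auto)
 obtain M where M: "\<And>T. T \<in> K \<Longrightarrow> sup_on (range \<psi>) T \<le> M" using compactin_bounded[OF p K B] by blast
 obtain k :: nat where k: "M \<le> real k" using real_arch_simple by blast
 obtain T where T: "T \<in> K" "real k < cmod (T (\<psi> k))" using \<psi>(3) by blast
 then show False
  using sup_on_upper[OF p B subsetD[OF top T(1)], of "\<psi> k"] M[OF T(1)] k by simp
qed

section \<open>Uniform decay of the tails of a compact set\<close>

lemma average_support:
 fixes u :: "'n::finite cfun"
 assumes "\<And>x. S < norm x \<Longrightarrow> u x = 0" "0 < d" "S + d < norm x"
 shows "average mollifier d u x = 0"
proof -
 have Z: "u (x + d *\<^sub>R z) * mollifier z = 0" for z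
 proof (cases "norm z \<le> 1")
  case True
  then have "norm (d *\<^sub>R z) \<le> d" using assms(2) by (simp add: mult_left_le)
  then have "S < norm (x + d *\<^sub>R z)" using assms(3) norm_diff_ineq[of x "d *\<^sub>R z"] by linarith
  then show ?thesis using assms(1) by simp
 next
  case False
  then show ?thesis using mollifier_eq_0[of z] by simp
 qed
 show ?thesis unfolding average_def Z by simp
qed

lemma test_mollify:
 fixes u :: "'n::finite cfun"
 assumes u: "u \<in> test_functions" and d: "0 < d"
 shows "average mollifier d u \<in> test_functions"
proof -
 obtain S where "0 < S" "\<forall>x. S < norm x \<longrightarrow> u x = 0" using test_functions_support[OF u] by blast
 then show ?thesis
  using average_support[of S u d] d
  by (intro test_functionsI[where R = "S + d"] smooth_average test_smooth_bounded u test_mollifier) auto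
qed

lemma D_norm_mollify_diff:
 fixes u :: "'n::finite cfun"
 assumes p: "1 \<le> p" and u: "u \<in> D_L p" "smooth_bounded u" and d: "0 < d"
 shows "D_norm p m (\<lambda>x. u x - average mollifier d u x) \<le> d * (real CARD('n) * D_norm p (Suc m) u)"
proof (rule weighted_norm_leI)
 fix ks :: "'n list" assume ks: "length ks \<le> m"
 have su: "smooth u" using u(1) D_L_smooth by blast
 have "Lp_ball p (D_norm p (Suc m) u) (partial_deriv i (iter_deriv ks u))" for i
  using D_norm_ball[OF p u(1), of "ks @ [i]" "Suc m"] ks by (simp add: iter_deriv_append iter_deriv_Cons)
 from Lp_ball_mollify_diff_gradient[OF p smooth_iter_deriv[OF su] d this]
 show "Lp_ball p (d * (real CARD('n) * D_norm p (Suc m) u)) (\<lambda>x. 1 * iter_deriv ks (\<lambda>x. u x - average mollifier d u x) x)"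
  by (simp add: iter_deriv_diff su smooth_average u(2) test_mollifier iter_deriv_average)
qed

text \<open>At a fixed scale all derivatives fall on the kernel, so a set bounded in order 0 becomes
  bounded in every order. The constant blows up as \<open>h\<close> tends to 0, which is harmless
  since \<open>h\<close> is fixed beforehand.\<close>

lemma D_norm_mollify_le:
 fixes h :: real
 assumes p: "1 \<le> p" and h: "0 < h"
 shows "\<exists>c\<ge>0. \<forall>u :: 'n::finite cfun. u \<in> D_L p \<longrightarrow> smooth_bounded u \<longrightarrow>
  D_norm p k (average mollifier h u) \<le> c * D_norm p 0 u"
proof -
 have "\<exists>W>0. \<forall>u d. continuous_on UNIV u \<longrightarrow> Lp_ball p d u \<longrightarrow> Lp_ball p (W * d) (average (iter_deriv ks mollifier) h u)"
  for ks :: "'n list"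
  using Lp_ball_average_test[OF p test_iter_deriv[OF test_mollifier], of ks] by blast
 then obtain W where W: "\<And>ks :: 'n list. 0 < W ks"
  "\<And>ks u d. continuous_on UNIV u \<Longrightarrow> Lp_ball p d u \<Longrightarrow> Lp_ball p (W ks * d) (average (iter_deriv ks mollifier) h u)"
  by metis
 define c where "c = (\<Sum>ks :: 'n list | length ks \<le> k. \<bar>(- 1 / h) ^ length ks\<bar> * W ks)"
 have c0: "0 \<le> c" unfolding c_def using W(1) by (intro sum_nonneg mult_nonneg_nonneg) (auto intro: less_imp_le)
 have "D_norm p k (average mollifier h u) \<le> c * D_norm p 0 u" if u: "u \<in> D_L p" "smooth_bounded u" for u :: "'n cfun"
 proof (rule weighted_norm_leI)
  fix ks :: "'n list" assume ks: "length ks \<le> k"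
  have su: "smooth u" using u(1) D_L_smooth by blast
  let ?a = "\<bar>(- 1 / h) ^ length ks\<bar>"
  have N0: "0 \<le> D_norm p 0 u" by (rule weighted_norm_nonneg[OF su])
  have "Lp_ball p (D_norm p 0 u) u" using D_norm_ball[OF p u(1), of "[]" 0] by simp
  then have b: "Lp_ball p (W ks * D_norm p 0 u) (average (iter_deriv ks mollifier) h u)"
   using W(2) su smooth_continuous by blast
  have E: "iter_deriv ks (average mollifier h u) = (\<lambda>x. of_real ((- 1 / h) ^ length ks) * average (iter_deriv ks mollifier) h u x)"
   using average_iter_deriv_by_parts[OF su test_mollifier, of h ks] h
   by (simp only: iter_deriv_average[OF u(2) test_mollifier]) auto
  have "Lp_ball p (?a * (W ks * D_norm p 0 u)) (\<lambda>x. of_real ((- 1 / h) ^ length ks) * average (iter_deriv ks mollifier) h u x)"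
  proof (rule Lp_ball_dominated[OF p _ Lp_ball_nonneg[OF b] b])
   show "(\<lambda>x. of_real ((- 1 / h) ^ length ks) * average (iter_deriv ks mollifier) h u x) \<in> borel_measurable lborel"
    using average_measurable[OF smooth_continuous[OF su] test_iter_deriv[OF test_mollifier], of ks h] by simp
  qed (auto simp: norm_mult simp flip: of_real_power)
  moreover have "?a * W ks \<le> c"
   unfolding c_def using ks W(1) finite_lists_le
   by (intro member_le_sum[of ks _ "\<lambda>ks. \<bar>(- 1 / h) ^ length ks\<bar> * W ks"])
    (auto intro!: mult_nonneg_nonneg less_imp_le[OF W(1)])
  then have "?a * (W ks * D_norm p 0 u) \<le> c * D_norm p 0 u"
   using mult_right_mono[OF _ N0, of "?a * W ks" c] by (simp add: mult.assoc)
  ultimately show "Lp_ball p (c * D_norm p 0 u) (\<lambda>x. 1 * iter_deriv ks (average mollifier h u) x)"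
   unfolding E mult_1 by (rule Lp_ball_mono)
 qed
 then show ?thesis using c0 by blast
qed

text \<open>The argument splits \<open>\<psi>\<close> into its mollification and the remainder.
  Equicontinuity handles the remainder, which is small in order \<open>m\<close> by one more
  derivative of \<open>\<psi>\<close>; the mollifications form a bounded set, over which a finite
  net of \<open>K\<close> and the tail estimate for single functionals apply.\<close>

theorem compactin_tail_small:
 fixes K :: "'n::finite functional set"
 assumes p: "1 < p" and K: "compactin (dual_topology p) K"
  and C: "0 \<le> C" "\<And>T f. T \<in> K \<Longrightarrow> f \<in> core p \<Longrightarrow> cmod (T f) \<le> C * D_norm p m f" and e: "0 < e"
 shows "\<exists>R0\<ge>1. \<forall>R\<ge>R0. \<forall>T\<in>K. \<forall>\<psi>\<in>test_functions.
  cmod (T (\<lambda>x. tail_cutoff R x * \<psi> x)) \<le> e * D_norm p (Suc m) \<psi>"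
proof -
 have p': "1 \<le> p" using p by simp
 have top: "K \<subseteq> dual p"
  using compactin_subset_topspace[OF K] unfolding dual_topology_def topspace_seminorm_topology .
 have sn: "seminorm_on (core p) (D_norm p j :: 'n cfun \<Rightarrow> real)" for j
  by (rule seminorm_on_core[OF p' weight_const])
 have "\<exists>L\<ge>1. \<forall>R\<ge>1. \<forall>\<psi> :: 'n cfun. \<psi> \<in> D_L p \<longrightarrow>
  D_norm p j (\<lambda>x. tail_cutoff R x * \<psi> x) \<le> L * D_norm p j \<psi>" for j
  by (rule D_norm_tail_cutoff_le[OF p'])
 then obtain L where L: "\<And>j. 1 \<le> L j" "\<And>j R (\<psi> :: 'n cfun). 1 \<le> R \<Longrightarrow> \<psi> \<in> D_L p \<Longrightarrow>
  D_norm p j (\<lambda>x. tail_cutoff R x * \<psi> x) \<le> L j * D_norm p j \<psi>" by metis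
 let ?n = "real CARD('n)"
 \<comment> \<open>The remainder contributes at most \<open>C * (L m * (h * n))\<close>, which this
   makes at most \<open>e / 3\<close>; \<open>C + 1\<close> allows \<open>C = 0\<close>.\<close>
 define h where "h = e / (3 * (C + 1) * L m * ?n)"
 have Lm: "0 < L m" using L(1)[of m] by linarith
 have h: "0 < h" using e C(1) Lm by (simp add: h_def)
 let ?P = "average (mollifier :: 'n cfun) h"
 have "\<exists>c\<ge>0. \<forall>u :: 'n cfun. u \<in> D_L p \<longrightarrow> smooth_bounded u \<longrightarrow> D_norm p k (?P u) \<le> c * D_norm p 0 u" for k
  by (rule D_norm_mollify_le[OF p' h])
 then obtain c where c: "\<And>k. 0 \<le> c k" "\<And>k (u :: 'n cfun). u \<in> D_L p \<Longrightarrow> smooth_bounded u \<Longrightarrow> D_norm p k (?P u) \<le> c k * D_norm p 0 u"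
  by metis
 have Pt: "?P u \<in> test_functions" if "u \<in> test_functions" for u by (rule test_mollify[OF that h])
 have cP: "D_norm p k (?P u) \<le> c k * D_norm p (Suc m) u" if u: "u \<in> test_functions" for k u
  using order_trans[OF c(2)[OF test_D_L[OF p' u] test_smooth_bounded[OF u]]
    mult_left_mono[OF weighted_norm_mono_order[OF test_smooth[OF u]] c(1)]] by simp
 \<comment> \<open>All radii \<open>R\<close> are included, so that one finite net of
   \<open>K\<close> serves every tail.\<close>
 define B where "B = {\<lambda>x. tail_cutoff R x * ?P \<psi> x | R \<psi>. 1 \<le> R \<and> \<psi> \<in> test_functions \<and> D_norm p (Suc m) \<psi> \<le> 1}"
 have B: "D_bounded p B"
  unfolding D_bounded_def
 proof (intro conjI allI)
  have z: "(\<lambda>x :: real ^ 'n. 0) \<in> test_functions" by (simp add: test_functions_def smooth_const)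
  have "D_norm p (Suc m) (\<lambda>x :: real ^ 'n. 0) = 0"
   by (rule seminorm_on_zero[OF function_space_core[OF p'] sn])
  then have "(\<lambda>x. tail_cutoff 1 x * ?P (\<lambda>x. 0) x) \<in> B"
   unfolding B_def using z by fastforce
  then show "B \<noteq> {}" by blast
  show "B \<subseteq> core p" unfolding B_def using test_core[OF p' tail_cutoff_test[OF _ Pt]] by fastforce
  fix j
  have "D_norm p j (\<lambda>x. tail_cutoff R x * ?P \<psi> x) \<le> L j * c j"
   if "1 \<le> R" "\<psi> \<in> test_functions" "D_norm p (Suc m) \<psi> \<le> 1" for R \<psi>
  proof -
   have "D_norm p j (\<lambda>x. tail_cutoff R x * ?P \<psi> x) \<le> L j * D_norm p j (?P \<psi>)"
    by (rule L(2)[OF that(1) test_D_L[OF p' Pt[OF that(2)]]])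
   also have "... \<le> L j * (c j * 1)"
    using order_trans[OF cP[OF that(2), of j] mult_left_mono[OF that(3) c(1)]] L(1)[of j]
    by (intro mult_left_mono) auto
   finally show ?thesis by simp
  qed
  then show "\<exists>c. \<forall>f\<in>B. D_norm p j f \<le> c" unfolding B_def by blast
 qed
 obtain K0 where K0: "finite K0" "K0 \<subseteq> K" "\<And>T. T \<in> K \<Longrightarrow> \<exists>T0\<in>K0. sup_on B (\<lambda>f. T f - T0 f) < e / 3"
 proof -
  have "0 < e / 3" using e by simp
  from compactin_totally_bounded[OF p' K B this] show ?thesis using that by (elim exE conjE) simp
 qed
 \<comment> \<open>The functionals of the net act on mollified functions, whose norm of order
   \<open>m\<close> may be as large as \<open>c m\<close>.\<close>
 define e' where "e' = e / (3 * (c m + 1))"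
 have e': "0 < e'" using e c(1)[of m] by (simp add: e'_def add_nonneg_pos)
 have "\<exists>R0\<ge>1. \<forall>R\<ge>R0. \<forall>\<psi>\<in>test_functions. cmod (T (\<lambda>x. tail_cutoff R x * \<psi> x)) \<le> e' * D_norm p m \<psi>" if "T \<in> K0" for T
 proof -
  have TK: "T \<in> K" using that K0(2) by blast
  then have Td: "T \<in> dual p" using top by blast
  show ?thesis by (rule dual_tail_small[OF p Td C(1) _ e']) (rule C(2)[OF TK])
 qed
 then obtain R1 where R1: "\<And>T. T \<in> K0 \<Longrightarrow> 1 \<le> R1 T" "\<And>T R \<psi>. T \<in> K0 \<Longrightarrow> R1 T \<le> R \<Longrightarrow> \<psi> \<in> test_functions \<Longrightarrow>
   cmod (T (\<lambda>x. tail_cutoff R x * \<psi> x)) \<le> e' * D_norm p m \<psi>"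
  by metis
 define R0 where "R0 = 1 + (\<Sum>T\<in>K0. R1 T)"
 have R0: "1 \<le> R0" "\<And>T. T \<in> K0 \<Longrightarrow> R1 T \<le> R0"
 proof -
  have nn: "0 \<le> R1 T" if "T \<in> K0" for T using R1(1)[OF that] by linarith
  show "1 \<le> R0" unfolding R0_def using nn by (simp add: sum_nonneg)
  fix T assume "T \<in> K0"
  then have "R1 T \<le> (\<Sum>T\<in>K0. R1 T)" using nn K0(1) by (intro member_le_sum) auto
  then show "R1 T \<le> R0" by (simp add: R0_def)
 qed
 have unit: "cmod (T (\<lambda>x. tail_cutoff R x * \<psi> x)) \<le> e"
  if R: "R0 \<le> R" and T: "T \<in> K" and \<psi>: "\<psi> \<in> test_functions" and N: "D_norm p (Suc m) \<psi> \<le> 1" for R T \<psi>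
 proof -
  have R': "1 \<le> R" using R R0(1) by linarith
  have Td: "T \<in> dual p" using T top by blast
  let ?d = "\<lambda>x. \<psi> x - ?P \<psi> x" and ?t = "\<lambda>u x. tail_cutoff R x * u x"
  have P\<psi>: "?P \<psi> \<in> test_functions" by (rule Pt[OF \<psi>])
  have d: "?d \<in> test_functions" using test_lincomb[OF \<psi> P\<psi>, of 1 "-1"] by simp
  have td: "?t ?d \<in> core p" "?t (?P \<psi>) \<in> core p"
   using test_core[OF p' tail_cutoff_test[OF _ d]] test_core[OF p' tail_cutoff_test[OF _ P\<psi>]] R' by auto
  have split: "T (?t \<psi>) = T (?t ?d) + T (?t (?P \<psi>))"
   using dual_add[OF p' Td td] by (simp add: algebra_simps)
  have "cmod (T (?t ?d)) \<le> C * D_norm p m (?t ?d)" by (rule C(2)[OF T td(1)])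
  also have "... \<le> C * (L m * D_norm p m ?d)"
   using L(2)[OF R' test_D_L[OF p' d], of m] C(1) by (intro mult_left_mono)
  also have "... \<le> C * (L m * (h * (?n * 1)))"
  proof -
   have "D_norm p m ?d \<le> h * (?n * D_norm p (Suc m) \<psi>)"
    by (rule D_norm_mollify_diff[OF p' test_D_L[OF p' \<psi>] test_smooth_bounded[OF \<psi>] h])
   also have "... \<le> h * (?n * 1)" using N h by (intro mult_left_mono) auto
   finally show ?thesis using C(1) Lm by (intro mult_left_mono) auto
  qed
  also have "... \<le> (C + 1) * (L m * (h * (?n * 1)))" using Lm h by (intro mult_right_mono) auto
  also have "... = e / 3"
  proof -
   define D where "D = C + 1"
   have "0 < D" using C(1) by (simp add: D_def)
   then show ?thesis unfolding h_def D_def[symmetric] using Lm by simp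
  qed
  finally have 1: "cmod (T (?t ?d)) \<le> e / 3" .
  obtain T0 where T0: "T0 \<in> K0" "sup_on B (\<lambda>f. T f - T0 f) < e / 3" using K0(3)[OF T] by blast
  have T0d: "T0 \<in> dual p" using T0(1) K0(2) top by blast
  have "?t (?P \<psi>) \<in> B" unfolding B_def using R' \<psi> N by blast
  then have "cmod (T (?t (?P \<psi>)) - T0 (?t (?P \<psi>))) \<le> sup_on B (\<lambda>f. T f - T0 f)"
   by (rule sup_on_upper[OF p' B function_space_closed(2)[OF function_space_dual[OF p'] Td T0d]])
  then have 2: "cmod (T (?t (?P \<psi>)) - T0 (?t (?P \<psi>))) \<le> e / 3" using T0(2) by linarith
  have "cmod (T0 (?t (?P \<psi>))) \<le> e' * D_norm p m (?P \<psi>)"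
   using R1(2)[OF T0(1) _ P\<psi>] R0(2)[OF T0(1)] R by force
  also have "... \<le> e' * (c m * 1)"
   using order_trans[OF cP[OF \<psi>, of m] mult_left_mono[OF N c(1)]] e' by (intro mult_left_mono) auto
  also have "... \<le> e' * (c m + 1)" using e' by (intro mult_left_mono) auto
  also have "... = e / 3"
  proof -
   define D where "D = c m + 1"
   have "0 < D" using c(1)[of m] by (simp add: D_def)
   then show ?thesis unfolding e'_def D_def[symmetric] by simp
  qed
  finally have 3: "cmod (T0 (?t (?P \<psi>))) \<le> e / 3" .
  have "cmod (T (?t \<psi>)) = cmod (T (?t ?d) + ((T (?t (?P \<psi>)) - T0 (?t (?P \<psi>))) + T0 (?t (?P \<psi>))))"
   unfolding split by simp
  also have "... \<le> cmod (T (?t ?d)) + (cmod (T (?t (?P \<psi>)) - T0 (?t (?P \<psi>))) + cmod (T0 (?t (?P \<psi>))))"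
   by (intro order_trans[OF norm_triangle_ineq] add_left_mono norm_triangle_ineq)
  finally show ?thesis using 1 2 3 by linarith
 qed
 \<comment> \<open>Homogeneity extends the bound from the unit ball; if the norm of
   \<open>\<psi>\<close> vanishes, arbitrary multiples are admissible and the value must be
   0.\<close>
 have "cmod (T (\<lambda>x. tail_cutoff R x * \<psi> x)) \<le> e * D_norm p (Suc m) \<psi>"
  if R: "R0 \<le> R" and T: "T \<in> K" and \<psi>: "\<psi> \<in> test_functions" for R T \<psi>
 proof -
  have Td: "T \<in> dual p" using T top by blast
  have R': "0 < R" using R R0(1) by linarith
  have tc: "(\<lambda>x. tail_cutoff R x * \<psi> x) \<in> core p" using test_core[OF p' tail_cutoff_test[OF R' \<psi>]] .
  let ?N = "D_norm p (Suc m) \<psi>"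
  have sc: "s * cmod (T (\<lambda>x. tail_cutoff R x * \<psi> x)) \<le> e" if s: "0 \<le> s" "s * ?N \<le> 1" for s
  proof -
   have s\<psi>: "(\<lambda>x. of_real s * \<psi> x) \<in> test_functions" using test_mult_left(1)[OF \<psi> smooth_const] .
   have "D_norm p (Suc m) (\<lambda>x. of_real s * \<psi> x) = s * ?N"
    using seminorm_on_cmult[OF sn test_core[OF p' \<psi>], of "Suc m" "of_real s"] s(1) by simp
   then have "cmod (T (\<lambda>x. tail_cutoff R x * (of_real s * \<psi> x))) \<le> e"
    using unit[OF R T s\<psi>] s(2) by simp
   moreover have "T (\<lambda>x. tail_cutoff R x * (of_real s * \<psi> x)) = of_real s * T (\<lambda>x. tail_cutoff R x * \<psi> x)"
    using dual_cmult[OF p' Td tc, of "of_real s"] by (simp add: mult.left_commute)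
   ultimately show ?thesis using s(1) by (simp add: norm_mult)
  qed
  have N0: "0 \<le> ?N" by (rule weighted_norm_nonneg[OF test_smooth[OF \<psi>]])
  show ?thesis
  proof (cases "?N = 0")
   case True
   have "cmod (T (\<lambda>x. tail_cutoff R x * \<psi> x)) = 0"
   proof (rule ccontr)
    assume nz: "cmod (T (\<lambda>x. tail_cutoff R x * \<psi> x)) \<noteq> 0"
    then show False using sc[of "(e + 1) / cmod (T (\<lambda>x. tail_cutoff R x * \<psi> x))"] True e by simp
   qed
   then show ?thesis using True by simp
  next
   case False
   then show ?thesis using sc[of "1 / ?N"] N0 by (simp add: divide_le_eq mult.commute)
  qed
 qed
 then show ?thesis using R0(1) by blast
qed

text \<open>Dyadic decomposition: the tails of \<open>K\<close> decrease like \<open>4\<^sup>-\<^sup>j\<close> while the weight decreases only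
 like \<open>2\<^sup>-\<^sup>j\<close>.\<close>

theorem compactin_dominated_by_weight:
 fixes K :: "'n::finite functional set"
 assumes p: "1 < p" and K: "compactin (dual_topology p) K"
 shows "\<exists>G\<in>C_0. \<exists>m C. 0 \<le> C \<and> (\<forall>T\<in>K. \<forall>\<phi>\<in>test_functions. cmod (T \<phi>) \<le> C * weighted_norm p G m \<phi>)"
proof -
 have p': "1 \<le> p" using p by simp
 have top: "K \<subseteq> dual p"
  using compactin_subset_topspace[OF K] unfolding dual_topology_def topspace_seminorm_topology .
 obtain m0 C where C: "0 \<le> C" "\<And>T f. T \<in> K \<Longrightarrow> f \<in> core p \<Longrightarrow> cmod (T f) \<le> C * D_norm p m0 f"
  using compactin_equicontinuous[OF p' K] by blast
 \<comment> \<open>One derivative more than equicontinuity requires, because the uniform tail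
   estimate loses one.\<close>
 define m where "m = Suc m0"
 have C': "cmod (T f) \<le> C * D_norm p m f" if "T \<in> K" "f \<in> core p" for T f
  unfolding m_def
  using order_trans[OF C(2)[OF that] mult_left_mono[OF weighted_norm_mono_order[OF D_L_smooth[OF core_subset_D_L[OF that(2)]]] C(1)]]
  by simp
 have "\<exists>r\<ge>1. \<forall>R\<ge>r. \<forall>T\<in>K. \<forall>\<psi>\<in>test_functions.
  cmod (T (\<lambda>x. tail_cutoff R x * \<psi> x)) \<le> (1 / 4) ^ j * D_norm p m \<psi>" for j
  unfolding m_def by (rule compactin_tail_small[OF p K C(1)]) (use C(2) in auto)
 then obtain r where r: "\<And>j :: nat. 1 \<le> r j" "\<And>j R T \<psi>. r j \<le> R \<Longrightarrow> T \<in> K \<Longrightarrow> \<psi> \<in> test_functions \<Longrightarrow>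
  cmod (T (\<lambda>x. tail_cutoff R x * \<psi> x)) \<le> (1 / 4) ^ j * D_norm p m \<psi>" by metis
 \<comment> \<open>The partial sums increase, exceed \<open>j\<close>, and satisfy
   \<open>R j / 2 \<ge> r j\<close>; the last property lets the tail estimate be used at half the
   radius.\<close>
 define R where "R j = (\<Sum>i\<le>j. 2 * r i)" for j :: nat
 have R1: "real j + 1 \<le> R j" for j
 proof (induction j)
  case 0
  then show ?case using r(1)[of 0] by (simp add: R_def)
 next
  case (Suc j)
  then show ?case using r(1)[of "Suc j"] by (simp add: R_def)
 qed
 have R1': "1 \<le> R j" for j using R1[of j] by linarith
 have Rr: "2 * r j \<le> R j" for j
  unfolding R_def using r(1) by (intro member_le_sum) (auto intro: order_trans[of _ 1])
 have RS: "R j \<le> R (Suc j)" for j using r(1)[of "Suc j"] by (simp add: R_def)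
 \<comment> \<open>The \<open>j\<close>-th ring lies inside radius \<open>2 * R (Suc j)\<close>, so
   there the constant 1 is dominated by \<open>2 ^ j\<close> times the weight.\<close>
 obtain G :: "'n cfun" where G: "G \<in> C_0" "\<And>j x. norm x \<le> 2 * R (Suc j) \<Longrightarrow> (1 / 2) ^ j \<le> cmod (G x)"
 proof -
  have "real j \<le> 2 * R (Suc j)" for j using R1[of "Suc j"] by simp
  from weight_decaying_slowly[of "\<lambda>j. 2 * R (Suc j)", OF this] show ?thesis using that by blast
 qed
 have wG: "weight G" using G(1) C_0_weight by blast
 have w2G: "weight (\<lambda>x. 2 ^ j * G x)" for j :: nat
 proof -
  obtain b where b: "0 \<le> b" "\<And>x. cmod (G x) \<le> b" using wG by (auto simp: weight_def)
  show ?thesis unfolding weight_def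
   using b by (intro conjI exI[of _ "2 ^ j * b"] continuous_intros weight_continuous[OF wG]) (auto simp: norm_mult norm_power)
 qed
 obtain c where c: "1 \<le> c" "\<And>R ks x. 1 \<le> R \<Longrightarrow> length ks \<le> m \<Longrightarrow>
   cmod (iter_deriv ks (cutoff R) (x :: real ^ 'n)) \<le> c * indicator (cball 0 (2 * R)) x"
  using cutoff_mult_cutoff_bound[of m] by blast
 let ?L = "leibniz_const TYPE('n) m"
 have L0: "0 \<le> ?L" by (rule leibniz_const_nonneg)
 have est: "D_norm p m (\<lambda>x. a x * \<phi> x) \<le> ?L * d * (2 ^ j * weighted_norm p G m \<phi>)"
  if \<phi>: "\<phi> \<in> test_functions" and a: "smooth a" and d: "0 \<le> d"
   and bd: "\<And>ks x. length ks \<le> m \<Longrightarrow> cmod (iter_deriv ks a x) \<le> d * indicator (cball 0 (2 * R (Suc j))) x" for \<phi> a d j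
 proof -
  have \<phi>D: "\<phi> \<in> D_L p" using test_D_L[OF p' \<phi>] .
  have [measurable]: "cball 0 (2 * R (Suc j)) \<in> sets (borel :: (real ^ 'n) measure)" by auto
  have "D_norm p m (\<lambda>x. a x * \<phi> x) \<le> ?L * d * weighted_norm p (\<lambda>x. 2 ^ j * G x) m \<phi>"
  proof (rule weighted_norm_Leibniz[OF p' a \<phi>D d bd _ _ weight_const w2G])
   fix x :: "real ^ 'n"
   show "indicator (cball 0 (2 * R (Suc j))) x * cmod 1 \<le> cmod (2 ^ j * G x)"
    using mult_left_mono[OF G(2)[of x j], of "2 ^ j"]
    by (auto simp: indicator_def norm_mult norm_power power_one_over)
  qed auto
  also have "... \<le> ?L * d * (2 ^ j * weighted_norm p G m \<phi>)"
   using d L0 by (intro mult_left_mono weighted_norm_mono_weight[OF p' w2G wG \<phi>D]) (auto simp: norm_mult norm_power)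
  finally show ?thesis .
 qed
 let ?w = "\<lambda>\<phi>. weighted_norm p G m \<phi>"
 have "cmod (T \<phi>) \<le> (C * ?L * c + 4 * ?L * c) * ?w \<phi>" if T: "T \<in> K" and \<phi>: "\<phi> \<in> test_functions" for T \<phi>
 proof -
  have Td: "T \<in> dual p" using T top by blast
  have w0: "0 \<le> ?w \<phi>" by (rule weighted_norm_nonneg[OF test_smooth[OF \<phi>]])
  let ?v = "\<lambda>j x. (cutoff (R (Suc j)) x - cutoff (R j) x) * \<phi> x"
  have vt: "?v j \<in> test_functions" for j
   by (rule test_mult_left(1)[OF \<phi> smooth_diff[OF smooth_cutoff smooth_cutoff]])
  have ct: "(\<lambda>x. cutoff (R j) x * \<phi> x) \<in> test_functions" for j
   by (rule test_mult_left(1)[OF \<phi> smooth_cutoff])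
  have step: "cmod (T (?v j)) \<le> 2 * ?L * c * ((1 / 2) ^ j * ?w \<phi>)" for j
  proof -
   \<comment> \<open>The ring starts at radius \<open>R j\<close>, where
     \<open>cutoff (R j / 2)\<close> has already become 0; hence the tail estimate applies to the
     ring itself.\<close>
   have "tail_cutoff (R j / 2) x * ?v j x = ?v j x" for x :: "real ^ 'n"
   proof (cases "norm x \<le> R j")
    case True
    then have "cutoff (R j) x = 1" "cutoff (R (Suc j)) x = 1"
     using R1'[of j] R1'[of "Suc j"] RS[of j] by (auto intro!: cutoff_eq_1)
    then show ?thesis by simp
   next
    case False
    then have "cutoff (R j / 2) x = 0" using R1'[of j] by (intro cutoff_eq_0) auto
    then show ?thesis by (simp add: tail_cutoff_def)
   qed
   then have E: "(\<lambda>x. tail_cutoff (R j / 2) x * ?v j x) = ?v j" by (intro ext)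
   have "cmod (T (?v j)) = cmod (T (\<lambda>x. tail_cutoff (R j / 2) x * ?v j x))" by (simp only: E)
   also have "... \<le> (1 / 4) ^ j * D_norm p m (?v j)"
    using Rr[of j] by (intro r(2) T vt) simp
   also have "... \<le> (1 / 4) ^ j * (?L * (2 * c) * (2 ^ j * ?w \<phi>))"
   proof (rule mult_left_mono, rule est[OF \<phi> smooth_diff[OF smooth_cutoff smooth_cutoff]])
    fix ks :: "'n list" and x :: "real ^ 'n" assume ks: "length ks \<le> m"
    have "cmod (iter_deriv ks (cutoff (R (Suc j))) x - iter_deriv ks (cutoff (R j)) x) \<le>
      c * indicator (cball 0 (2 * R (Suc j))) x + c * indicator (cball 0 (2 * R j)) x"
     using norm_triangle_ineq4 c(2)[OF R1' ks] by (meson add_mono order_trans)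
    also have "... \<le> 2 * c * indicator (cball 0 (2 * R (Suc j))) x"
     using RS[of j] c(1) by (auto simp: indicator_def)
    finally show "cmod (iter_deriv ks (\<lambda>x. cutoff (R (Suc j)) x - cutoff (R j) x) x) \<le>
      2 * c * indicator (cball 0 (2 * R (Suc j))) x"
     by (simp add: iter_deriv_diff smooth_cutoff)
   qed (use c(1) in auto)
   also have "... = 2 * ?L * c * (((1 / 4) ^ j * 2 ^ j) * ?w \<phi>)" by (simp add: mult_ac)
   also have "(1 / 4 :: real) ^ j * 2 ^ j = (1 / 2) ^ j" by (simp flip: power_mult_distrib)
   finally show ?thesis .
  qed
  have first: "cmod (T (\<lambda>x. cutoff (R 0) x * \<phi> x)) \<le> C * (?L * c * (2 ^ 0 * ?w \<phi>))"
  proof -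
   have "D_norm p m (\<lambda>x. cutoff (R 0) x * \<phi> x) \<le> ?L * c * (2 ^ 0 * ?w \<phi>)"
   proof (rule est[OF \<phi> smooth_cutoff])
    fix ks :: "'n list" and x :: "real ^ 'n" assume ks: "length ks \<le> m"
    have "c * indicator (cball 0 (2 * R 0)) x \<le> c * indicator (cball 0 (2 * R (Suc 0))) x"
     using RS[of 0] c(1) by (auto simp: indicator_def)
    then show "cmod (iter_deriv ks (cutoff (R 0)) x) \<le> c * indicator (cball 0 (2 * R (Suc 0))) x"
     using c(2)[OF R1' ks, of 0 x] by linarith
   qed (use c(1) in auto)
   then show ?thesis
    using order_trans[OF C'[OF T test_core[OF p' ct]] mult_left_mono[OF _ C(1)]] by blast
  qed
  have sum: "T (\<lambda>x. cutoff (R J) x * \<phi> x) = T (\<lambda>x. cutoff (R 0) x * \<phi> x) + (\<Sum>j<J. T (?v j))" for J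
  proof (induction J)
   case (Suc J)
   have "T (\<lambda>x. cutoff (R J) x * \<phi> x + ?v J x) = T (\<lambda>x. cutoff (R J) x * \<phi> x) + T (?v J)"
    by (rule dual_add[OF p' Td test_core[OF p' ct] test_core[OF p' vt]])
   then show ?case using Suc by (simp add: algebra_simps)
  qed simp
  obtain S where S: "\<forall>x. S < norm x \<longrightarrow> \<phi> x = 0" using test_functions_support[OF \<phi>] by blast
  obtain J :: nat where J: "S \<le> real J" using real_arch_simple by blast
  \<comment> \<open>Compact support makes the decomposition finite, so no convergence in the predual
    is involved; the bound is uniform in \<open>J\<close> by the geometric series.\<close>
  have "\<phi> = (\<lambda>x. cutoff (R J) x * \<phi> x)"
  proof
   fix x show "\<phi> x = cutoff (R J) x * \<phi> x"
   proof (cases "S < norm x")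
    case False
    then have "cutoff (R J) x = 1" using J R1[of J] R1'[of J] by (intro cutoff_eq_1) auto
    then show ?thesis by simp
   qed (use S in simp)
  qed
  then have "cmod (T \<phi>) = cmod (T (\<lambda>x. cutoff (R 0) x * \<phi> x) + (\<Sum>j<J. T (?v j)))"
   using sum[of J] by simp
  also have "... \<le> cmod (T (\<lambda>x. cutoff (R 0) x * \<phi> x)) + (\<Sum>j<J. cmod (T (?v j)))"
   by (intro order_trans[OF norm_triangle_ineq] add_left_mono norm_sum)
  also have "... \<le> C * (?L * c * ?w \<phi>) + (\<Sum>j<J. 2 * ?L * c * ((1 / 2) ^ j * ?w \<phi>))"
   using first step by (intro add_mono sum_mono) auto
  also have "(\<Sum>j<J. 2 * ?L * c * ((1 / 2) ^ j * ?w \<phi>)) = (2 * ?L * c * ?w \<phi>) * (\<Sum>j<J. (1 / 2) ^ j)"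
   by (simp add: sum_distrib_left mult_ac)
  also have "... \<le> (2 * ?L * c * ?w \<phi>) * 2"
  proof (rule mult_left_mono)
   have "(\<Sum>j<J. (1 / 2 :: real) ^ j) = (1 - (1 / 2) ^ J) / (1 - 1 / 2)"
    by (simp add: sum_gp_strict)
   then show "(\<Sum>j<J. (1 / 2 :: real) ^ j) \<le> 2" by simp
  qed (use L0 c(1) w0 in auto)
  finally show ?thesis by (simp add: algebra_simps)
 qed
 moreover have "0 \<le> C * ?L * c + 4 * ?L * c" using C(1) L0 c(1) by auto
 ultimately show ?thesis using G(1) by blast
qed

section \<open>The duality pairing\<close>

lemma D_norm_cutoff_le:
 assumes p: "1 \<le> p"
 shows "\<exists>K\<ge>1. \<forall>R\<ge>1. \<forall>\<psi> :: 'n::finite cfun. \<psi> \<in> D_L p \<longrightarrow>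
  D_norm p m (\<lambda>x. cutoff R x * \<psi> x) \<le> K * D_norm p m \<psi>"
proof -
 obtain c where c: "1 \<le> c" "\<And>R ks x. 1 \<le> R \<Longrightarrow> length ks \<le> m \<Longrightarrow>
   cmod (iter_deriv ks (cutoff R) (x :: real ^ 'n)) \<le> c * 1"
  using cutoff_deriv_bound[of m] by auto
 let ?K = "leibniz_const TYPE('n) m * c"
 have "D_norm p m (\<lambda>x. cutoff R x * \<psi> x) \<le> (?K + 1) * D_norm p m \<psi>"
  if R: "1 \<le> R" and \<psi>: "\<psi> \<in> D_L p" for R and \<psi> :: "'n cfun"
 proof -
  have "D_norm p m (\<lambda>x. cutoff R x * \<psi> x) \<le> ?K * D_norm p m \<psi>"
   by (rule weighted_norm_Leibniz[where w = "\<lambda>_. 1", OF p smooth_cutoff \<psi> _ c(2)[OF R] _ _ weight_const weight_const])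
    (use c(1) in auto)
  then show ?thesis using weighted_norm_nonneg[OF D_L_smooth[OF \<psi>], of p "\<lambda>_. 1" m] by (simp add: distrib_right)
 qed
 moreover have "1 \<le> ?K + 1" using c(1) leibniz_const_nonneg[where 'n = 'n, of m] by simp
 ultimately show ?thesis by blast
qed

lemma cutoff_core: "1 \<le> p \<Longrightarrow> smooth \<phi> \<Longrightarrow> 0 < R \<Longrightarrow> (\<lambda>x. cutoff R x * \<phi> x) \<in> core p"
 by (rule test_core[OF _ cutoff_mult_test])

text \<open>For the infinite exponent \<open>\<phi>\<close> need not lie in \<open>core p\<close>
  and its truncations need not converge there. Their differences, however, are bounded in norm and
  supported far out, where \<open>T\<close> is small.\<close>

lemma dual_cutoff_convergent:
 fixes T :: "'n::finite functional"
 assumes p: "1 < p" and T: "T \<in> dual p" and \<phi>: "\<phi> \<in> D_L p"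
 shows "convergent (\<lambda>k. T (\<lambda>x. cutoff (real k) x * \<phi> x))"
proof -
 have p': "1 \<le> p" using p by simp
 have s\<phi>: "smooth \<phi>" using D_L_smooth[OF \<phi>] .
 obtain m C where C: "0 \<le> C" "\<And>f. f \<in> core p \<Longrightarrow> cmod (T f) \<le> C * D_norm p m f"
  using dual_bound[OF p' T] by blast
 obtain K where K: "1 \<le> K" "\<And>R (\<psi> :: 'n cfun). 1 \<le> R \<Longrightarrow> \<psi> \<in> D_L p \<Longrightarrow>
   D_norm p m (\<lambda>x. cutoff R x * \<psi> x) \<le> K * D_norm p m \<psi>"
  using D_norm_cutoff_le[OF p', of m] by blast
 let ?N = "D_norm p m \<phi>"
 have N0: "0 \<le> ?N" by (rule weighted_norm_nonneg[OF s\<phi>])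
 have "Cauchy (\<lambda>k. T (\<lambda>x. cutoff (real k) x * \<phi> x))"
 proof (rule CauchyI')
  fix e :: real assume e: "0 < e"
  define e' where "e' = e / (2 * K * ?N + 1)"
  have e': "0 < e'" using e K(1) N0 by (simp add: e'_def add_nonneg_pos)
  obtain R0 where R0: "1 \<le> R0" "\<And>R \<psi>. R0 \<le> R \<Longrightarrow> \<psi> \<in> test_functions \<Longrightarrow> cmod (T (\<lambda>x. tail_cutoff R x * \<psi> x)) \<le> e' * D_norm p m \<psi>"
   using dual_tail_small[OF p T C e'] by blast
  obtain k0 :: nat where k0: "2 * R0 \<le> k0" using real_arch_simple by blast
  have "dist (T (\<lambda>x. cutoff (real j) x * \<phi> x)) (T (\<lambda>x. cutoff (real k) x * \<phi> x)) < e" if j: "k0 \<le> j" and k: "j < k" for j k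
  proof -
   have j1: "1 \<le> real j" "1 \<le> real k" "real j \<le> real k" "R0 \<le> real j / 2" using j k k0 R0(1) by auto
   let ?\<psi> = "\<lambda>x. cutoff (real j) x * \<phi> x - cutoff (real k) x * \<phi> x"
   have t: "(\<lambda>x. cutoff (real j) x * \<phi> x) \<in> test_functions" "(\<lambda>x. cutoff (real k) x * \<phi> x) \<in> test_functions"
    using cutoff_mult_test[OF s\<phi>] j1 by auto
   have \<psi>: "?\<psi> \<in> test_functions" using test_lincomb[OF t, of 1 "-1"] by simp
   \<comment> \<open>The difference of two truncations vanishes up to radius \<open>j\<close>, and
     from there on \<open>cutoff (real j / 2)\<close> is 0.\<close>
   have "tail_cutoff (real j / 2) x * ?\<psi> x = ?\<psi> x" for x
   proof (cases "norm x \<le> real j")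
    case True
    then have "cutoff (real j) x = 1" "cutoff (real k) x = 1" using j1 by (auto intro!: cutoff_eq_1)
    then show ?thesis by simp
   next
    case False
    then have "cutoff (real j / 2) x = 0" using j1 by (intro cutoff_eq_0) auto
    then show ?thesis by (simp add: tail_cutoff_def)
   qed
   then have E: "(\<lambda>x. tail_cutoff (real j / 2) x * ?\<psi> x) = ?\<psi>" by (intro ext)
   have "dist (T (\<lambda>x. cutoff (real j) x * \<phi> x)) (T (\<lambda>x. cutoff (real k) x * \<phi> x)) = cmod (T ?\<psi>)"
    using dual_diff[OF p' T test_core[OF p' t(1)] test_core[OF p' t(2)]] by (simp add: dist_norm)
   also have "... = cmod (T (\<lambda>x. tail_cutoff (real j / 2) x * ?\<psi> x))" by (simp only: E)
   also have "... \<le> e' * D_norm p m ?\<psi>" by (rule R0(2)[OF j1(4) \<psi>])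
   also have "... \<le> e' * (2 * K * ?N)"
   proof (rule mult_left_mono)
    show "D_norm p m ?\<psi> \<le> 2 * K * ?N"
     using seminorm_on_diff[OF function_space_core[OF p'] seminorm_on_core[OF p' weight_const] test_core[OF p' t(1)] test_core[OF p' t(2)], of 1 m]
      K(2)[OF j1(1) \<phi>] K(2)[OF j1(2) \<phi>] by simp
   qed (use e' in simp)
   also have "... < e' * (2 * K * ?N + 1)" using e' by simp
   also have "... = e"
   proof -
    define D where "D = 2 * K * ?N + 1"
    have "0 < D" using K(1) N0 by (simp add: D_def add_nonneg_pos)
    then show ?thesis unfolding e'_def D_def[symmetric] by simp
   qed
   finally show ?thesis .
  qed
  then show "\<exists>M. \<forall>j\<ge>M. \<forall>k>j. dist (T (\<lambda>x. cutoff (real j) x * \<phi> x)) (T (\<lambda>x. cutoff (real k) x * \<phi> x)) < e" by blast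
 qed
 then show ?thesis by (simp add: Cauchy_convergent_iff)
qed

lemma dual_cutoff_tendsto:
 fixes T :: "'n::finite functional"
 assumes p: "1 \<le> p" and T: "T \<in> dual p" and \<phi>: "\<phi> \<in> core p"
 shows "(\<lambda>k. T (\<lambda>x. cutoff (real k) x * \<phi> x)) \<longlonglongrightarrow> T \<phi>"
proof -
 obtain m C where C: "0 \<le> C" "\<And>f. f \<in> core p \<Longrightarrow> cmod (T f) \<le> C * D_norm p m f"
  using dual_bound[OF p T] by blast
 have s\<phi>: "smooth \<phi>" using D_L_smooth[OF core_subset_D_L[OF \<phi>]] .
 have "(\<lambda>k. T \<phi> - T (\<lambda>x. cutoff (real k) x * \<phi> x)) \<longlonglongrightarrow> 0"
 proof (rule Lim_null_comparison)
  show "(\<lambda>k. C * D_norm p m (\<lambda>x. tail_cutoff (real k) x * \<phi> x)) \<longlonglongrightarrow> 0"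
   using tendsto_mult_right_zero[OF D_norm_tail_tendsto_0[OF p \<phi>]] .
  show "\<forall>\<^sub>F k in sequentially. norm (T \<phi> - T (\<lambda>x. cutoff (real k) x * \<phi> x)) \<le> C * D_norm p m (\<lambda>x. tail_cutoff (real k) x * \<phi> x)"
  proof (rule eventually_sequentiallyI[of 1])
   fix k :: nat assume "1 \<le> k"
   then have k: "0 < real k" by simp
   have "T \<phi> - T (\<lambda>x. cutoff (real k) x * \<phi> x) = T (\<lambda>x. tail_cutoff (real k) x * \<phi> x)"
    unfolding tail_cutoff_mult using dual_diff[OF p T \<phi> cutoff_core[OF p s\<phi> k]] by simp
   then show "norm (T \<phi> - T (\<lambda>x. cutoff (real k) x * \<phi> x)) \<le> C * D_norm p m (\<lambda>x. tail_cutoff (real k) x * \<phi> x)"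
    using C(2)[OF tail_cutoff_core[OF p k \<phi>]] by simp
  qed
 qed
 then show ?thesis using tendsto_diff[OF tendsto_const[of "T \<phi>"], of "\<lambda>k. T \<phi> - T (\<lambda>x. cutoff (real k) x * \<phi> x)" 0] by simp
qed

text \<open>Truncations reduce the claim to test functions; they may increase the norm by the factor
  \<open>K\<close>, which is compensated by starting from \<open>e / K\<close>.\<close>

lemma dual_tail_small_core:
 fixes T :: "'n::finite functional"
 assumes p: "1 < p" and T: "T \<in> dual p" and m: "\<And>f. f \<in> core p \<Longrightarrow> cmod (T f) \<le> C * D_norm p m f" "0 \<le> C"
  and e: "0 < e"
 shows "\<exists>R\<ge>1. \<forall>\<psi>\<in>core p. cmod (T (\<lambda>x. tail_cutoff R x * \<psi> x)) \<le> e * D_norm p m \<psi>"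
proof -
 have p': "1 \<le> p" using p by simp
 obtain K where K: "1 \<le> K" "\<And>R (\<psi> :: 'n cfun). 1 \<le> R \<Longrightarrow> \<psi> \<in> D_L p \<Longrightarrow>
   D_norm p m (\<lambda>x. cutoff R x * \<psi> x) \<le> K * D_norm p m \<psi>"
  using D_norm_cutoff_le[OF p', of m] by blast
 have "0 < e / K" using e K(1) by simp
 then obtain R where R: "1 \<le> R" "\<And>\<psi>. \<psi> \<in> test_functions \<Longrightarrow> cmod (T (\<lambda>x. tail_cutoff R x * \<psi> x)) \<le> (e / K) * D_norm p m \<psi>"
  using dual_tail_small[OF p T m(2,1)] by blast
 have "cmod (T (\<lambda>x. tail_cutoff R x * \<psi> x)) \<le> e * D_norm p m \<psi>" if \<psi>: "\<psi> \<in> core p" for \<psi>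
 proof (rule LIMSEQ_le_const2)
  have \<psi>D: "\<psi> \<in> D_L p" using core_subset_D_L[OF \<psi>] .
  have "(\<lambda>x. tail_cutoff R x * \<psi> x) \<in> core p" using tail_cutoff_core[OF p' _ \<psi>] R(1) by simp
  from tendsto_norm[OF dual_cutoff_tendsto[OF p' T this]]
  show "(\<lambda>k. cmod (T (\<lambda>x. cutoff (real k) x * (tail_cutoff R x * \<psi> x)))) \<longlonglongrightarrow> cmod (T (\<lambda>x. tail_cutoff R x * \<psi> x))" .
  have "cmod (T (\<lambda>x. cutoff (real k) x * (tail_cutoff R x * \<psi> x))) \<le> e * D_norm p m \<psi>" if "1 \<le> k" for k
  proof -
   have k: "1 \<le> real k" using that by simp
   have "cmod (T (\<lambda>x. tail_cutoff R x * (cutoff (real k) x * \<psi> x))) \<le> (e / K) * D_norm p m (\<lambda>x. cutoff (real k) x * \<psi> x)"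
    using R(2) cutoff_mult_test[OF D_L_smooth[OF \<psi>D]] k by simp
   also have "... \<le> (e / K) * (K * D_norm p m \<psi>)"
    using K(2)[OF k \<psi>D] e K(1) by (intro mult_left_mono) auto
   finally show ?thesis using K(1) by (simp add: mult.left_commute)
  qed
  then show "\<exists>N. \<forall>k\<ge>N. cmod (T (\<lambda>x. cutoff (real k) x * (tail_cutoff R x * \<psi> x))) \<le> e * D_norm p m \<psi>" by blast
 qed
 then show ?thesis using R(1) by blast
qed

subsection \<open>Density of the test functions\<close>

text \<open>A Riemann sum: the covering balls are made disjoint one by one, and the weight of a node
  is the measure of its piece. The weights are chosen before \<open>G\<close>, so one formula serves
  all Lipschitz functions simultaneously.\<close>

lemma finite_quadrature:
 fixes J :: "(real ^ 'n) set"
 assumes "finite J" "A \<in> sets borel" "A \<subseteq> cball 0 r" "A \<subseteq> (\<Union>y\<in>J. ball y h)"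
 shows "\<exists>v. \<forall>G :: 'n cfun. \<forall>L\<ge>0. continuous_on UNIV G \<longrightarrow> (\<forall>y z. cmod (G y - G z) \<le> L * dist y z) \<longrightarrow>
  cmod ((LBINT x. indicator A x *\<^sub>R G x) - (\<Sum>y\<in>J. complex_of_real (v y) * G y)) \<le> L * h * measure lborel A"
 using assms
proof (induction J arbitrary: A rule: finite_induct)
 case empty
 then show ?case by auto
next
 case (insert y J)
 let ?A1 = "A \<inter> ball y h" and ?A2 = "A - ball y h"
 have m: "A \<in> sets borel" "?A1 \<in> sets borel" "?A2 \<in> sets borel" using insert.prems(1) by auto
 note [measurable] = m
 have "?A2 \<subseteq> (\<Union>y\<in>J. ball y h)" using insert.prems(3) by auto
 then obtain v where v: "\<And>(G :: 'n cfun) L. 0 \<le> L \<Longrightarrow> continuous_on UNIV G \<Longrightarrow> (\<forall>y z. cmod (G y - G z) \<le> L * dist y z) \<Longrightarrow>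
  cmod ((LBINT x. indicator ?A2 x *\<^sub>R G x) - (\<Sum>y\<in>J. complex_of_real (v y) * G y)) \<le> L * h * measure lborel ?A2"
  using insert.IH[OF m(3)] insert.prems(2) by blast
 have fin: "emeasure lborel A < \<infinity>"
  using emeasure_mono[OF insert.prems(2), of lborel] emeasure_lborel_cball_finite[of "0 :: real ^ 'n" r]
  by (auto intro: le_less_trans)
 have fin1: "emeasure lborel ?A1 < \<infinity>" "emeasure lborel ?A2 < \<infinity>"
  using emeasure_mono[of ?A1 A lborel] emeasure_mono[of ?A2 A lborel] fin m by (auto intro: le_less_trans)
 have sum: "measure lborel A = measure lborel ?A1 + measure lborel ?A2"
  using measure_Union[of lborel ?A1 ?A2] fin1 m by (auto simp: Int_Diff_Un less_top)
 \<comment> \<open>The new node takes the part of \<open>A\<close> inside its ball; the induction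
   hypothesis distributes the rest over the other nodes.\<close>
 let ?v = "v(y := measure lborel ?A1)"
 show ?case
 proof (intro exI[of _ ?v] allI impI)
  fix G :: "'n cfun" and L :: real
  assume L: "0 \<le> L" and G: "continuous_on UNIV G" "\<forall>y z. cmod (G y - G z) \<le> L * dist y z"
  have iB: "integrable lborel (\<lambda>x. indicator (cball 0 r) x *\<^sub>R G x)"
   by (rule borel_integrable_compact) (auto intro: continuous_on_subset[OF G(1)])
  have i: "integrable lborel (\<lambda>x. indicator S x *\<^sub>R G x)" if "S \<in> sets borel" "S \<subseteq> A" for S
  proof -
   have "integrable lborel (\<lambda>x. indicator S x *\<^sub>R (indicator (cball 0 r) x *\<^sub>R G x))"
    using that(1) by (intro integrable_mult_indicator iB) simp
   moreover have "(\<lambda>x. indicator S x *\<^sub>R (indicator (cball 0 r) x *\<^sub>R G x)) = (\<lambda>x. indicator S x *\<^sub>R G x)"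
    using that(2) insert.prems(2) by (auto simp: fun_eq_iff indicator_def)
   ultimately show ?thesis by simp
  qed
  have i1: "integrable lborel (\<lambda>x. indicator ?A1 x *\<^sub>R G x)" and i2: "integrable lborel (\<lambda>x. indicator ?A2 x *\<^sub>R G x)"
   using i m by auto
  have ic: "integrable lborel (\<lambda>x. indicator ?A1 x *\<^sub>R c)" for c :: complex
   using fin1(1) m(2) by (intro integrable_scaleR_left integrable_real_indicator) auto
  have "(\<lambda>x. indicator A x *\<^sub>R G x) = (\<lambda>x. indicator ?A1 x *\<^sub>R G x + indicator ?A2 x *\<^sub>R G x)"
   by (auto simp: fun_eq_iff indicator_def)
  then have IA: "(LBINT x. indicator A x *\<^sub>R G x) = (LBINT x. indicator ?A1 x *\<^sub>R G x) + (LBINT x. indicator ?A2 x *\<^sub>R G x)"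
   using i1 i2 by simp
  have Ic: "(LBINT x. indicator ?A1 x *\<^sub>R G y) = of_real (measure lborel ?A1) * G y"
   using fin1(1) m(2) by (simp add: scaleR_conv_of_real[where 'a = complex])
  have "cmod ((LBINT x. indicator ?A1 x *\<^sub>R G x) - of_real (measure lborel ?A1) * G y) =
    cmod (LBINT x. indicator ?A1 x *\<^sub>R G x - indicator ?A1 x *\<^sub>R G y)"
   unfolding Ic[symmetric] using Bochner_Integration.integral_diff[OF i1 ic] by simp
  also have "... \<le> (LBINT x. cmod (indicator ?A1 x *\<^sub>R G x - indicator ?A1 x *\<^sub>R G y))"
   by (rule integral_norm_bound)
  also have "... \<le> (LBINT x. indicator ?A1 x * (L * h))"
  proof (rule integral_mono)
   show "integrable lborel (\<lambda>x. cmod (indicator ?A1 x *\<^sub>R G x - indicator ?A1 x *\<^sub>R G y))"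
    by (intro integrable_norm Bochner_Integration.integrable_diff i1 ic)
   show "integrable lborel (\<lambda>x. indicator ?A1 x * (L * h))"
    using fin1(1) m(2) by (intro integrable_mult_left integrable_real_indicator) auto
   fix x
   show "cmod (indicator ?A1 x *\<^sub>R G x - indicator ?A1 x *\<^sub>R G y) \<le> indicator ?A1 x * (L * h)"
   proof (cases "x \<in> ?A1")
    case True
    have "cmod (G x - G y) \<le> L * dist x y" using G(2) by blast
    also have "... \<le> L * h" using True L by (intro mult_left_mono) (auto simp: dist_commute)
    finally show ?thesis using True by simp
   qed simp
  qed
  also have "... = L * h * measure lborel ?A1"
   using fin1(1) m(2) by simp
  finally have 1: "cmod ((LBINT x. indicator ?A1 x *\<^sub>R G x) - of_real (measure lborel ?A1) * G y) \<le> L * h * measure lborel ?A1" .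
  have S: "(\<Sum>z\<in>insert y J. complex_of_real (?v z) * G z) = of_real (measure lborel ?A1) * G y + (\<Sum>z\<in>J. complex_of_real (v z) * G z)"
  proof -
   have "(\<Sum>z\<in>J. complex_of_real (?v z) * G z) = (\<Sum>z\<in>J. complex_of_real (v z) * G z)"
    using insert.hyps(2) by (intro sum.cong) auto
   then show ?thesis using insert.hyps by simp
  qed
  show "cmod ((LBINT x. indicator A x *\<^sub>R G x) - (\<Sum>z\<in>insert y J. complex_of_real (?v z) * G z)) \<le> L * h * measure lborel A"
   unfolding IA S sum
   using norm_triangle_mono[OF 1 v[OF L G]] by (simp add: algebra_simps)
 qed
qed

text \<open>An approximate point mass at \<open>y\<close>: for \<open>d > 0\<close>, integrating a
  continuous function against it gives the mollified value at \<open>y\<close>. Combinations of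
  point values thereby become integrals against test functions.\<close>

definition bump_at :: "real \<Rightarrow> real ^ 'n \<Rightarrow> 'n cfun" where
 "bump_at d y x = of_real (inverse d ^ CARD('n)) * mollifier (inverse d *\<^sub>R (y - x))"

lemma mollifier_even: "mollifier (inverse d *\<^sub>R (x - y)) = mollifier (inverse d *\<^sub>R (y - x))"
proof -
 have "norm (inverse d *\<^sub>R (x - y)) = norm (inverse d *\<^sub>R (y - x))"
  by (simp add: norm_minus_commute)
 then show ?thesis unfolding mollifier_def bump_def by (simp only:)
qed

lemma bump_at_affine: "bump_at d y = (\<lambda>x :: real ^ 'n. of_real (inverse d ^ CARD('n)) * mollifier (inverse d *\<^sub>R y + (- inverse d) *\<^sub>R x))"
 by (simp add: bump_at_def fun_eq_iff scaleR_diff_right)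

lemma smooth_bump_at: "smooth (bump_at d y)"
 unfolding bump_at_affine
 by (intro smooth_cmult smooth_affine test_smooth[OF test_mollifier])

lemma iter_deriv_bump_at:
 fixes x y :: "real ^ 'n"
 shows "iter_deriv ks (bump_at d y) x =
 of_real (inverse d ^ CARD('n)) * (of_real ((- inverse d) ^ length ks) * iter_deriv ks mollifier (inverse d *\<^sub>R (y - x)))"
proof -
 have arg: "inverse d *\<^sub>R y + (- inverse d) *\<^sub>R x = inverse d *\<^sub>R (y - x)"
  by (simp add: scaleR_diff_right)
 show ?thesis
  unfolding bump_at_affine iter_deriv_cmult[OF smooth_affine[OF test_smooth[OF test_mollifier]]]
   iter_deriv_affine[OF test_smooth[OF test_mollifier]] arg ..
qed

lemma test_bump_at:
 fixes y :: "real ^ 'n"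
 assumes d: "0 < d"
 shows "bump_at d y \<in> test_functions"
proof (rule test_functionsI[OF smooth_bump_at])
 fix x :: "real ^ 'n" assume "norm y + d < norm x"
 then have "d < norm (y - x)" using norm_triangle_ineq2[of x y] by (simp add: norm_minus_commute)
 then have "1 < norm (inverse d *\<^sub>R (y - x))" using d unfolding norm_scaleR by (simp add: field_simps)
 then show "bump_at d y x = 0" by (simp add: bump_at_def mollifier_eq_0)
qed

lemma average_eq_integral_bump_at:
 fixes u :: "'n::finite cfun"
 assumes u: "continuous_on UNIV u" and d: "0 < d"
 shows "average mollifier d u y = (LBINT x. bump_at d y x * u x)"
  and "integrable lborel (\<lambda>x. bump_at d y x * u x)"
proof -
 note cv = average_change_of_variables[OF u test_mollifier d, of y]
 have E: "bump_at d y x * u x = of_real (inverse d ^ CARD('n)) * (u x * mollifier (inverse d *\<^sub>R (x - y)))" for x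
  unfolding bump_at_def mollifier_even[of d x y] by (simp add: mult_ac)
 show "average mollifier d u y = (LBINT x. bump_at d y x * u x)"
  unfolding E cv(1) by simp
 show "integrable lborel (\<lambda>x. bump_at d y x * u x)"
  unfolding E using cv(2) by simp
qed

lemma cmod_le_D_norm_infinity:
 fixes \<psi> :: "'n::finite cfun"
 assumes \<psi>: "\<psi> \<in> D_L \<infinity>" and ks: "length ks \<le> m"
 shows "cmod (iter_deriv ks \<psi> x) \<le> D_norm \<infinity> m \<psi>"
proof -
 have s: "smooth \<psi>" using D_L_smooth[OF \<psi>] .
 have "cmod (iter_deriv ks \<psi> x) \<le> Lp_norm \<infinity> (iter_deriv ks \<psi>)"
  by (rule cmod_le_Lp_norm_infinity[OF smooth_continuous[OF smooth_iter_deriv[OF s]] D_L_in_Lp[OF \<psi>]])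
 also have "... \<le> D_norm \<infinity> m \<psi>" using Lp_norm_le_weighted_norm[OF s ks, of \<infinity> "\<lambda>_. 1"] by simp
 finally show ?thesis .
qed

text \<open>Quadrature of the convolution integral replaces a mollified function by finitely many
  bumps whose coefficients are point values. Nodes and weights are common to all
  \<open>\<psi>\<close> in a ball of order 1, so that \<open>T\<close> of the approximation is a
  fixed combination of point evaluations.\<close>

lemma mollify_quadrature:
 assumes t: "0 < t" and e: "0 < e" and R: "0 < R" and b0: "0 \<le> b"
 shows "\<exists>J v. finite J \<and> (\<forall>\<psi> :: 'n::finite cfun. \<psi> \<in> D_L \<infinity> \<longrightarrow> D_norm \<infinity> 1 \<psi> \<le> b \<longrightarrow>
  (\<forall>x ks. norm x \<le> R \<longrightarrow> length ks \<le> m \<longrightarrow>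
   cmod (iter_deriv ks (\<lambda>x. average mollifier t \<psi> x - (\<Sum>y\<in>J. (complex_of_real (v y) * \<psi> y) * bump_at t y x)) x) \<le> e))"
proof -
 let ?n = "real CARD('n)"
 have tk: "iter_deriv ks mollifier \<in> test_functions" for ks :: "'n list"
  using test_iter_deriv[OF test_mollifier] .
 obtain M0 where M0: "0 \<le> M0" "\<And>(ks :: 'n list) x. length ks \<le> Suc m \<Longrightarrow> cmod (iter_deriv ks mollifier x) \<le> M0"
  using smooth_bounded_uniform[OF test_smooth_bounded[OF test_mollifier], of "Suc m"] by blast
 have klip: "cmod (iter_deriv ks mollifier x - iter_deriv ks mollifier y) \<le> ?n * M0 * dist x y" if ks: "length ks \<le> m" for ks :: "'n list" and x y
 proof -
  have "cmod (partial_deriv i (iter_deriv ks mollifier) x) \<le> M0" for i x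
   using M0(2)[of "ks @ [i]" x] ks by (simp add: iter_deriv_append iter_deriv_Cons)
  from smooth_bounded_lipschitz[OF smooth_differentiable[OF test_smooth[OF tk]] this, of y "x - y"]
  show ?thesis by (simp add: dist_norm)
 qed
 define r where "r = R + t"
 \<comment> \<open>Lipschitz constant of the product of \<open>\<psi>\<close>, with bound
   \<open>b\<close> and Lipschitz constant \<open>n * b\<close>, and a rescaled kernel derivative,
   with bound \<open>M0\<close> and Lipschitz constant \<open>n * M0 / t\<close>.\<close>
 define L where "L = ?n * b * M0 + b * (?n * M0 * inverse t)"
 have L0: "0 \<le> L" using b0 M0(1) t by (simp add: L_def)
 let ?D = "cball 0 r :: (real ^ 'n) set"
 \<comment> \<open>Majorant of the powers of \<open>1 / t\<close> produced by up to \<open>m\<close>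
   derivatives of the kernel and by the change of variables.\<close>
 define F where "F = (1 + inverse t) ^ m * inverse t ^ CARD('n)"
 have F0: "0 \<le> F" using t by (simp add: F_def)
 define h where "h = e / (F * L * measure lborel ?D + 1)"
 have Dn: "0 < F * L * measure lborel ?D + 1" using F0 L0 by (simp add: add_nonneg_pos)
 have h: "0 < h" using e Dn by (simp add: h_def)
 obtain J where J: "finite J" "?D \<subseteq> (\<Union>y\<in>J. ball y h)"
 proof -
  have "\<exists>X. finite X \<and> X \<subseteq> ?D \<and> ?D \<subseteq> (\<Union>x\<in>X. ball x h)"
   using seq_compact_imp_totally_bounded[OF compact_imp_seq_compact[OF compact_cball[of "0 :: real ^ 'n" r]]] h by simp
  then show ?thesis using that by (elim exE conjE)
 qed
 obtain v where v: "\<And>(G :: 'n cfun) L. 0 \<le> L \<Longrightarrow> continuous_on UNIV G \<Longrightarrow> (\<forall>y z. cmod (G y - G z) \<le> L * dist y z) \<Longrightarrow>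
  cmod ((LBINT x. indicator ?D x *\<^sub>R G x) - (\<Sum>y\<in>J. complex_of_real (v y) * G y)) \<le> L * h * measure lborel ?D"
 proof -
  have D: "?D \<in> sets borel" by auto
  from finite_quadrature[OF J(1) D order_refl J(2)] obtain v where
   v: "\<forall>G :: 'n cfun. \<forall>L\<ge>0. continuous_on UNIV G \<longrightarrow> (\<forall>y z. cmod (G y - G z) \<le> L * dist y z) \<longrightarrow>
    cmod ((LBINT x. indicator ?D x *\<^sub>R G x) - (\<Sum>y\<in>J. complex_of_real (v y) * G y)) \<le> L * h * measure lborel ?D"
   by (elim exE)
  show ?thesis by (rule that) (rule v[THEN spec, THEN spec, THEN mp, THEN mp, THEN mp])
 qed
 have "cmod (iter_deriv ks (\<lambda>x. average mollifier t \<psi> x - (\<Sum>y\<in>J. (complex_of_real (v y) * \<psi> y) * bump_at t y x)) x) \<le> e"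
  if \<psi>: "\<psi> \<in> D_L \<infinity>" and b: "D_norm \<infinity> 1 \<psi> \<le> b" and x: "norm x \<le> R" and ks: "length ks \<le> m" for \<psi> x ks
 proof -
  have sb: "smooth_bounded \<psi>" using \<psi> D_L_infinity_smooth_bounded by blast
  have s\<psi>: "smooth \<psi>" using D_L_smooth[OF \<psi>] .
  have c\<psi>: "continuous_on UNIV \<psi>" using smooth_continuous[OF s\<psi>] .
  have \<psi>b: "cmod (\<psi> z) \<le> b" for z using order_trans[OF cmod_le_D_norm_infinity[OF \<psi>, of "[]" 1 z] b] by simp
  have "cmod (partial_deriv i \<psi> z) \<le> b" for i z
   using order_trans[OF cmod_le_D_norm_infinity[OF \<psi>, of "[i]" 1 z] b] by (simp add: iter_deriv_Cons)
  from smooth_bounded_lipschitz[OF smooth_differentiable[OF s\<psi>] this]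
  have \<psi>l: "cmod (\<psi> y - \<psi> z) \<le> ?n * b * dist y z" for y z
   by (metis add.commute diff_add_cancel dist_norm)
  let ?k = "\<lambda>z. iter_deriv ks mollifier (inverse t *\<^sub>R (z - x))"
  let ?G = "\<lambda>z. \<psi> z * ?k z"
  have ck: "continuous_on UNIV ?k"
   by (intro continuous_on_compose2[OF smooth_continuous[OF test_smooth[OF tk]]] continuous_intros) auto
  have cG: "continuous_on UNIV ?G" by (intro continuous_intros c\<psi> ck)
  have lG: "\<forall>y z. cmod (?G y - ?G z) \<le> L * dist y z"
  proof (intro allI)
   fix y z
   have "?G y - ?G z = (\<psi> y - \<psi> z) * ?k y + \<psi> z * (?k y - ?k z)" by (simp add: algebra_simps)
   then have "cmod (?G y - ?G z) \<le> cmod (\<psi> y - \<psi> z) * cmod (?k y) + cmod (\<psi> z) * cmod (?k y - ?k z)"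
    by (metis norm_mult norm_triangle_ineq)
   also have "... \<le> (?n * b * dist y z) * M0 + b * (?n * M0 * (inverse t * dist y z))"
   proof (intro add_mono mult_mono \<psi>l \<psi>b M0(2))
    have "cmod (?k y - ?k z) \<le> ?n * M0 * dist (inverse t *\<^sub>R (y - x)) (inverse t *\<^sub>R (z - x))"
     by (rule klip[OF ks])
    also have "dist (inverse t *\<^sub>R (y - x)) (inverse t *\<^sub>R (z - x)) = inverse t * dist y z"
     using t by (simp add: dist_norm flip: scaleR_diff_right)
    finally show "cmod (?k y - ?k z) \<le> ?n * M0 * (inverse t * dist y z)" .
   qed (use ks b0 M0(1) t in auto)
   finally show "cmod (?G y - ?G z) \<le> L * dist y z" by (simp add: L_def algebra_simps)
  qed
  have "?G z = 0" if "z \<notin> ?D" for z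
  proof -
   have "t < norm (z - x)" using that x norm_triangle_ineq2[of z x] by (simp add: r_def)
   then have n1: "1 < norm (inverse t *\<^sub>R (z - x))" using t unfolding norm_scaleR by (simp add: field_simps)
   have "?k z = 0"
    by (rule iter_deriv_support[of 1 mollifier "inverse t *\<^sub>R (z - x)" ks]) (rule mollifier_eq_0, assumption, rule n1)
   then show ?thesis by (simp only: mult_zero_right)
  qed
  then have ID: "(\<lambda>z. indicator ?D z *\<^sub>R ?G z) = ?G" by (auto simp: fun_eq_iff indicator_def)
  have q: "cmod ((LBINT z. ?G z) - (\<Sum>y\<in>J. complex_of_real (v y) * ?G y)) \<le> L * h * measure lborel ?D"
   using v[OF L0 cG lG] unfolding ID .
  let ?a = "complex_of_real ((- inverse t) ^ length ks)" and ?d = "complex_of_real (inverse t ^ CARD('n))"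
  have "iter_deriv ks (average mollifier t \<psi>) x = ?a * average (iter_deriv ks mollifier) t \<psi> x"
   unfolding iter_deriv_average[OF sb test_mollifier]
   using average_iter_deriv_by_parts[OF s\<psi> test_mollifier, of t ks x] t by (simp add: divide_inverse)
  also have "... = ?a * (?d * (LBINT z. ?G z))"
   by (simp only: average_change_of_variables(1)[OF c\<psi> tk t])
  finally have 1: "iter_deriv ks (average mollifier t \<psi>) x = ?a * (?d * (LBINT z. ?G z))" .
  have "iter_deriv ks (\<lambda>x. \<Sum>y\<in>J. (complex_of_real (v y) * \<psi> y) * bump_at t y x) x =
    (\<Sum>y\<in>J. (complex_of_real (v y) * \<psi> y) * iter_deriv ks (bump_at t y) x)"
   by (subst iter_deriv_sum) (auto simp: iter_deriv_cmult smooth_cmult smooth_bump_at)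
  also have "... = ?a * (?d * (\<Sum>y\<in>J. complex_of_real (v y) * ?G y))"
   unfolding iter_deriv_bump_at sum_distrib_left by (intro sum.cong) (auto simp: mult_ac)
  finally have 2: "iter_deriv ks (\<lambda>x. \<Sum>y\<in>J. (complex_of_real (v y) * \<psi> y) * bump_at t y x) x =
    ?a * (?d * (\<Sum>y\<in>J. complex_of_real (v y) * ?G y))" .
  have "iter_deriv ks (\<lambda>x. average mollifier t \<psi> x - (\<Sum>y\<in>J. (complex_of_real (v y) * \<psi> y) * bump_at t y x)) x =
    iter_deriv ks (average mollifier t \<psi>) x - iter_deriv ks (\<lambda>x. \<Sum>y\<in>J. (complex_of_real (v y) * \<psi> y) * bump_at t y x) x"
  proof (subst iter_deriv_diff)
   show "smooth (\<lambda>x. \<Sum>y\<in>J. complex_of_real (v y) * \<psi> y * bump_at t y x)"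
    by (rule smooth_sum) (rule smooth_cmult, rule smooth_bump_at)
  qed (auto intro: smooth_average sb test_mollifier)
  also have "... = ?a * (?d * ((LBINT z. ?G z) - (\<Sum>y\<in>J. complex_of_real (v y) * ?G y)))"
   unfolding 1 2 by (simp only: right_diff_distrib)
  finally have "cmod (iter_deriv ks (\<lambda>x. average mollifier t \<psi> x - (\<Sum>y\<in>J. (complex_of_real (v y) * \<psi> y) * bump_at t y x)) x) =
    inverse t ^ length ks * (inverse t ^ CARD('n) * cmod ((LBINT z. ?G z) - (\<Sum>y\<in>J. complex_of_real (v y) * ?G y)))"
   using t by (simp add: norm_mult norm_power norm_inverse)
  also have "... \<le> (1 + inverse t) ^ m * (inverse t ^ CARD('n) * (L * h * measure lborel ?D))"
  proof (intro mult_mono q)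
   have "inverse t ^ length ks \<le> (1 + inverse t) ^ length ks" using t by (intro power_mono) auto
   also have "... \<le> (1 + inverse t) ^ m" using t ks by (intro power_increasing) auto
   finally show "inverse t ^ length ks \<le> (1 + inverse t) ^ m" .
  qed (use t L0 h in auto)
  also have "... = (F * L * measure lborel ?D) * h" by (simp add: F_def mult_ac)
  also have "... \<le> (F * L * measure lborel ?D + 1) * h" using h by (intro mult_right_mono) auto
  also have "... = e" unfolding h_def using Dn by (metis less_irrefl nonzero_mult_div_cancel_left times_divide_eq_right)
  finally show ?thesis .
 qed
 then show ?thesis using J(1) by blast
qed

lemma weighted_cutoff_local:
 fixes w :: "'n::finite cfun"
 assumes R: "1 \<le> R" and w: "smooth w" and c: "0 \<le> c"
  and bd: "\<And>R ks x. 1 \<le> R \<Longrightarrow> length ks \<le> m \<Longrightarrow> cmod (iter_deriv ks (cutoff R) (x :: real ^ 'n)) \<le> c * indicator (cball 0 (2 * R)) x"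
  and e: "0 \<le> e" and le: "\<And>x ks. norm x \<le> 2 * R \<Longrightarrow> length ks \<le> m \<Longrightarrow> cmod (iter_deriv ks w x) \<le> e"
 shows "D_norm \<infinity> m (\<lambda>x. cutoff R x * w x) \<le> leibniz_const TYPE('n) m * c * e"
proof (rule weighted_norm_leI)
 fix ks :: "'n list" assume ks: "length ks \<le> m"
 have "Lp_ball \<infinity> (2 ^ m * c * (\<Sum>ls :: 'n list | length ls \<le> m. e)) (\<lambda>x. 1 * iter_deriv ks (\<lambda>x. cutoff R x * w x) x)"
 proof (rule Lp_ball_Leibniz[OF _ smooth_cutoff w c bd[OF R] _ _ _ ks])
  fix ls :: "'n list" assume ls: "length ls \<le> m"
  have m: "iter_deriv ls w \<in> borel_measurable borel"
   using borel_measurable_continuous[OF smooth_continuous[OF smooth_iter_deriv[OF w]]] .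
  have cb: "cball 0 (2 * R) \<in> sets (borel :: (real ^ 'n) measure)" by auto
  show "Lp_ball \<infinity> e (\<lambda>x. of_real (indicator (cball 0 (2 * R)) x) * (1 * iter_deriv ls w x))"
  proof (rule bounded_in_Lp_infinity[OF _ e])
   have "(\<lambda>x :: real ^ 'n. complex_of_real (indicator (cball 0 (2 * R)) x)) \<in> borel_measurable borel"
    by (rule borel_measurable_complex_of_real[OF borel_measurable_indicator[OF cb]])
   then show "(\<lambda>x. of_real (indicator (cball 0 (2 * R)) x) * (1 * iter_deriv ls w x)) \<in> borel_measurable lborel"
    using m by simp
   show "cmod (of_real (indicator (cball 0 (2 * R)) x) * (1 * iter_deriv ls w x)) \<le> e" for x
    using le[OF _ ls, of x] e by (auto simp: indicator_def)
  qed
 qed auto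
 then show "Lp_ball \<infinity> (leibniz_const TYPE('n) m * c * e) (\<lambda>x. 1 * iter_deriv ks (\<lambda>x. cutoff R x * w x) x)"
  by (simp add: leibniz_const_def mult_ac)
qed

text \<open>Four errors of size \<open>e / 4\<close>: dropping the tail, mollifying at scale
  \<open>h\<close>, replacing the mollification by a quadrature sum, and mollifying point values at
  a second scale \<open>\<epsilon>\<close>. The third turns \<open>T\<close> into a combination of
  point evaluations, the fourth turns these into integration against a test function.\<close>

theorem test_functions_dense_in_dual:
 fixes T :: "'n::finite functional"
 assumes T: "T \<in> dual \<infinity>" and B: "D_bounded \<infinity> B" and e: "0 < e"
 shows "\<exists>f\<in>test_functions. \<forall>\<psi>\<in>B. cmod (T \<psi> - (LBINT x. f x * \<psi> x)) \<le> e"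
proof -
 let ?n = "real CARD('n)"
 have p: "1 < (\<infinity> :: ennreal)" "1 \<le> (\<infinity> :: ennreal)" by auto
 obtain m C where C: "0 \<le> C" "\<And>f. f \<in> core \<infinity> \<Longrightarrow> cmod (T f) \<le> C * D_norm \<infinity> m f"
  using dual_bound[OF p(2) T] by blast
 have Bc: "\<psi> \<in> core \<infinity>" "\<psi> \<in> D_L \<infinity>" "smooth_bounded \<psi>" "smooth \<psi>" if "\<psi> \<in> B" for \<psi>
  using that B core_subset_D_L D_L_infinity_smooth_bounded smooth_bounded_smooth unfolding D_bounded_def by blast+
 obtain b0 where b0: "\<And>\<psi>. \<psi> \<in> B \<Longrightarrow> D_norm \<infinity> (Suc m) \<psi> \<le> b0" using B unfolding D_bounded_def by blast
 define b where "b = max b0 1"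
 have b: "1 \<le> b" "\<And>\<psi>. \<psi> \<in> B \<Longrightarrow> D_norm \<infinity> (Suc m) \<psi> \<le> b" using b0 by (auto simp: b_def intro: max.coboundedI1)
 have bj: "D_norm \<infinity> j \<psi> \<le> b" if "\<psi> \<in> B" "j \<le> Suc m" for \<psi> j
  using order_trans[OF weighted_norm_mono_order[OF Bc(4)[OF that(1)] that(2)] b(2)[OF that(1)]] .
 have "0 < e / (4 * b)" using e b(1) by simp
 then obtain R where R: "1 \<le> R" "\<And>\<psi>. \<psi> \<in> core \<infinity> \<Longrightarrow> cmod (T (\<lambda>x. tail_cutoff R x * \<psi> x)) \<le> e / (4 * b) * D_norm \<infinity> m \<psi>"
  using dual_tail_small_core[OF p(1) T C(2,1)] by blast
 have R0: "0 < R" using R(1) by simp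
 obtain c where c: "1 \<le> c" "\<And>R ks x. 1 \<le> R \<Longrightarrow> length ks \<le> m \<Longrightarrow>
   cmod (iter_deriv ks (cutoff R) (x :: real ^ 'n)) \<le> c * indicator (cball 0 (2 * R)) x"
  using cutoff_mult_cutoff_bound[of m] by blast
 define L where "L = leibniz_const TYPE('n) m * c"
 have L0: "0 \<le> L" unfolding L_def using c(1) by (intro mult_nonneg_nonneg leibniz_const_nonneg) auto
 have cut: "cmod (T (\<lambda>x. cutoff R x * w x)) \<le> (C * L) * d"
  if "smooth w" "0 \<le> d" "\<And>x ks. norm x \<le> 2 * R \<Longrightarrow> length ks \<le> m \<Longrightarrow> cmod (iter_deriv ks w x) \<le> d" for w d
 proof -
  have "D_norm \<infinity> m (\<lambda>x. cutoff R x * w x) \<le> L * d"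
   unfolding L_def by (rule weighted_cutoff_local[OF R(1) that(1) _ c(2) that(2,3)]) (use c(1) in auto)
  then show ?thesis
   using order_trans[OF C(2)[OF cutoff_core[OF p(2) that(1) R0]] mult_left_mono[OF _ C(1)]] by (simp add: mult.assoc)
 qed
 \<comment> \<open>By \<open>cut\<close>, an error of \<open>e / (4 * D)\<close> in the derivatives
   up to order \<open>m\<close> on the ball of radius \<open>2 * R\<close> changes the value of
   \<open>T\<close> after the cutoff by at most \<open>e / 4\<close>.\<close>
 define D where "D = C * L + 1"
 have D: "0 < D" using C(1) L0 by (simp add: D_def add_nonneg_pos)
 have DD: "(C * L) * (e / (4 * D)) \<le> e / 4"
 proof -
  have "(C * L) * (e / (4 * D)) \<le> D * (e / (4 * D))" using e D by (intro mult_right_mono) (auto simp: D_def)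
  also have "... = e / 4" using D by simp
  finally show ?thesis .
 qed
 define h where "h = e / (4 * D) / (?n * b)"
 have h: "0 < h" using e D b(1) by (simp add: h_def)
 let ?P = "\<lambda>h. average (mollifier :: 'n cfun) h"
 have sP: "smooth (?P h \<psi>)" if "\<psi> \<in> B" for h \<psi> using Bc(3)[OF that] smooth_average test_mollifier by blast
 have Pdiff: "cmod (iter_deriv ks (\<lambda>x. \<psi> x - ?P h \<psi> x) x) \<le> h * (?n * b)"
  if \<psi>: "\<psi> \<in> B" and ks: "length ks \<le> m" and h: "0 < h" for \<psi> ks x h
 proof -
  have sd: "smooth (\<lambda>x. \<psi> x - ?P h \<psi> x)" using smooth_diff Bc(4)[OF \<psi>] sP[OF \<psi>] by blast
  have "Lp_ball \<infinity> b (partial_deriv i (iter_deriv ks \<psi>))" for i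
   using Lp_ball_mono[OF D_norm_ball[OF p(2) Bc(2)[OF \<psi>], of "ks @ [i]" "Suc m"] b(2)[OF \<psi>]] ks
   by (simp add: iter_deriv_append iter_deriv_Cons)
  from Lp_ball_mollify_diff_gradient[OF p(2) smooth_iter_deriv[OF Bc(4)[OF \<psi>]] h this]
  have ball: "Lp_ball \<infinity> (h * (?n * b)) (iter_deriv ks (\<lambda>x. \<psi> x - ?P h \<psi> x))"
   by (simp add: iter_deriv_diff Bc(4)[OF \<psi>] sP[OF \<psi>] iter_deriv_average[OF Bc(3)[OF \<psi>] test_mollifier])
  have "cmod (iter_deriv ks (\<lambda>x. \<psi> x - ?P h \<psi> x) x) \<le> Lp_norm \<infinity> (iter_deriv ks (\<lambda>x. \<psi> x - ?P h \<psi> x))"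
   using ball smooth_continuous[OF smooth_iter_deriv[OF sd]] unfolding Lp_ball_def by (intro cmod_le_Lp_norm_infinity) auto
  also have "... \<le> h * (?n * b)" using ball unfolding Lp_ball_def by blast
  finally show ?thesis .
 qed
 have "0 < e / (4 * D)" "0 < 2 * R" "0 \<le> b" using e D R0 b(1) by auto
 from mollify_quadrature[OF h this, of m] obtain J v where J: "finite J"
  "\<And>(\<psi> :: 'n cfun) x ks. \<psi> \<in> D_L \<infinity> \<Longrightarrow> D_norm \<infinity> 1 \<psi> \<le> b \<Longrightarrow> norm x \<le> 2 * R \<Longrightarrow> length ks \<le> m \<Longrightarrow>
   cmod (iter_deriv ks (\<lambda>x. ?P h \<psi> x - (\<Sum>y\<in>J. (complex_of_real (v y) * \<psi> y) * bump_at h y x)) x) \<le> e / (4 * D)"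
  by blast
 \<comment> \<open>The coefficient of evaluation at the node \<open>y\<close>: \<open>T\<close>
   applied to the quadrature sum is linear in the values of \<open>\<psi>\<close> at the
   nodes.\<close>
 define d where "d y = of_real (v y) * T (\<lambda>x. cutoff R x * bump_at h y x)" for y
 define S where "S = (\<Sum>y\<in>J. cmod (d y)) + 1"
 have S: "0 < S" by (simp add: S_def sum_nonneg add_nonneg_pos)
 \<comment> \<open>The second scale is chosen last, since it must beat the total size of the
   coefficients, which depends on \<open>h\<close>.\<close>
 define \<epsilon> where "\<epsilon> = e / (4 * S * (?n * b))"
 have \<epsilon>: "0 < \<epsilon>" using e S b(1) by (simp add: \<epsilon>_def)
 let ?f = "\<lambda>x. \<Sum>y\<in>J. d y * bump_at \<epsilon> y x"
 have f: "?f \<in> test_functions"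
  using J(1)
 proof (induction J rule: finite_induct)
  case empty
  then show ?case by (simp add: test_functions_def smooth_const)
 next
  case (insert y J)
  then show ?case using test_lincomb[OF test_bump_at[OF \<epsilon>, of y] insert.IH, of "d y" 1] by simp
 qed
 have "cmod (T \<psi> - (LBINT x. ?f x * \<psi> x)) \<le> e" if \<psi>: "\<psi> \<in> B" for \<psi>
 proof -
  let ?A = "\<lambda>x. \<Sum>y\<in>J. (complex_of_real (v y) * \<psi> y) * bump_at h y x"
  have c\<psi>: "continuous_on UNIV \<psi>" using smooth_continuous[OF Bc(4)[OF \<psi>]] .
  have sA: "smooth ?A" by (intro smooth_sum smooth_cmult smooth_bump_at)
  let ?c = "\<lambda>u x. cutoff R x * u x"
  have cc: "?c u \<in> core \<infinity>" if "smooth u" for u by (rule cutoff_core[OF p(2) that R0])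
  have 1: "cmod (T (\<lambda>x. tail_cutoff R x * \<psi> x)) \<le> e / 4"
  proof -
   have "e / (4 * b) * D_norm \<infinity> m \<psi> \<le> e / (4 * b) * b" using e b(1) bj[OF \<psi>, of m] by (intro mult_left_mono) auto
   then show ?thesis using R(2)[OF Bc(1)[OF \<psi>]] b(1) by simp
  qed
  have 2: "cmod (T (?c (\<lambda>x. \<psi> x - ?P h \<psi> x))) \<le> e / 4"
  proof -
   have E: "h * (?n * b) = e / (4 * D)" using b(1) by (simp add: h_def)
   have "cmod (T (?c (\<lambda>x. \<psi> x - ?P h \<psi> x))) \<le> (C * L) * (e / (4 * D))"
    by (rule cut[OF smooth_diff[OF Bc(4)[OF \<psi>] sP[OF \<psi>]]]) (use e D Pdiff[OF \<psi> _ h] in \<open>auto simp: E\<close>)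
   then show ?thesis using DD by linarith
  qed
  have 3: "cmod (T (?c (\<lambda>x. ?P h \<psi> x - ?A x))) \<le> e / 4"
  proof -
   have "cmod (T (?c (\<lambda>x. ?P h \<psi> x - ?A x))) \<le> (C * L) * (e / (4 * D))"
    using e D bj[OF \<psi>, of 1] by (intro cut smooth_diff sP[OF \<psi>] sA J(2) Bc(2)[OF \<psi>]) auto
   then show ?thesis using DD by linarith
  qed
  have TA: "T (?c ?A) = (\<Sum>y\<in>J. d y * \<psi> y)"
   using J(1) unfolding d_def
  proof (induction J rule: finite_induct)
   case empty
   have "(\<lambda>x. cutoff R x * 0) = (\<lambda>x :: real ^ 'n. 0 * 0)" by simp
   then show ?case
    using dual_cmult[OF p(2) T function_space_zero[OF function_space_core[OF p(2)]], of 0] by simp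
  next
   case (insert y J)
   let ?A' = "\<lambda>x. \<Sum>y\<in>J. (complex_of_real (v y) * \<psi> y) * bump_at h y x"
   have "smooth ?A'" by (intro smooth_sum smooth_cmult smooth_bump_at)
   then have "T (\<lambda>x. (complex_of_real (v y) * \<psi> y) * ?c (bump_at h y) x + 1 * ?c ?A' x) =
     (complex_of_real (v y) * \<psi> y) * T (?c (bump_at h y)) + 1 * T (?c ?A')"
    by (intro dual_lincomb[OF p(2) T] cc smooth_bump_at)
   then show ?case using insert by (simp add: algebra_simps)
  qed
  have If: "(LBINT x. ?f x * \<psi> x) = (\<Sum>y\<in>J. d y * ?P \<epsilon> \<psi> y)"
  proof -
   have "(LBINT x. ?f x * \<psi> x) = (LBINT x. (\<Sum>y\<in>J. d y * (bump_at \<epsilon> y x * \<psi> x)))"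
    by (simp add: sum_distrib_right mult.assoc)
   also have "... = (\<Sum>y\<in>J. (LBINT x. d y * (bump_at \<epsilon> y x * \<psi> x)))"
    using average_eq_integral_bump_at(2)[OF c\<psi> \<epsilon>] by (intro Bochner_Integration.integral_sum) auto
   also have "... = (\<Sum>y\<in>J. d y * ?P \<epsilon> \<psi> y)"
    by (simp add: average_eq_integral_bump_at(1)[OF c\<psi> \<epsilon>])
   finally show ?thesis .
  qed
  have 4: "cmod ((\<Sum>y\<in>J. d y * \<psi> y) - (\<Sum>y\<in>J. d y * ?P \<epsilon> \<psi> y)) \<le> e / 4"
  proof -
   have "cmod ((\<Sum>y\<in>J. d y * \<psi> y) - (\<Sum>y\<in>J. d y * ?P \<epsilon> \<psi> y)) = cmod (\<Sum>y\<in>J. d y * (\<psi> y - ?P \<epsilon> \<psi> y))"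
    by (simp add: right_diff_distrib sum_subtractf)
   also have "... \<le> (\<Sum>y\<in>J. cmod (d y) * (\<epsilon> * (?n * b)))"
   proof (rule sum_norm_le)
    fix y
    show "cmod (d y * (\<psi> y - ?P \<epsilon> \<psi> y)) \<le> cmod (d y) * (\<epsilon> * (?n * b))"
     unfolding norm_mult using Pdiff[OF \<psi> _ \<epsilon>, of "[]" y] by (intro mult_left_mono) auto
   qed
   also have "... = (S - 1) * (\<epsilon> * (?n * b))" by (simp add: S_def sum_distrib_right)
   also have "... \<le> S * (\<epsilon> * (?n * b))" using \<epsilon> b(1) by (intro mult_right_mono) auto
   also have "... = e / 4" using S b(1) by (simp add: \<epsilon>_def)
   finally show ?thesis .
  qed
  have tc: "(\<lambda>x. tail_cutoff R x * \<psi> x) \<in> core \<infinity>" using tail_cutoff_core[OF p(2) R0 Bc(1)[OF \<psi>]] .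
  have s1: "T \<psi> = T (\<lambda>x. tail_cutoff R x * \<psi> x) + T (?c \<psi>)"
   using dual_add[OF p(2) T tc cc[OF Bc(4)[OF \<psi>]]] by (simp add: tail_cutoff_mult)
  have s2: "T (?c \<psi>) = T (?c (\<lambda>x. \<psi> x - ?P h \<psi> x)) + T (?c (?P h \<psi>))"
   using dual_add[OF p(2) T cc[OF smooth_diff[OF Bc(4)[OF \<psi>] sP[OF \<psi>]]] cc[OF sP[OF \<psi>]], of h h] by (simp add: algebra_simps)
  have s3: "T (?c (?P h \<psi>)) = T (?c (\<lambda>x. ?P h \<psi> x - ?A x)) + T (?c ?A)"
   using dual_add[OF p(2) T cc[OF smooth_diff[OF sP[OF \<psi>] sA]] cc[OF sA], of h] by (simp add: right_diff_distrib)
  have E: "T \<psi> - (LBINT x. ?f x * \<psi> x) = T (\<lambda>x. tail_cutoff R x * \<psi> x) + (T (?c (\<lambda>x. \<psi> x - ?P h \<psi> x)) +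
    (T (?c (\<lambda>x. ?P h \<psi> x - ?A x)) + ((\<Sum>y\<in>J. d y * \<psi> y) - (\<Sum>y\<in>J. d y * ?P \<epsilon> \<psi> y))))"
   unfolding s1 s2 s3 TA If by simp
  have "cmod (T \<psi> - (LBINT x. ?f x * \<psi> x)) \<le> e / 4 + (e / 4 + (e / 4 + e / 4))"
   unfolding E by (intro norm_triangle_mono 1 2 3 4)
  then show ?thesis by simp
 qed
 then show ?thesis by (intro bexI[OF _ f] ballI)
qed

section \<open>The pairing at the infinite exponent\<close>

lemma strong_seminorms_directed:
 fixes P0 :: "('n::finite functional \<Rightarrow> real) set"
 assumes p: "1 \<le> p" and "finite P0" "P0 \<subseteq> strong_seminorms (core p) (D_L_seminorms p)"
 shows "\<exists>B. D_bounded p B \<and> (\<forall>r\<in>P0. \<forall>T\<in>dual p. r T \<le> sup_on B T)"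
 using assms(2,3)
proof (induction P0 rule: finite_induct)
 case empty
 have "(\<lambda>x :: real ^ 'n. 0) \<in> core p" using function_space_zero[OF function_space_core[OF p]] .
 then have "D_bounded p {\<lambda>x :: real ^ 'n. 0}" unfolding D_bounded_def by auto
 then show ?case by blast
next
 case (insert r P0)
 then obtain B where B: "D_bounded p B" "\<And>r T. r \<in> P0 \<Longrightarrow> T \<in> dual p \<Longrightarrow> r T \<le> sup_on B T" by blast
 obtain B' where B': "r = sup_on B'" "D_bounded p B'"
  using insert.prems unfolding strong_seminorms_eq by auto
 have U: "D_bounded p (B \<union> B')"
  unfolding D_bounded_def
 proof (intro conjI allI)
  fix m
  obtain c c' where "\<And>f. f \<in> B \<Longrightarrow> D_norm p m f \<le> c" "\<And>f. f \<in> B' \<Longrightarrow> D_norm p m f \<le> c'"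
   using B(1) B'(2) unfolding D_bounded_def by meson
  then show "\<exists>c. \<forall>f\<in>B \<union> B'. D_norm p m f \<le> c"
   by (intro exI[of _ "max c c'"]) (auto intro: max.coboundedI1 max.coboundedI2)
 qed (use B(1) B'(2) in \<open>auto simp: D_bounded_def\<close>)
 have sup: "sup_on B T \<le> sup_on (B \<union> B') T" "sup_on B' T \<le> sup_on (B \<union> B') T" if T: "T \<in> dual p" for T
  using sup_on_upper[OF p U T] by (auto intro!: sup_on_least[OF p B(1)] sup_on_least[OF p B'(2)])
 then have "r' T \<le> sup_on (B \<union> B') T" if "r' \<in> insert r P0" "T \<in> dual p" for r' T
  using that B(2)[of r' T] B'(1) sup[of T] by (cases "r' = r") fastforce+
 then show ?case using U by blast
qed

lemma D'_L1_of_test_eq: "D'_L1_of_test f = (\<lambda>\<psi>. if \<psi> \<in> core \<infinity> then LBINT x. f x * \<psi> x else 0)"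
 by (simp add: D'_L1_of_test_def core_def)

lemma D'_L1_of_test_dual:
 fixes f :: "'n::finite cfun"
 assumes f: "f \<in> test_functions"
 shows "D'_L1_of_test f \<in> dual \<infinity>"
  and "\<psi> \<in> D_L \<infinity> \<Longrightarrow> integrable lborel (\<lambda>x. f x * \<psi> x)"
proof -
 obtain R where R: "\<forall>x. R < norm x \<longrightarrow> f x = 0" using test_functions_support[OF f] by blast
 show int: "integrable lborel (\<lambda>x. f x * \<psi> x)" if "\<psi> \<in> D_L \<infinity>" for \<psi>
  by (rule integrable_compact_support[where R = R])
   (use R in \<open>auto intro!: continuous_on_mult smooth_continuous[OF test_smooth[OF f]] smooth_continuous[OF D_L_smooth[OF that]]\<close>)
 have p: "1 \<le> (\<infinity> :: ennreal)" by simp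
 show "D'_L1_of_test f \<in> dual \<infinity>"
 proof (rule dualI[OF p, where C = "LBINT x. cmod (f x)" and m = 0])
  fix g h :: "'n cfun" and a b
  assume g: "g \<in> core \<infinity>"
  have gD: "g \<in> D_L \<infinity>" using core_subset_D_L[OF g] .
  have "cmod (LBINT x. f x * g x) \<le> (LBINT x. cmod (f x) * D_norm \<infinity> 0 g)"
  proof (rule Bochner_Integration.integral_norm_bound_integral[OF int[OF gD]])
   show "integrable lborel (\<lambda>x. cmod (f x) * D_norm \<infinity> 0 g)"
    using integrable_norm[OF test_integrable[OF f]] by simp
   show "cmod (f x * g x) \<le> cmod (f x) * D_norm \<infinity> 0 g" for x
    unfolding norm_mult using cmod_le_D_norm_infinity[OF gD, of "[]" 0 x] by (intro mult_left_mono) auto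
  qed
  then show "cmod (D'_L1_of_test f g) \<le> (LBINT x. cmod (f x)) * D_norm \<infinity> 0 g"
   using g by (simp add: D'_L1_of_test_eq)
  assume h: "h \<in> core \<infinity>"
  have "(\<lambda>x. a * g x + b * h x) \<in> core \<infinity>" using function_space_lincomb[OF function_space_core[OF p] g h] .
  moreover have "(\<lambda>x. f x * (a * g x + b * h x)) = (\<lambda>x. a * (f x * g x) + b * (f x * h x))"
   by (simp add: fun_eq_iff algebra_simps)
  ultimately show "D'_L1_of_test f (\<lambda>x. a * g x + b * h x) = a * D'_L1_of_test f g + b * D'_L1_of_test f h"
   using g h int[OF gD] int[OF core_subset_D_L[OF h]] by (simp add: D'_L1_of_test_eq)
 qed (simp add: D'_L1_of_test_eq)
qed

lemma functionals_eq_on_test_functions: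
 fixes \<Phi> \<Psi> :: "'n::finite functional \<Rightarrow> complex"
 assumes \<Phi>: "\<Phi> \<in> cdual (dual \<infinity>) (strong_seminorms (core \<infinity>) (D_L_seminorms \<infinity>))"
  and \<Psi>: "\<Psi> \<in> cdual (dual \<infinity>) (strong_seminorms (core \<infinity>) (D_L_seminorms \<infinity>))"
  and eq: "\<And>f. f \<in> test_functions \<Longrightarrow> \<Phi> (D'_L1_of_test f) = \<Psi> (D'_L1_of_test f)"
 shows "\<Phi> = \<Psi>"
proof
 fix T :: "'n functional"
 have p: "1 \<le> (\<infinity> :: ennreal)" by simp
 let ?F = "dual \<infinity> :: 'n functional set"
 note F = function_space_dual[OF p]
 show "\<Phi> T = \<Psi> T"
 proof (cases "T \<in> ?F")
  case False
  then show ?thesis using \<Phi> \<Psi> by (simp add: cdual_def)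
 next
  case T: True
  obtain P1 e1 where 1: "finite P1" "P1 \<subseteq> strong_seminorms (core \<infinity>) (D_L_seminorms \<infinity>)" "0 < e1"
   "\<And>T. T \<in> ?F \<Longrightarrow> (\<forall>r\<in>P1. r T < e1) \<Longrightarrow> cmod (\<Phi> T) < 1"
   using cdual_bounded_near_0[OF F strong_seminorms_seminorm[OF p] \<Phi>] by metis
  obtain P2 e2 where 2: "finite P2" "P2 \<subseteq> strong_seminorms (core \<infinity>) (D_L_seminorms \<infinity>)" "0 < e2"
   "\<And>T. T \<in> ?F \<Longrightarrow> (\<forall>r\<in>P2. r T < e2) \<Longrightarrow> cmod (\<Psi> T) < 1"
   using cdual_bounded_near_0[OF F strong_seminorms_seminorm[OF p] \<Psi>] by metis
  have "finite (P1 \<union> P2)" "P1 \<union> P2 \<subseteq> strong_seminorms (core \<infinity>) (D_L_seminorms \<infinity>)" using 1 2 by auto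
  from strong_seminorms_directed[OF p this] obtain B where B: "D_bounded \<infinity> B"
   "\<And>r T. r \<in> P1 \<union> P2 \<Longrightarrow> T \<in> ?F \<Longrightarrow> r T \<le> sup_on B T" by blast
  \<comment> \<open>The approximation of \<open>T\<close> by a test function is so close that even
    \<open>n\<close> times the error lies where both functionals stay below 1; since they agree on
    test functions, only the error contributes.\<close>
  have est: "real n * cmod (\<Phi> T - \<Psi> T) \<le> 2" for n :: nat
  proof -
   define e where "e = min e1 e2 / (real n + 1) / 2"
   have e: "0 < e" using 1(3) 2(3) by (simp add: e_def)
   obtain f where f: "f \<in> test_functions" "\<And>\<psi>. \<psi> \<in> B \<Longrightarrow> cmod (T \<psi> - (LBINT x. f x * \<psi> x)) \<le> e"
    using test_functions_dense_in_dual[OF T B(1) e] by blast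
   let ?T = "D'_L1_of_test f"
   have Tf: "?T \<in> ?F" by (rule D'_L1_of_test_dual(1)[OF f(1)])
   let ?d = "\<lambda>\<psi>. T \<psi> - ?T \<psi>"
   have d: "?d \<in> ?F" using function_space_closed(2)[OF F T Tf] .
   have "sup_on B ?d \<le> e"
    using f(2) B(1) by (intro sup_on_least[OF p B(1)]) (auto simp: D'_L1_of_test_eq D_bounded_def)
   let ?nd = "\<lambda>\<psi>. of_nat n * ?d \<psi>"
   have nd: "?nd \<in> ?F" using function_space_closed(3)[OF F d d] .
   have "sup_on B ?nd = real n * sup_on B ?d"
    using seminorm_on_cmult[OF seminorm_on_sup_on[OF p B(1)] d, of "of_nat n"] by simp
   also have "... \<le> (real n + 1) * e" using \<open>sup_on B ?d \<le> e\<close> e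
    by (intro mult_mono) (auto intro: seminorm_on_nonneg[OF seminorm_on_sup_on[OF p B(1)] d])
   also have "... = min e1 e2 / 2"
   proof -
    define N where "N = real n + 1"
    have "0 < N" by (simp add: N_def)
    then show ?thesis unfolding e_def N_def[symmetric] by simp
   qed
   also have "... < min e1 e2"
   proof -
    have "0 < min e1 e2" using 1(3) 2(3) by simp
    then show ?thesis by linarith
   qed
   finally have lt: "sup_on B ?nd < min e1 e2" .
   have "\<forall>r\<in>P1. r ?nd < e1" "\<forall>r\<in>P2. r ?nd < e2"
    using B(2)[OF _ nd] lt by fastforce+
   then have "cmod (\<Phi> ?nd) < 1" "cmod (\<Psi> ?nd) < 1" using 1(4)[OF nd] 2(4)[OF nd] by auto
   moreover have "\<Phi> ?nd = of_nat n * (\<Phi> T - \<Phi> ?T)" "\<Psi> ?nd = of_nat n * (\<Psi> T - \<Psi> ?T)"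
    using cdual_cmult[OF \<Phi> d, of "of_nat n"] cdual_diff[OF \<Phi> T Tf]
     cdual_cmult[OF \<Psi> d, of "of_nat n"] cdual_diff[OF \<Psi> T Tf] by simp_all
   ultimately have "cmod (of_nat n * (\<Phi> T - \<Phi> ?T) - of_nat n * (\<Psi> T - \<Psi> ?T)) \<le> 2"
    using norm_triangle_ineq4[of "of_nat n * (\<Phi> T - \<Phi> ?T)" "of_nat n * (\<Psi> T - \<Psi> ?T)"] by simp
   moreover have "of_nat n * (\<Phi> T - \<Phi> ?T) - of_nat n * (\<Psi> T - \<Psi> ?T) = of_nat n * (\<Phi> T - \<Psi> T)"
    using eq[OF f(1)] by (simp add: algebra_simps)
   ultimately show ?thesis by (simp add: norm_mult)
  qed
  show ?thesis
  proof (rule ccontr)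
   assume ne: "\<Phi> T \<noteq> \<Psi> T"
   then have pos: "0 < cmod (\<Phi> T - \<Psi> T)" by simp
   obtain n :: nat where "2 / cmod (\<Phi> T - \<Psi> T) < n" using reals_Archimedean2 by blast
   then have "2 < real n * cmod (\<Phi> T - \<Psi> T)" using pos by (simp add: field_simps)
   then show False using est[of n] by linarith
  qed
 qed
qed

definition limit_functional :: "'n::finite cfun \<Rightarrow> 'n functional \<Rightarrow> complex" where
 "limit_functional \<phi> T = (if T \<in> dual \<infinity> then lim (\<lambda>k. T (\<lambda>x. cutoff (real k) x * \<phi> x)) else 0)"

lemma limit_functional_tendsto:
 assumes "\<phi> \<in> D_L \<infinity>" "T \<in> dual \<infinity>"
 shows "(\<lambda>k. T (\<lambda>x. cutoff (real k) x * \<phi> x)) \<longlonglongrightarrow> limit_functional \<phi> T"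
 using dual_cutoff_convergent[OF _ assms(2,1)] assms(2)
 by (simp add: limit_functional_def convergent_LIMSEQ_iff)

text \<open>The truncations of \<open>\<phi>\<close> form a bounded set in the predual, and the
  limit is dominated by the supremum over this set, which is one of the strong seminorms.\<close>

lemma limit_functional_cdual:
 fixes \<phi> :: "'n::finite cfun"
 assumes \<phi>: "\<phi> \<in> D_L \<infinity>"
 shows "limit_functional \<phi> \<in> cdual (dual \<infinity>) (strong_seminorms (core \<infinity>) (D_L_seminorms \<infinity>))"
proof -
 have p: "1 \<le> (\<infinity> :: ennreal)" by simp
 have s\<phi>: "smooth \<phi>" using D_L_smooth[OF \<phi>] .
 \<comment> \<open>\<open>Suc k\<close> makes the radii start at 1, where the uniform bound for
   truncations is available.\<close>
 define B where "B = range (\<lambda>k x. cutoff (real (Suc k)) x * \<phi> x)"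
 have B: "D_bounded \<infinity> B"
  unfolding D_bounded_def
 proof (intro conjI allI)
  show "B \<subseteq> core \<infinity>" unfolding B_def using cutoff_core[OF p s\<phi>] by auto
  fix m
  from D_norm_cutoff_le[OF p, of m] obtain K where
   "\<And>R. 1 \<le> R \<Longrightarrow> D_norm \<infinity> m (\<lambda>x. cutoff R x * \<phi> x) \<le> K * D_norm \<infinity> m \<phi>"
   using \<phi> by metis
  then show "\<exists>c. \<forall>f\<in>B. D_norm \<infinity> m f \<le> c"
   unfolding B_def by (intro exI[of _ "K * D_norm \<infinity> m \<phi>"]) auto
 qed (simp add: B_def)
 show ?thesis
 proof (rule cdualI[OF function_space_dual[OF p] strong_seminorms_seminorm[OF p], where \<rho> = "sup_on B" and C = 1])
  show "sup_on B \<in> strong_seminorms (core \<infinity>) (D_L_seminorms \<infinity>)"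
   unfolding strong_seminorms_eq using B by blast
  fix S T :: "'n functional" and a b
  show "limit_functional \<phi> S = 0" if "S \<notin> dual \<infinity>" using that by (simp add: limit_functional_def)
  assume S: "S \<in> dual \<infinity>"
  have "cmod (limit_functional \<phi> S) \<le> sup_on B S"
  proof (rule LIMSEQ_le_const2[OF tendsto_norm[OF limit_functional_tendsto[OF \<phi> S]]])
   have "cmod (S (\<lambda>x. cutoff (real k) x * \<phi> x)) \<le> sup_on B S" if "1 \<le> k" for k
   proof (rule sup_on_upper[OF p B S])
    show "(\<lambda>x. cutoff (real k) x * \<phi> x) \<in> B"
     unfolding B_def using that by (intro range_eqI[of _ _ "k - 1"]) simp
   qed
   then show "\<exists>N. \<forall>k\<ge>N. cmod (S (\<lambda>x. cutoff (real k) x * \<phi> x)) \<le> sup_on B S" by blast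
  qed
  then show "cmod (limit_functional \<phi> S) \<le> 1 * sup_on B S" by simp
  assume T: "T \<in> dual \<infinity>"
  have "(\<lambda>\<psi>. a * S \<psi> + b * T \<psi>) \<in> dual \<infinity>" using function_space_lincomb[OF function_space_dual[OF p] S T] .
  from limit_functional_tendsto[OF \<phi> this]
  show "limit_functional \<phi> (\<lambda>\<psi>. a * S \<psi> + b * T \<psi>) = a * limit_functional \<phi> S + b * limit_functional \<phi> T"
   by (rule LIMSEQ_unique) (intro tendsto_intros limit_functional_tendsto[OF \<phi>] S T)
 qed
qed

lemma limit_functional_test:
 fixes \<phi> :: "'n::finite cfun"
 assumes \<phi>: "\<phi> \<in> D_L \<infinity>" and f: "f \<in> test_functions"
 shows "limit_functional \<phi> (D'_L1_of_test f) = (LBINT x. f x * \<phi> x)"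
proof (rule LIMSEQ_unique[OF limit_functional_tendsto[OF \<phi> D'_L1_of_test_dual(1)[OF f]] tendsto_eventually])
 obtain R where R: "\<forall>x. R < norm x \<longrightarrow> f x = 0" using test_functions_support[OF f] by blast
 obtain k0 :: nat where k0: "max R 1 \<le> k0" using real_arch_simple by blast
 show "\<forall>\<^sub>F k in sequentially. D'_L1_of_test f (\<lambda>x. cutoff (real k) x * \<phi> x) = (LBINT x. f x * \<phi> x)"
 proof (rule eventually_sequentiallyI[of k0])
  fix k assume "k0 \<le> k"
  then have k: "0 < real k" "R \<le> real k" using k0 by auto
  have E: "f x * (cutoff (real k) x * \<phi> x) = f x * \<phi> x" for x
   using R cutoff_eq_1[OF k(1), of x] k(2) by (cases "norm x \<le> real k") auto
  show "D'_L1_of_test f (\<lambda>x. cutoff (real k) x * \<phi> x) = (LBINT x. f x * \<phi> x)"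
   unfolding D'_L1_of_test_eq E by (rule if_P) (rule cutoff_core[OF _ D_L_smooth[OF \<phi>] k(1)], simp)
 qed
qed

lemma D'_L_1_eq: "D'_L 1 = dual \<infinity>" "D'_L_seminorms 1 = strong_seminorms (core \<infinity>) (D_L_seminorms \<infinity>)"
 by (simp_all add: D'_L_def D'_L_seminorms_def predual_def predual_seminorms_def dual_def core_def)

text \<open>The limit of truncations has the defining properties of the description, and density
  leaves no other candidate.\<close>

theorem D_Linf_functional_eq:
 fixes \<phi> :: "'n::finite cfun"
 assumes \<phi>: "\<phi> \<in> D_L \<infinity>"
 shows "D_Linf_functional \<phi> = limit_functional \<phi>"
 unfolding D_Linf_functional_def D'_L_1_eq
proof (rule the_equality)
 show "limit_functional \<phi> \<in> cdual (dual \<infinity>) (strong_seminorms (core \<infinity>) (D_L_seminorms \<infinity>)) \<and>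
   (\<forall>f\<in>test_functions. limit_functional \<phi> (D'_L1_of_test f) = (LBINT x. f x * \<phi> x))"
  using limit_functional_cdual[OF \<phi>] limit_functional_test[OF \<phi>] by blast
 fix \<Phi>
 assume "\<Phi> \<in> cdual (dual \<infinity>) (strong_seminorms (core \<infinity>) (D_L_seminorms \<infinity>)) \<and>
   (\<forall>f\<in>test_functions. \<Phi> (D'_L1_of_test f) = (LBINT x. f x * \<phi> x))"
 then show "\<Phi> = limit_functional \<phi>"
  using limit_functional_cdual[OF \<phi>] limit_functional_test[OF \<phi>]
  by (intro functionals_eq_on_test_functions) auto
qed

text \<open>A description of the pairing common to all exponents; later estimates are proved for
  test functions and passed to this limit, without treating the infinite exponent
  separately.\<close>

theorem D_L_pairing_tendsto:
 fixes \<phi> :: "'n::finite cfun"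
 assumes p: "1 < p" and \<phi>: "\<phi> \<in> D_L p" and T: "T \<in> dual p"
 shows "(\<lambda>k. T (\<lambda>x. cutoff (real k) x * \<phi> x)) \<longlonglongrightarrow> D_L_pairing p \<phi> T"
proof (cases "p = \<infinity>")
 case True
 then show ?thesis
  using limit_functional_tendsto[of \<phi> T] \<phi> T D_Linf_functional_eq[of \<phi>] by (simp add: D_L_pairing_def)
next
 case False
 then have "\<phi> \<in> core p" using \<phi> by (simp add: core_def)
 then show ?thesis
  using dual_cutoff_tendsto[OF _ T] p False by (simp add: D_L_pairing_def)
qed

section \<open>The resolvent of the Laplacian\<close>

text \<open>The type is kept general because the function is used on the reals, on vectors and on
  pairs of both, where it factorises.\<close>

definition gauss :: "real \<Rightarrow> 'a::real_normed_vector \<Rightarrow> real" where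
 "gauss a x = exp (- (norm x)\<^sup>2 / a)"

lemma gauss_pos: "0 < gauss a x"
 by (simp add: gauss_def)

lemma continuous_gauss: "continuous_on S (gauss a)"
 unfolding gauss_def divide_inverse by (intro continuous_intros)

lemma integrable_gauss:
 assumes a: "0 < a"
 shows "integrable lborel (gauss a :: 'a::euclidean_space \<Rightarrow> real)"
proof (rule integrableI_nonneg)
 show "gauss a \<in> borel_measurable lborel"
  using borel_measurable_continuous_onI[OF continuous_gauss] by simp
 define \<sigma> where "\<sigma> = sqrt (a / 2)"
 have \<sigma>: "0 < \<sigma>" "2 * \<sigma>\<^sup>2 = a" using a by (simp_all add: \<sigma>_def)
 let ?c = "sqrt (2 * pi * \<sigma>\<^sup>2)"
 have c: "0 < ?c" using \<sigma>(1) by simp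
 have "(\<lambda>t. exp (- t\<^sup>2 / a)) = (\<lambda>t. ?c * normal_density 0 \<sigma> t)"
  using c \<sigma>(1) unfolding normal_density_def \<sigma>(2) by (simp add: fun_eq_iff)
 then have i: "integrable lborel (\<lambda>t :: real. exp (- t\<^sup>2 / a))"
  using integrable_normal_density[OF \<sigma>(1)] by simp
 have "gauss a x = (\<Prod>b\<in>Basis. exp (- (x \<bullet> b)\<^sup>2 / a))" for x :: 'a
 proof -
  have "(norm x)\<^sup>2 = (\<Sum>b\<in>Basis. (x \<bullet> b)\<^sup>2)"
   unfolding power2_norm_eq_inner by (subst euclidean_inner) (simp add: power2_eq_square)
  then show ?thesis
   by (simp add: gauss_def exp_sum sum_negf sum_divide_distrib flip: exp_sum)
 qed
 then have "(\<integral>\<^sup>+x. ennreal (gauss a (x :: 'a)) \<partial>lborel) = (\<Prod>b\<in>(Basis :: 'a set). (\<integral>\<^sup>+t. ennreal (exp (- t\<^sup>2 / a)) \<partial>lborel))"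
  using nn_integral_lborel_prod[of "\<lambda>(_ :: 'a) t. ennreal (exp (- t\<^sup>2 / a))"]
  by (simp add: prod_ennreal)
 also have "... < \<infinity>"
  using i by (simp add: nn_integral_eq_integral ennreal_power integral_nonneg_AE)
 finally show "(\<integral>\<^sup>+x. ennreal (gauss a (x :: 'a)) \<partial>lborel) < \<infinity>" .
qed (simp add: less_imp_le gauss_pos)

lemma integral_gauss_pos:
 assumes a: "0 < a"
 shows "0 < (LBINT x. gauss a (x :: 'a::euclidean_space))"
proof -
 have i: "integrable lborel (gauss a :: 'a \<Rightarrow> real)" by (rule integrable_gauss[OF a])
 have "0 \<le> (LBINT x. gauss a (x :: 'a))" by (intro integral_nonneg_AE) (simp add: less_imp_le gauss_pos)
 moreover have False if "(LBINT x. gauss a (x :: 'a)) = 0"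
 proof -
  have "AE x :: 'a in lborel. gauss a x = 0"
   using integral_nonneg_eq_0_iff_AE[OF i] that by (simp add: less_imp_le gauss_pos)
  then have "AE x :: 'a in lborel. False" by (rule eventually_mono) (metis gauss_pos less_irrefl)
  then show False using ae_filter_eq_bot_iff[of "lborel :: 'a measure"] by (simp add: trivial_limit_def)
 qed
 ultimately show ?thesis by (cases "(LBINT x. gauss a (x :: 'a)) = 0") auto
qed

lemma gauss_pair: "gauss a (s, z) = gauss a s * gauss a z"
 by (simp add: gauss_def norm_Pair diff_divide_distrib exp_diff exp_minus field_simps flip: exp_add)

text \<open>Polynomial growth is paid for by doubling the width:
  \<open>1 / 4 - 1 / 8 = 1 / 8\<close>, and \<open>exp (t / 8) \<ge> 1 + t / 8\<close> dominates the
  quadratic factor up to 16.\<close>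

lemma poly_gauss: "(1 + norm x)\<^sup>2 * gauss 4 x \<le> 16 * gauss 8 x"
proof -
 let ?t = "(norm x)\<^sup>2"
 have "2 * norm x \<le> 1 + ?t" using zero_le_power2[of "norm x - 1"] by (simp add: power2_diff)
 then have "(1 + norm x)\<^sup>2 \<le> 16 * (1 + ?t / 8)" by (simp add: power2_sum)
 also have "... \<le> 16 * exp (?t / 8)" using exp_ge_add_one_self[of "?t / 8"] by (rule mult_left_mono) simp
 finally have "(1 + norm x)\<^sup>2 * gauss 4 x \<le> (16 * exp (?t / 8)) * gauss 4 x"
  using gauss_pos[of 4 x] by (intro mult_right_mono) auto
 also have "... = 16 * gauss 8 x" by (simp add: gauss_def flip: exp_add)
 finally show ?thesis .
qed

lemma gauss_le_gauss: "0 < a \<Longrightarrow> a \<le> b \<Longrightarrow> gauss a x \<le> gauss b x"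
 by (simp add: gauss_def frac_le)

lemma poly_gauss_pair:
 assumes "0 \<le> s"
 shows "(1 + s)\<^sup>2 * (1 + norm z)\<^sup>2 * (gauss 1 s * gauss 4 z) \<le> 256 * gauss 8 (s, z)"
proof -
 have "(1 + s)\<^sup>2 * gauss 1 s \<le> (1 + s)\<^sup>2 * gauss 4 s" by (intro mult_left_mono gauss_le_gauss) auto
 also have "... \<le> 16 * gauss 8 s" using poly_gauss[of s] assms by simp
 finally have 1: "(1 + s)\<^sup>2 * gauss 1 s \<le> 16 * gauss 8 s" .
 have "((1 + s)\<^sup>2 * gauss 1 s) * ((1 + norm z)\<^sup>2 * gauss 4 z) \<le> (16 * gauss 8 s) * (16 * gauss 8 z)"
  by (rule mult_mono[OF 1 poly_gauss]) (auto intro: mult_nonneg_nonneg less_imp_le[OF gauss_pos])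
 then show ?thesis by (simp add: gauss_pair mult_ac)
qed

lemma gauss_dominated:
 fixes v :: "'a::euclidean_space \<Rightarrow> complex"
 assumes v: "v \<in> borel_measurable borel" and le: "\<And>z. cmod (v z) \<le> K * gauss a z" and a: "0 < a"
 shows "integrable lborel v"
proof (rule Bochner_Integration.integrable_bound[OF integrable_mult_right[OF integrable_gauss[OF a], of K]])
 show "AE z in lborel. norm (v z) \<le> norm (K * gauss a z)"
  using order_trans[OF le abs_ge_self] by simp
qed (use v in simp)

lemma smooth_gauss_deriv:
 fixes z :: "real ^ 'n"
 shows "(\<lambda>z. complex_of_real (gauss 4 z)) differentiable (at z)"
  and "partial_deriv i (\<lambda>z. complex_of_real (gauss 4 z)) z = of_real (- (z $ i / 2) * gauss 4 z)"
proof -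
 have "((\<lambda>z. gauss 4 z) has_derivative (\<lambda>h. - (z \<bullet> h / 2) * gauss 4 z)) (at z)"
  unfolding gauss_def power2_norm_eq_inner
  by (auto intro!: derivative_eq_intros simp: inner_commute algebra_simps)
 then have D: "((\<lambda>z. complex_of_real (gauss 4 z)) has_derivative (\<lambda>h. of_real (- (z \<bullet> h / 2) * gauss 4 z))) (at z)"
  by (rule has_derivative_of_real)
 show "(\<lambda>z. complex_of_real (gauss 4 z)) differentiable (at z)" using D differentiable_def by blast
 show "partial_deriv i (\<lambda>z. complex_of_real (gauss 4 z)) z = of_real (- (z $ i / 2) * gauss 4 z)"
  unfolding partial_deriv_eq[OF D] by (simp add: inner_axis)
qed

text \<open>The derivative of \<open>gauss 4\<close> in direction \<open>i\<close> is
  \<open>- z $ i / 2\<close> times itself. Hence a derivative of \<open>v (x + s z)\<close>, which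
  comes with a factor \<open>s\<close>, can be traded for a factor \<open>z $ i / 2\<close>, and
  back.\<close>

lemma gauss_by_parts:
 fixes v :: "'n::finite cfun"
 assumes v: "smooth_bounded v"
 shows "(LBINT z. of_real s * partial_deriv i v (x + s *\<^sub>R z) * of_real (gauss 4 z)) =
    (LBINT z. v (x + s *\<^sub>R z) * of_real (z $ i / 2 * gauss 4 z))"
  and "integrable lborel (\<lambda>z. v (x + s *\<^sub>R z) * of_real (gauss 4 z))"
  and "integrable lborel (\<lambda>z. v (x + s *\<^sub>R z) * of_real (z $ i * gauss 4 z))"
proof -
 have s: "smooth v" using smooth_bounded_smooth[OF v] .
 have aff: "continuous_on UNIV (\<lambda>z. w (x + s *\<^sub>R z))" if "smooth w" for w :: "'n cfun"
  by (rule continuous_translate[OF smooth_continuous[OF that]])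
 have int0: "integrable lborel (\<lambda>z. w (x + s *\<^sub>R z) * of_real (gauss 4 z))"
  "integrable lborel (\<lambda>z. w (x + s *\<^sub>R z) * of_real (z $ i * gauss 4 z))" if w: "smooth_bounded w" for w :: "'n cfun"
 proof -
  obtain c where c: "\<And>x. cmod (w x) \<le> c" using w unfolding smooth_bounded_def by (metis iter_deriv_Nil)
  have c0: "0 \<le> c" using order_trans[OF norm_ge_zero c] .
  have "cmod (w (x + s *\<^sub>R z) * of_real (t * gauss 4 z)) \<le> (c * 16) * gauss 8 z" if t: "\<bar>t\<bar> \<le> (1 + norm z)\<^sup>2" for t z
  proof -
   have "cmod (w (x + s *\<^sub>R z) * of_real (t * gauss 4 z)) \<le> c * ((1 + norm z)\<^sup>2 * gauss 4 z)"
    unfolding norm_mult norm_of_real abs_mult using c c0 t gauss_pos[of 4 z] by (intro mult_mono) auto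
   also have "... \<le> c * (16 * gauss 8 z)" using c0 by (intro mult_left_mono poly_gauss)
   finally show ?thesis by simp
  qed
  note le = this
  have m: "(\<lambda>z. w (x + s *\<^sub>R z) * of_real (h z * gauss 4 z)) \<in> borel_measurable borel"
   if "continuous_on UNIV h" for h :: "real ^ 'n \<Rightarrow> real"
   by (intro borel_measurable_continuous continuous_intros aff smooth_bounded_smooth w that continuous_gauss)
  have "1 \<le> (1 + norm z)\<^sup>2" for z :: "real ^ 'n" by (simp add: power2_eq_square algebra_simps add_nonneg_nonneg)
  then show "integrable lborel (\<lambda>z. w (x + s *\<^sub>R z) * of_real (gauss 4 z))"
   using gauss_dominated[OF m[of "\<lambda>_. 1"], of "c * 16" 8] le[of 1] by simp
  have "\<bar>z $ i\<bar> \<le> (1 + norm z)\<^sup>2" for z :: "real ^ 'n"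
   using component_le_norm_cart[of z i] zero_le_power2[of "norm z"] norm_ge_zero[of z] unfolding power2_sum one_power2 by linarith
  then show "integrable lborel (\<lambda>z. w (x + s *\<^sub>R z) * of_real (z $ i * gauss 4 z))"
   by (intro gauss_dominated[OF m, of _ "c * 16" 8] le continuous_intros) auto
 qed
 show "integrable lborel (\<lambda>z. v (x + s *\<^sub>R z) * of_real (gauss 4 z))"
  "integrable lborel (\<lambda>z. v (x + s *\<^sub>R z) * of_real (z $ i * gauss 4 z))" by (fact int0[OF v])+
 let ?g = "\<lambda>z :: real ^ 'n. complex_of_real (gauss 4 z)"
 let ?u = "\<lambda>z. v (x + s *\<^sub>R z) * ?g z"
 let ?A = "\<lambda>z. of_real s * partial_deriv i v (x + s *\<^sub>R z) * ?g z"
 let ?B = "\<lambda>z. v (x + s *\<^sub>R z) * of_real (z $ i / 2 * gauss 4 z)"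
 have pd: "partial_deriv i ?u = (\<lambda>z. ?A z - ?B z)"
 proof
  fix z
  show "partial_deriv i ?u z = ?A z - ?B z"
   unfolding partial_deriv_mult[OF partial_deriv_affine(2)[OF smooth_differentiable[OF s]] smooth_gauss_deriv(1)]
    partial_deriv_affine(1)[OF smooth_differentiable[OF s]] smooth_gauss_deriv(2)
   by (simp add: scaleR_conv_of_real)
 qed
 have iA: "integrable lborel ?A"
  using integrable_mult_right[OF int0(1)[OF smooth_bounded_partial_deriv[OF v]], of "of_real s" i] by (simp add: mult.assoc)
 have iB: "integrable lborel ?B"
  using integrable_divide_zero[OF _ , of 2, OF int0(2)[OF v]] by simp
 have "(LBINT z. partial_deriv i ?u z) = 0"
 proof (rule integral_partial_deriv_eq_0)
  show "?u differentiable (at z)" for z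
   by (intro differentiable_mult partial_deriv_affine(2) smooth_differentiable s smooth_gauss_deriv(1))
  show "continuous_on UNIV (partial_deriv i ?u)"
   unfolding pd by (intro continuous_intros aff s smooth_partial_deriv continuous_gauss) auto
  show "integrable lborel (partial_deriv i ?u)" unfolding pd using iA iB by (rule Bochner_Integration.integrable_diff)
 qed (fact int0(1)[OF v])
 then show "(LBINT z. ?A z) = (LBINT z. ?B z)"
  unfolding pd using Bochner_Integration.integral_diff[OF iA iB] by simp
qed

text \<open>
 \<open>1 - \<Delta>\<close> is inverted by integrating \<open>d/ds (exp (-s\<^sup>2) \<phi>(x + s z))\<close> over \<open>s > 0\<close> and against the
 Gaussian in \<open>z\<close>.
\<close>

definition resolvent_kernel :: "real \<Rightarrow> real ^ 'n \<Rightarrow> real" where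
 "resolvent_kernel s z = indicator {0..} s * (gauss 1 s * gauss 4 z)"

text \<open>Quadratic growth in each variable is absorbed by widening both Gaussians to
  \<open>gauss 8\<close>; this justifies Fubini and the integration along single rays.\<close>

lemma resolvent_kernel_integrable:
 fixes u :: "real \<Rightarrow> 'n::finite cfun"
 assumes u: "continuous_on UNIV (\<lambda>p. u (fst p) (snd p))"
  and le: "\<And>s z. 0 \<le> s \<Longrightarrow> cmod (u s z) \<le> c * ((1 + s)\<^sup>2 * (1 + norm z)\<^sup>2)"
 shows "integrable (lborel \<Otimes>\<^sub>M lborel) (\<lambda>(s, z). u s z * of_real (resolvent_kernel s z))"
  and "integrable lborel (\<lambda>s. u s z * of_real (resolvent_kernel s z))"
proof -
 have c: "0 \<le> c" using order_trans[OF norm_ge_zero le[of 0 0]] by simp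
 let ?v = "\<lambda>p. u (fst p) (snd p) * of_real (resolvent_kernel (fst p) (snd p))"
 have [measurable]: "(\<lambda>p. u (fst p) (snd p)) \<in> borel_measurable (borel \<Otimes>\<^sub>M borel)"
  unfolding borel_prod using u by (rule borel_measurable_continuous_onI)
 have [measurable]: "(gauss a :: real \<Rightarrow> real) \<in> borel_measurable borel"
  "(gauss a :: real ^ 'n \<Rightarrow> real) \<in> borel_measurable borel" for a
  by (rule borel_measurable_continuous_onI[OF continuous_gauss])+
 have m: "?v \<in> borel_measurable borel"
  unfolding resolvent_kernel_def borel_prod[symmetric] by measurable
 have bd: "cmod (?v p) \<le> (c * 256) * gauss 8 p" for p
 proof (cases "0 \<le> fst p")
  case True
  have "cmod (?v p) = cmod (u (fst p) (snd p)) * (gauss 1 (fst p) * gauss 4 (snd p))"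
   using True gauss_pos[of 1 "fst p"] gauss_pos[of 4 "snd p"] by (simp add: resolvent_kernel_def norm_mult abs_mult)
  also have "... \<le> c * ((1 + fst p)\<^sup>2 * (1 + norm (snd p))\<^sup>2) * (gauss 1 (fst p) * gauss 4 (snd p))"
   using le[OF True] by (intro mult_right_mono) (auto intro: mult_nonneg_nonneg less_imp_le[OF gauss_pos])
  also have "... = c * ((1 + fst p)\<^sup>2 * (1 + norm (snd p))\<^sup>2 * (gauss 1 (fst p) * gauss 4 (snd p)))" by (simp add: mult_ac)
  also have "... \<le> c * (256 * gauss 8 (fst p, snd p))" using c poly_gauss_pair[OF True] by (intro mult_left_mono)
  finally show ?thesis by simp
 next
  case False
  then show ?thesis using c gauss_pos[of 8 p] by (simp add: resolvent_kernel_def)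
 qed
 have "integrable lborel ?v" by (rule gauss_dominated[OF m bd]) simp
 then show "integrable (lborel \<Otimes>\<^sub>M lborel) (\<lambda>(s, z). u s z * of_real (resolvent_kernel s z))"
  by (simp add: lborel_prod case_prod_beta')
 have "(\<lambda>s. ?v (s, z)) \<in> borel_measurable borel" using m unfolding borel_prod[symmetric] by measurable
 moreover have "cmod (?v (s, z)) \<le> (c * 256 * gauss 8 z) * gauss 8 s" for s
  using bd[of "(s, z)"] unfolding gauss_pair by (simp add: mult_ac)
 ultimately have "integrable lborel (\<lambda>s. ?v (s, z))" by (rule gauss_dominated) simp
 then show "integrable lborel (\<lambda>s. u s z * of_real (resolvent_kernel s z))" by simp
qed

section \<open>Integral representation of the inverse of \<open>1 - \<Delta>\<close>\<close>

lemma test_one_minus_laplacian: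
 assumes f: "f \<in> test_functions"
 shows "one_minus_laplacian f \<in> test_functions"
proof -
 obtain R where R: "\<forall>x. R < norm x \<longrightarrow> f x = 0" using test_functions_support[OF f] by blast
 have "one_minus_laplacian f x = 0" if x: "R < norm x" for x
 proof -
  have "iter_deriv ks f x = 0" for ks by (rule iter_deriv_support[of R]) (use R x in auto)
  from this[of "[]"] this[of "[_, _]"] show ?thesis
   unfolding one_minus_laplacian_def laplacian_iter_deriv by (simp only: iter_deriv_Nil sum.neutral_const diff_self)
 qed
 then show ?thesis by (rule test_functionsI[OF smooth_one_minus_laplacian[OF test_smooth[OF f]]])
qed

text \<open>The integrand is the derivative of \<open>- \<phi> (x + s z) * exp (- s^2)\<close> times
  a constant in \<open>s\<close>. The boundary term at infinity vanishes because
  \<open>\<phi>\<close> is bounded.\<close>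

lemma integral_over_ray:
 fixes \<phi> :: "'n::finite cfun"
 assumes \<phi>: "smooth \<phi>" and c: "\<And>x. cmod (\<phi> x) \<le> c"
  and int: "integrable lborel (\<lambda>s. (of_real (2 * s) * \<phi> (x + s *\<^sub>R z) -
   (\<Sum>i\<in>UNIV. of_real (z $ i) * partial_deriv i \<phi> (x + s *\<^sub>R z))) * of_real (resolvent_kernel s z))"
 shows "(LBINT s. (of_real (2 * s) * \<phi> (x + s *\<^sub>R z) -
   (\<Sum>i\<in>UNIV. of_real (z $ i) * partial_deriv i \<phi> (x + s *\<^sub>R z))) * of_real (resolvent_kernel s z)) =
  \<phi> x * of_real (gauss 4 z)"
proof (rule tendsto_unique[OF _ tendsto_integral_at_top[OF _ int]])
 let ?f = "\<lambda>s. (of_real (2 * s) * \<phi> (x + s *\<^sub>R z) -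
   (\<Sum>i\<in>UNIV. of_real (z $ i) * partial_deriv i \<phi> (x + s *\<^sub>R z))) * of_real (resolvent_kernel s z)"
 let ?F = "\<lambda>s. - (\<phi> (x + s *\<^sub>R z) * of_real (gauss 1 s)) * of_real (gauss 4 z)"
 let ?F' = "\<lambda>s. (of_real (2 * s) * \<phi> (x + s *\<^sub>R z) -
   (\<Sum>i\<in>UNIV. of_real (z $ i) * partial_deriv i \<phi> (x + s *\<^sub>R z))) * of_real (gauss 1 s * gauss 4 z)"
 have cont: "continuous_on S (\<lambda>s. w (x + s *\<^sub>R z))" if "smooth w" for w :: "'n cfun" and S
  by (intro continuous_on_compose2[OF smooth_continuous[OF that]] continuous_intros) auto
 have ftc: "(LBINT s. indicator {..y} s *\<^sub>R ?f s) = ?F y - ?F 0" if y: "0 \<le> y" for y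
 proof -
  have "(\<lambda>s. indicator {..y} s *\<^sub>R ?f s) = (\<lambda>s. indicator {0..y} s *\<^sub>R ?F' s)"
   by (auto simp: fun_eq_iff resolvent_kernel_def indicator_def)
  moreover have "(LBINT s. indicator {0..y} s *\<^sub>R ?F' s) = ?F y - ?F 0"
  proof (rule integral_FTC_Icc[OF y])
   fix s
   have g: "((\<lambda>s. complex_of_real (gauss 1 s)) has_vector_derivative of_real (- (2 * s) * gauss 1 s)) (at s within {0..y})"
    by (rule has_vector_derivative_of_real, unfold gauss_def has_real_derivative_iff_has_vector_derivative[symmetric])
     (auto intro!: derivative_eq_intros simp: power2_eq_square)
   show "(?F has_vector_derivative ?F' s) (at s within {0..y})"
    by (rule has_vector_derivative_eq_rhs[OF has_vector_derivative_mult_left[OF has_vector_derivative_minus[OF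
      has_vector_derivative_mult[OF has_vector_derivative_line[OF smooth_differentiable[OF \<phi>]] g]]]])
     (simp add: scaleR_conv_of_real algebra_simps sum_distrib_right)
  next
   show "continuous_on {0..y} ?F'"
    by (intro continuous_intros cont \<phi> smooth_partial_deriv continuous_gauss)
  qed
  ultimately show ?thesis by simp
 qed
 have "((\<lambda>s. cmod (\<phi> (x + s *\<^sub>R z) * of_real (gauss 1 s))) \<longlongrightarrow> 0) at_top"
 proof (rule tendsto_sandwich[OF _ _ tendsto_const])
  have "((\<lambda>s :: real. exp (- (s\<^sup>2) / 1)) \<longlongrightarrow> 0) at_top"
   by real_asymp
  from tendsto_mult_right_zero[OF this, of c]
  show "((\<lambda>s :: real. c * gauss 1 s) \<longlongrightarrow> 0) at_top" by (simp add: gauss_def)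
  show "\<forall>\<^sub>F s in at_top. cmod (\<phi> (x + s *\<^sub>R z) * of_real (gauss 1 s)) \<le> c * gauss 1 s"
   by (simp add: norm_mult abs_of_pos[OF gauss_pos] mult_right_mono[OF c less_imp_le[OF gauss_pos]])
 qed simp
 then have "((\<lambda>s. \<phi> (x + s *\<^sub>R z) * of_real (gauss 1 s)) \<longlongrightarrow> 0) at_top" by (simp add: tendsto_norm_zero_iff)
 then have "((\<lambda>s. ?F s - ?F 0) \<longlongrightarrow> - 0 * of_real (gauss 4 z) - ?F 0) at_top"
  by (intro tendsto_diff tendsto_mult tendsto_minus tendsto_const)
 then have "((\<lambda>s. ?F s - ?F 0) \<longlongrightarrow> \<phi> x * of_real (gauss 4 z)) at_top"
  by (simp add: gauss_def)
 then show "((\<lambda>y. LBINT s. indicator {..y} s *\<^sub>R ?f s) \<longlongrightarrow> \<phi> x * of_real (gauss 4 z)) at_top"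
  by (rule tendsto_cong[THEN iffD1, rotated]) (use ftc in \<open>auto intro!: eventually_at_top_linorderI[of 0]\<close>)
qed auto

text \<open>Up to normalisation this is the Laplace transform of the heat semigroup, after the
  substitutions time \<open>= s^2\<close> and displacement \<open>= s z\<close>, which remove the
  singularity at time 0. The width 4 makes integration by parts turn the sum of
  \<open>z $ i * partial_deriv i \<phi>\<close> into \<open>2 * s\<close> times the
  Laplacian.\<close>

lemma resolvent_formula:
 fixes \<phi> :: "'n::finite cfun"
 assumes \<phi>: "\<phi> \<in> test_functions"
 shows "\<phi> x * of_real (LBINT z. gauss 4 (z :: real ^ 'n)) =
   (LBINT s. LBINT z. (of_real (2 * s) * one_minus_laplacian \<phi> (x + s *\<^sub>R z)) * of_real (resolvent_kernel s z))"
proof -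
 have s: "smooth \<phi>" using test_smooth[OF \<phi>] .
 let ?P = "\<lambda>i. partial_deriv i \<phi>"
 let ?U = "\<lambda>s z. of_real (2 * s) * \<phi> (x + s *\<^sub>R z) - (\<Sum>i\<in>UNIV. of_real (z $ i) * ?P i (x + s *\<^sub>R z))"
 obtain c0 where c0: "0 \<le> c0" "\<And>x. cmod (\<phi> x) \<le> c0" using test_bounded[OF \<phi>] by blast
 have "\<exists>c. \<forall>x. cmod (?P i x) \<le> c" for i using test_bounded[OF test_partial_deriv[OF \<phi>]] by metis
 then obtain c1 where c1: "\<And>i x. cmod (?P i x) \<le> c1 i" by metis
 have comp: "continuous_on UNIV (\<lambda>p. w (x + fst p *\<^sub>R snd p))" if "smooth w" for w :: "'n cfun"
  by (intro continuous_on_compose2[OF smooth_continuous[OF that]] continuous_intros) auto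
 have cU: "continuous_on UNIV (\<lambda>p. ?U (fst p) (snd p))"
  by (intro continuous_intros comp s smooth_partial_deriv)
 have bU: "cmod (?U s z) \<le> (2 * c0 + sum c1 UNIV) * ((1 + s)\<^sup>2 * (1 + norm z)\<^sup>2)" if s: "0 \<le> s" for s z
 proof -
  let ?q = "(1 + s)\<^sup>2 * (1 + norm z)\<^sup>2"
  have 1: "1 \<le> (1 + t)\<^sup>2" "t \<le> (1 + t)\<^sup>2" if "0 \<le> t" for t :: real
   using that zero_le_power2[of t] unfolding power2_sum one_power2 by linarith+
  have q: "s \<le> ?q" "norm z \<le> ?q"
   using mult_mono[OF 1(2)[OF s] 1(1)[of "norm z"]] mult_mono[OF 1(1)[OF s] 1(2)[of "norm z"]] s by auto
  have "cmod (?U s z) \<le> cmod (of_real (2 * s) * \<phi> (x + s *\<^sub>R z)) + (\<Sum>i\<in>UNIV. cmod (of_real (z $ i) * ?P i (x + s *\<^sub>R z)))"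
   by (rule order_trans[OF norm_triangle_ineq4 add_left_mono[OF norm_sum]])
  also have "... \<le> (2 * ?q) * c0 + (\<Sum>i\<in>UNIV. ?q * c1 i)"
  proof (rule add_mono, goal_cases)
   case 1
   show ?case unfolding norm_mult using s q(1) c0 by (intro mult_mono) auto
  next
   case 2
   show ?case unfolding norm_mult norm_of_real
    by (intro sum_mono mult_mono c1 order_trans[OF component_le_norm_cart q(2)]) (auto simp: zero_le_mult_iff)
  qed
  also have "... = (2 * c0 + sum c1 UNIV) * ?q" by (simp only: distrib_right sum_distrib_right) (simp add: mult_ac)
  finally show ?thesis .
 qed
 note int = resolvent_kernel_integrable[OF cU bU]
 have "(LBINT s. LBINT z. ?U s z * of_real (resolvent_kernel s z)) =
   (LBINT z. LBINT s. ?U s z * of_real (resolvent_kernel s z))"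
  using lborel_pair.integral_fst[OF int(1)] lborel_pair.integral_snd[OF int(1)] by simp
 also have "... = (LBINT z. \<phi> x * of_real (gauss 4 (z :: real ^ 'n)))"
  by (simp only: integral_over_ray[OF s c0(2) int(2)])
 also have "... = \<phi> x * of_real (LBINT z. gauss 4 (z :: real ^ 'n))" by simp
 also have "(LBINT s. LBINT z. ?U s z * of_real (resolvent_kernel s z)) =
   (LBINT s. LBINT z. (of_real (2 * s) * one_minus_laplacian \<phi> (x + s *\<^sub>R z)) * of_real (resolvent_kernel s z))"
 proof (rule Bochner_Integration.integral_cong[OF refl])
  fix s :: real
  show "(LBINT z. ?U s z * of_real (resolvent_kernel s z)) =
   (LBINT z. (of_real (2 * s) * one_minus_laplacian \<phi> (x + s *\<^sub>R z)) * of_real (resolvent_kernel s z))"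
  proof (cases "0 \<le> s")
   case True
   let ?g = "\<lambda>z :: real ^ 'n. complex_of_real (gauss 4 z)" and ?e = "complex_of_real (gauss 1 s)"
   let ?a = "\<lambda>z. of_real (2 * s) * (\<phi> (x + s *\<^sub>R z) * ?g z)"
   let ?b = "\<lambda>i z. ?P i (x + s *\<^sub>R z) * of_real (z $ i * gauss 4 z)"
   let ?d = "\<lambda>i z. of_real (2 * s) * (partial_deriv i (?P i) (x + s *\<^sub>R z) * ?g z)"
   note sb = test_smooth_bounded[OF \<phi>] test_smooth_bounded[OF test_partial_deriv[OF \<phi>]]
    test_smooth_bounded[OF test_partial_deriv[OF test_partial_deriv[OF \<phi>]]]
   have ia: "integrable lborel ?a" and ib: "\<And>i. integrable lborel (?b i)" and id: "\<And>i. integrable lborel (?d i)"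
    using gauss_by_parts(2)[OF sb(1)] gauss_by_parts(3)[OF sb(2)] gauss_by_parts(2)[OF sb(3)] by auto
   have lin: "(LBINT z. ?e * (a z - (\<Sum>i\<in>UNIV. b i z))) = ?e * ((LBINT z. a z) - (\<Sum>i\<in>UNIV. (LBINT z. b i z)))"
    if "integrable lborel a" "\<And>i. integrable lborel (b i)" for a and b :: "'n \<Rightarrow> 'n cfun"
    using that by (simp add: Bochner_Integration.integral_diff Bochner_Integration.integral_sum integrable_sum)
   have bd: "(LBINT z. ?b i z) = (LBINT z. ?d i z)" for i
   proof -
    have "(LBINT z. ?b i z) = 2 * (LBINT z. ?P i (x + s *\<^sub>R z) * of_real (z $ i / 2 * gauss 4 z))"
     by (subst integral_mult_right_zero[symmetric]) (simp add: mult_ac)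
    also have "... = 2 * (LBINT z. of_real s * partial_deriv i (?P i) (x + s *\<^sub>R z) * ?g z)"
     by (simp only: gauss_by_parts(1)[OF sb(2)])
    also have "... = (LBINT z. ?d i z)"
     by (subst integral_mult_right_zero[symmetric]) (simp add: mult_ac)
    finally show ?thesis .
   qed
   have "(LBINT z. ?U s z * of_real (resolvent_kernel s z)) = (LBINT z. ?e * (?a z - (\<Sum>i\<in>UNIV. ?b i z)))"
    using True by (simp add: resolvent_kernel_def algebra_simps sum_distrib_right sum_distrib_left)
   also have "... = ?e * ((LBINT z. ?a z) - (\<Sum>i\<in>UNIV. (LBINT z. ?b i z)))"
    by (rule lin[OF ia ib])
   also have "... = ?e * ((LBINT z. ?a z) - (\<Sum>i\<in>UNIV. (LBINT z. ?d i z)))" by (simp only: bd)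
   also have "... = (LBINT z. ?e * (?a z - (\<Sum>i\<in>UNIV. ?d i z)))"
    by (rule lin[OF ia id, symmetric])
   also have "... = (LBINT z. (of_real (2 * s) * one_minus_laplacian \<phi> (x + s *\<^sub>R z)) * of_real (resolvent_kernel s z))"
    using True by (simp add: resolvent_kernel_def one_minus_laplacian_def laplacian_def algebra_simps sum_distrib_right sum_distrib_left)
   finally show ?thesis .
  qed (simp add: resolvent_kernel_def)
 qed
 finally show ?thesis by (rule sym)
qed

text \<open>The factor \<open>s\<close> pays for moving one derivative onto the Gaussian, so first
  derivatives need only \<open>(1 - \<Delta>) \<phi>\<close>. A second derivative would leave
  \<open>1 / s\<close>, which is not integrable at 0.\<close>

lemma resolvent_formula_deriv:
 fixes \<phi> :: "'n::finite cfun"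
 assumes \<phi>: "\<phi> \<in> test_functions"
 shows "partial_deriv i \<phi> x * of_real (LBINT z. gauss 4 (z :: real ^ 'n)) =
   (LBINT s. LBINT z. (of_real (z $ i) * one_minus_laplacian \<phi> (x + s *\<^sub>R z)) * of_real (resolvent_kernel s z))"
 unfolding resolvent_formula[OF test_partial_deriv[OF \<phi>]]
proof (rule Bochner_Integration.integral_cong[OF refl])
 fix s :: real
 let ?f = "one_minus_laplacian \<phi>"
 have "one_minus_laplacian (partial_deriv i \<phi>) = partial_deriv i ?f"
  using iter_deriv_one_minus_laplacian[OF test_smooth[OF \<phi>], of "[i]"] by (simp add: iter_deriv_Cons)
 then show "(LBINT z. (of_real (2 * s) * one_minus_laplacian (partial_deriv i \<phi>) (x + s *\<^sub>R z)) * of_real (resolvent_kernel s z)) =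
   (LBINT z. (of_real (z $ i) * ?f (x + s *\<^sub>R z)) * of_real (resolvent_kernel s z))"
 proof (cases "0 \<le> s")
  case True
  let ?e = "complex_of_real (2 * gauss 1 s)"
  assume C: "one_minus_laplacian (partial_deriv i \<phi>) = partial_deriv i ?f"
  have "(LBINT z. (of_real (2 * s) * partial_deriv i ?f (x + s *\<^sub>R z)) * of_real (resolvent_kernel s z)) =
    (LBINT z. ?e * (of_real s * partial_deriv i ?f (x + s *\<^sub>R z) * of_real (gauss 4 z)))"
   using True by (simp add: resolvent_kernel_def mult_ac)
  also have "... = (LBINT z. ?e * (?f (x + s *\<^sub>R z) * of_real (z $ i / 2 * gauss 4 z)))"
   by (simp only: integral_mult_right_zero gauss_by_parts(1)[OF test_smooth_bounded[OF test_one_minus_laplacian[OF \<phi>]]])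
  also have "... = (LBINT z. (of_real (z $ i) * ?f (x + s *\<^sub>R z)) * of_real (resolvent_kernel s z))"
   using True by (simp add: resolvent_kernel_def mult_ac)
  finally show ?thesis unfolding C .
 qed (simp add: resolvent_kernel_def)
qed

text \<open>Moving the weight from \<open>x\<close> to \<open>x + s z\<close> costs at most
  \<open>(1 + s) * (1 + norm z)\<close>, and \<open>h\<close> costs twice the same factor;
  \<open>poly_gauss_pair\<close> absorbs the product into \<open>512 * gauss 8\<close>, with
  \<open>512 = 2 * 256\<close>. What remains is an average of translates of
  \<open>G * f\<close>.\<close>

lemma resolvent_estimate_kernel:
 fixes \<phi> G :: "'n::finite cfun"
 assumes p: "1 \<le> p" and G: "moderate G" and f: "f \<in> test_functions" and u: "continuous_on UNIV u"
  and h: "continuous_on UNIV (\<lambda>p. h (fst p) (snd p))"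
  and hle: "\<And>s z. 0 \<le> s \<Longrightarrow> \<bar>h s z\<bar> \<le> 2 * ((1 + s) * (1 + norm z))"
  and eq: "\<And>x. u x * of_real (LBINT z. gauss 4 (z :: real ^ 'n)) =
   (LBINT s. LBINT z. (of_real (h s z) * f (x + s *\<^sub>R z)) * of_real (resolvent_kernel s z))"
 shows "(LBINT z. gauss 4 (z :: real ^ 'n)) * Lp_norm p (\<lambda>x. G x * u x) \<le>
   512 * (LBINT q. gauss 8 (q :: real \<times> (real ^ 'n))) * Lp_norm p (\<lambda>x. G x * f x)"
proof -
 let ?c = "LBINT z. gauss 4 (z :: real ^ 'n)" and ?W = "LBINT q. gauss 8 (q :: real \<times> (real ^ 'n))"
 let ?F = "\<lambda>x. G x * f x" and ?w = "\<lambda>q :: real \<times> (real ^ 'n). 512 * gauss 8 q"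
 have C0: "G \<in> C_0" and Gm: "cmod (G x) \<le> (1 + norm h) * cmod (G (x + h))" for x h
  using G by (auto simp: moderate_def)
 have cG: "continuous_on UNIV G" using C0 by (simp add: C_0_def)
 have cf: "continuous_on UNIV f" using smooth_continuous[OF test_smooth[OF f]] .
 obtain c where c: "0 \<le> c" "\<And>x. cmod (f x) \<le> c" using test_bounded[OF f] by blast
 obtain b where b: "0 \<le> b" "\<And>x. cmod (G x) \<le> b" using C_0_weight[OF C0] by (auto simp: weight_def)
 have F: "cmod (?F x) \<le> b * c" for x unfolding norm_mult using b c by (intro mult_mono) auto
 have wi: "integrable lborel ?w" using integrable_gauss[of 8] by simp
 have W0: "0 < ?W" by (rule integral_gauss_pos) simp
 have c0: "0 < ?c" by (rule integral_gauss_pos) simp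
 define Y :: "real \<times> (real ^ 'n) \<Rightarrow> real ^ 'n" where "Y = (\<lambda>q. fst q *\<^sub>R snd q)"
 have cY: "continuous_on UNIV Y" unfolding Y_def by (intro continuous_intros)
 have cFY: "continuous_on UNIV (\<lambda>q. ?F (x + Y q))" for x
  by (rule continuous_on_compose2[OF continuous_on_mult[OF cG cf]]) (auto intro!: continuous_intros cY)
 have int: "integrable lborel (\<lambda>q. cmod (?F (x + Y q)) * ?w q)" for x
 proof (rule Bochner_Integration.integrable_bound[OF integrable_mult_right[OF wi, of "b * c"]])
  show "(\<lambda>q. cmod (?F (x + Y q)) * ?w q) \<in> borel_measurable lborel"
   using borel_measurable_continuous_onI[OF continuous_on_mult[OF continuous_on_norm[OF cFY] continuous_on_mult[OF continuous_on_const continuous_gauss]]] by simp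
  show "AE q in lborel. norm (cmod (?F (x + Y q)) * ?w q) \<le> norm (b * c * ?w q)"
   unfolding norm_mult using F b(1) c(1) by (intro always_eventually allI mult_right_mono) (auto simp: norm_mult)
 qed
 have le: "cmod (of_real ?c * (G x * u x)) \<le> (LBINT q. cmod (?F (x + Y q)) * ?w q)" for x
 proof -
  let ?U = "\<lambda>s z. of_real (h s z) * f (x + s *\<^sub>R z)"
  have cU: "continuous_on UNIV (\<lambda>q. ?U (fst q) (snd q))"
   by (intro continuous_intros h continuous_on_compose2[OF cf]) auto
  have one: "(1 + s) * (1 + norm z) \<le> (1 + s)\<^sup>2 * (1 + norm z)\<^sup>2" if "0 \<le> s" for s z
   using that by (intro mult_mono self_le_power) auto
  have "cmod (?U s z) \<le> (2 * c) * ((1 + s)\<^sup>2 * (1 + norm z)\<^sup>2)" if s: "0 \<le> s" for s z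
  proof -
   have "cmod (?U s z) \<le> (2 * ((1 + s) * (1 + norm z))) * c"
    unfolding norm_mult norm_of_real using hle[OF s] c s by (intro mult_mono) auto
   also have "... \<le> (2 * ((1 + s)\<^sup>2 * (1 + norm z)\<^sup>2)) * c" using one[OF s] c(1) by (intro mult_right_mono mult_left_mono) auto
   finally show ?thesis by (simp add: mult_ac)
  qed
  note int' = resolvent_kernel_integrable(1)[OF cU this]
  let ?V = "\<lambda>q. ?U (fst q) (snd q) * of_real (resolvent_kernel (fst q) (snd q))"
  have iV: "integrable lborel ?V" using int' by (simp add: lborel_prod case_prod_beta')
  have "of_real ?c * (G x * u x) = G x * (LBINT q. ?V q)"
   using eq[of x] lborel_pair.integral_fst[OF int'] by (simp add: lborel_prod case_prod_beta' mult_ac)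
  also have "... = (LBINT q. G x * ?V q)" by simp
  finally have E: "of_real ?c * (G x * u x) = (LBINT q. G x * ?V q)" .
  show ?thesis unfolding E
  proof (rule Bochner_Integration.integral_norm_bound_integral[OF integrable_mult_right[OF iV] int])
   fix q :: "real \<times> (real ^ 'n)"
   obtain s z where q: "q = (s, z)" by (cases q)
   show "cmod (G x * ?V q) \<le> cmod (?F (x + Y q)) * ?w q"
   proof (cases "0 \<le> s")
    case False
    then show ?thesis using gauss_pos[of 8 q] by (simp add: q resolvent_kernel_def)
   next
    case s: True
    let ?f = "cmod (f (x + s *\<^sub>R z))" and ?k = "gauss 1 s * gauss 4 z"
    have k: "0 \<le> ?k" by (intro mult_nonneg_nonneg less_imp_le gauss_pos)
    have "norm (s *\<^sub>R z) \<le> s + norm z + s * norm z" using s by simp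
    then have "1 + norm (s *\<^sub>R z) \<le> (1 + s) * (1 + norm z)" by (simp add: algebra_simps)
    then have "cmod (G x) \<le> ((1 + s) * (1 + norm z)) * cmod (G (x + s *\<^sub>R z))"
     using order_trans[OF Gm[of x "s *\<^sub>R z"] mult_right_mono] by simp
    then have "cmod (G x) * (\<bar>h s z\<bar> * ?f * ?k) \<le>
      (((1 + s) * (1 + norm z)) * cmod (G (x + s *\<^sub>R z))) * (2 * ((1 + s) * (1 + norm z)) * ?f * ?k)"
     using hle[OF s] s by (intro mult_mono) (auto simp: less_imp_le gauss_pos)
    also have "... = cmod (?F (x + s *\<^sub>R z)) * (2 * ((1 + s)\<^sup>2 * (1 + norm z)\<^sup>2 * ?k))"
     by (simp add: norm_mult power2_eq_square mult_ac)
    also have "... \<le> cmod (?F (x + s *\<^sub>R z)) * (2 * (256 * gauss 8 (s, z)))"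
     by (intro mult_left_mono poly_gauss_pair s) auto
    finally have "cmod (G x) * (\<bar>h s z\<bar> * ?f * ?k) \<le> cmod (?F (x + s *\<^sub>R z)) * ?w q" by (simp add: q)
    moreover have "cmod (G x * ?V q) = cmod (G x) * (\<bar>h s z\<bar> * ?f * ?k)"
     using s k by (simp add: q resolvent_kernel_def norm_mult abs_of_nonneg less_imp_le gauss_pos abs_mult)
    ultimately show ?thesis by (simp add: q Y_def)
   qed
  qed
 qed
 have inp: "in_Lp p ?F"
  by (rule weight_in_Lp[OF p C_0_weight[OF C0]]) (use D_L_in_Lp[OF test_D_L[OF p f], of "[]"] in simp)
 have "Lp_ball p (512 * ?W * Lp_norm p ?F) (\<lambda>x. of_real ?c * (G x * u x))"
 proof (rule Lp_ball_average[OF p, where M = "lborel :: (real \<times> (real ^ 'n)) measure" and Y = Y and w = ?w and F = ?F])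
  show "Y \<in> borel_measurable lborel" "?w \<in> borel_measurable lborel"
   using borel_measurable_continuous_onI[OF cY] borel_measurable_integrable[OF wi] by simp_all
  show "(\<lambda>x. of_real ?c * (G x * u x)) \<in> borel_measurable lborel"
   using borel_measurable_continuous[of "\<lambda>x. of_real ?c * (G x * u x)"] cG u by (simp add: continuous_on_mult)
  show "(LBINT q. ?w q) \<le> 512 * ?W" by simp
 qed (use W0 wi inp int le in \<open>auto simp: less_imp_le gauss_pos in_Lp_ball sigma_finite_lborel\<close>)
 then have 1: "in_Lp p (\<lambda>x. of_real ?c * (G x * u x))" "Lp_norm p (\<lambda>x. of_real ?c * (G x * u x)) \<le> 512 * ?W * Lp_norm p ?F"
  by (auto simp: Lp_ball_def)
 show ?thesis
 proof -
  have "in_Lp p (\<lambda>x. G x * u x)" using Lp_norm_cmult(1)[OF p 1(1), of "inverse (of_real ?c)"] c0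
   by (simp add: mult.assoc[symmetric])
  from Lp_norm_cmult(2)[OF p this, of "of_real ?c"] 1(2) c0 show ?thesis by simp
 qed
qed

text \<open>One constant serves the function and its first derivatives, since both integral formulas
  have kernels with the same bound.\<close>

lemma resolvent_estimate:
 fixes G :: "'n::finite cfun"
 assumes p: "1 \<le> p" and G: "moderate G"
 shows "\<exists>C\<ge>1. \<forall>\<phi>\<in>test_functions. Lp_norm p (\<lambda>x. G x * \<phi> x) \<le> C * Lp_norm p (\<lambda>x. G x * one_minus_laplacian \<phi> x) \<and>
  (\<forall>i. Lp_norm p (\<lambda>x. G x * partial_deriv i \<phi> x) \<le> C * Lp_norm p (\<lambda>x. G x * one_minus_laplacian \<phi> x))"
proof -
 let ?c = "LBINT z. gauss 4 (z :: real ^ 'n)" and ?W = "LBINT q. gauss 8 (q :: real \<times> (real ^ 'n))"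
 have c: "0 < ?c" by (rule integral_gauss_pos) simp
 define C where "C = 512 * ?W / ?c"
 have C: "a \<le> max C 1 * b" if "?c * a \<le> 512 * ?W * b" "0 \<le> b" for a b
 proof -
  have "a \<le> C * b" using that(1) c by (simp add: C_def field_simps)
  also have "... \<le> max C 1 * b" using that(2) by (intro mult_right_mono) auto
  finally show ?thesis .
 qed
 show ?thesis
 proof (intro exI[of _ "max C 1"] conjI ballI allI)
  fix \<phi> :: "'n cfun" and i assume \<phi>: "\<phi> \<in> test_functions"
  have s: "smooth \<phi>" using test_smooth[OF \<phi>] .
  note f = test_one_minus_laplacian[OF \<phi>]
  show "Lp_norm p (\<lambda>x. G x * \<phi> x) \<le> max C 1 * Lp_norm p (\<lambda>x. G x * one_minus_laplacian \<phi> x)"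
  proof (rule C[OF resolvent_estimate_kernel[OF p G f smooth_continuous[OF s] _ _ resolvent_formula[OF \<phi>]] Lp_norm_nonneg])
   show "\<bar>2 * s\<bar> \<le> 2 * ((1 + s) * (1 + norm z))" if "0 \<le> s" for s and z :: "real ^ 'n"
   proof -
    have "0 \<le> s * norm z" using that by simp
    then show ?thesis using that norm_ge_zero[of z] unfolding distrib_left distrib_right by linarith
   qed
  qed (intro continuous_intros)
  show "Lp_norm p (\<lambda>x. G x * partial_deriv i \<phi> x) \<le> max C 1 * Lp_norm p (\<lambda>x. G x * one_minus_laplacian \<phi> x)"
  proof (rule C[OF resolvent_estimate_kernel[OF p G f smooth_continuous[OF smooth_partial_deriv[OF s]] _ _ resolvent_formula_deriv[OF \<phi>]] Lp_norm_nonneg])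
   show "\<bar>z $ i\<bar> \<le> 2 * ((1 + s) * (1 + norm z))" if "0 \<le> s" for s and z :: "real ^ 'n"
   proof -
    have "0 \<le> s * norm z" using that by simp
    then show ?thesis using that component_le_norm_cart[of z i] unfolding distrib_left distrib_right by linarith
   qed
  qed (intro continuous_intros)
 qed simp
qed

section \<open>Powers of \<open>1 - \<Delta>\<close> and their seminorms\<close>

lemma one_minus_laplacian_iter:
 assumes \<phi>: "smooth \<phi>"
 shows "one_minus_laplacian \<phi> = (\<lambda>x. \<phi> x - (\<Sum>i\<in>UNIV. iter_deriv [i, i] \<phi> x))"
 unfolding one_minus_laplacian_def[abs_def] laplacian_iter_deriv ..

lemma iter_deriv_one_minus_laplacian_eq:
 assumes \<phi>: "smooth \<phi>"
 shows "iter_deriv ks (one_minus_laplacian \<phi>) =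
  (\<lambda>x. 1 * iter_deriv ks \<phi> x + (-1) * (\<Sum>i\<in>UNIV. iter_deriv (ks @ [i, i]) \<phi> x))"
 unfolding iter_deriv_one_minus_laplacian[OF \<phi>] one_minus_laplacian_iter[OF smooth_iter_deriv[OF \<phi>]]
 by (simp add: iter_deriv_append fun_eq_iff)

lemma one_minus_laplacian_D_L:
 fixes \<phi> :: "'n::finite cfun"
 assumes p: "1 \<le> p" and \<phi>: "\<phi> \<in> D_L p" and g: "weight g"
 shows "one_minus_laplacian \<phi> \<in> D_L p"
  and "weighted_norm p g m (one_minus_laplacian \<phi>) \<le> (1 + real CARD('n)) * weighted_norm p g (m + 2) \<phi>"
proof -
 have s: "smooth \<phi>" using D_L_smooth[OF \<phi>] .
 have "in_Lp p (\<lambda>x. \<Sum>i\<in>UNIV. iter_deriv (ks @ [i, i]) \<phi> x)" for ks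
 proof -
  have "Lp_ball p (\<Sum>i\<in>UNIV. Lp_norm p (iter_deriv (ks @ [i, i]) \<phi>)) (\<lambda>x. \<Sum>i\<in>UNIV. iter_deriv (ks @ [i, i]) \<phi> x)"
   by (rule Lp_ball_sum[OF p]) (rule in_Lp_ball[OF D_L_in_Lp[OF \<phi>]])
  then show ?thesis by (simp add: Lp_ball_def)
 qed
 then show "one_minus_laplacian \<phi> \<in> D_L p"
  unfolding D_L_iff iter_deriv_one_minus_laplacian_eq[OF s]
  by (intro conjI allI smooth_one_minus_laplacian s in_Lp_add[OF p] Lp_norm_cmult(1)[OF p] D_L_in_Lp[OF \<phi>])
 show "weighted_norm p g m (one_minus_laplacian \<phi>) \<le> (1 + real CARD('n)) * weighted_norm p g (m + 2) \<phi>"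
 proof (rule weighted_norm_leI)
  fix ks :: "'n list" assume ks: "length ks \<le> m"
  have "Lp_ball p (\<Sum>i\<in>(UNIV :: 'n set). weighted_norm p g (m + 2) \<phi>) (\<lambda>x. \<Sum>i\<in>UNIV. g x * iter_deriv (ks @ [i, i]) \<phi> x)"
   using ks by (intro Lp_ball_sum[OF p] weighted_Lp_ball[OF p g \<phi>]) simp
  with Lp_norm_cmult[OF p, of "\<lambda>x. \<Sum>i\<in>UNIV. g x * iter_deriv (ks @ [i, i]) \<phi> x" "- 1"]
  have 1: "Lp_ball p (real CARD('n) * weighted_norm p g (m + 2) \<phi>) (\<lambda>x. (- 1) * (\<Sum>i\<in>UNIV. g x * iter_deriv (ks @ [i, i]) \<phi> x))"
   unfolding Lp_ball_def by (simp only: sum_constant norm_minus_cancel norm_one mult_1)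
  have "Lp_ball p (weighted_norm p g (m + 2) \<phi>) (\<lambda>x. g x * iter_deriv ks \<phi> x)"
   using ks by (intro weighted_Lp_ball[OF p g \<phi>]) simp
  from Lp_ball_add[OF p this 1]
  show "Lp_ball p ((1 + real CARD('n)) * weighted_norm p g (m + 2) \<phi>) (\<lambda>x. g x * iter_deriv ks (one_minus_laplacian \<phi>) x)"
   unfolding iter_deriv_one_minus_laplacian_eq[OF s] by (simp add: algebra_simps sum_distrib_left)
 qed
qed

abbreviation (input) L_pow :: "nat \<Rightarrow> 'n::finite cfun \<Rightarrow> 'n cfun" where
 "L_pow m \<equiv> one_minus_laplacian ^^ m"

lemma one_minus_laplacian_pow_D_L:
 fixes \<phi> :: "'n::finite cfun"
 assumes p: "1 \<le> p" and \<phi>: "\<phi> \<in> D_L p" and g: "weight g"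
 shows "L_pow m \<phi> \<in> D_L p \<and> weighted_norm p g 0 (L_pow m \<phi>) \<le> (1 + real CARD('n)) ^ m * weighted_norm p g (2 * m) \<phi>"
proof -
 have "L_pow m \<phi> \<in> D_L p \<and> weighted_norm p g j (L_pow m \<phi>) \<le> (1 + real CARD('n)) ^ m * weighted_norm p g (j + 2 * m) \<phi>" for j
 proof (induction m arbitrary: j)
  case 0
  then show ?case using \<phi> by simp
 next
  case (Suc m)
  have "weighted_norm p g j (one_minus_laplacian (L_pow m \<phi>)) \<le> (1 + real CARD('n)) * weighted_norm p g (j + 2) (L_pow m \<phi>)"
   using one_minus_laplacian_D_L(2)[OF p _ g] Suc by blast
  also have "... \<le> (1 + real CARD('n)) * ((1 + real CARD('n)) ^ m * weighted_norm p g (j + 2 + 2 * m) \<phi>)"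
   using Suc[of "j + 2"] by (intro mult_left_mono) auto
  finally show ?case using one_minus_laplacian_D_L(1)[OF p _ g] Suc[of 0] by (simp add: mult.assoc)
 qed
 from this[of 0] show ?thesis by simp
qed

lemma one_minus_laplacian_lincomb:
 assumes f: "smooth f" and g: "smooth g"
 shows "one_minus_laplacian (\<lambda>x. a * f x + b * g x) = (\<lambda>x. a * one_minus_laplacian f x + b * one_minus_laplacian g x)"
 unfolding one_minus_laplacian_def[abs_def] laplacian_iter_deriv
 by (simp add: iter_deriv_add iter_deriv_cmult f g smooth_cmult fun_eq_iff sum.distrib sum_distrib_left algebra_simps)

lemma one_minus_laplacian_pow_lincomb:
 assumes "smooth f" "smooth g"
 shows "L_pow m (\<lambda>x. a * f x + b * g x) = (\<lambda>x. a * L_pow m f x + b * L_pow m g x)"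
proof -
 have "smooth (L_pow m f) \<and> smooth (L_pow m g) \<and> L_pow m (\<lambda>x. a * f x + b * g x) = (\<lambda>x. a * L_pow m f x + b * L_pow m g x)"
  by (induction m) (simp_all add: assms smooth_one_minus_laplacian one_minus_laplacian_lincomb)
 then show ?thesis by blast
qed

lemma weighted_norm_0:
 assumes "smooth \<phi>"
 shows "weighted_norm p g 0 \<phi> = Lp_norm p (\<lambda>x. g x * \<phi> x)"
 using Lp_norm_le_weighted_norm[OF assms, of "[]" 0 p g] weighted_norm_le[of 0 p g \<phi> "Lp_norm p (\<lambda>x. g x * \<phi> x)"]
 by (simp add: order_antisym)

lemma seminorm_on_one_minus_laplacian_pow:
 fixes g :: "'n::finite cfun"
 assumes p: "1 \<le> p" and g: "weight g"
 shows "seminorm_on (D_L p) (\<lambda>\<phi>. Lp_norm p (\<lambda>x. g x * L_pow m \<phi> x))"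
proof -
 have L: "L_pow m \<phi> \<in> D_L p" if "\<phi> \<in> D_L p" for \<phi> :: "'n cfun"
  using one_minus_laplacian_pow_D_L[OF p that g] by blast
 note W = seminorm_on_weighted_norm[OF p g, of 0]
 have eq: "Lp_norm p (\<lambda>x. g x * L_pow m \<phi> x) = weighted_norm p g 0 (L_pow m \<phi>)" if "\<phi> \<in> D_L p" for \<phi> :: "'n cfun"
  using weighted_norm_0[OF D_L_smooth[OF L[OF that]], of p g] by simp
 show ?thesis
  unfolding seminorm_on_def
 proof (intro conjI ballI allI)
  fix \<phi> \<psi> :: "'n cfun" and c assume \<phi>: "\<phi> \<in> D_L p"
  show "0 \<le> Lp_norm p (\<lambda>x. g x * L_pow m \<phi> x)" by (rule Lp_norm_nonneg)
  have 1: "(\<lambda>x. c * \<phi> x) \<in> D_L p" using D_L_lincomb[OF p \<phi> \<phi>, of c 0] by simp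
  have 2: "L_pow m (\<lambda>x. c * \<phi> x) = (\<lambda>x. c * L_pow m \<phi> x)"
   using one_minus_laplacian_pow_lincomb[OF D_L_smooth[OF \<phi>] D_L_smooth[OF \<phi>], of m c 0] by simp
  show "Lp_norm p (\<lambda>x. g x * L_pow m (\<lambda>x. c * \<phi> x) x) = cmod c * Lp_norm p (\<lambda>x. g x * L_pow m \<phi> x)"
   unfolding eq[OF 1] eq[OF \<phi>] unfolding 2 by (rule seminorm_on_cmult[OF W L[OF \<phi>]])
  assume \<psi>: "\<psi> \<in> D_L p"
  have 1: "(\<lambda>x. \<phi> x + \<psi> x) \<in> D_L p" using D_L_lincomb[OF p \<phi> \<psi>, of 1 1] by simp
  have 2: "L_pow m (\<lambda>x. \<phi> x + \<psi> x) = (\<lambda>x. L_pow m \<phi> x + L_pow m \<psi> x)"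
   using one_minus_laplacian_pow_lincomb[OF D_L_smooth[OF \<phi>] D_L_smooth[OF \<psi>], of m 1 1] by simp
  show "Lp_norm p (\<lambda>x. g x * L_pow m (\<lambda>x. \<phi> x + \<psi> x) x) \<le>
    Lp_norm p (\<lambda>x. g x * L_pow m \<phi> x) + Lp_norm p (\<lambda>x. g x * L_pow m \<psi> x)"
   unfolding eq[OF 1] eq[OF \<phi>] eq[OF \<psi>] unfolding 2 by (rule seminorm_on_add[OF W L[OF \<phi>] L[OF \<psi>]])
 qed
qed

text \<open>Each derivative is exchanged for one power of \<open>1 - \<Delta>\<close>, which
  commutes with the remaining derivatives. The integral formulas hold for test functions; truncation
  extends the bound to \<open>D_L p\<close>, because tails vanish in the weighted norms.\<close>

lemma weighted_norm_le_one_minus_laplacian_pow: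
 fixes G :: "'n::finite cfun"
 assumes p: "1 \<le> p" and G: "moderate G"
 shows "\<exists>C\<ge>0. \<forall>\<phi>\<in>D_L p. weighted_norm p G m \<phi> \<le> C * Lp_norm p (\<lambda>x. G x * L_pow m \<phi> x)"
proof -
 have C0: "G \<in> C_0" using G by (simp add: moderate_def)
 note w = C_0_weight[OF C0]
 obtain C where C: "1 \<le> C"
  "\<And>\<phi>. \<phi> \<in> test_functions \<Longrightarrow> Lp_norm p (\<lambda>x. G x * \<phi> x) \<le> C * Lp_norm p (\<lambda>x. G x * one_minus_laplacian \<phi> x)"
  "\<And>\<phi> i. \<phi> \<in> test_functions \<Longrightarrow> Lp_norm p (\<lambda>x. G x * partial_deriv i \<phi> x) \<le> C * Lp_norm p (\<lambda>x. G x * one_minus_laplacian \<phi> x)"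
  using resolvent_estimate[OF p G] by blast
 have tL: "L_pow k \<phi> \<in> test_functions" if "\<phi> \<in> test_functions" for k \<phi>
  by (induction k) (simp_all add: that test_one_minus_laplacian)
 have dL: "L_pow k (partial_deriv i \<phi>) = partial_deriv i (L_pow k \<phi>)" if "\<phi> \<in> test_functions" for k i and \<phi> :: "'n cfun"
 proof (induction k)
  case (Suc k)
  then show ?case
   using iter_deriv_one_minus_laplacian[OF test_smooth[OF tL[OF that, of k]], of "[i]"] by (simp add: iter_deriv_Cons)
 qed simp
 have 1: "Lp_norm p (\<lambda>x. G x * iter_deriv ks \<phi> x) \<le> C ^ length ks * Lp_norm p (\<lambda>x. G x * L_pow (length ks) \<phi> x)"
  if "\<phi> \<in> test_functions" for ks \<phi>
  using that
 proof (induction ks arbitrary: \<phi>)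
  case (Cons i ks)
  let ?k = "length ks"
  have "Lp_norm p (\<lambda>x. G x * iter_deriv ks (partial_deriv i \<phi>) x) \<le> C ^ ?k * Lp_norm p (\<lambda>x. G x * L_pow ?k (partial_deriv i \<phi>) x)"
   using Cons.IH[OF test_partial_deriv[OF Cons.prems]] .
  also have "... \<le> C ^ ?k * (C * Lp_norm p (\<lambda>x. G x * one_minus_laplacian (L_pow ?k \<phi>) x))"
   unfolding dL[OF Cons.prems] using C(1) by (intro mult_left_mono C(3) tL Cons.prems) auto
  finally show ?case by (simp add: iter_deriv_Cons mult.assoc mult.left_commute)
 qed (simp add: iter_deriv_Nil)
 have 2: "Lp_norm p (\<lambda>x. G x * \<phi> x) \<le> C ^ j * Lp_norm p (\<lambda>x. G x * L_pow j \<phi> x)" if \<phi>: "\<phi> \<in> test_functions" for j \<phi>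
 proof (induction j)
  case (Suc j)
  have "C ^ j * Lp_norm p (\<lambda>x. G x * L_pow j \<phi> x) \<le> C ^ j * (C * Lp_norm p (\<lambda>x. G x * one_minus_laplacian (L_pow j \<phi>) x))"
   using C(1) by (intro mult_left_mono C(2) tL \<phi>) auto
  then show ?case using Suc by (simp add: mult_ac)
 qed simp
 have test: "weighted_norm p G m \<phi> \<le> C ^ m * Lp_norm p (\<lambda>x. G x * L_pow m \<phi> x)" if \<phi>: "\<phi> \<in> test_functions" for \<phi>
 proof (rule weighted_norm_le)
  fix ks :: "'n list" assume ks: "length ks \<le> m"
  let ?k = "length ks"
  have "Lp_norm p (\<lambda>x. G x * iter_deriv ks \<phi> x) \<le> C ^ ?k * Lp_norm p (\<lambda>x. G x * L_pow ?k \<phi> x)" by (rule 1[OF \<phi>])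
  \<comment> \<open>A word shorter than \<open>m\<close> uses fewer powers; the missing ones are
    filled up by the estimate of a function by \<open>1 - \<Delta>\<close> applied to it.\<close>
  also have "... \<le> C ^ ?k * (C ^ (m - ?k) * Lp_norm p (\<lambda>x. G x * L_pow (m - ?k) (L_pow ?k \<phi>) x))"
   using C(1) by (intro mult_left_mono 2 tL \<phi>) auto
  also have "... = C ^ m * Lp_norm p (\<lambda>x. G x * L_pow m \<phi> x)"
  proof -
   have "L_pow (m - ?k) (L_pow ?k \<phi>) = L_pow m \<phi>" using ks by (metis comp_apply funpow_add le_add_diff_inverse2)
   moreover have "C ^ ?k * C ^ (m - ?k) = C ^ m" using ks by (simp flip: power_add)
   ultimately show ?thesis by (simp flip: mult.assoc)
  qed
  finally show "Lp_norm p (\<lambda>x. G x * iter_deriv ks \<phi> x) \<le> C ^ m * Lp_norm p (\<lambda>x. G x * L_pow m \<phi> x)" .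
 qed
 let ?N = "1 + real CARD('n)"
 have "weighted_norm p G m \<phi> \<le> C ^ m * Lp_norm p (\<lambda>x. G x * L_pow m \<phi> x)" if \<phi>: "\<phi> \<in> D_L p" for \<phi>
 proof -
  let ?t = "\<lambda>k x. tail_cutoff (real k) x * \<phi> x" and ?u = "\<lambda>k x. cutoff (real k) x * \<phi> x"
  let ?q = "\<lambda>\<phi>. Lp_norm p (\<lambda>x. G x * L_pow m \<phi> x)"
  note sW = seminorm_on_weighted_norm[OF p w] and sq = seminorm_on_one_minus_laplacian_pow[OF p w, of m]
  \<comment> \<open>The tail appears twice: in order \<open>m\<close> from splitting
    \<open>\<phi>\<close>, and in order \<open>2 * m\<close> because the operator of power
    \<open>m\<close> contains \<open>2 * m\<close> derivatives.\<close>
  have "weighted_norm p G m \<phi> \<le> C ^ m * (?q \<phi> + ?N ^ m * weighted_norm p G (2 * m) (?t k)) + weighted_norm p G m (?t k)"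
   if k: "1 \<le> k" for k
  proof -
   have k0: "0 < real k" using k by simp
   have t: "?t k \<in> D_L p" by (rule tail_cutoff_D_L[OF p k0 \<phi>])
   have ut: "?u k \<in> test_functions" by (rule cutoff_mult_test[OF D_L_smooth[OF \<phi>] k0])
   note u = test_D_L[OF p ut]
   have e: "\<phi> = (\<lambda>x. ?u k x + ?t k x)" by (simp add: tail_cutoff_mult)
   have mt: "(\<lambda>x. - 1 * ?t k x) \<in> D_L p" using D_L_lincomb[OF p t t, of "- 1" 0] by simp
   have "?q (?u k) = ?q (\<lambda>x. \<phi> x + - 1 * ?t k x)" by (simp add: tail_cutoff_mult)
   also have "... \<le> ?q \<phi> + ?q (\<lambda>x. - 1 * ?t k x)" by (rule seminorm_on_add[OF sq \<phi> mt])
   also have "?q (\<lambda>x. - 1 * ?t k x) = ?q (?t k)" using seminorm_on_cmult[OF sq t, of "- 1"] by simp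
   also have "?q (?t k) \<le> ?N ^ m * weighted_norm p G (2 * m) (?t k)"
   proof -
    have "L_pow m (?t k) \<in> D_L p" "weighted_norm p G 0 (L_pow m (?t k)) \<le> ?N ^ m * weighted_norm p G (2 * m) (?t k)"
     using one_minus_laplacian_pow_D_L[OF p t w, of m] by blast+
    then show ?thesis using weighted_norm_0[OF D_L_smooth[of "L_pow m (?t k)" p], of p G] by simp
   qed
   finally have q: "?q (?u k) \<le> ?q \<phi> + ?N ^ m * weighted_norm p G (2 * m) (?t k)" by simp
   have "weighted_norm p G m \<phi> \<le> weighted_norm p G m (?u k) + weighted_norm p G m (?t k)"
    by (subst e) (rule seminorm_on_add[OF sW u t])
   also have "weighted_norm p G m (?u k) \<le> C ^ m * ?q (?u k)" by (rule test[OF ut])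
   also have "C ^ m * ?q (?u k) \<le> C ^ m * (?q \<phi> + ?N ^ m * weighted_norm p G (2 * m) (?t k))"
    using C(1) q by (intro mult_left_mono) auto
   finally show ?thesis by simp
  qed
  then have ev: "\<forall>\<^sub>F k in sequentially. weighted_norm p G m \<phi> \<le> C ^ m * (?q \<phi> + ?N ^ m * weighted_norm p G (2 * m) (?t k)) + weighted_norm p G m (?t k)"
   by (rule eventually_sequentiallyI)
  have "(\<lambda>k. C ^ m * (?q \<phi> + ?N ^ m * weighted_norm p G (2 * m) (?t k)) + weighted_norm p G m (?t k)) \<longlonglongrightarrow>
    C ^ m * (?q \<phi> + ?N ^ m * 0) + 0"
   by (intro tendsto_intros weighted_norm_tail_tendsto_0[OF p C0 \<phi>])
  then show ?thesis using tendsto_lowerbound[OF _ ev] by simp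
 qed
 then show ?thesis using C(1) by (intro exI[of _ "C ^ m"]) auto
qed

section \<open>The topology of uniform convergence on compact sets\<close>

lemma D_L_pairing_lincomb:
 fixes \<phi> \<psi> :: "'n::finite cfun"
 assumes p: "1 < p" and \<phi>: "\<phi> \<in> D_L p" and \<psi>: "\<psi> \<in> D_L p" and T: "T \<in> dual p"
 shows "D_L_pairing p (\<lambda>x. a * \<phi> x + b * \<psi> x) T = a * D_L_pairing p \<phi> T + b * D_L_pairing p \<psi> T"
proof (rule LIMSEQ_unique)
 have p': "1 \<le> p" using p by simp
 let ?c = "\<lambda>\<phi> k x. cutoff (real k) x * \<phi> x"
 have "T (?c (\<lambda>x. a * \<phi> x + b * \<psi> x) k) = a * T (?c \<phi> k) + b * T (?c \<psi> k)" if "1 \<le> k" for k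
 proof -
  have k: "0 < real k" using that by simp
  have "?c (\<lambda>x. a * \<phi> x + b * \<psi> x) k = (\<lambda>x. a * ?c \<phi> k x + b * ?c \<psi> k x)" by (simp add: fun_eq_iff algebra_simps)
  then show ?thesis
   using dual_lincomb[OF p' T cutoff_core[OF p' D_L_smooth[OF \<phi>] k] cutoff_core[OF p' D_L_smooth[OF \<psi>] k]] by simp
 qed
 then have "\<forall>\<^sub>F k in sequentially. T (?c (\<lambda>x. a * \<phi> x + b * \<psi> x) k) = a * T (?c \<phi> k) + b * T (?c \<psi> k)"
  by (rule eventually_sequentiallyI)
 from tendsto_cong[OF this, THEN iffD1, OF D_L_pairing_tendsto[OF p D_L_lincomb[OF p' \<phi> \<psi>] T]]
 show "(\<lambda>k. a * T (?c \<phi> k) + b * T (?c \<psi> k)) \<longlonglongrightarrow> D_L_pairing p (\<lambda>x. a * \<phi> x + b * \<psi> x) T" .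
 show "(\<lambda>k. a * T (?c \<phi> k) + b * T (?c \<psi> k)) \<longlonglongrightarrow> a * D_L_pairing p \<phi> T + b * D_L_pairing p \<psi> T"
  by (intro tendsto_intros D_L_pairing_tendsto p \<phi> \<psi> T)
qed

text \<open>The bound passes to the limit of truncations because the weight makes their error
  vanish, even where the truncations do not converge in \<open>D_L p\<close>.\<close>

lemma D_L_pairing_bound:
 fixes \<phi> :: "'n::finite cfun"
 assumes p: "1 < p" and \<phi>: "\<phi> \<in> D_L p" and T: "T \<in> dual p" and G: "G \<in> C_0" and C: "0 \<le> C"
  and le: "\<And>\<psi>. \<psi> \<in> test_functions \<Longrightarrow> cmod (T \<psi>) \<le> C * weighted_norm p G m \<psi>"
 shows "cmod (D_L_pairing p \<phi> T) \<le> C * weighted_norm p G m \<phi>"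
proof -
 have p': "1 \<le> p" using p by simp
 let ?t = "\<lambda>k x. tail_cutoff (real k) x * \<phi> x" and ?u = "\<lambda>k x. cutoff (real k) x * \<phi> x"
 note W = seminorm_on_weighted_norm[OF p' C_0_weight[OF G], of m]
 have "cmod (T (?u k)) \<le> C * (weighted_norm p G m \<phi> + weighted_norm p G m (?t k))" if k: "1 \<le> k" for k
 proof -
  have k0: "0 < real k" using k by simp
  have t: "?t k \<in> D_L p" by (rule tail_cutoff_D_L[OF p' k0 \<phi>])
  have mt: "(\<lambda>x. - 1 * ?t k x) \<in> D_L p" using D_L_lincomb[OF p' t t, of "- 1" 0] by simp
  have e: "?u k = (\<lambda>x. \<phi> x + - 1 * ?t k x)" by (simp add: tail_cutoff_mult)
  have "weighted_norm p G m (?u k) \<le> weighted_norm p G m \<phi> + weighted_norm p G m (\<lambda>x. - 1 * ?t k x)"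
   unfolding e by (rule seminorm_on_add[OF W \<phi> mt])
  also have "weighted_norm p G m (\<lambda>x. - 1 * ?t k x) = weighted_norm p G m (?t k)"
   using seminorm_on_cmult[OF W t, of "- 1"] by simp
  finally show ?thesis
   using order_trans[OF le[OF cutoff_mult_test[OF D_L_smooth[OF \<phi>] k0]] mult_left_mono[OF _ C]] by blast
 qed
 then have ev: "\<forall>\<^sub>F k in sequentially. cmod (T (?u k)) \<le> C * (weighted_norm p G m \<phi> + weighted_norm p G m (?t k))"
  by (rule eventually_sequentiallyI)
 have "(\<lambda>k. C * (weighted_norm p G m \<phi> + weighted_norm p G m (?t k))) \<longlonglongrightarrow> C * (weighted_norm p G m \<phi> + 0)"
  by (intro tendsto_intros weighted_norm_tail_tendsto_0[OF p' G \<phi>])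
 from tendsto_le[OF _ this tendsto_norm[OF D_L_pairing_tendsto[OF p \<phi> T]] ev] show ?thesis by simp
qed

lemma compactin_dual_subset: "compactin (dual_topology p) K \<Longrightarrow> K \<subseteq> dual p"
 using compactin_subset_topspace[of "dual_topology p" K] by (simp add: dual_topology_def topspace_seminorm_topology)

lemma kappa_seminorm_dominated:
 fixes K :: "'n::finite functional set"
 assumes p: "1 < p" and K: "compactin (dual_topology p) K"
 shows "\<exists>G\<in>C_0. \<exists>m C. \<forall>\<phi>\<in>D_L p. \<forall>T\<in>K. cmod (D_L_pairing p \<phi> T) \<le> C * weighted_norm p G m \<phi>"
proof -
 obtain G m C where G: "G \<in> C_0" "0 \<le> C" "\<forall>T\<in>K. \<forall>\<phi>\<in>test_functions. cmod (T \<phi>) \<le> C * weighted_norm p G m \<phi>"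
  using compactin_dominated_by_weight[OF p K] by blast
 have "cmod (D_L_pairing p \<phi> T) \<le> C * weighted_norm p G m \<phi>" if "\<phi> \<in> D_L p" "T \<in> K" for \<phi> T
  using that G compactin_dual_subset[OF K] by (intro D_L_pairing_bound[OF p _ _ G(1,2)]) auto
 then show ?thesis using G(1) by (intro bexI[of _ G] exI[of _ m] exI[of _ C]) auto
qed

lemma seminorm_on_SUP:
 assumes K: "K \<noteq> {}" and b: "\<And>f. f \<in> E \<Longrightarrow> bdd_above ((\<lambda>T. cmod (B f T)) ` K)" and E: "function_space E"
  and lin: "\<And>f g a b T. f \<in> E \<Longrightarrow> g \<in> E \<Longrightarrow> T \<in> K \<Longrightarrow> B (\<lambda>x. a * f x + b * g x) T = a * B f T + b * B g T"
 shows "seminorm_on E (\<lambda>f. SUP T\<in>K. cmod (B f T))"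
 unfolding seminorm_on_def
proof (intro conjI ballI allI)
 fix f g c assume f: "f \<in> E"
 have up: "cmod (B f T) \<le> (SUP T\<in>K. cmod (B f T))" if "f \<in> E" "T \<in> K" for f T
  using that by (intro cSUP_upper b)
 obtain T where "T \<in> K" using K by blast
 then show "0 \<le> (SUP T\<in>K. cmod (B f T))" using order_trans[OF norm_ge_zero up[OF f]] by blast
 have Bc: "B (\<lambda>x. c * f x) T = c * B f T" if "f \<in> E" "T \<in> K" for f c T
  using lin[OF that(1,1,2), of c 0] by simp
 have le: "(SUP T\<in>K. cmod (B (\<lambda>x. c * f x) T)) \<le> cmod c * (SUP T\<in>K. cmod (B f T))" if "f \<in> E" for f c
  using that by (intro cSUP_least K) (simp add: Bc norm_mult mult_left_mono up)
 show "(SUP T\<in>K. cmod (B (\<lambda>x. c * f x) T)) = cmod c * (SUP T\<in>K. cmod (B f T))"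
 proof (cases "c = 0")
  case True
  then show ?thesis using K Bc[OF f, of _ 0] by (simp cong: SUP_cong_simp)
 next
  case False
  have "(\<lambda>x. c * f x) \<in> E" using function_space_lincomb[OF E f f, of c 0] by simp
  from le[OF this, of "inverse c"] have "(SUP T\<in>K. cmod (B f T)) \<le> inverse (cmod c) * (SUP T\<in>K. cmod (B (\<lambda>x. c * f x) T))"
   using False by (simp add: mult.assoc[symmetric] norm_inverse)
  then have "cmod c * (SUP T\<in>K. cmod (B f T)) \<le> (SUP T\<in>K. cmod (B (\<lambda>x. c * f x) T))"
   using False by (simp add: field_simps)
  then show ?thesis using le[OF f, of c] by simp
 qed
 assume g: "g \<in> E"
 have "B (\<lambda>x. f x + g x) T = B f T + B g T" if "T \<in> K" for T using lin[OF f g that, of 1 1] by simp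
 then show "(SUP T\<in>K. cmod (B (\<lambda>x. f x + g x) T)) \<le> (SUP T\<in>K. cmod (B f T)) + (SUP T\<in>K. cmod (B g T))"
  by (intro cSUP_least K) (simp add: norm_triangle_mono up f g)
qed

text \<open>For finite exponents a norming functional in the polar gives the value directly.
  Otherwise weighted evaluations of derivatives belong to the polar, and their pairing with
  \<open>\<phi>\<close> is the expected value, since the truncations eventually equal
  \<open>\<phi>\<close> near the point.\<close>

lemma weighted_norm_le_kappa:
 fixes g :: "'n::finite cfun"
 assumes p: "1 < p" and g: "g \<in> C_0" and \<phi>: "\<phi> \<in> D_L p"
 shows "weighted_norm p g m \<phi> \<le> (SUP T\<in>polar p g m. cmod (D_L_pairing p \<phi> T))"
proof (rule weighted_norm_leI)
 have p': "1 \<le> p" using p by simp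
 fix ks :: "'n list" assume ks: "length ks \<le> m"
 have "cmod (D_L_pairing p \<phi> T) \<le> 1 * weighted_norm p g m \<phi>" if "T \<in> polar p g m" for T
  using that test_core[OF p'] by (intro D_L_pairing_bound[OF p \<phi> _ g]) (auto simp: polar_def)
 then have b: "bdd_above ((\<lambda>T. cmod (D_L_pairing p \<phi> T)) ` polar p g m)" by (intro bdd_aboveI2) auto
 have up: "cmod (D_L_pairing p \<phi> T) \<le> (SUP T\<in>polar p g m. cmod (D_L_pairing p \<phi> T))" if "T \<in> polar p g m" for T
  using that b by (rule cSUP_upper)
 have inp: "in_Lp p (\<lambda>x. g x * iter_deriv ks \<phi> x)"
  by (rule weight_in_Lp[OF p' C_0_weight[OF g] D_L_in_Lp[OF \<phi>]])
 show "Lp_ball p (SUP T\<in>polar p g m. cmod (D_L_pairing p \<phi> T)) (\<lambda>x. g x * iter_deriv ks \<phi> x)"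
 proof (cases "p = \<infinity>")
  case False
  obtain T where T: "T \<in> polar p g m" "T \<phi> = of_real (Lp_norm p (\<lambda>x. g x * iter_deriv ks \<phi> x))"
   using polar_norming[OF p' False g ks \<phi>] by blast
  then show ?thesis using up[OF T(1)] False inp by (simp add: D_L_pairing_def Lp_ball_def Lp_norm_nonneg)
 next
  case True
  have le: "cmod (g x * iter_deriv ks \<phi> x) \<le> (SUP T\<in>polar p g m. cmod (D_L_pairing p \<phi> T))" for x
  proof -
   let ?T = "\<lambda>\<psi>. if \<psi> \<in> core \<infinity> then g x * iter_deriv ks \<psi> x else 0"
   have T: "?T \<in> polar p g m" unfolding True by (rule evaluation_in_polar[OF g ks])
   then have Td: "?T \<in> dual p" by (simp add: polar_def)
   obtain k0 :: nat where k0: "norm x < k0" using reals_Archimedean2 by blast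
   have "?T (\<lambda>x. cutoff (real k) x * \<phi> x) = g x * iter_deriv ks \<phi> x" if k: "k0 \<le> k" for k
   proof -
    have xk: "norm x < real k" using k0 k by simp
    then have k': "0 < real k" using norm_ge_zero[of x] by linarith
    have "iter_deriv ks (\<lambda>x. cutoff (real k) x * \<phi> x) x = iter_deriv ks \<phi> x"
    proof (rule iter_deriv_local)
     show "open (ball 0 (real k))" by simp
     show "cutoff (real k) y * \<phi> y = \<phi> y" if "y \<in> ball 0 (real k)" for y
      using that cutoff_eq_1[OF k', of y] by simp
    qed (use xk in simp)
    then show ?thesis using cutoff_core[OF _ D_L_smooth[OF \<phi>] k', of \<infinity>] by simp
   qed
   then have "(\<lambda>k. ?T (\<lambda>x. cutoff (real k) x * \<phi> x)) \<longlonglongrightarrow> g x * iter_deriv ks \<phi> x"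
    by (intro tendsto_eventually eventually_sequentiallyI)
   from LIMSEQ_unique[OF D_L_pairing_tendsto[OF p \<phi> Td] this] up[OF T] show ?thesis by simp
  qed
  show ?thesis
   unfolding True
   by (rule bounded_in_Lp_infinity[OF _ _ le[unfolded True]])
    (use inp in_Lp_measurable order_trans[OF norm_ge_zero le[of 0]] True in auto)
 qed
qed

section \<open>Conjugate exponents and the comparison of the three families\<close>

lemma inverse_inverse_ennreal: "inverse (inverse x) = (x :: ennreal)"
proof (cases x)
 case (real r)
 then show ?thesis by (cases "r = 0") (auto simp: inverse_ennreal)
qed simp

text \<open>Extended arithmetic has \<open>1 / \<infinity> = 0\<close>, so the relation between the
  exponents itself forces \<open>q = 1\<close> for infinite \<open>p\<close>, the case in which the
  predual is \<open>B_dot\<close>.\<close>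

lemma predual_eq:
 assumes p: "1 < p" and pq: "1 / p + 1 / q = 1"
 shows "predual q = core p" "predual_seminorms q = D_L_seminorms p"
proof -
 have "if q = 1 then p = \<infinity> else p \<noteq> \<infinity> \<and> conjugate_exponent q = p"
 proof (cases "p = \<infinity>")
  case True
  then have "inverse q = 1" using pq by (simp add: divide_ennreal_def)
  then have "q = 1" using inverse_inverse_ennreal[of q] by simp
  then show ?thesis using True by simp
 next
  case False
  \<comment> \<open>Cancellation by subtraction in the extended nonnegative reals requires a finite
    term.\<close>
  have ne: "inverse q \<noteq> \<infinity>"
  proof
   assume "inverse q = \<infinity>"
   then show False using pq by (simp add: divide_ennreal_def)
  qed
  have "1 - inverse q = inverse p"
  proof -
   have "1 - inverse q = (inverse p + inverse q) - inverse q" using pq by (simp add: divide_ennreal_def)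
   then show ?thesis using ne by simp
  qed
  then have "conjugate_exponent q = p" by (simp add: conjugate_exponent_def inverse_inverse_ennreal)
  moreover have "q \<noteq> 1" using \<open>1 - inverse q = inverse p\<close> False by auto
  ultimately show ?thesis using False by simp
 qed
 then show "predual q = core p" "predual_seminorms q = D_L_seminorms p"
  by (auto simp: predual_def predual_seminorms_def core_def split: if_splits)
qed

theorem proposition4:
  fixes p q :: ennreal
  assumes "1 < p" and "1 / p + 1 / q = 1"
  shows "generated_by_seminorms
           (kappa_topology (D_L p :: (real ^ 'n \<Rightarrow> complex) set) (D'_L_topology q) (D_L_pairing p))
           (D_L p)
           {\<lambda>\<phi>. Lp_norm p (\<lambda>x. g x * (one_minus_laplacian ^^ m) \<phi> x) | g m. g \<in> C_0}
       \<and> generated_by_seminorms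
           (kappa_topology (D_L p :: (real ^ 'n \<Rightarrow> complex) set) (D'_L_topology q) (D_L_pairing p))
           (D_L p)
           {\<lambda>\<phi>. SUP \<alpha>\<in>multi_indices m. Lp_norm p (\<lambda>x. g x * multi_deriv \<alpha> \<phi> x) | g m. g \<in> C_0}"
proof -
 have p: "1 < p" "1 \<le> p" using assms(1) by auto
 let ?E = "D_L p :: 'n cfun set"
 let ?P = "{\<lambda>\<phi>. SUP T\<in>K. cmod (D_L_pairing p \<phi> T) | K. absolutely_convex K \<and> compactin (dual_topology p) K}
  :: ('n cfun \<Rightarrow> real) set"
 let ?Q = "{\<lambda>\<phi>. Lp_norm p (\<lambda>x. g x * (one_minus_laplacian ^^ m) \<phi> x) | g m. g \<in> C_0} :: ('n cfun \<Rightarrow> real) set"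
 \<comment> \<open>Both topologies are compared with this family: polars link it to the compact
   sets, moderate weights to the powers of \<open>1 - \<Delta>\<close>.\<close>
 let ?R = "{weighted_norm p g m | g m. g \<in> C_0} :: ('n cfun \<Rightarrow> real) set"
 have top: "D'_L_topology q = (dual_topology p :: 'n functional topology)"
  by (simp add: D'_L_topology_def D'_L_def D'_L_seminorms_def predual_eq[OF assms] dual_topology_def dual_def)
 have E: "function_space ?E" by (rule function_space_D_L[OF p(2)])
 have sP: "\<forall>r\<in>?P. seminorm_on ?E r"
 proof clarify
  fix K :: "'n functional set"
  assume K: "absolutely_convex K" "compactin (dual_topology p) K"
  obtain G m C where "\<And>\<phi> T. \<phi> \<in> ?E \<Longrightarrow> T \<in> K \<Longrightarrow> cmod (D_L_pairing p \<phi> T) \<le> C * weighted_norm p G m \<phi>"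
   using kappa_seminorm_dominated[OF p(1) K(2)] by blast
  then show "seminorm_on ?E (\<lambda>\<phi>. SUP T\<in>K. cmod (D_L_pairing p \<phi> T))"
   using K compactin_dual_subset[OF K(2)]
   by (intro seminorm_on_SUP E D_L_pairing_lincomb[OF p(1)] bdd_aboveI2) (auto simp: absolutely_convex_def)
 qed
 have sQ: "\<forall>r\<in>?Q. seminorm_on ?E r"
  using seminorm_on_one_minus_laplacian_pow[OF p(2) C_0_weight] by blast
 have sR: "\<forall>r\<in>?R. seminorm_on ?E r"
  using seminorm_on_weighted_norm[OF p(2) C_0_weight] by blast
 have PR: "seminorm_topology ?E ?P = seminorm_topology ?E ?R"
 proof (rule seminorm_topology_eqI[OF E sP sR])
  fix r assume "r \<in> ?P"
  then obtain K where K: "absolutely_convex K" "compactin (dual_topology p) K"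
   and r: "r = (\<lambda>\<phi>. SUP T\<in>K. cmod (D_L_pairing p \<phi> T))" by blast
  obtain G m C where G: "G \<in> C_0"
   "\<And>\<phi> T. \<phi> \<in> ?E \<Longrightarrow> T \<in> K \<Longrightarrow> cmod (D_L_pairing p \<phi> T) \<le> C * weighted_norm p G m \<phi>"
   using kappa_seminorm_dominated[OF p(1) K(2)] by blast
  then have "\<forall>f\<in>?E. r f \<le> C * weighted_norm p G m f"
   unfolding r using K(1) by (intro ballI cSUP_least) (auto simp: absolutely_convex_def)
  moreover have "weighted_norm p G m \<in> ?R" using G(1) by blast
  ultimately show "\<exists>\<sigma>\<in>?R. \<exists>C. \<forall>f\<in>?E. r f \<le> C * \<sigma> f" by (intro bexI[of _ "weighted_norm p G m"] exI[of _ C])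
 next
  fix \<sigma> assume "\<sigma> \<in> ?R"
  then obtain g m where g: "g \<in> C_0" and \<sigma>: "\<sigma> = weighted_norm p g m" by blast
  let ?r = "\<lambda>\<phi> :: 'n cfun. SUP T\<in>polar p g m. cmod (D_L_pairing p \<phi> T)"
  have "?r \<in> ?P" using absolutely_convex_polar[OF p(2) C_0_weight[OF g]] compactin_polar[OF p(2) g] by blast
  moreover have "\<forall>f\<in>?E. \<sigma> f \<le> 1 * ?r f" using weighted_norm_le_kappa[OF p(1) g] by (simp add: \<sigma>)
  ultimately show "\<exists>r\<in>?P. \<exists>C. \<forall>f\<in>?E. \<sigma> f \<le> C * r f" by (intro bexI[of _ ?r] exI[of _ 1])
 qed
 have QR: "seminorm_topology ?E ?Q = seminorm_topology ?E ?R"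
 proof (rule seminorm_topology_eqI[OF E sQ sR])
  fix r assume "r \<in> ?Q"
  then obtain g m where g: "g \<in> C_0" and r: "r = (\<lambda>\<phi>. Lp_norm p (\<lambda>x. g x * (one_minus_laplacian ^^ m) \<phi> x))" by blast
  have "\<forall>f\<in>?E. r f \<le> (1 + real CARD('n)) ^ m * weighted_norm p g (2 * m) f"
  proof
   fix f assume "f \<in> ?E"
   from one_minus_laplacian_pow_D_L[OF p(2) this C_0_weight[OF g], of m]
   show "r f \<le> (1 + real CARD('n)) ^ m * weighted_norm p g (2 * m) f"
    using weighted_norm_0[OF D_L_smooth, of "(one_minus_laplacian ^^ m) f" p p g] by (simp add: r)
  qed
  moreover have "weighted_norm p g (2 * m) \<in> ?R" using g by blast
  ultimately show "\<exists>\<sigma>\<in>?R. \<exists>C. \<forall>f\<in>?E. r f \<le> C * \<sigma> f"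
   by (intro bexI[of _ "weighted_norm p g (2 * m)"] exI[of _ "(1 + real CARD('n)) ^ m"])
 next
  fix \<sigma> assume "\<sigma> \<in> ?R"
  then obtain g m where g: "g \<in> C_0" and \<sigma>: "\<sigma> = weighted_norm p g m" by blast
  \<comment> \<open>The resolvent estimate needs a moderate weight, so \<open>g\<close> is enlarged
    first; the larger weight still vanishes at infinity, hence its seminorm belongs to
    \<open>?Q\<close>.\<close>
  obtain G where G: "moderate G" "\<And>x. cmod (g x) \<le> cmod (G x)" using moderate_dominates_C_0[OF g] by blast
  then have C0: "G \<in> C_0" by (simp add: moderate_def)
  obtain C where C: "\<And>\<phi>. \<phi> \<in> ?E \<Longrightarrow> weighted_norm p G m \<phi> \<le> C * Lp_norm p (\<lambda>x. G x * (one_minus_laplacian ^^ m) \<phi> x)"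
   using weighted_norm_le_one_minus_laplacian_pow[OF p(2) G(1)] by blast
  let ?r = "\<lambda>\<phi> :: 'n cfun. Lp_norm p (\<lambda>x. G x * (one_minus_laplacian ^^ m) \<phi> x)"
  have "\<forall>f\<in>?E. \<sigma> f \<le> C * ?r f"
  proof
   fix f assume f: "f \<in> ?E"
   have "weighted_norm p g m f \<le> 1 * weighted_norm p G m f"
    by (rule weighted_norm_mono_weight[OF p(2) C_0_weight[OF g] C_0_weight[OF C0] f]) (use G(2) in auto)
   then show "\<sigma> f \<le> C * ?r f" using C[OF f] by (simp add: \<sigma>)
  qed
  moreover have "?r \<in> ?Q" using C0 by blast
  ultimately show "\<exists>r\<in>?Q. \<exists>C. \<forall>f\<in>?E. \<sigma> f \<le> C * r f" by (intro bexI[of _ ?r] exI[of _ C])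
 qed
 have "?R = {\<lambda>\<phi>. SUP \<alpha>\<in>multi_indices m. Lp_norm p (\<lambda>x. g x * multi_deriv \<alpha> \<phi> x) | g m. g \<in> C_0}"
  by (simp add: weighted_norm_def[abs_def])
 moreover have "kappa_topology ?E (D'_L_topology q) (D_L_pairing p) = seminorm_topology ?E ?P"
  by (simp add: kappa_topology_def top)
 ultimately show ?thesis
  using sQ sR PR QR unfolding generated_by_seminorms_def by simp
qed

end
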